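(* Let $(\Sigma,d_\Sigma)$ be a Polish space. Let $((W_i^n)_{1\le i\le n})_{n\ge1}$ be a triangular array of $\mathbb{R}_+$-valued random variables and $((X_i^n)_{1\le i\le n})_{n\ge1}$ a triangular array of $\Sigma$-valued random variables, all defined on a probability space $(\Omega,\mathcal{A},\mathbb{P})$, such that: for every $n$, $\sum_{i=1}^nW_i^n=n$; for every $n$, $(W_1^n,\dots,W_n^n)$ is exchangeable; $\left(\frac1n\sum_{i=1}^n\delta_{W_i^n}\right)_{n\ge1}$ satisfies an LDP on $M_1^1(\mathbb{R}_+)$ endowed with the distance $W_{1,|\cdot|}$ with good rate function $I^W$; $\left(\frac1n\sum_{i=1}^n\delta_{X_i^n}\right)_{n\ge1}$ satisfies an LDP on $M_1(\Sigma)$ endowed with the weak convergence topology with good rate function $I^X$; and for every $n$ the vectors $(X_1^n,\dots,X_n^n)$ and $(W_1^n,\dots,W_n^n)$ are independent. Then the sequence $$V^n=\frac1n\sum_{i=1}^n\delta_{(W_i^n,X_i^n)},\qquad n\ge1,$$ satisfies an LDP on $\mathcal{M}_1^1(\mathbb{R}_+\times\Sigma)$ endowed with the distance $\Delta$ with good rate function $$J(\rho)=H(\rho\,|\,\rho_1\otimes\rho_2)+I^W(\rho_1)+I^X(\rho_2).$$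
   Context: LDP: a sequence of Borel probability measures $(P^n)$ on a topological space $\mathcal{Y}$ satisfies an LDP with rate function $I$ if $I:\mathcal{Y}\to[0,\infty]$ is lower semicontinuous and, for every measurable $A\subset\mathcal{Y}$ with interior $A^o$ and closure $\bar A$, $-\inf_{A^o}I\le\liminf_n\frac1n\log P^n(A)\le\limsup_n\frac1n\log P^n(A)\le-\inf_{\bar A}I$. $I$ is good if its level sets $\{I\le\alpha\}$, $\alpha<\infty$, are compact. A sequence of random variables satisfies an LDP if their laws do. $M_1(E)$ denotes the set of Borel probability measures on $E$. $M_1^1(\mathbb{R}_+)=\{\rho\in M_1(\mathbb{R}_+):\int x\,\rho(dx)=1\}$. $W_{1,|\cdot|}(\rho,\gamma)=\inf_\pi\int|x-y|\,\pi(dx,dy)$ over couplings $\pi$ of $\rho,\gamma$. For $\rho\in M_1(\mathbb{R}_+\times\Sigma)$, $\rho_1,\rho_2$ are its marginals on $\mathbb{R}_+$ and $\Sigma$. $\mathcal{M}_1^1(\mathbb{R}_+\times\Sigma)=\{\rho\in M_1(\mathbb{R}_+\times\Sigma):\int x\,\rho_1(dx)=1\}$, with the distance $\Delta(\rho,\gamma)=W_{1,|\cdot|}(\rho_1,\gamma_1)+\beta_{BL,\delta}(\rho,\gamma)$, where $\delta$ is a metric on $\mathbb{R}_+\times\Sigma$ compatible with the product topology, $\beta_{BL,\delta}(\rho,\gamma)=\sup\{|\int f\,d\rho-\int f\,d\gamma|: f\in C_b(\mathbb{R}_+\times\Sigma),\ \|f\|_\infty+\|f\|_{L,\delta}\le1\}$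 with integrals over $\mathbb{R}_+\times\Sigma$, and $\|f\|_{L,\delta}=\sup_{x\ne y}|f(x)-f(y)|/\delta(x,y)$. $H(\nu|\rho)=\int\log\frac{d\nu}{d\rho}d\nu$ if $\nu\ll\rho$, $+\infty$ otherwise. Exchangeable means that the law is invariant under every permutation of coordinates. *)

theory Defs
  imports "HOL-Probability.Probability"
begin

section \<open>Borel probability measures on a subspace\<close>

text \<open>
  The subspace \<open>E\<close> of the ambient type is given as a set, so that \<open>\<real>\<^sub>+\<close> is \<open>{0..} :: real set\<close>
  and \<open>\<real>\<^sub>+ \<times> \<Sigma>\<close> is \<open>{0..} \<times> UNIV\<close>. Measures on \<open>E\<close> have space \<open>E\<close> itself, not the ambient type.
\<close>

abbreviation borel_on :: "'a::topological_space set \<Rightarrow> 'a measure" where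
  "borel_on E \<equiv> restrict_space borel E"

definition M1 :: "'a::topological_space set \<Rightarrow> 'a measure set" where
  "M1 E = {\<rho>. prob_space \<rho> \<and> sets \<rho> = sets (borel_on E)}"

definition weak_topology :: "'a::topological_space set \<Rightarrow> 'a measure topology" where
  "weak_topology E = topology_generated_by
     {{\<rho> \<in> M1 E. (\<integral>x. f x \<partial>\<rho>) \<in> U} | (f :: 'a \<Rightarrow> real) U.
        continuous_on E f \<and> bounded (f ` E) \<and> open U}"

definition empirical :: "'a::topological_space set \<Rightarrow> nat \<Rightarrow> (nat \<Rightarrow> 'a) \<Rightarrow> 'a measure" where
  "empirical E n x = measure_of E (sets (borel_on E))
     (\<lambda>A. (\<Sum>i=1..n. emeasure (return (borel_on E) (x i)) A) / of_nat n)"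

section \<open>Large deviation principles\<close>

definition borel_of :: "'a topology \<Rightarrow> 'a measure" where
  "borel_of T = sigma (topspace T) {U. openin T U}"

definition lower_semicontinuous :: "'a topology \<Rightarrow> ('a \<Rightarrow> ereal) \<Rightarrow> bool" where
  "lower_semicontinuous T I \<longleftrightarrow> (\<forall>\<alpha>. openin T {x \<in> topspace T. \<alpha> < I x})"

definition good_rate :: "'a topology \<Rightarrow> ('a \<Rightarrow> ereal) \<Rightarrow> bool" where
  "good_rate T I \<longleftrightarrow> (\<forall>\<alpha>::real. compactin T {x \<in> topspace T. I x \<le> ereal \<alpha>})"

text \<open>HOL sets \<open>ln 0 = 0\<close>; the logarithm of a probability needs the value \<open>-\<infinity>\<close> at \<open>0\<close>.\<close>

definition log_prob :: "real \<Rightarrow> ereal" where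
  "log_prob p = (if p = 0 then -\<infinity> else ereal (ln p))"

text \<open>Sequences are indexed by \<open>n \<ge> 1\<close>; index \<open>0\<close> is unconstrained.\<close>

definition LDP :: "'a topology \<Rightarrow> (nat \<Rightarrow> 'a measure) \<Rightarrow> ('a \<Rightarrow> ereal) \<Rightarrow> bool" where
  "LDP T P I \<longleftrightarrow>
     (\<forall>n\<ge>1. prob_space (P n) \<and> sets (P n) = sets (borel_of T)) \<and>
     (\<forall>x\<in>topspace T. 0 \<le> I x) \<and> lower_semicontinuous T I \<and>
     (\<forall>A\<in>sets (borel_of T).
        - (INF x\<in>T interior_of A. I x)
          \<le> liminf (\<lambda>n. ereal (1 / real n) * log_prob (measure (P n) A)) \<and>
        liminf (\<lambda>n. ereal (1 / real n) * log_prob (measure (P n) A))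
          \<le> limsup (\<lambda>n. ereal (1 / real n) * log_prob (measure (P n) A)) \<and>
        limsup (\<lambda>n. ereal (1 / real n) * log_prob (measure (P n) A))
          \<le> - (INF x\<in>T closure_of A. I x))"

definition LDP_rv :: "'w measure \<Rightarrow> 'a topology \<Rightarrow> (nat \<Rightarrow> 'w \<Rightarrow> 'a) \<Rightarrow> ('a \<Rightarrow> ereal) \<Rightarrow> bool" where
  "LDP_rv M T Y I \<longleftrightarrow>
     (\<forall>n\<ge>1. Y n \<in> measurable M (borel_of T)) \<and> LDP T (\<lambda>n. distr M (borel_of T) (Y n)) I"

section \<open>Wasserstein and bounded Lipschitz distances\<close>

text \<open>
  \<open>Metric_space\<close> demands nonnegativity and symmetry of the distance at all arguments, including those
  outside the carrier; the infimum and suprema are therefore taken in \<open>ennreal\<close>. On the spaces of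
  measures below they are finite, so \<^const>\<open>enn2real\<close> loses nothing.
\<close>

definition couplings :: "real set \<Rightarrow> real measure \<Rightarrow> real measure \<Rightarrow> (real \<times> real) measure set" where
  "couplings E \<rho> \<gamma> = {\<pi> \<in> M1 (E \<times> E). distr \<pi> (borel_on E) fst = \<rho> \<and> distr \<pi> (borel_on E) snd = \<gamma>}"

definition W1 :: "real measure \<Rightarrow> real measure \<Rightarrow> real" where
  "W1 \<rho> \<gamma> = enn2real (INF \<pi>\<in>couplings {0..} \<rho> \<gamma>. \<integral>\<^sup>+z. ennreal \<bar>fst z - snd z\<bar> \<partial>\<pi>)"

definition M11 :: "real measure set" where
  "M11 = {\<rho> \<in> M1 {0..}. (\<integral>\<^sup>+x. ennreal x \<partial>\<rho>) = 1}"

definition marg1 :: "(real \<times> 's::topological_space) measure \<Rightarrow> real measure" where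
  "marg1 \<rho> = distr \<rho> (borel_on {0..}) fst"

definition marg2 :: "(real \<times> 's::topological_space) measure \<Rightarrow> 's measure" where
  "marg2 \<rho> = distr \<rho> borel snd"

definition M11_prod :: "(real \<times> 's::topological_space) measure set" where
  "M11_prod = {\<rho> \<in> M1 ({0..} \<times> UNIV). (\<integral>\<^sup>+x. ennreal x \<partial>marg1 \<rho>) = 1}"

definition sup_norm :: "'a set \<Rightarrow> ('a \<Rightarrow> real) \<Rightarrow> ennreal" where
  "sup_norm E f = (SUP x\<in>E. ennreal \<bar>f x\<bar>)"

definition lip_norm :: "'a set \<Rightarrow> ('a \<Rightarrow> 'a \<Rightarrow> real) \<Rightarrow> ('a \<Rightarrow> real) \<Rightarrow> ennreal" where
  "lip_norm E \<delta> f = (SUP (x, y)\<in>{(x, y). x \<in> E \<and> y \<in> E \<and> x \<noteq> y}. ennreal (\<bar>f x - f y\<bar> / \<delta> x y))"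

definition \<beta>_BL :: "'a::topological_space set \<Rightarrow> ('a \<Rightarrow> 'a \<Rightarrow> real) \<Rightarrow> 'a measure \<Rightarrow> 'a measure \<Rightarrow> real" where
  "\<beta>_BL E \<delta> \<rho> \<gamma> =
     enn2real (SUP f\<in>{f. continuous_on E f \<and> bounded (f ` E) \<and> sup_norm E f + lip_norm E \<delta> f \<le> 1}.
       ennreal \<bar>(\<integral>x. f x \<partial>\<rho>) - (\<integral>x. f x \<partial>\<gamma>)\<bar>)"

definition \<Delta> ::
  "(real \<times> 's::topological_space \<Rightarrow> real \<times> 's \<Rightarrow> real) \<Rightarrow> (real \<times> 's) measure \<Rightarrow> (real \<times> 's) measure \<Rightarrow> real"
where
  "\<Delta> \<delta> \<rho> \<gamma> = W1 (marg1 \<rho>) (marg1 \<gamma>) + \<beta>_BL ({0..} \<times> UNIV) \<delta> \<rho> \<gamma>"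

definition topology_W1 :: "real measure topology" where
  "topology_W1 = Metric_space.mtopology M11 W1"

definition topology_\<Delta> ::
  "(real \<times> 's::topological_space \<Rightarrow> real \<times> 's \<Rightarrow> real) \<Rightarrow> (real \<times> 's) measure topology"
where
  "topology_\<Delta> \<delta> = Metric_space.mtopology M11_prod (\<Delta> \<delta>)"

definition compatible_metric :: "'a::topological_space set \<Rightarrow> ('a \<Rightarrow> 'a \<Rightarrow> real) \<Rightarrow> bool" where
  "compatible_metric E \<delta> \<longleftrightarrow> Metric_space E \<delta> \<and> Metric_space.mtopology E \<delta> = top_of_set E"

section \<open>Relative entropy, exchangeability and independence\<close>

text \<open>
  The integral of \<open>ln (d\<nu>/d\<rho>)\<close> may be \<open>+\<infinity>\<close> although \<open>\<nu> \<lless> \<rho>\<close>, so it is taken as positive part minus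
  negative part; for probability measures the negative part is finite. The library's
  \<^const>\<open>KL_divergence\<close> is a Bochner integral and would be \<open>0\<close> in that case.
\<close>

definition rel_entropy :: "'a measure \<Rightarrow> 'a measure \<Rightarrow> ereal" where
  "rel_entropy \<nu> \<rho> =
     (if absolutely_continuous \<rho> \<nu>
      then enn2ereal (\<integral>\<^sup>+x. ennreal (ln (enn2real (RN_deriv \<rho> \<nu> x))) \<partial>\<nu>)
         - enn2ereal (\<integral>\<^sup>+x. ennreal (- ln (enn2real (RN_deriv \<rho> \<nu> x))) \<partial>\<nu>)
      else \<infinity>)"

definition rate_J ::
  "(real measure \<Rightarrow> ereal) \<Rightarrow> ('s::topological_space measure \<Rightarrow> ereal) \<Rightarrow> (real \<times> 's) measure \<Rightarrow> ereal"
where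
  "rate_J IW IX \<rho> =
     rel_entropy \<rho> (marg1 \<rho> \<Otimes>\<^sub>M marg2 \<rho>) + IW (marg1 \<rho>) + IX (marg2 \<rho>)"

definition exchangeable :: "'w measure \<Rightarrow> 'a measure \<Rightarrow> nat \<Rightarrow> (nat \<Rightarrow> 'w \<Rightarrow> 'a) \<Rightarrow> bool" where
  "exchangeable M N n Y \<longleftrightarrow>
     (\<forall>\<sigma>. \<sigma> permutes {1..n} \<longrightarrow>
        distr M (PiM {1..n} (\<lambda>_. N)) (\<lambda>\<omega>. \<lambda>i\<in>{1..n}. Y (\<sigma> i) \<omega>)
        = distr M (PiM {1..n} (\<lambda>_. N)) (\<lambda>\<omega>. \<lambda>i\<in>{1..n}. Y i \<omega>))"

text \<open>The library's \<open>indep_var\<close> only relates random variables with values in one common type.\<close>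

definition independent_rvs ::
  "'w measure \<Rightarrow> 'a measure \<Rightarrow> ('w \<Rightarrow> 'a) \<Rightarrow> 'b measure \<Rightarrow> ('w \<Rightarrow> 'b) \<Rightarrow> bool"
where
  "independent_rvs M S Y T Z \<longleftrightarrow>
     Y \<in> measurable M S \<and> Z \<in> measurable M T \<and>
     prob_space.indep_set M {Y -` A \<inter> space M | A. A \<in> sets S} {Z -` B \<inter> space M | B. B \<in> sets T}"

section \<open>Well-definedness\<close>

lemma topspace_weak_topology: "topspace (weak_topology E) = M1 E"
proof -
  have "M1 E \<in> {{\<rho> \<in> M1 E. (\<integral>x. f x \<partial>\<rho>) \<in> U} | (f :: 'a \<Rightarrow> real) U.
        continuous_on E f \<and> bounded (f ` E) \<and> open U}"
    by (rule CollectI, rule exI[of _ "\<lambda>_. 0"], rule exI[of _ UNIV])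
       (auto intro!: boundedI[of _ 0])
  then show ?thesis
    unfolding weak_topology_def topology_generated_by_topspace by blast
qed

lemma
  shows space_empirical: "space (empirical E n x) = E"
    and sets_empirical: "sets (empirical E n x) = sets (borel_on E)"
proof -
  have "sets (borel_on E) \<subseteq> Pow E"
    using sets.space_closed[of "borel_on E"] by (simp add: space_restrict_space)
  moreover have "sigma_sets E (sets (borel_on E)) = sets (borel_on E)"
    using sets.sigma_sets_eq[of "borel_on E"] by (simp add: space_restrict_space)
  ultimately show "space (empirical E n x) = E" "sets (empirical E n x) = sets (borel_on E)"
    by (simp_all add: empirical_def)
qed

lemma emeasure_empirical:
  assumes A: "A \<in> sets (borel_on E)"
  shows "emeasure (empirical E n x) A = (\<Sum>i=1..n. indicator A (x i)) / of_nat n"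
proof -
  let ?\<mu> = "\<lambda>A. (\<Sum>i=1..n. emeasure (return (borel_on E) (x i)) A) / of_nat n"
  have "countably_additive (sets (borel_on E)) ?\<mu>"
  proof (rule countably_additiveI)
    fix F :: "nat \<Rightarrow> 'a set"
    assume F: "range F \<subseteq> sets (borel_on E)" "disjoint_family F"
    have "(\<Sum>k. ?\<mu> (F k)) = (\<Sum>k. \<Sum>i=1..n. emeasure (return (borel_on E) (x i)) (F k)) / of_nat n"
      by (simp add: divide_ennreal_def)
    also have "(\<Sum>k. \<Sum>i=1..n. emeasure (return (borel_on E) (x i)) (F k))
        = (\<Sum>i=1..n. \<Sum>k. emeasure (return (borel_on E) (x i)) (F k))"
      by (rule suminf_sum) simp
    also have "\<dots> = (\<Sum>i=1..n. emeasure (return (borel_on E) (x i)) (\<Union>k. F k))"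
      using F by (intro sum.cong refl suminf_emeasure) auto
    finally show "(\<Sum>k. ?\<mu> (F k)) = ?\<mu> (\<Union>k. F k)" .
  qed
  moreover have "positive (sets (borel_on E)) ?\<mu>"
    by (simp add: positive_def)
  moreover have "sigma_algebra E (sets (borel_on E))"
    using sets.sigma_algebra_axioms[of "borel_on E"] by (simp add: space_restrict_space)
  ultimately have "emeasure (empirical E n x) A = ?\<mu> A"
    using A unfolding empirical_def by (intro emeasure_measure_of_sigma)
  then show ?thesis
    using A by simp
qed

lemma empirical_in_M1:
  assumes "n \<ge> 1" "\<And>i. i \<in> {1..n} \<Longrightarrow> x i \<in> E"
  shows "empirical E n x \<in> M1 E"
proof -
  have "E \<in> sets (borel_on E)"
    using sets.top[of "borel_on E"] by (simp add: space_restrict_space)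
  then have "emeasure (empirical E n x) E = (\<Sum>i=1..n. indicator E (x i)) / of_nat n"
    by (rule emeasure_empirical)
  also have "\<dots> = (of_nat n :: ennreal) / of_nat n"
    using assms(2) by simp
  also have "\<dots> = 1"
    using assms(1) by (intro ennreal_divide_self) (auto simp: of_nat_less_top)
  finally show ?thesis
    by (auto simp: M1_def sets_empirical space_empirical intro!: prob_spaceI)
qed

text \<open>
  A measure on \<open>\<real>\<^sub>+ \<times> \<Sigma>\<close> and the product of its marginals live on the same \<open>\<sigma>\<close>-algebra, so that
  the Radon--Nikodym derivative in \<^const>\<open>rel_entropy\<close> is meaningful.
\<close>

lemma sets_marginals:
  fixes \<rho> :: "(real \<times> 's::second_countable_topology) measure"
  assumes "\<rho> \<in> M1 ({0..} \<times> UNIV)"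
  shows "sets (marg1 \<rho> \<Otimes>\<^sub>M marg2 \<rho>) = sets \<rho>"
proof -
  let ?A = "borel_on {0::real..}" and ?B = "borel :: 's measure"
  let ?E = "{0::real..} \<times> (UNIV :: 's set)"
  have sp: "space (?A \<Otimes>\<^sub>M ?B) = ?E"
    by (simp add: space_pair_measure space_restrict_space)
  have "sets (marg1 \<rho> \<Otimes>\<^sub>M marg2 \<rho>) = sets (?A \<Otimes>\<^sub>M ?B)"
    by (intro sets_pair_measure_cong) (simp_all add: marg1_def marg2_def)
  also have "\<dots> = sets (borel_on ?E)"
  proof (rule antisym)
    have "a \<times> b \<in> sets (borel_on ?E)" if "a \<in> sets ?A" "b \<in> sets ?B" for a b
    proof -
      obtain a' b' where ab: "a = {0..} \<inter> a'" "a' \<in> sets borel" "b = b'" "b' \<in> sets borel"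
        using \<open>a \<in> sets ?A\<close> \<open>b \<in> sets ?B\<close> by (auto simp: sets_restrict_space)
      then have "a' \<times> b' \<in> sets (borel \<Otimes>\<^sub>M borel)"
        by (intro pair_measureI)
      then have "a' \<times> b' \<in> sets (borel :: (real \<times> 's) measure)"
        by (simp only: borel_prod)
      moreover have "a \<times> b = ?E \<inter> (a' \<times> b')"
        using ab by auto
      ultimately show ?thesis
        by (auto simp: sets_restrict_space)
    qed
    then have "{a \<times> b |a b. a \<in> sets ?A \<and> b \<in> sets ?B} \<subseteq> sets (borel_on ?E)"
      by blast
    then have "sigma_sets (space (borel_on ?E)) {a \<times> b |a b. a \<in> sets ?A \<and> b \<in> sets ?B}
        \<subseteq> sets (borel_on ?E)"
      by (rule sets.sigma_sets_subset)
    moreover have "space (borel_on ?E) = space ?A \<times> space ?B"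
      by (simp add: space_restrict_space)
    ultimately show "sets (?A \<Otimes>\<^sub>M ?B) \<subseteq> sets (borel_on ?E)"
      unfolding sets_pair_measure by simp
  next
    have "(\<lambda>z. z) \<in> measurable (?A \<Otimes>\<^sub>M ?B) borel"
    proof -
      have "fst \<in> measurable (?A \<Otimes>\<^sub>M ?B) borel"
        by (rule measurable_compose[OF measurable_fst]) (rule measurable_restrict_space1, simp)
      moreover have "snd \<in> measurable (?A \<Otimes>\<^sub>M ?B) borel"
        by (rule measurable_snd)
      ultimately have "(\<lambda>z. (fst z, snd z)) \<in> measurable (?A \<Otimes>\<^sub>M ?B) (borel \<Otimes>\<^sub>M borel)"
        by (rule measurable_Pair)
      then show ?thesis
        by (simp add: borel_prod)
    qed
    then have "(\<lambda>z. z) \<in> measurable (?A \<Otimes>\<^sub>M ?B) (borel_on ?E)"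
      by (intro measurable_restrict_space2) (auto simp: sp)
    then show "sets (borel_on ?E) \<subseteq> sets (?A \<Otimes>\<^sub>M ?B)"
    proof (intro subsetI)
      fix S assume m: "(\<lambda>z. z) \<in> measurable (?A \<Otimes>\<^sub>M ?B) (borel_on ?E)" and S: "S \<in> sets (borel_on ?E)"
      have "(\<lambda>z. z) -` S \<inter> ?E \<in> sets (?A \<Otimes>\<^sub>M ?B)"
        using measurable_sets[OF m S] by (simp only: sp)
      moreover have "S \<subseteq> ?E"
        using sets.sets_into_space[OF S] by (simp add: space_restrict_space)
      ultimately show "S \<in> sets (?A \<Otimes>\<^sub>M ?B)"
        by (simp add: Int_absorb2)
    qed
  qed
  finally show ?thesis
    using assms by (simp add: M1_def)
qed

end

theory Submission
  imports Defs
begin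

text \<open>
  By exchangeability and independence, given the two empirical measures of weights and labels the pairing
  of the \<open>W\<^sub>i\<close> with the \<open>X\<^sub>i\<close> may be averaged over all permutations of the weights. Partition
  \<open>\<real>\<^sub>+\<close> and \<open>\<Sigma>\<close> into finitely many cells whose boundaries are null for a given pair of
  margins. The number of permutations with a prescribed contingency table of cells is a quotient of
  factorials, so its proportion is \<open>exp (- n H)\<close> up to subexponential factors, where \<open>H\<close> is the entropy
  of the table relative to the product of its margins. Refining the partition, these entropies increase to
  \<open>H(\<rho> | \<rho>\<^sub>1 \<otimes> \<rho>\<^sub>2)\<close> (Donsker--Varadhan), and bounded entropies together with
  converging margins force compactness for \<open>\<Delta>\<close>. This yields both bounds locally in the margins; goodness of
  \<open>I\<^sup>W\<close> and \<open>I\<^sup>X\<close> reduces the upper bound to finitely many pairs of margins.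
\<close>

section \<open>Contingency tables of permutations\<close>

text \<open>Entropy bounds are carried in linearised form: for a bounded f on cells, the integral of
  f under \<rho> minus that of exp f under the product of the margins, plus 1. For fixed f this is
  continuous in finitely many cell masses, so it survives limits in which densities have no reason
  to converge, and all f together recover the entropy. A bound on these functionals makes the limits
  of cell masses uniformly absolutely continuous with respect to the product of the margins. This
  takes the place of tightness: the finitely additive limit on the algebra of cells extends to a
  measure. It says nothing about the tails of the weights, but the W1 part of
  \<open>\<Delta>\<close> sees only the first margin, which a permutation does not change, so that
  part is inherited from the hypothesis on the weights. The cells must depend on the pair of
  margins, because cell masses are continuous only at margins that do not charge the boundaries. The
  topology on the label margins enters through open and closed neighbourhoods and cluster points;
  sequences are extracted from countably many cell masses.\<close>

definition xlnx :: "real \<Rightarrow> real" where "xlnx x = x * ln x"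

text \<open>Stirling's formula with a crude error, which is all that the exponential scale sees: n
  ln (1 + 1/n) \<le> 1 \<le> (n + 1) ln (1 + 1/n) drives the induction. It starts at 1 with error 1
  + ln n; the shift to ln (n + 1) admits n = 0, which occurs as the size of empty cells.\<close>

lemma ln_fact_bounds:
  "xlnx (real n) - real n \<le> ln (fact n)" (is "?P n")
  "ln (fact n) \<le> xlnx (real n) - real n + 1 + ln (real n + 1)"
proof -
  have "xlnx (real n) - real n \<le> ln (fact n) \<and> ln (fact n) \<le> xlnx (real n) - real n + 1 + ln (real n)"
    if "n \<ge> 1" for n using that
  proof (induction n rule: nat_induct_at_least)
    case base
    show ?case by (simp add: xlnx_def)
  next
    case (Suc n)
    define x where "x = real n"
    have x: "x \<ge> 1" using Suc by (simp add: x_def)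
    have e: "ln (fact (Suc n) :: real) = ln (x + 1) + ln (fact n)"
      using x by (simp add: ln_mult x_def add.commute)
    have l1: "ln (1 + 1/x) \<le> 1/x"
      using x by (intro ln_add_one_self_le_self) auto
    have l2: "ln (x/(x+1)) \<le> x/(x+1) - 1"
      using x by (intro ln_le_minus_one) auto
    have eq: "ln (1 + 1/x) = ln (x+1) - ln x" "ln (x/(x+1)) = ln x - ln (x+1)"
      using x ln_div[of "x+1" x] ln_div[of x "x+1"] by (simp_all add: add_divide_distrib)
    have "ln (x+1) - ln x \<le> 1/x" using l1 eq(1) by linarith
    then have "x * (ln (x+1) - ln x) \<le> x * (1/x)" using x by (intro mult_left_mono) auto
    then have a: "x * (ln (x+1) - ln x) \<le> 1" using x by simp
    have "x/(x+1) - 1 = - (1/(x+1))" using x by (simp add: field_simps)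
    then have "1/(x+1) \<le> ln (x+1) - ln x" using l2 eq(2) by linarith
    then have "(x+1) * (1/(x+1)) \<le> (x+1) * (ln (x+1) - ln x)" using x by (intro mult_left_mono) auto
    then have b: "(x+1) * (ln (x+1) - ln x) \<ge> 1" using x by simp
    show ?case
      using Suc(2) a b unfolding e by (simp add: xlnx_def x_def[symmetric] algebra_simps)
  qed
  note * = this
  show "xlnx (real n) - real n \<le> ln (fact n)"
    using *[of n] by (cases "n = 0") (auto simp: xlnx_def)
  show "ln (fact n) \<le> xlnx (real n) - real n + 1 + ln (real n + 1)"
  proof (cases "n = 0")
    case False
    then have "ln (real n) \<le> ln (real n + 1)" by simp
    then show ?thesis using *[of n] False by linarith
  qed (auto simp: xlnx_def)
qed

section \<open>Stabilisers of labellings and classes of permutations with equal table\<close>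

text \<open>The Young subgroup of a labelling: permutations that move indices only inside its level
  sets.\<close>

definition stab :: "'i set \<Rightarrow> ('i \<Rightarrow> 'k) \<Rightarrow> ('i \<Rightarrow> 'i) set" where
  "stab I f = {u. u permutes I \<and> (\<forall>i\<in>I. f (u i) = f i)}"

text \<open>A permutation of \<open>insert a S\<close> factors as the transposition of a with some b
  after a permutation of S. It preserves labels exactly when b carries the label of a and the second
  factor preserves labels on S, so the new index multiplies the count by the new size of its level
  set.\<close>

lemma card_stab:
  assumes "finite I"
  shows "card (stab I f) = (\<Prod>y\<in>f ` I. fact (card {i\<in>I. f i = y}))"
  using assms
proof (induction I rule: finite_induct)
  case empty
  have "stab {} f = {id}" by (auto simp: stab_def)
  then show ?case by simp
next
  case (insert a S)
  let ?D = "{b \<in> insert a S. f b = f a} \<times> stab S f"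
  let ?g = "\<lambda>(b, p). Transposition.transpose a b \<circ> p"
  have mem: "u permutes insert a S \<longleftrightarrow>
      (\<exists>b p. u = Transposition.transpose a b \<circ> p \<and> b \<in> insert a S \<and> p permutes S)" for u
  proof -
    have "u permutes insert a S \<longleftrightarrow> u \<in> {p. p permutes insert a S}" by simp
    then show ?thesis unfolding permutes_insert by (auto simp: image_iff)
  qed
  define F where "F y = card {i\<in>S. f i = y}" for y
  define F' where "F' y = card {i\<in>insert a S. f i = y}" for y
  have eq: "stab (insert a S) f = ?g ` ?D"
  proof (intro equalityI subsetI)
    fix u assume u: "u \<in> stab (insert a S) f"
    then have "u permutes insert a S" by (simp add: stab_def)
    then obtain b p where bp: "u = Transposition.transpose a b \<circ> p" "b \<in> insert a S" "p permutes S"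
      unfolding mem by blast
    have pa: "p a = a" using bp(3) insert(2) by (simp add: permutes_not_in)
    have "f (u a) = f a" using u by (auto simp: stab_def)
    then have fb: "f b = f a" using bp pa by simp
    have "f (p i) = f i" if "i \<in> S" for i
    proof -
      have "f (u i) = f i" using u that by (auto simp: stab_def)
      then show ?thesis using bp(1) fb by (cases "p i = a"; cases "p i = b") (auto simp: Transposition.transpose_def)
    qed
    then show "u \<in> ?g ` ?D" using bp fb by (auto simp: stab_def image_iff)
  next
    fix u assume "u \<in> ?g ` ?D"
    then obtain b p where bp: "u = Transposition.transpose a b \<circ> p" "b \<in> insert a S" "f b = f a" "p \<in> stab S f"
      by auto
    then have pS: "p permutes S" by (simp add: stab_def)
    then have "u permutes insert a S"
      unfolding mem using bp by blast
    moreover have "f (u i) = f i" if "i \<in> insert a S" for i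
    proof -
      have "f (p i) = f i" using that bp(4) pS insert(2) by (auto simp: stab_def permutes_not_in)
      then show ?thesis using bp(1,3) by (cases "p i = a"; cases "p i = b") (auto simp: Transposition.transpose_def)
    qed
    ultimately show "u \<in> stab (insert a S) f" by (simp add: stab_def)
  qed
  have inj: "inj_on ?g ?D"
  proof (rule inj_onI, clarify)
    fix b p b' p' assume h: "p \<in> stab S f" "p' \<in> stab S f" "Transposition.transpose a b \<circ> p = Transposition.transpose a b' \<circ> p'"
    have "p a = a" "p' a = a" using h insert(2) by (auto simp: stab_def permutes_not_in)
    with h(3) have "b = b'" by (metis comp_apply transpose_apply_first)
    have "p = Transposition.transpose a b \<circ> (Transposition.transpose a b \<circ> p)" for p
      by (simp add: fun_eq_iff)
    with h(3) \<open>b = b'\<close> show "b = b' \<and> p = p'" by metis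
  qed
  have "card (stab (insert a S) f) = card {b \<in> insert a S. f b = f a} * card (stab S f)"
    unfolding eq card_image[OF inj] card_cartesian_product ..
  also have "card {b \<in> insert a S. f b = f a} = Suc (F (f a))"
  proof -
    have "{b \<in> insert a S. f b = f a} = insert a {i\<in>S. f i = f a}" by auto
    then show ?thesis using insert(1,2) by (simp add: F_def)
  qed
  also have "card (stab S f) = (\<Prod>y\<in>f ` S. fact (F y))" unfolding F_def by (rule insert.IH)
  \<comment> \<open>If the label of a is new, its fibre in S is empty and contributes 0! = 1, so the
    product may include it.\<close>
  also have "\<dots> = (\<Prod>y\<in>insert (f a) (f ` S). fact (F y))"
  proof (cases "f a \<in> f ` S")
    case False
    then have "{i \<in> S. f i = f a} = {}" by (auto simp: image_iff)
    then have "F (f a) = 0" unfolding F_def by (metis card.empty)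
    then show ?thesis using insert(1) False by simp
  qed (simp add: insert_absorb)
  also have "\<dots> = fact (F (f a)) * (\<Prod>y\<in>f ` S - {f a}. fact (F y))"
    using insert(1) by (intro prod.insert_remove) auto
  also have "Suc (F (f a)) * \<dots> = fact (F' (f a)) * (\<Prod>y\<in>f ` S - {f a}. fact (F' y))"
  proof -
    have "{i \<in> insert a S. f i = f a} = insert a {i\<in>S. f i = f a}" by auto
    then have 1: "F' (f a) = Suc (F (f a))" using insert(1,2) by (simp add: F_def F'_def)
    have 2: "F' y = F y" if "y \<in> f ` S - {f a}" for y
      unfolding F_def F'_def using that by (intro arg_cong[where f=card]) auto
    have "(\<Prod>y\<in>f ` S - {f a}. fact (F' y)) = (\<Prod>y\<in>f ` S - {f a}. fact (F y) :: nat)"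
      by (intro prod.cong refl arg_cong[where f=fact] 2)
    then show ?thesis unfolding 1 fact_Suc by (simp add: algebra_simps)
  qed
  also have "\<dots> = (\<Prod>y\<in>insert (f a) (f ` S). fact (F' y))"
    using insert(1) by (intro prod.insert_remove[symmetric]) auto
  finally show ?case by (simp add: F'_def)
qed

lemma card_stab_superset:
  assumes "finite I" "f ` I \<subseteq> Y" "finite Y"
  shows "card (stab I f) = (\<Prod>y\<in>Y. fact (card {i\<in>I. f i = y}))"
proof -
  have "fact (card {i\<in>I. f i = y}) = (1::nat)" if "y \<in> Y - f ` I" for y
  proof -
    have "{i\<in>I. f i = y} = {}" using that by auto
    then show ?thesis by (metis card.empty fact_0)
  qed
  then show ?thesis unfolding card_stab[OF assms(1)]
    using assms by (intro prod.mono_neutral_left) auto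
qed

lemma finite_stab: "finite I \<Longrightarrow> finite (stab I f)"
  by (rule finite_subset[OF _ finite_permutations[of I]]) (auto simp: stab_def)

text \<open>Equal fibre sizes mean equal image multisets, and families with equal multisets differ
  by a permutation.\<close>

lemma exists_permutation_of_equal_fibres:
  fixes f g :: "'i \<Rightarrow> 'y"
  assumes "finite I" "\<And>y. card {i\<in>I. f i = y} = card {i\<in>I. g i = y}"
  obtains p where "p permutes I" "\<And>i. i \<in> I \<Longrightarrow> f i = g (p i)"
proof -
  have "image_mset f (mset_set I) = image_mset g (mset_set I)"
  proof (rule multiset_eqI)
    fix y
    have "count (image_mset h (mset_set I)) y = card {i\<in>I. h i = y}" for h :: "'i \<Rightarrow> 'y"
      using assms(1) by (subst count_image_mset) (auto intro!: arg_cong[where f=card])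
    then show "count (image_mset f (mset_set I)) y = count (image_mset g (mset_set I)) y"
      using assms(2) by simp
  qed
  from image_mset_eq_implies_permutes[OF assms(1) this] show ?thesis using that by metis
qed

lemma stab_comp: "u \<in> stab I f \<Longrightarrow> v \<in> stab I f \<Longrightarrow> u \<circ> v \<in> stab I f"
  by (auto simp: stab_def permutes_compose permutes_in_image)

lemma stab_inv:
  assumes "u \<in> stab I f"
  shows "inv u \<in> stab I f"
proof -
  have u: "u permutes I" "\<And>i. i\<in>I \<Longrightarrow> f (u i) = f i" using assms by (auto simp: stab_def)
  have "f (inv u i) = f i" if "i \<in> I" for i
    using u(2)[of "inv u i"] u(1) that by (metis permutes_inv permutes_in_image permutes_inverses(1))
  then show ?thesis using permutes_inv[OF u(1)] by (simp add: stab_def)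
qed

definition contingency :: "'i set \<Rightarrow> ('i \<Rightarrow> 'k) \<Rightarrow> ('i \<Rightarrow> 'l) \<Rightarrow> ('i \<Rightarrow> 'i) \<Rightarrow> 'k \<Rightarrow> 'l \<Rightarrow> nat" where
  "contingency I a b \<sigma> k l = card {i\<in>I. a (\<sigma> i) = k \<and> b i = l}"

text \<open>The row and column stabilisers act transitively on the permutations with a given contingency table.\<close>

lemma card_contingency_class:
  fixes a :: "'i \<Rightarrow> 'k" and b :: "'i \<Rightarrow> 'l"
  assumes I: "finite I" and s: "\<sigma> permutes I"
  shows "card {\<tau>. \<tau> permutes I \<and> contingency I a b \<tau> = contingency I a b \<sigma>}
      * card (stab I (\<lambda>i. (a (\<sigma> i), b i))) = card (stab I a) * card (stab I b)"
proof -
  let ?C = "{\<tau>. \<tau> permutes I \<and> contingency I a b \<tau> = contingency I a b \<sigma>}"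
  let ?S = "stab I (\<lambda>i. (a (\<sigma> i), b i))"
  \<comment> \<open>Equal tables mean equal fibres of the pair labelling: g matches these fibres,
    and h is the remaining factor, which preserves a.\<close>
  have ex: "\<exists>g h. g \<in> stab I b \<and> h \<in> stab I a \<and> \<tau> = h \<circ> \<sigma> \<circ> g" if t: "\<tau> \<in> ?C" for \<tau>
  proof -
    have tp: "\<tau> permutes I" using t by simp
    have "card {i\<in>I. (a (\<tau> i), b i) = y} = card {i\<in>I. (a (\<sigma> i), b i) = y}" for y
      using t by (cases y) (auto simp: contingency_def fun_eq_iff)
    from exists_permutation_of_equal_fibres[OF I this] obtain g where g: "g permutes I"
      "\<And>i. i \<in> I \<Longrightarrow> (a (\<tau> i), b i) = (a (\<sigma> (g i)), b (g i))" by metis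
    define h where "h = \<tau> \<circ> inv g \<circ> inv \<sigma>"
    have h: "h permutes I" unfolding h_def using g(1) s tp
      by (intro permutes_compose permutes_inv)
    have "a (h i) = a i" if "i \<in> I" for i
    proof -
      have "inv g (inv \<sigma> i) \<in> I" using g(1) s that by (metis permutes_in_image permutes_inv)
      then have "a (h i) = a (\<sigma> (g (inv g (inv \<sigma> i))))" using g(2) by (simp add: h_def)
      then show ?thesis using g(1) s by (simp add: permutes_inverses)
    qed
    moreover have "\<tau> = h \<circ> \<sigma> \<circ> g"
      using g(1) s by (auto simp: h_def fun_eq_iff permutes_inverses)
    ultimately show ?thesis using g h by (intro exI[of _ g] exI[of _ h]) (auto simp: stab_def)
  qed
  \<comment> \<open>One factorisation is fixed for each \<tau>. The factorisations of \<tau> form an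
    orbit of the stabiliser of the pair labelling, and the two injections below exploit this in the
    two directions.\<close>
  define G where "G \<tau> = (SOME g. \<exists>h. g \<in> stab I b \<and> h \<in> stab I a \<and> \<tau> = h \<circ> \<sigma> \<circ> g)" for \<tau>
  define H where "H \<tau> = (SOME h. h \<in> stab I a \<and> \<tau> = h \<circ> \<sigma> \<circ> G \<tau>)" for \<tau>
  have G: "\<exists>h. G \<tau> \<in> stab I b \<and> h \<in> stab I a \<and> \<tau> = h \<circ> \<sigma> \<circ> G \<tau>" if "\<tau> \<in> ?C" for \<tau>
    unfolding G_def by (rule someI_ex[OF ex[OF that]])
  have H: "H \<tau> \<in> stab I a \<and> \<tau> = H \<tau> \<circ> \<sigma> \<circ> G \<tau>" if "\<tau> \<in> ?C" for \<tau>
    unfolding H_def using someI_ex[of "\<lambda>h. h \<in> stab I a \<and> \<tau> = h \<circ> \<sigma> \<circ> G \<tau>"] G[OF that] by blast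
  note comp = stab_comp and invs = stab_inv
  have "card (?C \<times> ?S) \<le> card (stab I a \<times> stab I b)"
  proof (rule card_inj_on_le)
    \<comment> \<open>The chosen factorisation of \<tau> is twisted by u. The factors still multiply
      to \<tau>, after which u can be read off from the second component.\<close>
    let ?F = "\<lambda>(\<tau>, u). (H \<tau> \<circ> \<sigma> \<circ> inv u \<circ> inv \<sigma>, u \<circ> G \<tau>)"
    show "finite (stab I a \<times> stab I b)" by (intro finite_cartesian_product finite_stab I)
    show "?F ` (?C \<times> ?S) \<subseteq> stab I a \<times> stab I b"
    proof clarsimp
      fix \<tau> u assume t: "\<tau> permutes I" "contingency I a b \<tau> = contingency I a b \<sigma>" and u: "u \<in> ?S"
      have u': "u permutes I" using u by (simp add: stab_def)
      have iu: "inv u \<in> ?S" using invs[OF u] .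
      have "\<sigma> \<circ> inv u \<circ> inv \<sigma> \<in> stab I a"
      proof -
        have "a (\<sigma> (inv u (inv \<sigma> i))) = a i" if "i \<in> I" for i
        proof -
          have "inv \<sigma> i \<in> I" using s that by (metis permutes_in_image permutes_inv)
          then have "a (\<sigma> (inv u (inv \<sigma> i))) = a (\<sigma> (inv \<sigma> i))" using iu by (auto simp: stab_def)
          then show ?thesis using s by (simp add: permutes_inverses)
        qed
        then show ?thesis using s u' by (auto simp: stab_def intro!: permutes_compose permutes_inv)
      qed
      then have "H \<tau> \<circ> (\<sigma> \<circ> inv u \<circ> inv \<sigma>) \<in> stab I a"
        using H t by (intro comp[of "H \<tau>"]) auto
      moreover have "u \<in> stab I b" using u by (auto simp: stab_def)
      then have "u \<circ> G \<tau> \<in> stab I b" using G t by (intro comp) auto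
      ultimately show "H \<tau> \<circ> \<sigma> \<circ> inv u \<circ> inv \<sigma> \<in> stab I a \<and> u \<circ> G \<tau> \<in> stab I b"
        by (simp add: comp_assoc)
    qed
    show "inj_on ?F (?C \<times> ?S)"
    proof (rule inj_onI, clarify)
      fix \<tau> u \<tau>' u'
      assume t: "\<tau> permutes I" "contingency I a b \<tau> = contingency I a b \<sigma>" and u: "u \<in> ?S"
        and t': "\<tau>' permutes I" "contingency I a b \<tau>' = contingency I a b \<sigma>" and u': "u' \<in> ?S"
        and e1: "H \<tau> \<circ> \<sigma> \<circ> inv u \<circ> inv \<sigma> = H \<tau>' \<circ> \<sigma> \<circ> inv u' \<circ> inv \<sigma>" and e2: "u \<circ> G \<tau> = u' \<circ> G \<tau>'"
      have up: "u permutes I" "u' permutes I" using u u' by (auto simp: stab_def)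
      have rec: "\<rho> = (H \<rho> \<circ> \<sigma> \<circ> inv v \<circ> inv \<sigma>) \<circ> \<sigma> \<circ> (v \<circ> G \<rho>)" if "\<rho> \<in> ?C" "v permutes I" for \<rho> v
      proof -
        have "\<rho> = H \<rho> \<circ> \<sigma> \<circ> G \<rho>" using H[OF that(1)] by simp
        also have "\<dots> = (H \<rho> \<circ> \<sigma> \<circ> inv v \<circ> inv \<sigma>) \<circ> \<sigma> \<circ> (v \<circ> G \<rho>)"
          using s that by (auto simp: fun_eq_iff permutes_inverses)
        finally show ?thesis .
      qed
      have tt: "\<tau> = \<tau>'" using rec[of \<tau> u] rec[of \<tau>' u'] t t' up e1 e2 by simp
      have gp: "G \<tau> permutes I" using G[of \<tau>] t by (auto simp: stab_def)
      have "u = u'"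
      proof
        fix x
        have "u (G \<tau> (inv (G \<tau>) x)) = u' (G \<tau> (inv (G \<tau>) x))" using e2 tt by (metis comp_apply)
        then show "u x = u' x" using gp by (simp add: permutes_inverses)
      qed
      with tt show "\<tau> = \<tau>' \<and> u = u'" by simp
    qed
  qed
  moreover have "card (stab I a \<times> stab I b) \<le> card (?C \<times> ?S)"
  proof (rule card_inj_on_le)
    \<comment> \<open>The second component compares g with the factor chosen for the same
      permutation; the two differ by an element of the stabiliser of the pair labelling.\<close>
    let ?F = "\<lambda>(h, g). (h \<circ> \<sigma> \<circ> g, g \<circ> inv (G (h \<circ> \<sigma> \<circ> g)))"
    have inC: "h \<circ> \<sigma> \<circ> g \<in> ?C" if h: "h \<in> stab I a" and g: "g \<in> stab I b" for h g
    proof -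
      have "contingency I a b (h \<circ> \<sigma> \<circ> g) k l = contingency I a b \<sigma> k l" for k l
        unfolding contingency_def
      proof (rule bij_betw_same_card[of g])
        have gp: "g permutes I" and gb: "\<And>i. i \<in> I \<Longrightarrow> b (g i) = b i" using g by (auto simp: stab_def)
        have ha: "a (h (\<sigma> (g i))) = a (\<sigma> (g i))" if "i \<in> I" for i
          using h s gp that by (auto simp: stab_def permutes_in_image)
        show "bij_betw g {i \<in> I. a ((h \<circ> \<sigma> \<circ> g) i) = k \<and> b i = l} {i \<in> I. a (\<sigma> i) = k \<and> b i = l}"
        proof (rule bij_betw_imageI)
          show "inj_on g {i \<in> I. a ((h \<circ> \<sigma> \<circ> g) i) = k \<and> b i = l}"
            using gp by (meson inj_on_subset permutes_inj subset_UNIV)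
          show "g ` {i \<in> I. a ((h \<circ> \<sigma> \<circ> g) i) = k \<and> b i = l} = {i \<in> I. a (\<sigma> i) = k \<and> b i = l}"
          proof (intro equalityI subsetI)
            fix j assume j: "j \<in> {i \<in> I. a (\<sigma> i) = k \<and> b i = l}"
            define i where "i = inv g j"
            have "i \<in> I" "g i = j"
              using j gp by (auto simp: i_def permutes_inverses permutes_in_image permutes_inv)
            then show "j \<in> g ` {i \<in> I. a ((h \<circ> \<sigma> \<circ> g) i) = k \<and> b i = l}"
              using j ha gb by (intro image_eqI[of _ _ i]) auto
          qed (use ha gb gp in \<open>auto simp: permutes_in_image\<close>)
        qed
      qed
      then show ?thesis using h g s by (auto simp: stab_def fun_eq_iff intro!: permutes_compose)
    qed
    have fC: "finite ?C" by (rule finite_subset[OF _ finite_permutations[OF I]]) auto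
    show "finite (?C \<times> ?S)" by (intro finite_cartesian_product finite_stab I fC)
    show "?F ` (stab I a \<times> stab I b) \<subseteq> ?C \<times> ?S"
    proof (rule image_subsetI, clarsimp simp del: mem_Collect_eq o_apply)
      fix h g assume h: "h \<in> stab I a" and g: "g \<in> stab I b"
      define \<tau> where "\<tau> = h \<circ> \<sigma> \<circ> g"
      have t: "\<tau> \<in> ?C" unfolding \<tau>_def by (rule inC[OF h g])
      have gp: "g permutes I" "G \<tau> permutes I" using g G[OF t] by (auto simp: stab_def)
      have bG: "g \<circ> inv (G \<tau>) \<in> stab I b" using G[OF t] g by (intro comp invs) auto
      have "a (\<sigma> (g (inv (G \<tau>) i))) = a (\<sigma> i)" if "i \<in> I" for i
      proof -
        define j where "j = inv (G \<tau>) i"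
        have j: "j \<in> I" "G \<tau> j = i" using gp(2) that by (auto simp: j_def permutes_inverses permutes_in_image permutes_inv)
        have "a (\<sigma> (g j)) = a (h (\<sigma> (g j)))" using h s gp j by (auto simp: stab_def permutes_in_image)
        also have "\<dots> = a (\<tau> j)" by (simp add: \<tau>_def)
        also have "\<tau> j = H \<tau> (\<sigma> (G \<tau> j))" using H[OF t] by (metis comp_apply)
        also have "a \<dots> = a (\<sigma> (G \<tau> j))" using H[OF t] s gp j that by (auto simp: stab_def permutes_in_image)
        finally show ?thesis using j by (simp add: j_def)
      qed
      then have "g \<circ> inv (G \<tau>) \<in> ?S" using bG by (auto simp: stab_def)
      then show "h \<circ> \<sigma> \<circ> g \<in> ?C \<and> g \<circ> inv (G (h \<circ> \<sigma> \<circ> g)) \<in> ?S"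
        using t unfolding \<tau>_def by blast
    qed
    show "inj_on ?F (stab I a \<times> stab I b)"
    proof (rule inj_onI, clarify)
      fix h g h' g'
      assume h: "h \<in> stab I a" and g: "g \<in> stab I b" and h': "h' \<in> stab I a" and g': "g' \<in> stab I b"
        and e1: "h \<circ> \<sigma> \<circ> g = h' \<circ> \<sigma> \<circ> g'"
        and e2: "g \<circ> inv (G (h \<circ> \<sigma> \<circ> g)) = g' \<circ> inv (G (h' \<circ> \<sigma> \<circ> g'))"
      have gp: "G (h \<circ> \<sigma> \<circ> g) permutes I" using G[OF inC[OF h g]] by (auto simp: stab_def)
      have gg: "g = g'"
      proof
        fix x
        have "g (inv (G (h \<circ> \<sigma> \<circ> g)) (G (h \<circ> \<sigma> \<circ> g) x)) = g' (inv (G (h \<circ> \<sigma> \<circ> g)) (G (h \<circ> \<sigma> \<circ> g) x))"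
          using e2 unfolding e1[symmetric] by (metis comp_apply)
        then show "g x = g' x" using permutes_inverses[OF gp] by simp
      qed
      have "h = h'"
      proof
        fix x
        have gI: "g permutes I" using g by (auto simp: stab_def)
        have "(h \<circ> \<sigma> \<circ> g) (inv g (inv \<sigma> x)) = (h' \<circ> \<sigma> \<circ> g) (inv g (inv \<sigma> x))" using e1 gg by simp
        then show "h x = h' x" using gI s by (simp add: permutes_inverses)
      qed
      with gg show "h = h' \<and> g = g'" by simp
    qed
  qed
  ultimately show ?thesis by (simp add: card_cartesian_product)
qed

section \<open>Entropy of finite tables\<close>

lemma continuous_on_xlnx: "continuous_on {0..} xlnx"
proof -
  have "isCont (\<lambda>x. x * ln x) x" if "x > 0" for x :: real
    using that by (intro continuous_intros) auto
  moreover have "((\<lambda>x::real. x * ln x) \<longlongrightarrow> 0) (at 0 within {0..})"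
  proof (rule tendsto_sandwich)
    \<comment> \<open>The bound -2 sqrt x \<le> x ln x comes from ln (1 / s) \<le> 1 / s - 1 at s =
      sqrt x.\<close>
    show "((\<lambda>x. - 2 * sqrt x) \<longlongrightarrow> 0) (at 0 within {0..})"
      by (auto intro!: tendsto_eq_intros)
    have "eventually (\<lambda>x::real. x < 1) (at 0 within {0..})"
      by (rule order_tendstoD[OF tendsto_ident_at]) simp
    moreover have "eventually (\<lambda>x::real. x > 0) (at 0 within {0..})"
      by (auto simp: eventually_at_filter)
    ultimately have ev: "eventually (\<lambda>x::real. 0 < x \<and> x < 1) (at 0 within {0..})"
      by eventually_elim simp
    show "eventually (\<lambda>x::real. x * ln x \<le> 0) (at 0 within {0..})"
      using ev by eventually_elim (simp add: mult_le_0_iff)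
    show "eventually (\<lambda>x::real. - 2 * sqrt x \<le> x * ln x) (at 0 within {0..})"
      using ev
    proof eventually_elim
      case (elim x)
      define s where "s = sqrt x"
      have s: "s > 0" "x = s * s" using elim by (auto simp: s_def)
      have "ln (1 / s) \<le> 1 / s - 1" using s by (intro ln_le_minus_one) auto
      then have "s * (- ln s) \<le> s * (1 / s)" using s by (intro mult_left_mono) (auto simp: ln_div)
      then have "s * (- ln s) \<le> 1" using s by simp
      then have "s * (s * (- ln s)) \<le> s * 1" using s by (intro mult_left_mono) auto
      moreover have "x * ln x = - 2 * (s * (s * (- ln s)))" using s by (simp add: ln_mult algebra_simps)
      ultimately show ?case unfolding s_def[symmetric] by linarith
    qed
  qed simp
  ultimately have "((\<lambda>x. x * ln x) \<longlongrightarrow> x * ln x) (at x within {0..})" if "x \<ge> 0" for x :: real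
  proof (cases "x = 0")
    case False
    then have "isCont (\<lambda>x. x * ln x) x" using that \<open>\<And>x. 0 < x \<Longrightarrow> isCont (\<lambda>x. x * ln x) x\<close> by simp
    then show ?thesis by (metis continuous_at_imp_continuous_at_within continuous_within)
  qed simp
  then show ?thesis
    unfolding continuous_on_def xlnx_def[abs_def] by simp
qed

lemma tendsto_xlnx:
  assumes "(f \<longlongrightarrow> x) F" "x \<ge> 0" "eventually (\<lambda>i. f i \<ge> 0) F"
  shows "((\<lambda>i. xlnx (f i)) \<longlongrightarrow> xlnx x) F"
  using continuous_on_tendsto_compose[OF continuous_on_xlnx assms(1)] assms by auto

lemma xlnx_scale: "c > 0 \<Longrightarrow> x \<ge> 0 \<Longrightarrow> xlnx (c * x) = c * xlnx x + c * x * ln c"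
  by (cases "x = 0") (auto simp: xlnx_def ln_mult algebra_simps)

text \<open>The mutual information, sum of p ln (p / (r c)), of a table with row sums r and column
  sums c, expanded so that it is visibly continuous in the entries, vanishing ones included.\<close>

definition tent :: "'k set \<Rightarrow> 'l set \<Rightarrow> ('k \<Rightarrow> 'l \<Rightarrow> real) \<Rightarrow> real" where
  "tent K L p = (\<Sum>k\<in>K. \<Sum>l\<in>L. xlnx (p k l))
     - (\<Sum>k\<in>K. xlnx (\<Sum>l\<in>L. p k l)) - (\<Sum>l\<in>L. xlnx (\<Sum>k\<in>K. p k l))"

lemma tent_cong:
  "(\<And>k l. k \<in> K \<Longrightarrow> l \<in> L \<Longrightarrow> p k l = q k l) \<Longrightarrow> tent K L p = tent K L q"
  unfolding tent_def by (simp cong: sum.cong)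

lemma tendsto_tent:
  assumes "\<And>k l. k \<in> K \<Longrightarrow> l \<in> L \<Longrightarrow> (\<lambda>j. t j k l) \<longlonglongrightarrow> p k l"
    and "\<And>j k l. k \<in> K \<Longrightarrow> l \<in> L \<Longrightarrow> t j k l \<ge> 0"
  shows "(\<lambda>j. tent K L (t j)) \<longlonglongrightarrow> tent K L p"
proof -
  have p0: "p k l \<ge> 0" if "k \<in> K" "l \<in> L" for k l
    using assms(1)[OF that] assms(2)[OF that] by (intro tendsto_lowerbound[of _ _ sequentially]) auto
  show ?thesis unfolding tent_def
    by (intro tendsto_diff tendsto_sum tendsto_xlnx assms sum_nonneg p0 always_eventually allI) auto
qed

text \<open>Termwise this is ln t \<le> t - 1 at t = r c exp f / p; the summand 1 is the total mass
  of p. It is the finite form of the linearised entropy bound.\<close>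

lemma tent_young:
  fixes p :: "'k \<Rightarrow> 'l \<Rightarrow> real"
  assumes fin: "finite K" "finite L" and p0: "\<And>k l. k \<in> K \<Longrightarrow> l \<in> L \<Longrightarrow> p k l \<ge> 0"
    and p1: "(\<Sum>k\<in>K. \<Sum>l\<in>L. p k l) = 1"
  shows "(\<Sum>k\<in>K. \<Sum>l\<in>L. p k l * f k l) - (\<Sum>k\<in>K. \<Sum>l\<in>L. (\<Sum>l\<in>L. p k l) * (\<Sum>k\<in>K. p k l) * exp (f k l)) + 1
    \<le> tent K L p"
proof -
  define r where "r k = (\<Sum>l\<in>L. p k l)" for k
  define c where "c l = (\<Sum>k\<in>K. p k l)" for l
  have r0: "r k \<ge> 0" if "k \<in> K" for k using that p0 by (auto simp: r_def intro!: sum_nonneg)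
  have c0: "c l \<ge> 0" if "l \<in> L" for l using that p0 by (auto simp: c_def intro!: sum_nonneg)
  have "tent K L p = (\<Sum>k\<in>K. \<Sum>l\<in>L. xlnx (p k l)) - (\<Sum>k\<in>K. \<Sum>l\<in>L. p k l * ln (r k)) - (\<Sum>l\<in>L. \<Sum>k\<in>K. p k l * ln (c l))"
    unfolding tent_def xlnx_def r_def c_def by (simp add: sum_distrib_right)
  also have "(\<Sum>l\<in>L. \<Sum>k\<in>K. p k l * ln (c l)) = (\<Sum>k\<in>K. \<Sum>l\<in>L. p k l * ln (c l))" by (rule sum.swap)
  finally have t: "tent K L p = (\<Sum>k\<in>K. \<Sum>l\<in>L. xlnx (p k l) - p k l * ln (r k) - p k l * ln (c l))"
    by (simp add: sum_subtractf)
  have "p k l * f k l - r k * c l * exp (f k l) + p k l \<le> xlnx (p k l) - p k l * ln (r k) - p k l * ln (c l)"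
    if kl: "k \<in> K" "l \<in> L" for k l
  proof (cases "p k l = 0")
    case True
    then show ?thesis using r0 c0 kl by (simp add: xlnx_def)
  next
    case False
    then have pp: "p k l > 0" using p0[OF kl] by simp
    have "p k l \<le> r k" "p k l \<le> c l"
      unfolding r_def c_def using kl p0 fin by (auto intro!: member_le_sum)
    then have rc: "r k > 0" "c l > 0" using pp by auto
    have "ln (r k * c l * exp (f k l) / p k l) \<le> r k * c l * exp (f k l) / p k l - 1"
      using pp rc by (intro ln_le_minus_one) auto
    then have "ln (r k) + ln (c l) + f k l - ln (p k l) \<le> r k * c l * exp (f k l) / p k l - 1"
      using pp rc by (simp add: ln_div ln_mult)
    then have "p k l * (ln (r k) + ln (c l) + f k l - ln (p k l)) \<le> p k l * (r k * c l * exp (f k l) / p k l - 1)"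
      using pp by (intro mult_left_mono) auto
    then show ?thesis using pp by (simp add: xlnx_def algebra_simps)
  qed
  then have "(\<Sum>k\<in>K. \<Sum>l\<in>L. p k l * f k l - r k * c l * exp (f k l) + p k l) \<le> tent K L p"
    unfolding t by (intro sum_mono) auto
  then show ?thesis using p1 by (simp add: sum.distrib sum_subtractf r_def c_def)
qed

section \<open>Counting permutations by the entropy of their table\<close>

text \<open>The proportion of permutations with a given table is a quotient of products of K + L
  rows and columns, K L cells and n, all as factorials. The first factor counts these factorials,
  the second bounds the error of each in \<open>ln_fact_bounds\<close>.\<close>

definition corr :: "nat \<Rightarrow> nat \<Rightarrow> nat \<Rightarrow> real" where
  "corr K L n = (real K + real L + real K * real L + 1) * (1 + ln (real n + 1))"

locale two_labellings =
  fixes I :: "'i set" and a :: "'i \<Rightarrow> 'k" and b :: "'i \<Rightarrow> 'l" and K L and n :: nat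
  assumes I: "finite I" "card I = n" "n \<ge> 1" and fin: "finite K" "finite L"
    and aK: "a ` I \<subseteq> K" and bL: "b ` I \<subseteq> L"
begin

definition tab :: "('i \<Rightarrow> 'i) \<Rightarrow> 'k \<Rightarrow> 'l \<Rightarrow> real" where
  "tab \<sigma> k l = real (contingency I a b \<sigma> k l) / real n"

lemma contingency_rows:
  assumes "\<sigma> permutes I"
  shows "(\<Sum>l\<in>L. contingency I a b \<sigma> k l) = card {i\<in>I. a i = k}"
proof -
  have "(\<Sum>l\<in>L. contingency I a b \<sigma> k l) = card (\<Union>l\<in>L. {i\<in>I. a (\<sigma> i) = k \<and> b i = l})"
    unfolding contingency_def using fin I by (subst card_UN_disjoint) auto
  also have "(\<Union>l\<in>L. {i\<in>I. a (\<sigma> i) = k \<and> b i = l}) = {i\<in>I. a (\<sigma> i) = k}" using bL by auto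
  also have "card \<dots> = card {i\<in>I. a i = k}"
  proof (rule bij_betw_same_card[of \<sigma>], rule bij_betw_imageI)
    show "inj_on \<sigma> {i \<in> I. a (\<sigma> i) = k}" using assms by (meson inj_on_subset permutes_inj subset_UNIV)
    show "\<sigma> ` {i \<in> I. a (\<sigma> i) = k} = {i \<in> I. a i = k}"
    proof (intro equalityI subsetI)
      fix j assume j: "j \<in> {i \<in> I. a i = k}"
      have "\<sigma> (inv \<sigma> j) = j" "inv \<sigma> j \<in> I"
        using assms j by (auto simp: permutes_inverses permutes_in_image permutes_inv)
      then show "j \<in> \<sigma> ` {i \<in> I. a (\<sigma> i) = k}" using j by (intro image_eqI[of _ _ "inv \<sigma> j"]) auto
    qed (use assms in \<open>auto simp: permutes_in_image\<close>)
  qed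
  finally show ?thesis .
qed

lemma contingency_cols:
  assumes "\<sigma> permutes I"
  shows "(\<Sum>k\<in>K. contingency I a b \<sigma> k l) = card {i\<in>I. b i = l}"
proof -
  have "(\<Sum>k\<in>K. contingency I a b \<sigma> k l) = card (\<Union>k\<in>K. {i\<in>I. a (\<sigma> i) = k \<and> b i = l})"
    unfolding contingency_def using fin I by (subst card_UN_disjoint) auto
  also have "(\<Union>k\<in>K. {i\<in>I. a (\<sigma> i) = k \<and> b i = l}) = {i\<in>I. b i = l}"
    using aK assms by (auto simp: permutes_in_image image_subset_iff)
  finally show ?thesis .
qed

lemma sum_card_fibres: "(\<Sum>k\<in>K. card {i\<in>I. a i = k}) = n" "(\<Sum>l\<in>L. card {i\<in>I. b i = l}) = n"
proof -
  have "(\<Sum>k\<in>K. card {i\<in>I. a i = k}) = card (\<Union>k\<in>K. {i\<in>I. a i = k})"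
    using fin I by (subst card_UN_disjoint) auto
  also have "(\<Union>k\<in>K. {i\<in>I. a i = k}) = I" using aK by auto
  finally show "(\<Sum>k\<in>K. card {i\<in>I. a i = k}) = n" using I by simp
  have "(\<Sum>l\<in>L. card {i\<in>I. b i = l}) = card (\<Union>l\<in>L. {i\<in>I. b i = l})"
    using fin I by (subst card_UN_disjoint) auto
  also have "(\<Union>l\<in>L. {i\<in>I. b i = l}) = I" using bL by auto
  finally show "(\<Sum>l\<in>L. card {i\<in>I. b i = l}) = n" using I by simp
qed

text \<open>By \<open>card_contingency_class\<close> the size of the class is a quotient of
  factorials. In Stirling's formula the linear terms cancel because rows, columns and cells each sum
  to n; the entropy and the remainders R are what is left.\<close>

lemma ln_card_class:
  assumes s: "\<sigma> permutes I"
  defines "C \<equiv> {\<tau>. \<tau> permutes I \<and> contingency I a b \<tau> = contingency I a b \<sigma>}"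
  shows "\<bar>ln (real (card C)) - ln (fact n) + real n * tent K L (tab \<sigma>)\<bar> \<le> corr (card K) (card L) n"
    and "card C > 0"
proof -
  let ?T = "contingency I a b \<sigma>"
  define r where "r k = card {i\<in>I. a i = k}" for k
  define c where "c l = card {i\<in>I. b i = l}" for l
  have "finite C" unfolding C_def by (rule finite_subset[OF _ finite_permutations[OF I(1)]]) auto
  then show C0: "card C > 0" using s by (auto simp: C_def card_gt_0_iff)
  have Ta: "card (stab I a) = (\<Prod>k\<in>K. fact (r k))"
    unfolding r_def using I fin aK by (intro card_stab_superset)
  have Tb: "card (stab I b) = (\<Prod>l\<in>L. fact (c l))"
    unfolding c_def using I fin bL by (intro card_stab_superset)
  have "card (stab I (\<lambda>i. (a (\<sigma> i), b i))) = (\<Prod>y\<in>K\<times>L. fact (card {i\<in>I. (a (\<sigma> i), b i) = y}))"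
    using I fin aK bL s by (intro card_stab_superset) (auto simp: permutes_in_image image_subset_iff)
  also have "\<dots> = (\<Prod>k\<in>K. \<Prod>l\<in>L. fact (?T k l))"
    unfolding prod.cartesian_product by (intro prod.cong) (auto simp: contingency_def)
  finally have Tab: "card (stab I (\<lambda>i. (a (\<sigma> i), b i))) = (\<Prod>k\<in>K. \<Prod>l\<in>L. fact (?T k l))" .
  have "real (card C) * (\<Prod>k\<in>K. \<Prod>l\<in>L. fact (?T k l)) = (\<Prod>k\<in>K. fact (r k)) * (\<Prod>l\<in>L. fact (c l))"
    using arg_cong[OF card_contingency_class[OF I(1) s, of a b], of real] unfolding Ta Tb Tab C_def by simp
  then have "ln (real (card C) * (\<Prod>k\<in>K. \<Prod>l\<in>L. fact (?T k l))) = ln ((\<Prod>k\<in>K. fact (r k)) * (\<Prod>l\<in>L. fact (c l)))"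
    by simp
  then have e: "ln (real (card C)) = (\<Sum>k\<in>K. ln (fact (r k))) + (\<Sum>l\<in>L. ln (fact (c l))) - (\<Sum>k\<in>K. \<Sum>l\<in>L. ln (fact (?T k l)))"
    using C0 by (simp add: ln_mult prod_pos ln_prod fin)
  define E where "E = 1 + ln (real n + 1)"
  define R where "R m = ln (fact m) - (xlnx (real m) - real m)" for m :: nat
  have R: "0 \<le> R m \<and> R m \<le> E" if "m \<le> n" for m
  proof -
    have "ln (real m + 1) \<le> ln (real n + 1)" using that by simp
    then show ?thesis using ln_fact_bounds[of m] unfolding R_def E_def by linarith
  qed
  have rn: "r k \<le> n" for k unfolding r_def using I by (auto intro!: card_mono)
  have cn: "c l \<le> n" for l unfolding c_def using I by (auto intro!: card_mono)
  have Tn: "?T k l \<le> n" for k l unfolding contingency_def using I by (auto intro!: card_mono)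
  have rs: "(\<Sum>l\<in>L. real (?T k l)) = real (r k)" for k
    using contingency_rows[OF s, of k] unfolding r_def by (simp flip: of_nat_sum)
  have cs: "(\<Sum>k\<in>K. real (?T k l)) = real (c l)" for l
    using contingency_cols[OF s, of l] unfolding c_def by (simp flip: of_nat_sum)
  have sr: "(\<Sum>k\<in>K. real (r k)) = real n" using sum_card_fibres(1) unfolding r_def by (simp flip: of_nat_sum)
  have sc: "(\<Sum>l\<in>L. real (c l)) = real n" using sum_card_fibres(2) unfolding c_def by (simp flip: of_nat_sum)
  have sT: "(\<Sum>k\<in>K. \<Sum>l\<in>L. real (?T k l)) = real n" by (simp add: rs sr)
  have n0: "real n > 0" using I by simp
  have sc1: "real n * xlnx (x / real n) = xlnx x - x * ln (real n)" if "x \<ge> 0" for x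
    using xlnx_scale[OF n0, of "x / real n"] that n0 by simp
  \<comment> \<open>Rescaling by n corrects each term by a multiple of ln n. The cells contribute -
    n ln n, rows and columns + n ln n each, which leaves \<open>xlnx n\<close>.\<close>
  have ten: "real n * tent K L (tab \<sigma>) = (\<Sum>k\<in>K. \<Sum>l\<in>L. xlnx (?T k l)) - (\<Sum>k\<in>K. xlnx (r k)) - (\<Sum>l\<in>L. xlnx (c l)) + xlnx n"
  proof -
    have "real n * tent K L (tab \<sigma>) = (\<Sum>k\<in>K. \<Sum>l\<in>L. real n * xlnx (real (?T k l) / real n))
        - (\<Sum>k\<in>K. real n * xlnx (real (r k) / real n)) - (\<Sum>l\<in>L. real n * xlnx (real (c l) / real n))"
      unfolding tent_def tab_def sum_divide_distrib[symmetric] rs cs by (simp add: right_diff_distrib sum_distrib_left)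
    also have "\<dots> = (\<Sum>k\<in>K. \<Sum>l\<in>L. xlnx (?T k l) - real (?T k l) * ln n)
        - (\<Sum>k\<in>K. xlnx (r k) - real (r k) * ln n) - (\<Sum>l\<in>L. xlnx (c l) - real (c l) * ln n)"
      by (simp add: sc1)
    also have "\<dots> = (\<Sum>k\<in>K. \<Sum>l\<in>L. xlnx (?T k l)) - (\<Sum>k\<in>K. xlnx (r k)) - (\<Sum>l\<in>L. xlnx (c l)) + xlnx n"
      using sr sc sT by (simp add: sum_subtractf sum_distrib_right[symmetric] xlnx_def)
    finally show ?thesis .
  qed
  have "ln (real (card C)) - ln (fact n) + real n * tent K L (tab \<sigma>)
     = (\<Sum>k\<in>K. R (r k)) + (\<Sum>l\<in>L. R (c l)) - (\<Sum>k\<in>K. \<Sum>l\<in>L. R (?T k l)) - R n"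
    unfolding e ten R_def using sr sc sT by (simp add: sum_subtractf sum.distrib)
  moreover have "0 \<le> (\<Sum>k\<in>K. R (r k))" "(\<Sum>k\<in>K. R (r k)) \<le> real (card K) * E"
    using R rn by (auto intro!: sum_nonneg sum_bounded_above)
  moreover have "0 \<le> (\<Sum>l\<in>L. R (c l))" "(\<Sum>l\<in>L. R (c l)) \<le> real (card L) * E"
    using R cn by (auto intro!: sum_nonneg sum_bounded_above)
  moreover have "0 \<le> (\<Sum>k\<in>K. \<Sum>l\<in>L. R (?T k l))" "(\<Sum>k\<in>K. \<Sum>l\<in>L. R (?T k l)) \<le> real (card K) * (real (card L) * E)"
    using R Tn by (auto intro!: sum_nonneg sum_bounded_above)
  moreover have "0 \<le> R n" "R n \<le> E" using R[of n] by auto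
  moreover have "corr (card K) (card L) n = real (card K) * E + real (card L) * E + real (card K) * (real (card L) * E) + E"
    unfolding corr_def E_def by (simp add: algebra_simps)
  ultimately show "\<bar>ln (real (card C)) - ln (fact n) + real n * tent K L (tab \<sigma>)\<bar> \<le> corr (card K) (card L) n"
    by linarith
qed

text \<open>A union over classes of equal table: every entry lies in {0..n}, so there are at most (n
  + 1)^(K L) tables, and each class is bounded by \<open>ln_card_class\<close>.\<close>

lemma card_entropy_ge:
  "real (card {\<sigma>. \<sigma> permutes I \<and> \<beta> \<le> tent K L (tab \<sigma>)})
     \<le> fact n * (real n + 1) ^ (card K * card L) * exp (corr (card K) (card L) n) * exp (- real n * \<beta>)"
proof -
  let ?S = "{\<sigma>. \<sigma> permutes I \<and> \<beta> \<le> tent K L (tab \<sigma>)}"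
  let ?c = "contingency I a b"
  let ?B = "fact n * exp (corr (card K) (card L) n) * exp (- real n * \<beta>)"
  have fS: "finite ?S" by (rule finite_subset[OF _ finite_permutations[OF I(1)]]) auto
  have fib: "real (card {\<sigma>\<in>?S. ?c \<sigma> = ?c \<tau>}) \<le> ?B" if "\<tau> \<in> ?S" for \<tau>
  proof -
    let ?C = "{\<sigma>. \<sigma> permutes I \<and> ?c \<sigma> = ?c \<tau>}"
    have t: "\<tau> permutes I" "\<beta> \<le> tent K L (tab \<tau>)" using that by auto
    have "card {\<sigma>\<in>?S. ?c \<sigma> = ?c \<tau>} \<le> card ?C"
      by (rule card_mono) (auto intro: finite_subset[OF _ finite_permutations[OF I(1)]])
    also have "real (card ?C) = exp (ln (real (card ?C)))" using ln_card_class(2)[OF t(1)] by simp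
    also have "\<dots> \<le> exp (ln (fact n) - real n * tent K L (tab \<tau>) + corr (card K) (card L) n)"
      using ln_card_class(1)[OF t(1)] by (intro iffD2[OF exp_le_cancel_iff]) linarith
    also have "\<dots> \<le> exp (ln (fact n) - real n * \<beta> + corr (card K) (card L) n)"
      using t(2) by (intro iffD2[OF exp_le_cancel_iff]) (simp add: mult_left_mono)
    also have "\<dots> = ?B" by (simp add: exp_add exp_diff exp_minus field_simps)
    finally show ?thesis by linarith
  qed
  have img: "card (?c ` ?S) \<le> (n + 1) ^ (card K * card L)"
  proof -
    let ?r = "\<lambda>T. restrict (case_prod T) (K \<times> L)"
    have "card (?c ` ?S) \<le> card (PiE (K \<times> L) (\<lambda>_. {..n}))"
    proof (rule card_inj_on_le[of ?r])
      \<comment> \<open>Tables are functions on all pairs of labels; they vanish off K x L, so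
        restricting them to K x L is injective.\<close>
      have z: "?c \<sigma> k l = 0" if "\<sigma> permutes I" "(k, l) \<notin> K \<times> L" for \<sigma> k l
      proof -
        have "{i\<in>I. a (\<sigma> i) = k \<and> b i = l} = {}"
          using that aK bL by (auto simp: permutes_in_image image_subset_iff)
        then show ?thesis unfolding contingency_def by (metis card.empty)
      qed
      show "inj_on ?r (?c ` ?S)"
      proof (rule inj_onI, clarify)
        fix \<sigma> \<tau> assume p: "\<sigma> permutes I" "\<tau> permutes I" and e: "?r (?c \<sigma>) = ?r (?c \<tau>)"
        have "?c \<sigma> k l = ?c \<tau> k l" for k l
        proof (cases "(k, l) \<in> K \<times> L")
          case True
          then show ?thesis using fun_cong[OF e, of "(k, l)"] by simp
        qed (use z p in simp)
        then show "?c \<sigma> = ?c \<tau>" by blast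
      qed
      have le: "?c \<sigma> k l \<le> n" for \<sigma> k l
        unfolding contingency_def using card_mono[OF I(1), of "{i\<in>I. a (\<sigma> i) = k \<and> b i = l}"] I by simp
      show "?r ` ?c ` ?S \<subseteq> PiE (K \<times> L) (\<lambda>_. {..n})"
      proof (rule image_subsetI, erule imageE, hypsubst)
        fix \<sigma> show "?r (?c \<sigma>) \<in> PiE (K \<times> L) (\<lambda>_. {..n})"
          by (simp add: restrict_PiE_iff le split_beta)
      qed
      show "finite (PiE (K \<times> L) (\<lambda>_. {..n}))" using fin by (intro finite_PiE) auto
    qed
    also have "\<dots> = (n + 1) ^ (card K * card L)" using fin by (simp add: card_PiE card_cartesian_product)
    finally show ?thesis .
  qed
  have "real (card ?S) = (\<Sum>T\<in>?c ` ?S. real (card {\<sigma>\<in>?S. ?c \<sigma> = T}))"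
  proof -
    have "?S = (\<Union>T\<in>?c ` ?S. {\<sigma>\<in>?S. ?c \<sigma> = T})" by auto
    then have "card ?S = card (\<Union>T\<in>?c ` ?S. {\<sigma>\<in>?S. ?c \<sigma> = T})" by simp
    also have "\<dots> = (\<Sum>T\<in>?c ` ?S. card {\<sigma>\<in>?S. ?c \<sigma> = T})"
    proof (rule card_UN_disjoint)
      show "finite (?c ` ?S)" using fS by (rule finite_imageI)
      show "\<forall>T\<in>?c ` ?S. finite {\<sigma>\<in>?S. ?c \<sigma> = T}"
        by (intro ballI finite_subset[OF _ fS] subsetI) (erule CollectE, erule conjE)
      show "\<forall>i\<in>?c ` ?S. \<forall>j\<in>?c ` ?S. i \<noteq> j \<longrightarrow> {\<sigma>\<in>?S. ?c \<sigma> = i} \<inter> {\<sigma>\<in>?S. ?c \<sigma> = j} = {}"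
        by blast
    qed
    finally show ?thesis by simp
  qed
  also have "\<dots> \<le> (\<Sum>T\<in>?c ` ?S. ?B)" using fib by (intro sum_mono) (auto simp only: image_iff)
  also have "\<dots> = real (card (?c ` ?S)) * ?B" by simp
  also have "\<dots> \<le> real ((n + 1) ^ (card K * card L)) * ?B"
    using img by (intro mult_right_mono) (simp_all del: of_nat_power)
  also have "real ((n + 1) ^ (card K * card L)) = (real n + 1) ^ (card K * card L)" by (simp add: add.commute)
  finally show ?thesis by (simp only: mult_ac)
qed

end

section \<open>Realising a prescribed table by a permutation\<close>

text \<open>Indices are reserved label by label; \<open>None\<close> collects those left over, since
  the m l need not exhaust R.\<close>

lemma exists_labelling_with_fibres:
  assumes "finite L" "finite R" "(\<Sum>l\<in>L. m l) \<le> card R"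
  shows "\<exists>\<alpha> :: 'i \<Rightarrow> 'l option. (\<forall>l\<in>L. card {i\<in>R. \<alpha> i = Some l} = m l) \<and> (\<forall>i. \<alpha> i \<in> insert None (Some ` L))"
  using assms
proof (induction L arbitrary: R rule: finite_induct)
  case empty
  then show ?case by (intro exI[of _ "\<lambda>_. None"]) auto
next
  case (insert l L)
  have "m l \<le> card R" using insert by auto
  then obtain R0 where R0: "R0 \<subseteq> R" "card R0 = m l" "finite R0" by (meson obtain_subset_with_card_n)
  have "(\<Sum>l\<in>L. m l) \<le> card (R - R0)" using insert R0 by (simp add: card_Diff_subset)
  then obtain \<alpha> where \<alpha>: "\<forall>l\<in>L. card {i\<in>R - R0. \<alpha> i = Some l} = m l" "\<forall>i. \<alpha> i \<in> insert None (Some ` L)"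
    using insert.IH[of "R - R0"] insert by auto
  define \<beta> where "\<beta> i = (if i \<in> R0 then Some l else \<alpha> i)" for i
  have "\<alpha> i \<noteq> Some l" for i using \<alpha>(2)[rule_format, of i] insert(2) by auto
  then have "{i\<in>R. \<beta> i = Some l} = R0" using R0(1) by (auto simp: \<beta>_def)
  moreover have "{i\<in>R. \<beta> i = Some l'} = {i\<in>R - R0. \<alpha> i = Some l'}" if "l' \<in> L" for l'
    using that insert(2) by (auto simp: \<beta>_def)
  moreover have "\<beta> i \<in> insert None (Some ` insert l L)" for i
    using \<alpha>(2)[rule_format, of i] by (auto simp: \<beta>_def)
  ultimately show ?case using \<alpha>(1) R0(2) by (intro exI[of _ \<beta>]) simp
qed

text \<open>Each row is treated separately, and the labels remember the row.\<close>

lemma exists_labelling_with_fibres2: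
  fixes a :: "'i \<Rightarrow> 'k"
  assumes "finite L" "finite I" "\<And>k. k \<in> K \<Longrightarrow> (\<Sum>l\<in>L. m k l) \<le> card {i\<in>I. a i = k}" "a ` I \<subseteq> K"
  shows "\<exists>\<alpha> :: 'i \<Rightarrow> ('k \<times> 'l) option. (\<forall>k\<in>K. \<forall>l\<in>L. card {i\<in>I. \<alpha> i = Some (k, l)} = m k l) \<and>
     (\<forall>i\<in>I. \<forall>k l. \<alpha> i = Some (k, l) \<longrightarrow> a i = k \<and> l \<in> L)"
proof -
  have "\<forall>k\<in>K. \<exists>\<alpha> :: 'i \<Rightarrow> 'l option. (\<forall>l\<in>L. card {i\<in>{i\<in>I. a i = k}. \<alpha> i = Some l} = m k l) \<and> (\<forall>i. \<alpha> i \<in> insert None (Some ` L))"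
    using assms by (intro ballI exists_labelling_with_fibres) auto
  from bchoice[OF this] obtain \<alpha> where \<alpha>: "\<forall>k\<in>K. (\<forall>l\<in>L. card {i\<in>{i\<in>I. a i = k}. \<alpha> k i = Some l} = m k l) \<and> (\<forall>i. \<alpha> k i \<in> insert None (Some ` (L :: 'l set)))"
    by blast
  define \<beta> where "\<beta> i = map_option (\<lambda>l. (a i, l)) (\<alpha> (a i) i)" for i
  have "{i\<in>I. \<beta> i = Some (k, l)} = {i\<in>{i\<in>I. a i = k}. \<alpha> k i = Some l}" for k l
    by (auto simp: \<beta>_def)
  moreover have "a i = k \<and> l \<in> L" if "i \<in> I" "\<beta> i = Some (k, l)" for i k l
  proof -
    have "a i \<in> K" using that assms by auto
    then have "\<alpha> (a i) i \<in> insert None (Some ` L)" using \<alpha> by blast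
    then show ?thesis using that by (auto simp: \<beta>_def)
  qed
  ultimately show ?thesis using \<alpha> by (intro exI[of _ \<beta>]) auto
qed

context two_labellings begin

text \<open>Each side reserves m k l of its indices for the cell (k, l): \<alpha> inside the rows,
  \<beta> inside the columns. The reserved classes have equal sizes, hence so do the leftovers, and
  a permutation matching the two labellings fills each cell as required. Leftovers may fall into any
  cell, whence only an inequality.\<close>

lemma exists_permutation_dominating_table:
  assumes "\<And>k. k \<in> K \<Longrightarrow> (\<Sum>l\<in>L. m k l) \<le> card {i\<in>I. a i = k}"
    and "\<And>l. l \<in> L \<Longrightarrow> (\<Sum>k\<in>K. m k l) \<le> card {i\<in>I. b i = l}"
  obtains \<sigma> where "\<sigma> permutes I" "\<And>k l. k \<in> K \<Longrightarrow> l \<in> L \<Longrightarrow> m k l \<le> contingency I a b \<sigma> k l"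
proof -
  obtain \<alpha> :: "'i \<Rightarrow> ('k \<times> 'l) option" where \<alpha>: "\<forall>k\<in>K. \<forall>l\<in>L. card {i\<in>I. \<alpha> i = Some (k, l)} = m k l"
     "\<forall>i\<in>I. \<forall>k l. \<alpha> i = Some (k, l) \<longrightarrow> a i = k \<and> l \<in> L"
    using exists_labelling_with_fibres2[of L I K m a] assms(1) fin I aK by auto
  obtain \<beta>' :: "'i \<Rightarrow> ('l \<times> 'k) option" where \<beta>': "\<forall>l\<in>L. \<forall>k\<in>K. card {i\<in>I. \<beta>' i = Some (l, k)} = m k l"
     "\<forall>i\<in>I. \<forall>l k. \<beta>' i = Some (l, k) \<longrightarrow> b i = l \<and> k \<in> K"
    using exists_labelling_with_fibres2[of K I L "\<lambda>l k. m k l" b] assms(2) fin I bL by auto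
  define \<beta> where "\<beta> i = map_option prod.swap (\<beta>' i)" for i
  have \<beta>S: "\<beta> i = Some (k, l) \<longleftrightarrow> \<beta>' i = Some (l, k)" for i k l by (auto simp: \<beta>_def)
  have some: "card {i\<in>I. \<beta> i = Some (k, l)} = card {i\<in>I. \<alpha> i = Some (k, l)}" for k l
  proof (cases "k \<in> K \<and> l \<in> L")
    case True
    then show ?thesis using \<alpha> \<beta>' by (simp add: \<beta>S)
  next
    case False
    have "{i\<in>I. \<alpha> i = Some (k, l)} = {}" using \<alpha>(2) aK False by auto
    moreover have "{i\<in>I. \<beta> i = Some (k, l)} = {}" using \<beta>'(2) bL False by (auto simp: \<beta>S)
    ultimately show ?thesis by (simp only:)
  qed
  have none: "card {i\<in>I. \<gamma> i = None} + (\<Sum>y\<in>K\<times>L. card {i\<in>I. \<gamma> i = Some y}) = card I"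
    if "\<And>i y. i \<in> I \<Longrightarrow> \<gamma> i = Some y \<Longrightarrow> y \<in> K \<times> L" for \<gamma> :: "'i \<Rightarrow> ('k \<times> 'l) option"
  proof -
    have "card {i\<in>I. \<gamma> i = None} + card (\<Union>y\<in>K\<times>L. {i\<in>I. \<gamma> i = Some y}) = card ({i\<in>I. \<gamma> i = None} \<union> (\<Union>y\<in>K\<times>L. {i\<in>I. \<gamma> i = Some y}))"
      using I fin by (intro card_Un_disjoint[symmetric]) auto
    also have "{i\<in>I. \<gamma> i = None} \<union> (\<Union>y\<in>K\<times>L. {i\<in>I. \<gamma> i = Some y}) = I"
    proof (intro equalityI subsetI)
      fix i assume i: "i \<in> I"
      show "i \<in> {i\<in>I. \<gamma> i = None} \<union> (\<Union>y\<in>K\<times>L. {i\<in>I. \<gamma> i = Some y})"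
        using i that[of i] by (cases "\<gamma> i") auto
    qed auto
    also have "card (\<Union>y\<in>K\<times>L. {i\<in>I. \<gamma> i = Some y}) = (\<Sum>y\<in>K\<times>L. card {i\<in>I. \<gamma> i = Some y})"
      using I fin by (intro card_UN_disjoint) auto
    finally show ?thesis .
  qed
  have na: "card {i\<in>I. \<alpha> i = None} + (\<Sum>y\<in>K\<times>L. card {i\<in>I. \<alpha> i = Some y}) = card I"
    using \<alpha>(2) aK by (intro none) (auto simp: image_subset_iff)
  have nb: "card {i\<in>I. \<beta> i = None} + (\<Sum>y\<in>K\<times>L. card {i\<in>I. \<beta> i = Some y}) = card I"
    using \<beta>'(2) bL by (intro none) (auto simp: image_subset_iff \<beta>S)
  have "(\<Sum>y\<in>K\<times>L. card {i\<in>I. \<beta> i = Some y}) = (\<Sum>y\<in>K\<times>L. card {i\<in>I. \<alpha> i = Some y})"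
    using some by (intro sum.cong) auto
  then have "card {i\<in>I. \<beta> i = None} = card {i\<in>I. \<alpha> i = None}" using na nb by linarith
  then have "card {i\<in>I. \<beta> i = y} = card {i\<in>I. \<alpha> i = y}" for y using some by (cases y) auto
  from exists_permutation_of_equal_fibres[OF I(1) this] obtain \<sigma> where
    s: "\<sigma> permutes I" "\<And>i. i \<in> I \<Longrightarrow> \<beta> i = \<alpha> (\<sigma> i)" by metis
  show ?thesis
  proof (rule that[OF s(1)])
    fix k l assume kl: "k \<in> K" "l \<in> L"
    have "m k l = card {i\<in>I. \<beta> i = Some (k, l)}" using \<alpha>(1) some kl by simp
    also have "\<dots> \<le> contingency I a b \<sigma> k l" unfolding contingency_def
    proof (rule card_mono)
      show "{i \<in> I. \<beta> i = Some (k, l)} \<subseteq> {i \<in> I. a (\<sigma> i) = k \<and> b i = l}"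
      proof clarify
        fix i assume i: "i \<in> I" "\<beta> i = Some (k, l)"
        have "\<alpha> (\<sigma> i) = Some (k, l)" "\<sigma> i \<in> I" using i s by (auto simp: permutes_in_image)
        then show "a (\<sigma> i) = k \<and> b i = l" using i \<alpha>(2) \<beta>'(2) by (auto simp: \<beta>S)
      qed
    qed (use I in auto)
    finally show "m k l \<le> contingency I a b \<sigma> k l" .
  qed
qed

text \<open>Lowering each entry by \<eta> and rounding down makes the table fit under the actual row
  and column counts, so that \<open>exists_permutation_dominating_table\<close> applies. A table
  that is at least p - \<eta> - 1/n in each cell and has the same total mass is close to p from both
  sides.\<close>

lemma exists_permutation_near_table:
  assumes p0: "\<And>k l. k \<in> K \<Longrightarrow> l \<in> L \<Longrightarrow> p k l \<ge> 0" and p1: "(\<Sum>k\<in>K. \<Sum>l\<in>L. p k l) = 1" and \<eta>: "\<eta> > 0"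
    and r: "\<And>k. k \<in> K \<Longrightarrow> \<bar>card {i\<in>I. a i = k} / real n - (\<Sum>l\<in>L. p k l)\<bar> < \<eta>"
    and c: "\<And>l. l \<in> L \<Longrightarrow> \<bar>card {i\<in>I. b i = l} / real n - (\<Sum>k\<in>K. p k l)\<bar> < \<eta>"
  obtains \<sigma> where "\<sigma> permutes I"
    "(\<Sum>k\<in>K. \<Sum>l\<in>L. \<bar>tab \<sigma> k l - p k l\<bar>) \<le> 2 * real (card K) * real (card L) * (\<eta> + 1 / real n)"
proof -
  have n0: "real n > 0" using I by simp
  define q where "q k l = max 0 (p k l - \<eta>)" for k l
  define m where "m k l = nat \<lfloor>real n * q k l\<rfloor>" for k l
  have q0: "q k l \<ge> 0" for k l by (simp add: q_def)
  have m: "real (m k l) \<le> real n * q k l" "real n * q k l - 1 \<le> real (m k l)" for k l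
  proof -
    have "real n * q k l \<ge> 0" using q0 by simp
    then show "real (m k l) \<le> real n * q k l" "real n * q k l - 1 \<le> real (m k l)" unfolding m_def by linarith+
  qed
  \<comment> \<open>If any entry stays positive, the sum has lost at least \<eta>, which is the
    tolerance granted to a row or a column.\<close>
  have aux: "(\<Sum>x\<in>A. max 0 (g x - \<eta>)) \<le> max 0 ((\<Sum>x\<in>A. g x) - \<eta>)"
    if "finite A" "\<And>x. x \<in> A \<Longrightarrow> g x \<ge> 0" for A :: "'z set" and g :: "'z \<Rightarrow> real"
    using that
  proof (induction A rule: finite_induct)
    case (insert x F)
    have "(\<Sum>x\<in>F. g x) \<ge> 0" "g x \<ge> 0" using insert by (auto intro: sum_nonneg)
    then have "max 0 (g x - \<eta>) + max 0 ((\<Sum>x\<in>F. g x) - \<eta>) \<le> max 0 (g x + (\<Sum>x\<in>F. g x) - \<eta>)"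
      using \<eta> by (auto simp: max_def)
    moreover have "(\<Sum>x\<in>F. max 0 (g x - \<eta>)) \<le> max 0 ((\<Sum>x\<in>F. g x) - \<eta>)"
      using insert by auto
    ultimately show ?case using insert(1,2) by simp
  qed simp
  have rows: "(\<Sum>l\<in>L. m k l) \<le> card {i\<in>I. a i = k}" if k: "k \<in> K" for k
  proof -
    have "real (\<Sum>l\<in>L. m k l) \<le> (\<Sum>l\<in>L. real n * q k l)" using m by (auto intro!: sum_mono)
    also have "\<dots> = real n * (\<Sum>l\<in>L. q k l)" by (simp add: sum_distrib_left)
    also have "\<dots> \<le> real n * max 0 ((\<Sum>l\<in>L. p k l) - \<eta>)"
      unfolding q_def using fin p0 k by (intro mult_left_mono aux) auto
    also have "\<dots> \<le> real n * (card {i\<in>I. a i = k} / real n)"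
      using r[OF k] by (intro mult_left_mono) auto
    also have "\<dots> = real (card {i\<in>I. a i = k})" using n0 by simp
    finally show ?thesis by (simp only: of_nat_le_iff)
  qed
  have cols: "(\<Sum>k\<in>K. m k l) \<le> card {i\<in>I. b i = l}" if l: "l \<in> L" for l
  proof -
    have "real (\<Sum>k\<in>K. m k l) \<le> (\<Sum>k\<in>K. real n * q k l)" using m by (auto intro!: sum_mono)
    also have "\<dots> = real n * (\<Sum>k\<in>K. q k l)" by (simp add: sum_distrib_left)
    also have "\<dots> \<le> real n * max 0 ((\<Sum>k\<in>K. p k l) - \<eta>)"
      unfolding q_def using fin p0 l by (intro mult_left_mono aux) auto
    also have "\<dots> \<le> real n * (card {i\<in>I. b i = l} / real n)"
      using c[OF l] by (intro mult_left_mono) auto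
    also have "\<dots> = real (card {i\<in>I. b i = l})" using n0 by simp
    finally show ?thesis by (simp only: of_nat_le_iff)
  qed
  obtain \<sigma> where s: "\<sigma> permutes I" "\<And>k l. k \<in> K \<Longrightarrow> l \<in> L \<Longrightarrow> m k l \<le> contingency I a b \<sigma> k l"
    using exists_permutation_dominating_table[OF rows cols] by metis
  have ge: "p k l - tab \<sigma> k l \<le> \<eta> + 1 / real n" if "k \<in> K" "l \<in> L" for k l
  proof -
    have "real n * (p k l - \<eta>) - 1 \<le> real n * q k l - 1" using n0 by (simp add: q_def)
    also have "\<dots> \<le> real (contingency I a b \<sigma> k l)" using m(2)[of k l] s(2)[OF that] by linarith
    also have "\<dots> = real n * tab \<sigma> k l" using n0 by (simp add: tab_def)
    finally have "real n * (p k l - \<eta> - 1 / real n) \<le> real n * tab \<sigma> k l" using n0 by (simp add: algebra_simps)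
    then show ?thesis using n0 by (simp add: mult_le_cancel_left_pos)
  qed
  have tot: "(\<Sum>k\<in>K. \<Sum>l\<in>L. tab \<sigma> k l) = 1"
  proof -
    have "(\<Sum>k\<in>K. \<Sum>l\<in>L. contingency I a b \<sigma> k l) = n"
      using contingency_rows[OF s(1)] sum_card_fibres(1) by simp
    then have "(\<Sum>k\<in>K. \<Sum>l\<in>L. real (contingency I a b \<sigma> k l)) = real n" by (simp flip: of_nat_sum)
    then show ?thesis unfolding tab_def using n0 by (simp add: sum_divide_distrib[symmetric])
  qed
  have e: "\<eta> + 1 / real n \<ge> 0" using \<eta> by simp
  \<comment> \<open>From x \<ge> -c follows |x| \<le> 2 c + x, and here the x sum to 0 because both
    tables have total mass 1.\<close>
  have "\<bar>tab \<sigma> k l - p k l\<bar> \<le> 2 * (\<eta> + 1 / real n) + (tab \<sigma> k l - p k l)" if "k \<in> K" "l \<in> L" for k l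
    using ge[OF that] e by (auto simp: abs_if)
  then have "(\<Sum>k\<in>K. \<Sum>l\<in>L. \<bar>tab \<sigma> k l - p k l\<bar>) \<le> (\<Sum>k\<in>K. \<Sum>l\<in>L. 2 * (\<eta> + 1 / real n) + (tab \<sigma> k l - p k l))"
    by (intro sum_mono) auto
  also have "\<dots> = 2 * real (card K) * real (card L) * (\<eta> + 1 / real n)"
    using tot p1 by (simp add: sum.distrib sum_subtractf)
  finally show ?thesis using that s(1) by blast
qed

end

lemma corr_over_n: "(\<lambda>n. corr k l n / real n) \<longlonglongrightarrow> 0"
proof -
  have "(\<lambda>n. ln (real (Suc n)) / real (Suc n) * ((real n + 1) / real n)) \<longlonglongrightarrow> 0 * 1"
  proof (rule tendsto_mult)
    show "(\<lambda>n. ln (real (Suc n)) / real (Suc n)) \<longlonglongrightarrow> 0"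
      using LIMSEQ_Suc[OF lim_ln_over_n] by simp
    show "(\<lambda>n. (real n + 1) / real n) \<longlonglongrightarrow> 1"
    proof (rule Lim_transform_eventually)
      show "(\<lambda>n. 1 + 1 / real n) \<longlonglongrightarrow> 1" using lim_1_over_n[where 'a=real] by (auto intro!: tendsto_eq_intros)
      show "eventually (\<lambda>n. 1 + 1 / real n = (real n + 1) / real n) sequentially"
        using eventually_gt_at_top[of 0] by eventually_elim (simp add: field_simps)
    qed
  qed
  moreover have "ln (real (Suc n)) / real (Suc n) * ((real n + 1) / real n) = ln (real n + 1) / real n" for n
  proof -
    have "L / N * (N / m) = L / m" if "N \<noteq> 0" for L N m :: real using that by simp
    moreover have "real (Suc n) = real n + 1" by simp
    ultimately show ?thesis by (simp only:)
  qed
  ultimately have "(\<lambda>n. ln (real n + 1) / real n) \<longlonglongrightarrow> 0" by simp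
  then have "(\<lambda>n. (real k + real l + real k * real l + 1) * (1 / real n + ln (real n + 1) / real n)) \<longlonglongrightarrow> (real k + real l + real k * real l + 1) * (0 + 0)"
    by (intro tendsto_mult tendsto_const tendsto_add lim_1_over_n)
  moreover have "D * (1 / m + L / m) = D * (1 + L) / m" for D L m :: real
    by (simp add: add_divide_distrib[symmetric])
  ultimately show ?thesis unfolding corr_def by simp
qed

text \<open>One permutation with a table near p suffices: all members of its class share the table,
  and \<open>ln_card_class\<close> gives the class the size n! exp (- n tent) up to subexponential
  factors. Both \<eta> and n0 depend only on p and \<epsilon>, so the bound is uniform over all
  labellings with nearly the right row and column sums.\<close>

lemma card_near_table_ge:
  fixes p :: "'k \<Rightarrow> 'l \<Rightarrow> real"
  assumes fin: "finite K" "finite L"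
    and p0: "\<And>k l. k \<in> K \<Longrightarrow> l \<in> L \<Longrightarrow> p k l \<ge> 0" and p1: "(\<Sum>k\<in>K. \<Sum>l\<in>L. p k l) = 1" and \<epsilon>: "\<epsilon> > 0"
  shows "\<exists>\<eta>>0. \<exists>n0. \<forall>n\<ge>n0. \<forall>(I :: nat set) a b. two_labellings I a b K L n \<longrightarrow>
      (\<forall>k\<in>K. \<bar>card {i\<in>I. a i = k} / real n - (\<Sum>l\<in>L. p k l)\<bar> < \<eta>) \<longrightarrow>
      (\<forall>l\<in>L. \<bar>card {i\<in>I. b i = l} / real n - (\<Sum>k\<in>K. p k l)\<bar> < \<eta>) \<longrightarrow>
      fact n * exp (- real n * (tent K L p + \<epsilon>)) \<le>
        real (card {\<sigma>. \<sigma> permutes I \<and> (\<Sum>k\<in>K. \<Sum>l\<in>L. \<bar>two_labellings.tab I a b n \<sigma> k l - p k l\<bar>) < \<epsilon>})"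
proof -
  \<comment> \<open>Upper semicontinuity of the entropy at p on an L1 neighbourhood, deduced from
    sequential continuity.\<close>
  have "\<exists>\<kappa>>0. \<forall>t. (\<forall>k\<in>K. \<forall>l\<in>L. t k l \<ge> 0) \<longrightarrow> (\<Sum>k\<in>K. \<Sum>l\<in>L. \<bar>t k l - p k l\<bar>) < \<kappa> \<longrightarrow> tent K L t < tent K L p + \<epsilon> / 2"
  proof (rule ccontr)
    assume neg: "\<not> ?thesis"
    have "\<forall>j. \<exists>t. (\<forall>k\<in>K. \<forall>l\<in>L. t k l \<ge> 0) \<and> (\<Sum>k\<in>K. \<Sum>l\<in>L. \<bar>t k l - p k l\<bar>) < 1 / real (Suc j) \<and> \<not> tent K L t < tent K L p + \<epsilon> / 2"
    proof (intro allI)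
      fix j
      have "0 < 1 / real (Suc j)" by simp
      with neg show "\<exists>t. (\<forall>k\<in>K. \<forall>l\<in>L. t k l \<ge> 0) \<and> (\<Sum>k\<in>K. \<Sum>l\<in>L. \<bar>t k l - p k l\<bar>) < 1 / real (Suc j) \<and> \<not> tent K L t < tent K L p + \<epsilon> / 2"
        by blast
    qed
    from choice[OF this] obtain t where t: "\<And>j k l. k \<in> K \<Longrightarrow> l \<in> L \<Longrightarrow> t j k l \<ge> 0"
      "\<And>j. (\<Sum>k\<in>K. \<Sum>l\<in>L. \<bar>t j k l - p k l\<bar>) < 1 / real (Suc j)" "\<And>j. \<not> tent K L (t j) < tent K L p + \<epsilon> / 2"
      by blast
    have "(\<lambda>j. t j k l) \<longlonglongrightarrow> p k l" if "k \<in> K" "l \<in> L" for k l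
    proof -
      have A: "\<bar>t j k l - p k l\<bar> \<le> 1 / real (Suc j)" for j
      proof -
        have "\<bar>t j k l - p k l\<bar> \<le> (\<Sum>l\<in>L. \<bar>t j k l - p k l\<bar>)"
          using that fin by (intro member_le_sum[where f="\<lambda>l. \<bar>t j k l - p k l\<bar>"]) auto
        also have "\<dots> \<le> (\<Sum>k\<in>K. \<Sum>l\<in>L. \<bar>t j k l - p k l\<bar>)"
          using that fin by (intro member_le_sum[where f="\<lambda>k. \<Sum>l\<in>L. \<bar>t j k l - p k l\<bar>"]) (auto intro: sum_nonneg)
        finally show ?thesis using t(2)[of j] by linarith
      qed
      have B: "(\<lambda>j. 1 / real (Suc j)) \<longlonglongrightarrow> 0" using LIMSEQ_Suc[OF lim_1_over_n[where 'a=real]] by simp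
      have "eventually (\<lambda>j. norm (t j k l - p k l) \<le> 1 / real (Suc j)) sequentially"
        unfolding real_norm_def by (intro always_eventually allI A)
      from Lim_null_comparison[OF this B] have "(\<lambda>j. t j k l - p k l) \<longlonglongrightarrow> 0" .
      then show ?thesis by (rule LIM_zero_cancel)
    qed
    then have "(\<lambda>j. tent K L (t j)) \<longlonglongrightarrow> tent K L p" using t(1) by (intro tendsto_tent) auto
    then have "eventually (\<lambda>j. tent K L (t j) < tent K L p + \<epsilon> / 2) sequentially"
      using \<epsilon> by (intro order_tendstoD(2)) auto
    then show False using t(3) by (auto simp: eventually_sequentially)
  qed
  then obtain \<kappa> where \<kappa>0: "\<kappa> > 0" and \<kappa>t: "\<forall>t. (\<forall>k\<in>K. \<forall>l\<in>L. t k l \<ge> 0) \<longrightarrow> (\<Sum>k\<in>K. \<Sum>l\<in>L. \<bar>t k l - p k l\<bar>) < \<kappa> \<longrightarrow> tent K L t < tent K L p + \<epsilon> / 2"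
    by blast
  note \<kappa> = \<kappa>0 \<kappa>t[rule_format]
  define D where "D = 2 * real (card K) * real (card L) + 1"
  have D: "D > 0" by (simp add: D_def add_nonneg_pos)
  define \<theta> where "\<theta> = min \<kappa> \<epsilon>"
  have \<theta>: "\<theta> > 0" using \<kappa> \<epsilon> by (simp add: \<theta>_def)
  \<comment> \<open>With 1 / n < \<eta> the distance of the tables is at most D * 2 \<eta> =
    \<theta> / 2.\<close>
  define \<eta> where "\<eta> = \<theta> / (4 * D)"
  have \<eta>: "\<eta> > 0" using \<theta> D by (simp add: \<eta>_def)
  have "eventually (\<lambda>n. 1 / real n < \<eta> \<and> corr (card K) (card L) n / real n < \<epsilon> / 2) sequentially"
    using \<eta> \<epsilon> by (intro eventually_conj order_tendstoD(2)[OF lim_1_over_n] order_tendstoD(2)[OF corr_over_n]) auto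
  then obtain n0 where n0: "\<And>n. n \<ge> n0 \<Longrightarrow> 1 / real n < \<eta> \<and> corr (card K) (card L) n / real n < \<epsilon> / 2"
    by (auto simp: eventually_sequentially)
  show ?thesis
  proof (rule exI[of _ \<eta>], intro conjI \<eta> exI[of _ n0] allI impI)
    fix n and I :: "nat set" and a b
    assume n: "n \<ge> n0" and tl: "two_labellings I a b K L n"
      and r: "\<forall>k\<in>K. \<bar>card {i\<in>I. a i = k} / real n - (\<Sum>l\<in>L. p k l)\<bar> < \<eta>"
      and c: "\<forall>l\<in>L. \<bar>card {i\<in>I. b i = l} / real n - (\<Sum>k\<in>K. p k l)\<bar> < \<eta>"
    interpret two_labellings I a b K L n by (rule tl)
    let ?S = "{\<sigma>. \<sigma> permutes I \<and> (\<Sum>k\<in>K. \<Sum>l\<in>L. \<bar>tab \<sigma> k l - p k l\<bar>) < \<epsilon>}"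
    obtain \<sigma> where s: "\<sigma> permutes I" "(\<Sum>k\<in>K. \<Sum>l\<in>L. \<bar>tab \<sigma> k l - p k l\<bar>) \<le> 2 * real (card K) * real (card L) * (\<eta> + 1 / real n)"
      by (rule exists_permutation_near_table[OF p0 p1 \<eta> r[rule_format] c[rule_format]])
    have "2 * real (card K) * real (card L) * (\<eta> + 1 / real n) \<le> D * (2 * \<eta>)"
      using n0[OF n] \<eta> D by (intro mult_mono) (auto simp: D_def)
    also have "\<dots> < \<theta>" using \<theta> D by (simp add: \<eta>_def)
    finally have st: "(\<Sum>k\<in>K. \<Sum>l\<in>L. \<bar>tab \<sigma> k l - p k l\<bar>) < \<theta>" using s(2) by linarith
    let ?C = "{\<tau>. \<tau> permutes I \<and> contingency I a b \<tau> = contingency I a b \<sigma>}"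
    have "?C \<subseteq> ?S" using st by (auto simp: tab_def[abs_def] \<theta>_def)
    then have CS: "card ?C \<le> card ?S"
      by (intro card_mono) (auto intro: finite_subset[OF _ finite_permutations[OF I(1)]])
    have "tent K L (tab \<sigma>) < tent K L p + \<epsilon> / 2" using st by (intro \<kappa>(2)) (auto simp: \<theta>_def tab_def)
    then have "real n * tent K L (tab \<sigma>) \<le> real n * (tent K L p + \<epsilon> / 2)" by (intro mult_left_mono) auto
    moreover have "corr (card K) (card L) n \<le> real n * (\<epsilon> / 2)"
      using n0[OF n] I by (simp add: field_simps)
    ultimately have "ln (fact n) - real n * (tent K L p + \<epsilon>) \<le> ln (real (card ?C))"
      using ln_card_class(1)[OF s(1)] by (simp add: algebra_simps)
    then have "exp (ln (fact n) - real n * (tent K L p + \<epsilon>)) \<le> exp (ln (real (card ?C)))" by simp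
    also have "\<dots> = real (card ?C)" using ln_card_class(2)[OF s(1)] by simp
    also have "\<dots> \<le> real (card ?S)" using CS by simp
    also have "exp (ln (fact n) - real n * (tent K L p + \<epsilon>)) = fact n * exp (- real n * (tent K L p + \<epsilon>))"
      by (simp add: exp_diff exp_minus divide_inverse)
    finally show "fact n * exp (- real n * (tent K L p + \<epsilon>)) \<le> real (card ?S)" .
  qed
qed

section \<open>Borel probability measures on a subspace: basic facts\<close>

lemma
  assumes "\<rho> \<in> M1 E"
  shows M1_prob: "prob_space \<rho>" and M1_sets: "sets \<rho> = sets (borel_on E)" and M1_space: "space \<rho> = E"
  using assms sets_eq_imp_space_eq[of \<rho> "borel_on E"] by (auto simp: M1_def space_restrict_space)

lemma M1_measurable: "\<rho> \<in> M1 E \<Longrightarrow> measurable \<rho> N = measurable (borel_on E) N"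
  by (intro measurable_cong_sets M1_sets refl)

lemma M1_continuous_measurable:
  fixes f :: "'a::topological_space \<Rightarrow> 'b::topological_space"
  shows "\<rho> \<in> M1 E \<Longrightarrow> continuous_on E f \<Longrightarrow> f \<in> borel_measurable \<rho>"
  unfolding M1_measurable by (rule borel_measurable_continuous_on_restrict)

lemma M1_bounded_integrable:
  fixes f :: "'a::topological_space \<Rightarrow> real"
  assumes "\<rho> \<in> M1 E" "f \<in> borel_measurable \<rho>" "\<And>x. x \<in> E \<Longrightarrow> \<bar>f x\<bar> \<le> C"
  shows "integrable \<rho> f"
proof -
  interpret prob_space \<rho> using assms(1) by (rule M1_prob)
  show ?thesis using assms M1_space[OF assms(1)]
    by (intro integrable_const_bound[of _ C]) auto
qed

lemma M1_eqI:
  assumes "\<rho> \<in> M1 E" "\<gamma> \<in> M1 E" "\<And>A. A \<in> sets (borel_on E) \<Longrightarrow> emeasure \<rho> A = emeasure \<gamma> A"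
  shows "\<rho> = \<gamma>"
  using assms M1_sets by (intro measure_eqI) auto

lemma distr_in_M1:
  assumes "prob_space M" "f \<in> measurable M (borel_on E)"
  shows "distr M (borel_on E) f \<in> M1 E"
  using prob_space.prob_space_distr[OF assms] by (simp add: M1_def)

lemma continuous_measurable_borel_on:
  fixes f :: "'a::topological_space \<Rightarrow> 'b::topological_space"
  assumes "continuous_on E f" "f ` E \<subseteq> F"
  shows "f \<in> measurable (borel_on E) (borel_on F)"
  using assms by (intro measurable_restrict_space2 borel_measurable_continuous_on_restrict)
    (auto simp: space_restrict_space)

section \<open>Empirical measures\<close>

text \<open>Integrals against empirical measures become finite averages over a uniform law. That law
  is restricted to {1..n} because x may leave E at other indices, where it could not be measurable
  into \<open>borel_on E\<close>.\<close>

lemma empirical_eq_distr: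
  assumes n: "n \<ge> 1" and x: "\<And>i. i \<in> {1..n} \<Longrightarrow> x i \<in> E"
  shows "empirical E n x = distr (restrict_space (measure_pmf (pmf_of_set {1..n})) {1..n}) (borel_on E) x"
proof (rule measure_eqI)
  show "sets (empirical E n x) = sets (distr (restrict_space (measure_pmf (pmf_of_set {1..n})) {1..n}) (borel_on E) x)"
    by (simp add: sets_empirical)
  fix A assume "A \<in> sets (empirical E n x)"
  then have A: "A \<in> sets (borel_on E)" by (simp add: sets_empirical)
  have m: "x \<in> measurable (restrict_space (measure_pmf (pmf_of_set {1..n})) {1..n}) (borel_on E)"
    using x by (auto simp: measurable_def space_restrict_space sets_restrict_space)
  have "emeasure (distr (restrict_space (measure_pmf (pmf_of_set {1..n})) {1..n}) (borel_on E) x) A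
     = emeasure (measure_pmf (pmf_of_set {1..n})) (x -` A \<inter> {1..n})"
    using A m by (subst emeasure_distr) (auto simp: space_restrict_space emeasure_restrict_space)
  also have "\<dots> = ennreal (real (card ({1..n} \<inter> (x -` A \<inter> {1..n}))) / real (card {1..n}))"
    using n by (subst emeasure_pmf_of_set) auto
  also have "{1..n} \<inter> (x -` A \<inter> {1..n}) = {i\<in>{1..n}. x i \<in> A}" by auto
  also have "ennreal (real (card {i\<in>{1..n}. x i \<in> A}) / real (card {1..n})) = of_nat (card {i\<in>{1..n}. x i \<in> A}) / of_nat n"
    using n by (simp add: divide_ennreal ennreal_of_nat_eq_real_of_nat)
  also have "of_nat (card {i\<in>{1..n}. x i \<in> A}) = (\<Sum>i=1..n. indicator A (x i) :: ennreal)"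
    by (simp add: indicator_def sum.If_cases Int_def conj_commute)
  finally show "emeasure (empirical E n x) A = emeasure (distr (restrict_space (measure_pmf (pmf_of_set {1..n})) {1..n}) (borel_on E) x) A"
    using emeasure_empirical[OF A, of n x] by simp
qed

lemma measure_empirical:
  assumes n: "n \<ge> 1" and A: "A \<in> sets (borel_on E)"
  shows "measure (empirical E n x) A = real (card {i\<in>{1..n}. x i \<in> A}) / real n"
proof -
  define c where "c = card {i\<in>{1..n}. x i \<in> A}"
  have "of_nat c = (\<Sum>i=1..n. indicator A (x i) :: ennreal)"
    by (simp add: c_def indicator_def sum.If_cases Int_def conj_commute)
  then have "emeasure (empirical E n x) A = of_nat c / of_nat n"
    using emeasure_empirical[OF A, of n x] by simp
  also have "\<dots> = ennreal (real c / real n)"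
    using n by (simp add: divide_ennreal ennreal_of_nat_eq_real_of_nat)
  finally show ?thesis by (simp add: measure_def c_def)
qed

lemma nn_integral_empirical:
  assumes n: "n \<ge> 1" and x: "\<And>i. i \<in> {1..n} \<Longrightarrow> x i \<in> E" and f: "f \<in> borel_measurable (borel_on E)"
  shows "(\<integral>\<^sup>+z. f z \<partial>empirical E n x) = (\<Sum>i=1..n. f (x i)) / of_nat n"
proof -
  let ?P = "measure_pmf (pmf_of_set {1..n})"
  have m: "x \<in> measurable (restrict_space ?P {1..n}) (borel_on E)"
    using x by (auto simp: measurable_def space_restrict_space sets_restrict_space)
  have eq: "empirical E n x = distr (restrict_space ?P {1..n}) (borel_on E) x"
    by (intro empirical_eq_distr n x)
  have "(\<integral>\<^sup>+z. f z \<partial>empirical E n x) = (\<integral>\<^sup>+i. f (x i) \<partial>restrict_space ?P {1..n})"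
    unfolding eq using m f by (subst nn_integral_distr) auto
  also have "\<dots> = (\<integral>\<^sup>+i. f (x i) * indicator {1..n} i \<partial>?P)"
    by (subst nn_integral_restrict_space) auto
  also have "\<dots> = (\<Sum>i=1..n. f (x i) * indicator {1..n} i) / of_nat (card {1..n})"
    using n by (subst nn_integral_pmf_of_set) auto
  also have "\<dots> = (\<Sum>i=1..n. f (x i)) / of_nat n" by simp
  finally show ?thesis .
qed

lemma integral_empirical:
  fixes f :: "'a::topological_space \<Rightarrow> real"
  assumes n: "n \<ge> 1" and x: "\<And>i. i \<in> {1..n} \<Longrightarrow> x i \<in> E" and f: "f \<in> borel_measurable (borel_on E)"
  shows "(\<integral>z. f z \<partial>empirical E n x) = (\<Sum>i=1..n. f (x i)) / real n"
proof -
  let ?P = "measure_pmf (pmf_of_set {1..n})"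
  have m: "x \<in> measurable (restrict_space ?P {1..n}) (borel_on E)"
    using x by (auto simp: measurable_def space_restrict_space sets_restrict_space)
  have eq: "empirical E n x = distr (restrict_space ?P {1..n}) (borel_on E) x"
    by (intro empirical_eq_distr n x)
  have "(\<integral>z. f z \<partial>empirical E n x) = (\<integral>i. f (x i) \<partial>restrict_space ?P {1..n})"
    unfolding eq using m f by (subst integral_distr) auto
  also have "\<dots> = (\<integral>i. indicator {1..n} i *\<^sub>R f (x i) \<partial>?P)"
    by (subst integral_restrict_space) auto
  also have "\<dots> = (\<Sum>i=1..n. indicator {1..n} i *\<^sub>R f (x i)) / of_nat (card {1..n})"
    using n by (subst integral_pmf_of_set) auto
  also have "\<dots> = (\<Sum>i=1..n. f (x i)) / of_nat n" by simp
  finally show ?thesis .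
qed

lemma distr_empirical:
  assumes n: "n \<ge> 1" and x: "\<And>i. i \<in> {1..n} \<Longrightarrow> x i \<in> E" and g: "g \<in> measurable (borel_on E) (borel_on F)"
  shows "distr (empirical E n x) (borel_on F) g = empirical F n (\<lambda>i. g (x i))"
proof (rule measure_eqI)
  fix A assume "A \<in> sets (distr (empirical E n x) (borel_on F) g)"
  then have A: "A \<in> sets (borel_on F)" by simp
  have gm: "g \<in> measurable (empirical E n x) (borel_on F)"
    using g by (subst measurable_cong_sets[OF sets_empirical refl])
  have B: "g -` A \<inter> E \<in> sets (borel_on E)"
    using measurable_sets[OF g A] by (simp add: space_restrict_space)
  have "emeasure (distr (empirical E n x) (borel_on F) g) A = emeasure (empirical E n x) (g -` A \<inter> E)"
    using gm A by (subst emeasure_distr) (auto simp: space_empirical)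
  also have "\<dots> = (\<Sum>i=1..n. indicator (g -` A \<inter> E) (x i)) / of_nat n" by (rule emeasure_empirical[OF B])
  also have "(\<Sum>i=1..n. indicator (g -` A \<inter> E) (x i)) = (\<Sum>i=1..n. indicator A (g (x i)) :: ennreal)"
    using x by (intro sum.cong) (auto simp: indicator_def)
  finally show "emeasure (distr (empirical E n x) (borel_on F) g) A = emeasure (empirical F n (\<lambda>i. g (x i))) A"
    by (simp add: emeasure_empirical[OF A])
qed (simp add: sets_empirical)

section \<open>The Wasserstein distance on the half-line\<close>

text \<open>On the line the Wasserstein distance is the L1 distance of distribution functions. In
  this form it is a formula rather than an infimum, and the triangle inequality becomes
  pointwise.\<close>

definition cdf_dist :: "real measure \<Rightarrow> real measure \<Rightarrow> ennreal" where
  "cdf_dist \<rho> \<gamma> = (\<integral>\<^sup>+t. ennreal \<bar>measure \<rho> ({0..} \<inter> {..t}) - measure \<gamma> ({0..} \<inter> {..t})\<bar> \<partial>lborel)"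

abbreviation cost :: "(real \<times> real) measure \<Rightarrow> ennreal" where
  "cost \<pi> \<equiv> (\<integral>\<^sup>+z. ennreal \<bar>fst z - snd z\<bar> \<partial>\<pi>)"

text \<open>|x - y| is the length of the set of thresholds that separate x from y.\<close>

lemma abs_diff_eq_nn_integral:
  "ennreal \<bar>x - y\<bar> = (\<integral>\<^sup>+t. ennreal \<bar>(if x \<le> t then 1 else 0) - (if y \<le> t then 1 else 0)\<bar> \<partial>lborel)" for x y :: real
proof -
  have "(\<integral>\<^sup>+t. ennreal \<bar>(if x \<le> t then 1 else 0) - (if y \<le> t then 1 else 0)\<bar> \<partial>lborel)
      = (\<integral>\<^sup>+t. indicator {min x y..<max x y} t \<partial>lborel)"
    by (intro nn_integral_cong) (auto simp: indicator_def)
  also have "\<dots> = ennreal \<bar>x - y\<bar>" by (auto simp: abs_if min_def max_def)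
  finally show ?thesis ..
qed

lemma couplings_D:
  assumes "\<pi> \<in> couplings {0..} \<rho> \<gamma>"
  shows "\<pi> \<in> M1 ({0..} \<times> {0..})" and "\<rho> = distr \<pi> (borel_on {0..}) fst" "\<gamma> = distr \<pi> (borel_on {0..}) snd"
    and "fst \<in> measurable \<pi> (borel_on {0..})" "snd \<in> measurable \<pi> (borel_on {0..})"
    and "fst \<in> borel_measurable \<pi>" "snd \<in> borel_measurable \<pi>"
proof -
  show p: "\<pi> \<in> M1 ({0..} \<times> {0..})" and "\<rho> = distr \<pi> (borel_on {0..}) fst" "\<gamma> = distr \<pi> (borel_on {0..}) snd"
    using assms by (auto simp: couplings_def)
  show "fst \<in> measurable \<pi> (borel_on {0..})" "snd \<in> measurable \<pi> (borel_on {0..})"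
    unfolding M1_measurable[OF p] by (intro continuous_measurable_borel_on continuous_intros; force)+
  show "fst \<in> borel_measurable \<pi>" "snd \<in> borel_measurable \<pi>"
    by (rule M1_continuous_measurable[OF p], intro continuous_intros)+
qed

text \<open>After exchanging the integrals, the difference of the distribution functions at a
  threshold is the expectation of a difference of two indicators, bounded by the expectation of its
  absolute value.\<close>

lemma cdf_dist_le_cost:
  assumes \<pi>: "\<pi> \<in> couplings {0..} \<rho> \<gamma>"
  shows "cdf_dist \<rho> \<gamma> \<le> cost \<pi>"
proof -
  note p = couplings_D[OF \<pi>]
  note [measurable] = p(6,7)
  interpret prob_space \<pi> by (rule M1_prob[OF p(1)])
  interpret pair_sigma_finite \<pi> lborel ..
  have sp: "space \<pi> = {0..} \<times> {0..}" by (rule M1_space[OF p(1)])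
  have cost: "cost \<pi> = (\<integral>\<^sup>+t. (\<integral>\<^sup>+z. ennreal \<bar>(if fst z \<le> t then 1 else 0) - (if snd z \<le> t then 1 else 0)\<bar> \<partial>\<pi>) \<partial>lborel)"
    by (subst abs_diff_eq_nn_integral, subst Fubini') auto
  show ?thesis unfolding cdf_dist_def cost
  proof (rule nn_integral_mono)
    fix t :: real
    have s: "{0..} \<inter> {..t} \<in> sets (borel_on {0..})" by (auto simp: sets_restrict_space)
    have 1: "measure \<rho> ({0..} \<inter> {..t}) = (\<integral>z. (if fst z \<le> t then 1 else 0) \<partial>\<pi>)"
    proof -
      have "measure \<rho> ({0..} \<inter> {..t}) = measure \<pi> {z\<in>space \<pi>. fst z \<le> t}"
        unfolding p(2) using p(4) s by (subst measure_distr) (auto simp: sp intro!: arg_cong[where f="measure \<pi>"])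
      also have "\<dots> = (\<integral>z. indicator {z\<in>space \<pi>. fst z \<le> t} z \<partial>\<pi>)" by simp
      also have "\<dots> = (\<integral>z. (if fst z \<le> t then 1 else 0) \<partial>\<pi>)"
        by (intro Bochner_Integration.integral_cong) (auto simp: indicator_def)
      finally show ?thesis .
    qed
    have 2: "measure \<gamma> ({0..} \<inter> {..t}) = (\<integral>z. (if snd z \<le> t then 1 else 0) \<partial>\<pi>)"
    proof -
      have "measure \<gamma> ({0..} \<inter> {..t}) = measure \<pi> {z\<in>space \<pi>. snd z \<le> t}"
        unfolding p(3) using p(5) s by (subst measure_distr) (auto simp: sp intro!: arg_cong[where f="measure \<pi>"])
      also have "\<dots> = (\<integral>z. indicator {z\<in>space \<pi>. snd z \<le> t} z \<partial>\<pi>)" by simp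
      also have "\<dots> = (\<integral>z. (if snd z \<le> t then 1 else 0) \<partial>\<pi>)"
        by (intro Bochner_Integration.integral_cong) (auto simp: indicator_def)
      finally show ?thesis .
    qed
    have i: "integrable \<pi> (\<lambda>z. if fst z \<le> t then 1 else 0 :: real)" "integrable \<pi> (\<lambda>z. if snd z \<le> t then 1 else 0 :: real)"
      by (auto intro!: integrable_const_bound[of _ 1])
    have "\<bar>measure \<rho> ({0..} \<inter> {..t}) - measure \<gamma> ({0..} \<inter> {..t})\<bar>
        = norm (\<integral>z. (if fst z \<le> t then 1 else 0) - (if snd z \<le> t then 1 else 0 :: real) \<partial>\<pi>)"
      unfolding 1 2 Bochner_Integration.integral_diff[OF i, symmetric] real_norm_def ..
    also have "\<dots> \<le> (\<integral>z. norm ((if fst z \<le> t then 1 else 0) - (if snd z \<le> t then 1 else 0) :: real) \<partial>\<pi>)"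
      by (rule integral_norm_bound)
    finally have "ennreal \<bar>measure \<rho> ({0..} \<inter> {..t}) - measure \<gamma> ({0..} \<inter> {..t})\<bar>
        \<le> ennreal (\<integral>z. \<bar>(if fst z \<le> t then 1 else 0) - (if snd z \<le> t then 1 else 0)\<bar> \<partial>\<pi>)"
      by (simp add: ennreal_leI)
    also have "\<dots> = (\<integral>\<^sup>+z. ennreal \<bar>(if fst z \<le> t then 1 else 0) - (if snd z \<le> t then 1 else 0)\<bar> \<partial>\<pi>)"
      using i by (intro nn_integral_eq_integral[symmetric] integrable_abs Bochner_Integration.integrable_diff) auto
    finally show "ennreal \<bar>measure \<rho> ({0..} \<inter> {..t}) - measure \<gamma> ({0..} \<inter> {..t})\<bar>
      \<le> (\<integral>\<^sup>+z. ennreal \<bar>(if fst z \<le> t then 1 else 0) - (if snd z \<le> t then 1 else 0)\<bar> \<partial>\<pi>)" .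
  qed
qed

text \<open>Transport from the half-line to the whole line gives access to distribution functions
  and their generalised inverses.\<close>

lemma push_real_distribution:
  assumes "\<rho> \<in> M1 ({0..} :: real set)"
  shows "cdf_distribution (distr \<rho> borel (\<lambda>x. x))"
    and "cdf (distr \<rho> borel (\<lambda>x. x)) t = measure \<rho> ({0..} \<inter> {..t})"
    and "A \<in> sets (borel_on {0..}) \<Longrightarrow> emeasure (distr \<rho> borel (\<lambda>x. x)) A = emeasure \<rho> A"
proof -
  interpret prob_space \<rho> by (rule M1_prob[OF assms])
  have [measurable]: "(\<lambda>x. x) \<in> borel_measurable \<rho>" using assms by (intro M1_continuous_measurable continuous_intros)
  show "cdf_distribution (distr \<rho> borel (\<lambda>x. x))"
    unfolding cdf_distribution_def real_distribution_def real_distribution_axioms_def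
    by (auto intro: prob_space_distr)
  show "cdf (distr \<rho> borel (\<lambda>x. x)) t = measure \<rho> ({0..} \<inter> {..t})"
    using M1_space[OF assms] by (auto simp: cdf_def measure_distr Int_commute vimage_def)
  assume "A \<in> sets (borel_on {0..})"
  then have "A \<in> sets borel" "A \<subseteq> {0..}" by (auto simp: sets_restrict_space)
  then show "emeasure (distr \<rho> borel (\<lambda>x. x)) A = emeasure \<rho> A"
    using M1_space[OF assms] by (subst emeasure_distr) (auto intro!: arg_cong[where f="emeasure \<rho>"])
qed

text \<open>The quantile coupling: both quantile functions are evaluated at the same uniform
  variable. At a threshold t they disagree only on the interval between the two values of the
  distribution functions, so the bound of \<open>cdf_dist_le_cost\<close> is attained.\<close>

lemma exists_optimal_coupling:
  assumes \<rho>: "\<rho> \<in> M1 {0..}" and \<gamma>: "\<gamma> \<in> M1 {0..}"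
  shows "\<exists>\<pi>\<in>couplings {0..} \<rho> \<gamma>. cost \<pi> \<le> cdf_dist \<rho> \<gamma>"
proof -
  let ?r = "distr \<rho> borel (\<lambda>x. x)" and ?g = "distr \<gamma> borel (\<lambda>x. x)"
  interpret R: cdf_distribution ?r by (rule push_real_distribution(1)[OF \<rho>])
  interpret G: cdf_distribution ?g by (rule push_real_distribution(1)[OF \<gamma>])
  let ?\<Omega> = "restrict_space lborel {0<..<1::real}"
  interpret \<Omega>: prob_space ?\<Omega>
    by (auto simp add: emeasure_restrict_space space_restrict_space intro!: prob_spaceI)
  have so: "space ?\<Omega> = {0<..<1}" by (simp add: space_restrict_space)
  have mo: "measurable ?\<Omega> N = measurable (restrict_space borel {0<..<1}) N" for N :: "'z measure"
    by (intro measurable_cong_sets) (auto simp: sets_restrict_space)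
  \<comment> \<open>Quantiles at levels u > 0 are nonnegative because the distribution function
    vanishes on negative arguments.\<close>
  have nonneg: "I u \<ge> 0" if u: "0 < u" "u < 1" and ps: "\<And>x. u \<le> cdf (distr \<kappa> borel (\<lambda>x. x)) x \<longleftrightarrow> I u \<le> x"
     and \<kappa>: "\<kappa> \<in> M1 {0..}" for I :: "real \<Rightarrow> real" and \<kappa> u
  proof (rule ccontr)
    assume "\<not> 0 \<le> I u"
    then have "{0..} \<inter> {..I u} = {}" by auto
    then have "measure \<kappa> ({0..} \<inter> {..I u}) = 0" by (metis measure_empty)
    moreover have "u \<le> cdf (distr \<kappa> borel (\<lambda>x. x)) (I u)" using ps by simp
    ultimately show False using u push_real_distribution(2)[OF \<kappa>, of "I u"] by linarith
  qed
  have R0: "R.I u \<ge> 0" if "u \<in> {0<..<1}" for u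
    using that by (intro nonneg[OF _ _ R.pseudoinverse \<rho>]) auto
  have G0: "G.I u \<ge> 0" if "u \<in> {0<..<1}" for u
    using that by (intro nonneg[OF _ _ G.pseudoinverse \<gamma>]) auto
  have mR: "R.I \<in> borel_measurable ?\<Omega>" and mG: "G.I \<in> borel_measurable ?\<Omega>"
    unfolding mo by measurable
  let ?h = "\<lambda>u. (R.I u, G.I u)"
  have mh: "?h \<in> measurable ?\<Omega> (borel_on ({0..} \<times> {0..}))"
    using mR mG R0 G0 so by (intro measurable_restrict_space2) (auto intro!: borel_measurable_Pair)
  define \<pi> where "\<pi> = distr ?\<Omega> (borel_on ({0..} \<times> {0..})) ?h"
  have \<pi>: "\<pi> \<in> M1 ({0..} \<times> {0..})" unfolding \<pi>_def by (intro distr_in_M1 mh) (rule \<Omega>.prob_space_axioms)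
  have mfs: "fst \<in> measurable (borel_on ({0..} \<times> {0..} :: (real \<times> real) set)) (borel_on {0..})" "snd \<in> measurable (borel_on ({0..} \<times> {0..} :: (real \<times> real) set)) (borel_on {0..})"
    by (intro continuous_measurable_borel_on continuous_intros; force)+
  have mR': "R.I \<in> measurable ?\<Omega> (borel_on {0..})" "G.I \<in> measurable ?\<Omega> (borel_on {0..})"
    using mR mG R0 G0 so by (auto intro!: measurable_restrict_space2)
  have marg: "distr ?\<Omega> (borel_on {0..}) J = \<kappa>"
    if "J \<in> measurable ?\<Omega> (borel_on {0..})" "distr ?\<Omega> borel J = distr \<kappa> borel (\<lambda>x. x)" "\<kappa> \<in> M1 {0..}" "J \<in> borel_measurable ?\<Omega>" for J :: "real \<Rightarrow> real" and \<kappa>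
  proof (rule M1_eqI[OF distr_in_M1 that(3)])
    fix A :: "real set" assume A: "A \<in> sets (borel_on {0..})"
    then have "A \<in> sets borel" by (auto simp: sets_restrict_space)
    then have "emeasure (distr ?\<Omega> (borel_on {0..}) J) A = emeasure (distr ?\<Omega> borel J) A"
      using A that(1,4) by (simp only: emeasure_distr)
    then show "emeasure (distr ?\<Omega> (borel_on {0..}) J) A = emeasure \<kappa> A"
      using push_real_distribution(3)[OF that(3) A] that(2) by simp
  qed (use that \<Omega>.prob_space_axioms in auto)
  have borel_lborel: "distr ?\<Omega> borel R.I = ?r" "distr ?\<Omega> borel G.I = ?g"
    using R.distr_I_eq_M G.distr_I_eq_M by auto
  have "distr \<pi> (borel_on {0..}) fst = \<rho>"
    unfolding \<pi>_def using mfs mh marg[OF mR'(1) borel_lborel(1) \<rho> mR] by (simp add: distr_distr comp_def)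
  moreover have "distr \<pi> (borel_on {0..}) snd = \<gamma>"
    unfolding \<pi>_def using mfs mh marg[OF mR'(2) borel_lborel(2) \<gamma> mG] by (simp add: distr_distr comp_def)
  ultimately have c: "\<pi> \<in> couplings {0..} \<rho> \<gamma>" using \<pi> by (simp add: couplings_def)
  have "cost \<pi> = (\<integral>\<^sup>+u. ennreal \<bar>R.I u - G.I u\<bar> \<partial>?\<Omega>)"
    unfolding \<pi>_def using mh by (subst nn_integral_distr) (auto intro!: borel_measurable_continuous_on_restrict continuous_intros measurable_compose[OF _ measurable_ennreal])
  also have "\<dots> = (\<integral>\<^sup>+u. (\<integral>\<^sup>+t. ennreal \<bar>(if R.I u \<le> t then 1 else 0) - (if G.I u \<le> t then 1 else 0)\<bar> \<partial>lborel) \<partial>?\<Omega>)"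
    by (subst abs_diff_eq_nn_integral) (rule refl)
  also have "\<dots> = (\<integral>\<^sup>+t. (\<integral>\<^sup>+u. ennreal \<bar>(if R.I u \<le> t then 1 else 0) - (if G.I u \<le> t then 1 else 0)\<bar> \<partial>?\<Omega>) \<partial>lborel)"
  proof -
    interpret pair_sigma_finite ?\<Omega> lborel ..
    note [measurable] = mR mG
    show ?thesis by (subst Fubini') auto
  qed
  also have "\<dots> \<le> cdf_dist \<rho> \<gamma>" unfolding cdf_dist_def
  proof (rule nn_integral_mono)
    fix t :: real
    let ?F = "cdf ?r t" and ?G = "cdf ?g t"
    have "(\<integral>\<^sup>+u. ennreal \<bar>(if R.I u \<le> t then 1 else 0) - (if G.I u \<le> t then 1 else 0)\<bar> \<partial>?\<Omega>)
      = (\<integral>\<^sup>+u. ennreal \<bar>(if R.I u \<le> t then 1 else 0) - (if G.I u \<le> t then 1 else 0)\<bar> * indicator {0<..<1} u \<partial>lborel)"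
      by (subst nn_integral_restrict_space) auto
    also have "\<dots> \<le> (\<integral>\<^sup>+u. indicator {min ?F ?G<..max ?F ?G} u \<partial>lborel)"
    proof (rule nn_integral_mono)
      fix u :: real
      show "ennreal \<bar>(if R.I u \<le> t then 1 else 0) - (if G.I u \<le> t then 1 else 0)\<bar> * indicator {0<..<1} u
         \<le> indicator {min ?F ?G<..max ?F ?G} u"
      proof (cases "u \<in> {0<..<1}")
        case True
        then have "u \<le> ?F \<longleftrightarrow> R.I u \<le> t" "u \<le> ?G \<longleftrightarrow> G.I u \<le> t"
          using R.pseudoinverse[of u t] G.pseudoinverse[of u t] by auto
        then show ?thesis using True by (auto simp: indicator_def)
      qed simp
    qed
    also have "\<dots> = ennreal \<bar>?F - ?G\<bar>" by (auto simp: abs_if min_def max_def)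
    finally show "(\<integral>\<^sup>+u. ennreal \<bar>(if R.I u \<le> t then 1 else 0) - (if G.I u \<le> t then 1 else 0)\<bar> \<partial>?\<Omega>)
       \<le> ennreal \<bar>measure \<rho> ({0..} \<inter> {..t}) - measure \<gamma> ({0..} \<inter> {..t})\<bar>"
      by (simp add: push_real_distribution(2)[OF \<rho>] push_real_distribution(2)[OF \<gamma>])
  qed
  finally show ?thesis using c by blast
qed

lemma M11_D: "\<rho> \<in> M11 \<Longrightarrow> \<rho> \<in> M1 {0..}" "\<rho> \<in> M11 \<Longrightarrow> (\<integral>\<^sup>+x. ennreal x \<partial>\<rho>) = 1"
  by (auto simp: M11_def)

text \<open>|x - y| \<le> x + y and both means are 1. This keeps the infimum in \<open>W1\<close>
  finite, so \<open>enn2real\<close> is faithful on \<open>M11\<close>.\<close>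

lemma cost_finite:
  assumes \<pi>: "\<pi> \<in> couplings {0..} \<rho> \<gamma>" and "\<rho> \<in> M11" "\<gamma> \<in> M11"
  shows "cost \<pi> \<le> 2"
proof -
  note p = couplings_D[OF \<pi>]
  have sp: "space \<pi> = {0..} \<times> {0..}" by (rule M1_space[OF p(1)])
  have m: "ennreal \<in> borel_measurable (borel_on {0..})" by (intro measurable_restrict_space1) measurable
  have "(\<integral>\<^sup>+z. ennreal (fst z) \<partial>\<pi>) = 1"
    using M11_D(2)[OF assms(2)] p(4) m unfolding p(2) by (subst (asm) nn_integral_distr) auto
  moreover have "(\<integral>\<^sup>+z. ennreal (snd z) \<partial>\<pi>) = 1"
    using M11_D(2)[OF assms(3)] p(5) m unfolding p(3) by (subst (asm) nn_integral_distr) auto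
  moreover have "cost \<pi> \<le> (\<integral>\<^sup>+z. ennreal (fst z) + ennreal (snd z) \<partial>\<pi>)"
    by (intro nn_integral_mono) (auto simp: sp ennreal_plus[symmetric] simp del: ennreal_plus intro!: ennreal_leI)
  moreover have "(\<integral>\<^sup>+z. ennreal (fst z) + ennreal (snd z) \<partial>\<pi>) = (\<integral>\<^sup>+z. ennreal (fst z) \<partial>\<pi>) + (\<integral>\<^sup>+z. ennreal (snd z) \<partial>\<pi>)"
    using p(6,7) by (intro nn_integral_add) auto
  ultimately show ?thesis by simp
qed

lemma W1_eq:
  assumes "\<rho> \<in> M11" "\<gamma> \<in> M11"
  shows "ennreal (W1 \<rho> \<gamma>) = cdf_dist \<rho> \<gamma>" and "\<exists>\<pi>\<in>couplings {0..} \<rho> \<gamma>. cost \<pi> = ennreal (W1 \<rho> \<gamma>)"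
proof -
  obtain \<pi> where \<pi>: "\<pi> \<in> couplings {0..} \<rho> \<gamma>" "cost \<pi> \<le> cdf_dist \<rho> \<gamma>"
    using exists_optimal_coupling[of \<rho> \<gamma>] assms M11_D by blast
  have "(INF \<pi>\<in>couplings {0..} \<rho> \<gamma>. cost \<pi>) = cdf_dist \<rho> \<gamma>"
    using \<pi> by (intro antisym INF_greatest cdf_dist_le_cost) (auto intro: INF_lower2)
  moreover have "cdf_dist \<rho> \<gamma> < \<infinity>"
    using cdf_dist_le_cost[OF \<pi>(1)] cost_finite[OF \<pi>(1) assms]
    by (metis ennreal_numeral_less_top infinity_ennreal_def order_le_less_trans order_trans)
  ultimately show e: "ennreal (W1 \<rho> \<gamma>) = cdf_dist \<rho> \<gamma>" unfolding W1_def by simp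
  show "\<exists>\<pi>\<in>couplings {0..} \<rho> \<gamma>. cost \<pi> = ennreal (W1 \<rho> \<gamma>)"
    using \<pi> cdf_dist_le_cost[OF \<pi>(1)] e by (intro bexI[of _ \<pi>]) auto
qed

lemma W1_le_cost:
  assumes "\<rho> \<in> M11" "\<gamma> \<in> M11" "\<pi> \<in> couplings {0..} \<rho> \<gamma>" "cost \<pi> \<le> ennreal c" "c \<ge> 0"
  shows "W1 \<rho> \<gamma> \<le> c"
proof -
  have "ennreal (W1 \<rho> \<gamma>) \<le> ennreal c"
    unfolding W1_eq(1)[OF assms(1,2)] using cdf_dist_le_cost[OF assms(3)] assms(4) by (rule order_trans)
  then show ?thesis using assms(5) by simp
qed

lemma W1_nonneg: "W1 \<rho> \<gamma> \<ge> 0" by (simp add: W1_def)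

text \<open>The coordinates of couplings are swapped. This covers all arguments, as
  \<open>Metric_space\<close> demands, whereas the formula through \<open>cdf_dist\<close> is tied
  to \<open>M11\<close>.\<close>

lemma W1_commute: "W1 \<rho> \<gamma> = W1 \<gamma> \<rho>"
proof -
  have le: "(INF \<pi>\<in>couplings {0..} \<rho> \<gamma>. cost \<pi>) \<le> (INF \<pi>\<in>couplings {0..} \<gamma> \<rho>. cost \<pi>)" for \<rho> \<gamma>
  proof (rule INF_greatest)
    fix \<pi> assume \<pi>: "\<pi> \<in> couplings {0..} \<gamma> \<rho>"
    note p = couplings_D[OF \<pi>]
    have sw: "prod.swap \<in> measurable \<pi> (borel_on ({0..} \<times> {0..}))"
      unfolding M1_measurable[OF p(1)] by (intro continuous_measurable_borel_on continuous_on_swap) auto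
    have mfs: "fst \<in> measurable (borel_on ({0..} \<times> {0..} :: (real \<times> real) set)) (borel_on {0..})" "snd \<in> measurable (borel_on ({0..} \<times> {0..} :: (real \<times> real) set)) (borel_on {0..})"
      by (intro continuous_measurable_borel_on continuous_intros; force)+
    let ?\<pi> = "distr \<pi> (borel_on ({0..} \<times> {0..})) prod.swap"
    have "?\<pi> \<in> couplings {0..} \<rho> \<gamma>"
      using sw mfs p(1) by (auto simp: couplings_def distr_distr comp_def p(2)[symmetric] p(3)[symmetric] intro!: distr_in_M1 M1_prob)
    moreover have "cost ?\<pi> = cost \<pi>"
      using sw by (subst nn_integral_distr) (auto intro!: measurable_compose[OF _ measurable_ennreal] borel_measurable_continuous_on_restrict continuous_intros simp: abs_minus_commute)
    ultimately show "(INF \<pi>\<in>couplings {0..} \<rho> \<gamma>. cost \<pi>) \<le> cost \<pi>"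
      using INF_lower[of ?\<pi> "couplings {0..} \<rho> \<gamma>" cost] by simp
  qed
  show ?thesis unfolding W1_def by (rule arg_cong[where f=enn2real], rule antisym; rule le)
qed

lemma Metric_space_W1: "Metric_space M11 W1"
proof
  fix \<rho> \<gamma> show "0 \<le> W1 \<rho> \<gamma>" by (simp add: W1_def)
  show "W1 \<rho> \<gamma> = W1 \<gamma> \<rho>" by (rule W1_commute)
next
  fix \<rho> \<gamma> assume a: "\<rho> \<in> M11" "\<gamma> \<in> M11"
  show "W1 \<rho> \<gamma> = 0 \<longleftrightarrow> \<rho> = \<gamma>"
  proof
    \<comment> \<open>The infimum is attained, so distance 0 yields a coupling carried by the
      diagonal.\<close>
    assume "W1 \<rho> \<gamma> = 0"
    then obtain \<pi> where \<pi>: "\<pi> \<in> couplings {0..} \<rho> \<gamma>" "cost \<pi> = 0" using W1_eq(2)[OF a] by auto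
    note p = couplings_D[OF \<pi>(1)]
    have "AE z in \<pi>. ennreal \<bar>fst z - snd z\<bar> = 0"
      using \<pi>(2) p(6,7) by (subst (asm) nn_integral_0_iff_AE) auto
    then have "AE z in \<pi>. fst z = snd z" by eventually_elim (simp add: ennreal_eq_0_iff)
    then show "\<rho> = \<gamma>" unfolding p(2,3) using p(4,5) by (intro distr_cong_AE) auto
  next
    assume "\<rho> = \<gamma>"
    then have "ennreal (W1 \<rho> \<gamma>) = 0" unfolding W1_eq(1)[OF a] by (simp add: cdf_dist_def)
    then show "W1 \<rho> \<gamma> = 0" using W1_nonneg[of \<rho> \<gamma>] by (simp add: ennreal_eq_0_iff)
  qed
next
  fix \<rho> \<gamma> \<kappa> assume a: "\<rho> \<in> M11" "\<gamma> \<in> M11" "\<kappa> \<in> M11"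
  have m: "(\<lambda>t. measure \<rho> ({0..} \<inter> {..t})) \<in> borel_measurable lborel" if "\<rho> \<in> M11" for \<rho>
  proof -
    interpret cdf_distribution "distr \<rho> borel (\<lambda>x. x)" using that M11_D by (intro push_real_distribution)
    have "cdf (distr \<rho> borel (\<lambda>x. x)) = (\<lambda>t. measure \<rho> ({0..} \<inter> {..t}))"
      by (rule ext) (rule push_real_distribution(2)[OF M11_D(1)[OF that]])
    then show ?thesis using measurable_C by simp
  qed
  have "cdf_dist \<rho> \<kappa> \<le> (\<integral>\<^sup>+t. ennreal \<bar>measure \<rho> ({0..} \<inter> {..t}) - measure \<gamma> ({0..} \<inter> {..t})\<bar>
     + ennreal \<bar>measure \<gamma> ({0..} \<inter> {..t}) - measure \<kappa> ({0..} \<inter> {..t})\<bar> \<partial>lborel)"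
    unfolding cdf_dist_def by (intro nn_integral_mono) (simp flip: ennreal_plus)
  also have "\<dots> = cdf_dist \<rho> \<gamma> + cdf_dist \<gamma> \<kappa>"
    unfolding cdf_dist_def using m[OF a(1)] m[OF a(2)] m[OF a(3)] by (intro nn_integral_add) auto
  finally have "ennreal (W1 \<rho> \<kappa>) \<le> ennreal (W1 \<rho> \<gamma> + W1 \<gamma> \<kappa>)"
    using a by (simp add: W1_eq(1) W1_nonneg)
  then show "W1 \<rho> \<kappa> \<le> W1 \<rho> \<gamma> + W1 \<gamma> \<kappa>"
    using W1_nonneg[of \<rho> \<gamma>] W1_nonneg[of \<gamma> \<kappa>] by (simp del: ennreal_plus)
qed

text \<open>The easy half of Kantorovich duality, read off from an optimal coupling.\<close>

lemma lipschitz_integral_diff_le_W1: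
  fixes f :: "real \<Rightarrow> real"
  assumes a: "\<rho> \<in> M11" "\<gamma> \<in> M11" and f: "\<And>x y. x \<ge> 0 \<Longrightarrow> y \<ge> 0 \<Longrightarrow> \<bar>f x - f y\<bar> \<le> L * \<bar>x - y\<bar>"
    and C: "\<And>x. x \<ge> 0 \<Longrightarrow> \<bar>f x\<bar> \<le> C" and m: "f \<in> borel_measurable borel" and L: "L \<ge> 0"
  shows "\<bar>(\<integral>x. f x \<partial>\<rho>) - (\<integral>x. f x \<partial>\<gamma>)\<bar> \<le> L * W1 \<rho> \<gamma>"
proof -
  obtain \<pi> where \<pi>: "\<pi> \<in> couplings {0..} \<rho> \<gamma>" "cost \<pi> = ennreal (W1 \<rho> \<gamma>)" using W1_eq(2)[OF a] by auto
  note p = couplings_D[OF \<pi>(1)]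
  have sp: "space \<pi> = {0..} \<times> {0..}" by (rule M1_space[OF p(1)])
  have m': "f \<in> borel_measurable (borel_on {0..})" using m by (rule measurable_restrict_space1)
  note [measurable] = m p(6,7)
  have i: "integrable \<pi> (\<lambda>z. f (fst z))" "integrable \<pi> (\<lambda>z. f (snd z))"
    using C by (auto intro!: M1_bounded_integrable[OF p(1), of _ C])
  have ic: "integrable \<pi> (\<lambda>z. \<bar>fst z - snd z\<bar>)"
    using \<pi>(2) by (intro integrableI_bounded) auto
  have ii: "(\<integral>z. \<bar>fst z - snd z\<bar> \<partial>\<pi>) = W1 \<rho> \<gamma>"
    using nn_integral_eq_integral[OF ic] \<pi>(2) W1_nonneg by simp
  have "(\<integral>x. f x \<partial>\<rho>) - (\<integral>x. f x \<partial>\<gamma>) = (\<integral>z. f (fst z) \<partial>\<pi>) - (\<integral>z. f (snd z) \<partial>\<pi>)"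
    unfolding p(2,3) using p(4,5) m' by (simp add: integral_distr)
  also have "\<dots> = (\<integral>z. f (fst z) - f (snd z) \<partial>\<pi>)" using i by simp
  finally have "\<bar>(\<integral>x. f x \<partial>\<rho>) - (\<integral>x. f x \<partial>\<gamma>)\<bar> \<le> (\<integral>z. \<bar>f (fst z) - f (snd z)\<bar> \<partial>\<pi>)"
    using integral_norm_bound[of \<pi> "\<lambda>z. f (fst z) - f (snd z)"] by simp
  also have "\<dots> \<le> (\<integral>z. L * \<bar>fst z - snd z\<bar> \<partial>\<pi>)"
  proof (rule integral_mono)
    show "integrable \<pi> (\<lambda>z. \<bar>f (fst z) - f (snd z)\<bar>)" using i by (intro integrable_abs Bochner_Integration.integrable_diff)
    show "integrable \<pi> (\<lambda>z. L * \<bar>fst z - snd z\<bar>)" using ic by (rule integrable_mult_right)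
  qed (use f sp in auto)
  also have "\<dots> = L * W1 \<rho> \<gamma>" using ii by simp
  finally show ?thesis .
qed

lemma empirical_in_M11:
  assumes "n \<ge> 1" "\<And>i. i \<in> {1..n} \<Longrightarrow> w i \<ge> 0" "(\<Sum>i=1..n. w i) = real n"
  shows "empirical {0..} n w \<in> M11"
proof -
  have "(\<integral>\<^sup>+x. ennreal x \<partial>empirical {0..} n w) = (\<Sum>i=1..n. ennreal (w i)) / of_nat n"
    using assms by (intro nn_integral_empirical) (auto intro!: measurable_restrict_space1)
  also have "(\<Sum>i=1..n. ennreal (w i)) = ennreal (real n)" using assms by (subst sum_ennreal) auto
  also have "\<dots> / of_nat n = 1" using assms(1) by (simp add: divide_ennreal ennreal_of_nat_eq_real_of_nat)
  finally show ?thesis using assms empirical_in_M1[of n w "{0..}"] by (simp add: M11_def)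
qed

text \<open>The coupling that pairs equal indices is admissible, though in general not
  optimal.\<close>

lemma W1_empirical_le:
  assumes n: "n \<ge> 1" and w: "\<And>i. i \<in> {1..n} \<Longrightarrow> w i \<ge> 0" "(\<Sum>i=1..n. w i) = real n"
    and w': "\<And>i. i \<in> {1..n} \<Longrightarrow> w' i \<ge> 0" "(\<Sum>i=1..n. w' i) = real n"
  shows "W1 (empirical {0..} n w) (empirical {0..} n w') \<le> (\<Sum>i=1..n. \<bar>w i - w' i\<bar>) / real n"
proof (rule W1_le_cost)
  let ?E = "{0..} \<times> {0..} :: (real \<times> real) set"
  let ?\<pi> = "empirical ?E n (\<lambda>i. (w i, w' i))"
  have mfs: "fst \<in> measurable (borel_on ?E) (borel_on {0..})" "snd \<in> measurable (borel_on ?E) (borel_on {0..})"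
    by (intro continuous_measurable_borel_on continuous_intros; force)+
  have "distr ?\<pi> (borel_on {0..}) fst = empirical {0..} n (\<lambda>i. fst (w i, w' i))"
    by (rule distr_empirical[OF n _ mfs(1)]) (use w w' in auto)
  moreover have "distr ?\<pi> (borel_on {0..}) snd = empirical {0..} n (\<lambda>i. snd (w i, w' i))"
    by (rule distr_empirical[OF n _ mfs(2)]) (use w w' in auto)
  ultimately show "?\<pi> \<in> couplings {0..} (empirical {0..} n w) (empirical {0..} n w')"
    using n w w' by (auto simp: couplings_def intro!: empirical_in_M1)
  have "cost ?\<pi> = (\<Sum>i=1..n. ennreal \<bar>w i - w' i\<bar>) / of_nat n"
    using n w w' by (subst nn_integral_empirical)
     (auto intro!: measurable_compose[OF _ measurable_ennreal] borel_measurable_continuous_on_restrict continuous_intros)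
  also have "\<dots> = ennreal ((\<Sum>i=1..n. \<bar>w i - w' i\<bar>) / real n)"
    using n by (simp add: sum_ennreal divide_ennreal ennreal_of_nat_eq_real_of_nat sum_nonneg)
  finally show "cost ?\<pi> \<le> ennreal ((\<Sum>i=1..n. \<bar>w i - w' i\<bar>) / real n)" by simp
qed (use assms in \<open>auto intro!: empirical_in_M11 divide_nonneg_nonneg sum_nonneg\<close>)

section \<open>The bounded Lipschitz distance\<close>

lemma M1_emeasure_borel:
  assumes "\<rho> \<in> M1 E" "B \<in> sets borel"
  shows "emeasure (distr \<rho> borel (\<lambda>x. x)) B = emeasure \<rho> (E \<inter> B)"
proof -
  have "(\<lambda>x. x) \<in> borel_measurable \<rho>" using assms by (intro M1_continuous_measurable continuous_intros)
  then show ?thesis using assms M1_space[OF assms(1)] by (subst emeasure_distr) (auto simp: vimage_def Int_commute)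
qed

lemma M1_eqI_generator:
  fixes \<rho> \<gamma> :: "'a::topological_space measure"
  assumes \<rho>: "\<rho> \<in> M1 E" and \<gamma>: "\<gamma> \<in> M1 E" and G: "Int_stable G" "sets (borel_on E) = sigma_sets E G" "G \<subseteq> Pow E"
    and eq: "\<And>A. A \<in> G \<Longrightarrow> measure \<rho> A = measure \<gamma> A"
  shows "\<rho> = \<gamma>"
proof -
  interpret R: prob_space \<rho> by (rule M1_prob[OF \<rho>])
  interpret S: prob_space \<gamma> by (rule M1_prob[OF \<gamma>])
  have sp: "space \<rho> = E" "space \<gamma> = E" using M1_space[OF \<rho>] M1_space[OF \<gamma>] by auto
  have me: "measure \<rho> A = measure \<gamma> A" if "A \<in> sigma_sets E G" for A
    using G(1,3) that
  proof (induction rule: sigma_sets_induct_disjoint)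
    case (basic A) then show ?case by (rule eq)
  next
    case empty then show ?case by simp
  next
    case (compl A)
    then have "A \<in> sets \<rho>" "A \<in> sets \<gamma>" using M1_sets[OF \<rho>] M1_sets[OF \<gamma>] G(2) by auto
    then show ?case using compl R.prob_compl S.prob_compl sp by simp
  next
    case (union A)
    then have "range A \<subseteq> sets \<rho>" "range A \<subseteq> sets \<gamma>" using M1_sets[OF \<rho>] M1_sets[OF \<gamma>] G(2) by auto
    then have "(\<lambda>n. measure \<rho> (A n)) sums measure \<rho> (\<Union>n. A n)" "(\<lambda>n. measure \<gamma> (A n)) sums measure \<gamma> (\<Union>n. A n)"
      using union R.finite_measure_UNION[of A] S.finite_measure_UNION[of A] by auto
    moreover have "(\<lambda>n. measure \<rho> (A n)) = (\<lambda>n. measure \<gamma> (A n))" using union by blast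
    ultimately show ?case using sums_unique2 by metis
  qed
  show ?thesis
    using me G(2) by (intro M1_eqI[OF \<rho> \<gamma>]) (simp add: R.emeasure_eq_measure S.emeasure_eq_measure)
qed

lemma M1_eqI_open:
  fixes \<rho> \<gamma> :: "'a::topological_space measure"
  assumes \<rho>: "\<rho> \<in> M1 E" and \<gamma>: "\<gamma> \<in> M1 E" and eq: "\<And>U. open U \<Longrightarrow> measure \<rho> (E \<inter> U) = measure \<gamma> (E \<inter> U)"
  shows "\<rho> = \<gamma>"
proof -
  interpret R: prob_space \<rho> by (rule M1_prob[OF \<rho>])
  interpret S: prob_space \<gamma> by (rule M1_prob[OF \<gamma>])
  have id: "(\<lambda>x. x) \<in> borel_measurable \<rho>" "(\<lambda>x. x) \<in> borel_measurable \<gamma>"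
    by (rule M1_continuous_measurable[OF \<rho>] M1_continuous_measurable[OF \<gamma>], intro continuous_intros)+
  have P: "prob_space (distr \<rho> borel (\<lambda>x. x))" "prob_space (distr \<gamma> borel (\<lambda>x. x))"
    using R.prob_space_distr[OF id(1)] S.prob_space_distr[OF id(2)] by auto
  have "distr \<rho> borel (\<lambda>x. x) = distr \<gamma> borel (\<lambda>x. x)"
  proof (rule M1_eqI_generator[where E=UNIV and G="{U. open U}"])
    show "distr \<rho> borel (\<lambda>x. x) \<in> M1 UNIV" "distr \<gamma> borel (\<lambda>x. x) \<in> M1 UNIV"
      using P by (auto simp: M1_def)
    show "Int_stable {U::'a set. open U}" by (auto simp: Int_stable_def)
    show "sets (borel_on UNIV) = sigma_sets UNIV {U::'a set. open U}" by (simp add: borel_def)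
    fix A :: "'a set" assume "A \<in> {U. open U}"
    then have "open A" by simp
    then show "measure (distr \<rho> borel (\<lambda>x. x)) A = measure (distr \<gamma> borel (\<lambda>x. x)) A"
      using eq[OF \<open>open A\<close>] M1_emeasure_borel[OF \<rho>, of A] M1_emeasure_borel[OF \<gamma>, of A] by (simp add: measure_def)
  qed auto
  note e = this
  show ?thesis
  proof (rule M1_eqI[OF \<rho> \<gamma>])
    fix A assume "A \<in> sets (borel_on E)"
    then obtain B where B: "A = E \<inter> B" "B \<in> sets borel" by (auto simp: sets_restrict_space)
    show "emeasure \<rho> A = emeasure \<gamma> A"
      unfolding B(1) using e M1_emeasure_borel[OF \<rho> B(2)] M1_emeasure_borel[OF \<gamma> B(2)] by simp
  qed
qed

definition BL :: "'a::topological_space set \<Rightarrow> ('a \<Rightarrow> 'a \<Rightarrow> real) \<Rightarrow> ('a \<Rightarrow> real) set" where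
  "BL E \<delta> = {f. continuous_on E f \<and> bounded (f ` E) \<and> sup_norm E f + lip_norm E \<delta> f \<le> 1}"

lemma \<beta>_BL_BL: "\<beta>_BL E \<delta> \<rho> \<gamma> = enn2real (SUP f\<in>BL E \<delta>. ennreal \<bar>(\<integral>x. f x \<partial>\<rho>) - (\<integral>x. f x \<partial>\<gamma>)\<bar>)"
  by (simp add: \<beta>_BL_def BL_def)

locale compat =
  fixes E :: "'a::topological_space set" and \<delta> :: "'a \<Rightarrow> 'a \<Rightarrow> real"
  assumes compat: "compatible_metric E \<delta>"
begin

sublocale MS: Metric_space E \<delta> using compat by (simp add: compatible_metric_def)

lemma mtop: "MS.mtopology = top_of_set E" using compat by (simp add: compatible_metric_def)

lemma open_ball_in:
  assumes "open U" "x \<in> E" "x \<in> U"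
  shows "\<exists>r>0. \<forall>y\<in>E. \<delta> x y < r \<longrightarrow> y \<in> U"
proof -
  have "openin MS.mtopology (E \<inter> U)" unfolding mtop using assms(1) by (rule openin_open_Int)
  then obtain r where "r > 0" "MS.mball x r \<subseteq> E \<inter> U" using assms unfolding MS.openin_mtopology by blast
  then show ?thesis using assms(2) by (intro exI[of _ r]) (auto simp: MS.in_mball)
qed

lemma ball_is_open: "x \<in> E \<Longrightarrow> \<exists>U. open U \<and> {y\<in>E. \<delta> x y < r} = E \<inter> U"
proof -
  assume x: "x \<in> E"
  have "openin (top_of_set E) (MS.mball x r)" unfolding mtop[symmetric] by (rule MS.openin_mball)
  then obtain U where "open U" "MS.mball x r = E \<inter> U" unfolding openin_open by blast
  moreover have "MS.mball x r = {y\<in>E. \<delta> x y < r}" using x by (auto simp: MS.in_mball)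
  ultimately show ?thesis by auto
qed

lemma continuous_at_ball:
  fixes f :: "'a \<Rightarrow> real"
  assumes "continuous_on E f" "x \<in> E" "\<epsilon> > 0"
  shows "\<exists>r>0. \<forall>y\<in>E. \<delta> x y < r \<longrightarrow> \<bar>f y - f x\<bar> < \<epsilon>"
proof -
  have "open (ball (f x) \<epsilon>)" "f x \<in> ball (f x) \<epsilon>" using assms(3) by simp_all
  with assms(1,2) obtain A where A: "open A" "x \<in> A" "\<forall>y\<in>E. y \<in> A \<longrightarrow> f y \<in> ball (f x) \<epsilon>"
    unfolding continuous_on_topological by blast
  obtain r where "r > 0" "\<forall>y\<in>E. \<delta> x y < r \<longrightarrow> y \<in> A" using open_ball_in[OF A(1) assms(2) A(2)] by blast
  then show ?thesis using A(3) by (intro exI[of _ r]) (auto simp: dist_real_def abs_minus_commute)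
qed

lemma lipschitz_continuous:
  fixes f :: "'a \<Rightarrow> real"
  assumes "\<And>x y. x \<in> E \<Longrightarrow> y \<in> E \<Longrightarrow> \<bar>f x - f y\<bar> \<le> L * \<delta> x y"
  shows "continuous_on E f"
  unfolding continuous_on_topological
proof (intro ballI allI impI)
  fix x B assume x: "x \<in> E" and B: "open B" "f x \<in> B"
  obtain e where e: "e > 0" "ball (f x) e \<subseteq> B" using B open_contains_ball by blast
  define r where "r = e / (1 + \<bar>L\<bar>)"
  have r: "r > 0" using e by (simp add: r_def)
  obtain U where U: "open U" "{y\<in>E. \<delta> x y < r} = E \<inter> U" using ball_is_open[OF x] by blast
  have "f y \<in> B" if y: "y \<in> E" "y \<in> U" for y
  proof -
    have d: "\<delta> x y < r" using U(2) y by blast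
    have "\<bar>f x - f y\<bar> \<le> L * \<delta> x y" using assms x y by blast
    also have "\<dots> \<le> (1 + \<bar>L\<bar>) * \<delta> x y" by (intro mult_right_mono) auto
    also have "\<dots> < (1 + \<bar>L\<bar>) * r" using d by (intro mult_strict_left_mono) auto
    also have "\<dots> = e" by (simp add: r_def)
    finally show ?thesis using e by (auto simp: dist_real_def)
  qed
  moreover have "x \<in> U"
  proof -
    have "x \<in> {y\<in>E. \<delta> x y < r}" using x r by simp
    then show ?thesis unfolding U(2) by simp
  qed
  ultimately show "\<exists>A. open A \<and> x \<in> A \<and> (\<forall>y\<in>E. y \<in> A \<longrightarrow> f y \<in> B)" using U(1) by blast
qed

lemma BL_D:
  assumes f: "f \<in> BL E \<delta>"
  shows "continuous_on E f" "x \<in> E \<Longrightarrow> \<bar>f x\<bar> \<le> 1" "x \<in> E \<Longrightarrow> y \<in> E \<Longrightarrow> \<bar>f x - f y\<bar> \<le> \<delta> x y"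
proof -
  show "continuous_on E f" using f by (simp add: BL_def)
  have s: "sup_norm E f + lip_norm E \<delta> f \<le> 1" using f by (simp add: BL_def)
  have s1: "sup_norm E f \<le> 1" by (rule order_trans[OF _ s]) (simp add: add_increasing2)
  have l1: "lip_norm E \<delta> f \<le> 1" by (rule order_trans[OF _ s]) (simp add: add_increasing)
  show "\<bar>f x\<bar> \<le> 1" if "x \<in> E"
  proof -
    have "ennreal \<bar>f x\<bar> \<le> sup_norm E f" unfolding sup_norm_def by (rule SUP_upper[OF that])
    then have "ennreal \<bar>f x\<bar> \<le> 1" using s1 by (rule order_trans)
    then show ?thesis by simp
  qed
  show "\<bar>f x - f y\<bar> \<le> \<delta> x y" if xy: "x \<in> E" "y \<in> E"
  proof (cases "x = y")
    case False
    then have d: "\<delta> x y > 0" using MS.mdist_pos_less[of x y] xy by simp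
    have "ennreal (\<bar>f x - f y\<bar> / \<delta> x y) \<le> lip_norm E \<delta> f"
      unfolding lip_norm_def using xy False by (intro SUP_upper2[of "(x, y)"]) auto
    then have "ennreal (\<bar>f x - f y\<bar> / \<delta> x y) \<le> 1" using l1 by (rule order_trans)
    then show ?thesis using d by (simp add: field_simps)
  qed simp
qed

lemma BL_I:
  fixes f :: "'a \<Rightarrow> real"
  assumes a: "\<And>x. x \<in> E \<Longrightarrow> \<bar>f x\<bar> \<le> a" and b: "\<And>x y. x \<in> E \<Longrightarrow> y \<in> E \<Longrightarrow> \<bar>f x - f y\<bar> \<le> b * \<delta> x y"
    and ab: "a \<ge> 0" "b \<ge> 0" "a + b \<le> 1"
  shows "f \<in> BL E \<delta>"
proof -
  have "sup_norm E f \<le> ennreal a" unfolding sup_norm_def using a by (intro SUP_least ennreal_leI) auto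
  moreover have "lip_norm E \<delta> f \<le> ennreal b" unfolding lip_norm_def
  proof (intro SUP_least, clarify)
    fix x y assume xy: "x \<in> E" "y \<in> E" "x \<noteq> y"
    then have "\<delta> x y > 0" using MS.mdist_pos_less[of x y] by simp
    then show "ennreal (\<bar>f x - f y\<bar> / \<delta> x y) \<le> ennreal b" using b[OF xy(1,2)] by (intro ennreal_leI) (simp add: divide_le_eq)
  qed
  ultimately have "sup_norm E f + lip_norm E \<delta> f \<le> ennreal a + ennreal b" by (rule add_mono)
  also have "\<dots> = ennreal (a + b)" using ab by simp
  also have "\<dots> \<le> ennreal 1" using ab by (intro ennreal_leI) auto
  finally have "sup_norm E f + lip_norm E \<delta> f \<le> 1" by simp
  moreover have "bounded (f ` E)" using a by (intro boundedI[of _ a]) auto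
  ultimately show ?thesis using lipschitz_continuous[OF b] by (simp add: BL_def)
qed

lemma BL_integrable: "\<rho> \<in> M1 E \<Longrightarrow> f \<in> BL E \<delta> \<Longrightarrow> integrable \<rho> f"
  using BL_D by (intro M1_bounded_integrable[of _ E _ 1] M1_continuous_measurable) auto

lemma BL_integral_le: "\<rho> \<in> M1 E \<Longrightarrow> f \<in> BL E \<delta> \<Longrightarrow> \<bar>\<integral>x. f x \<partial>\<rho>\<bar> \<le> 1"
proof -
  assume \<rho>: "\<rho> \<in> M1 E" and f: "f \<in> BL E \<delta>"
  interpret prob_space \<rho> by (rule M1_prob[OF \<rho>])
  have "\<bar>\<integral>x. f x \<partial>\<rho>\<bar> \<le> (\<integral>x. \<bar>f x\<bar> \<partial>\<rho>)" using integral_norm_bound[of \<rho> f] by simp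
  also have "\<dots> \<le> (\<integral>x. 1 \<partial>\<rho>)" using BL_integrable[OF \<rho> f] BL_D(2)[OF f] M1_space[OF \<rho>]
    by (intro integral_mono) auto
  finally show ?thesis by (simp add: prob_space)
qed

lemma \<beta>_BL_ge:
  assumes "\<rho> \<in> M1 E" "\<gamma> \<in> M1 E" "f \<in> BL E \<delta>"
  shows "\<bar>(\<integral>x. f x \<partial>\<rho>) - (\<integral>x. f x \<partial>\<gamma>)\<bar> \<le> \<beta>_BL E \<delta> \<rho> \<gamma>"
proof -
  let ?S = "SUP f\<in>BL E \<delta>. ennreal \<bar>(\<integral>x. f x \<partial>\<rho>) - (\<integral>x. f x \<partial>\<gamma>)\<bar>"
  have "?S \<le> ennreal 2"
  proof (rule SUP_least, rule ennreal_leI)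
    fix f assume "f \<in> BL E \<delta>"
    then have "\<bar>\<integral>x. f x \<partial>\<rho>\<bar> \<le> 1" "\<bar>\<integral>x. f x \<partial>\<gamma>\<bar> \<le> 1" using assms BL_integral_le by auto
    then show "\<bar>(\<integral>x. f x \<partial>\<rho>) - (\<integral>x. f x \<partial>\<gamma>)\<bar> \<le> 2" by linarith
  qed
  then have "?S < top" by (simp add: order_le_less_trans)
  then have "ennreal (\<beta>_BL E \<delta> \<rho> \<gamma>) = ?S" by (simp add: \<beta>_BL_BL)
  moreover have "ennreal \<bar>(\<integral>x. f x \<partial>\<rho>) - (\<integral>x. f x \<partial>\<gamma>)\<bar> \<le> ?S" by (rule SUP_upper[OF assms(3)])
  ultimately have "ennreal \<bar>(\<integral>x. f x \<partial>\<rho>) - (\<integral>x. f x \<partial>\<gamma>)\<bar> \<le> ennreal (\<beta>_BL E \<delta> \<rho> \<gamma>)" by simp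
  then show ?thesis by (simp add: \<beta>_BL_def)
qed

lemma \<beta>_BL_le:
  assumes "\<And>f. f \<in> BL E \<delta> \<Longrightarrow> \<bar>(\<integral>x. f x \<partial>\<rho>) - (\<integral>x. f x \<partial>\<gamma>)\<bar> \<le> c" "c \<ge> 0"
  shows "\<beta>_BL E \<delta> \<rho> \<gamma> \<le> c"
proof -
  have "(SUP f\<in>BL E \<delta>. ennreal \<bar>(\<integral>x. f x \<partial>\<rho>) - (\<integral>x. f x \<partial>\<gamma>)\<bar>) \<le> ennreal c"
    using assms by (intro SUP_least ennreal_leI)
  then show ?thesis unfolding \<beta>_BL_BL using assms(2) by (metis enn2real_leI)
qed

lemma \<beta>_BL_nonneg: "\<beta>_BL E \<delta> \<rho> \<gamma> \<ge> 0" by (simp add: \<beta>_BL_def)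

lemma \<beta>_BL_commute: "\<beta>_BL E \<delta> \<rho> \<gamma> = \<beta>_BL E \<delta> \<gamma> \<rho>"
  unfolding \<beta>_BL_def by (simp add: abs_minus_commute)

text \<open>Lower semicontinuous functions are approximated from below by their Lipschitz inf-convolutions.\<close>

lemma lsc_integral:
  fixes f :: "'a \<Rightarrow> real"
  assumes m: "f \<in> borel_measurable (borel_on E)" and f01: "\<And>x. x \<in> E \<Longrightarrow> 0 \<le> f x \<and> f x \<le> 1"
    and lsc: "\<And>x e. x \<in> E \<Longrightarrow> e > 0 \<Longrightarrow> \<exists>r>0. \<forall>y\<in>E. \<delta> x y < r \<longrightarrow> f x - e < f y"
    and \<rho>: "\<rho> \<in> M1 E" and \<epsilon>: "\<epsilon> > 0"
  shows "\<exists>\<eta>>0. \<forall>\<gamma>\<in>M1 E. \<beta>_BL E \<delta> \<gamma> \<rho> < \<eta> \<longrightarrow> (\<integral>x. f x \<partial>\<rho>) - \<epsilon> < (\<integral>x. f x \<partial>\<gamma>)"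
proof -
  interpret R: prob_space \<rho> by (rule M1_prob[OF \<rho>])
  \<comment> \<open>\<open>g m\<close> is the largest function below f on E with Lipschitz constant
    m; its pointwise convergence to f is where lower semicontinuity enters.\<close>
  define g where "g m x = (INF y\<in>E. f y + real m * \<delta> x y)" for m x
  have bdd: "bdd_below ((\<lambda>y. f y + real m * \<delta> x y) ` E)" for m x
    using f01 by (intro bdd_belowI2[of _ 0]) (auto intro!: add_nonneg_nonneg)
  have g0: "0 \<le> g m x" if "x \<in> E" for m x
    unfolding g_def using f01 that by (intro cINF_greatest) (auto intro!: add_nonneg_nonneg)
  have gf: "g m x \<le> f x" if "x \<in> E" for m x
    unfolding g_def using cINF_lower[OF bdd that, of m x] MS.mdist_zero[OF that] by simp
  have gl: "g m x \<le> g m y + real m * \<delta> x y" if "x \<in> E" "y \<in> E" for m x y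
  proof -
    have "g m x - real m * \<delta> x y \<le> g m y"
      unfolding g_def[of m y]
    proof (rule cINF_greatest)
      fix z assume z: "z \<in> E"
      have "g m x \<le> f z + real m * \<delta> x z" unfolding g_def by (rule cINF_lower[OF bdd z])
      also have "\<dots> \<le> f z + real m * (\<delta> x y + \<delta> y z)"
        using MS.triangle[OF that(1,2) z] by (intro add_left_mono mult_left_mono) auto
      finally show "g m x - real m * \<delta> x y \<le> f z + real m * \<delta> y z" by (simp add: algebra_simps)
    qed (use that in auto)
    then show ?thesis by simp
  qed
  have glip: "\<bar>g m x - g m y\<bar> \<le> real m * \<delta> x y" if "x \<in> E" "y \<in> E" for m x y
    using gl[OF that, of m] gl[OF that(2,1), of m] MS.commute[of x y] by (simp add: abs_le_iff)
  have lim: "(\<lambda>m. g m x) \<longlonglongrightarrow> f x" if x: "x \<in> E" for x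
  proof (rule LIMSEQ_I)
    fix e :: real assume e: "e > 0"
    obtain r where r: "r > 0" "\<forall>y\<in>E. \<delta> x y < r \<longrightarrow> f x - e / 2 < f y" using lsc[OF x, of "e/2"] e by auto
    \<comment> \<open>At distance r or more the penalty is at least 1, an upper bound of f, so only
      points of the ball compete for the infimum.\<close>
    obtain N where N: "real N > 1 / r" using reals_Archimedean2 by blast
    have "norm (g m x - f x) < e" if m: "m \<ge> N" for m
    proof -
      have "f x - e / 2 \<le> g m x" unfolding g_def
      proof (rule cINF_greatest)
        fix y assume y: "y \<in> E"
        show "f x - e / 2 \<le> f y + real m * \<delta> x y"
        proof (cases "\<delta> x y < r")
          case True
          have "0 \<le> real m * \<delta> x y" by simp
          moreover have "f x - e / 2 < f y" using True r(2) y by blast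
          ultimately show ?thesis by linarith
        next
          case False
          have "1 \<le> real N * r" using N r by (simp add: field_simps)
          also have "\<dots> \<le> real m * \<delta> x y" using m False r by (intro mult_mono) auto
          finally show ?thesis using f01[OF x] f01[OF y] e by linarith
        qed
      qed (use x in auto)
      then show ?thesis using gf[OF x, of m] e by auto
    qed
    then show "\<exists>no. \<forall>n\<ge>no. norm (g n x - f x) < e" by blast
  qed
  have gc: "continuous_on E (g m)" for m by (rule lipschitz_continuous[OF glip])
  have gm: "g m \<in> borel_measurable \<rho>" for m
    by (rule M1_continuous_measurable[OF \<rho> gc])
  have fm: "f \<in> borel_measurable \<kappa>" if "\<kappa> \<in> M1 E" for \<kappa> using m by (simp add: M1_measurable[OF that])
  have "(\<lambda>m. \<integral>x. g m x \<partial>\<rho>) \<longlonglongrightarrow> (\<integral>x. f x \<partial>\<rho>)"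
  proof (rule integral_dominated_convergence[where w="\<lambda>_. 1"])
    show "AE x in \<rho>. (\<lambda>m. g m x) \<longlonglongrightarrow> f x" using lim M1_space[OF \<rho>] by auto
    show "AE x in \<rho>. norm (g m x) \<le> 1" for m
    proof (rule AE_I2)
      fix x assume "x \<in> space \<rho>"
      then have x: "x \<in> E" using M1_space[OF \<rho>] by simp
      show "norm (g m x) \<le> 1" using g0[OF x, of m] gf[OF x, of m] f01[OF x] by simp
    qed
  qed (use gm fm[OF \<rho>] in auto)
  then have "eventually (\<lambda>m. (\<integral>x. f x \<partial>\<rho>) - \<epsilon>/2 < (\<integral>x. g m x \<partial>\<rho>)) sequentially"
    using \<epsilon> by (intro order_tendstoD(1)) auto
  then obtain m where mm: "(\<integral>x. f x \<partial>\<rho>) - \<epsilon>/2 < (\<integral>x. g m x \<partial>\<rho>)" by (auto simp: eventually_sequentially)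
  \<comment> \<open>\<open>g m\<close> is bounded by 1 with Lipschitz constant m, so division by 1 +
    m brings it into the unit ball \<open>BL\<close>.\<close>
  define k where "k = 1 + real m"
  have k: "k > 0" by (simp add: k_def)
  have h: "(\<lambda>x. g m x / k) \<in> BL E \<delta>"
  proof (rule BL_I[of _ "1/k" "real m / k"])
    fix x assume x: "x \<in> E"
    show "\<bar>g m x / k\<bar> \<le> 1/k" using g0[OF x, of m] gf[OF x, of m] f01[OF x] k by (simp add: divide_right_mono)
  next
    fix x y assume xy: "x \<in> E" "y \<in> E"
    have "\<bar>g m x / k - g m y / k\<bar> = \<bar>g m x - g m y\<bar> / k" using k by (simp flip: diff_divide_distrib)
    also have "\<dots> \<le> real m * \<delta> x y / k" using glip[OF xy] k by (intro divide_right_mono) auto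
    finally show "\<bar>g m x / k - g m y / k\<bar> \<le> real m / k * \<delta> x y" by simp
  next
    show "1/k + real m/k \<le> 1" using k by (simp add: k_def field_simps)
  qed (use k in auto)
  show ?thesis
  proof (intro exI[of _ "\<epsilon> / (2 * k)"] conjI ballI impI)
    show "0 < \<epsilon> / (2 * k)" using \<epsilon> k by simp
    fix \<gamma> assume \<gamma>: "\<gamma> \<in> M1 E" and b: "\<beta>_BL E \<delta> \<gamma> \<rho> < \<epsilon> / (2 * k)"
    interpret G: prob_space \<gamma> by (rule M1_prob[OF \<gamma>])
    have "\<bar>(\<integral>x. g m x / k \<partial>\<gamma>) - (\<integral>x. g m x / k \<partial>\<rho>)\<bar> < \<epsilon> / (2 * k)"
      using \<beta>_BL_ge[OF \<gamma> \<rho> h] b by linarith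
    then have "\<bar>(\<integral>x. g m x \<partial>\<gamma>) - (\<integral>x. g m x \<partial>\<rho>)\<bar> / k < \<epsilon> / (2 * k)"
      using k by (simp flip: diff_divide_distrib)
    then have "\<bar>(\<integral>x. g m x \<partial>\<gamma>) - (\<integral>x. g m x \<partial>\<rho>)\<bar> < \<epsilon> / 2" using k by (simp add: field_simps)
    moreover have "(\<integral>x. g m x \<partial>\<gamma>) \<le> (\<integral>x. f x \<partial>\<gamma>)"
    proof (rule integral_mono)
      show "integrable \<gamma> (g m)"
      proof (rule M1_bounded_integrable[OF \<gamma> M1_continuous_measurable[OF \<gamma> gc]])
        fix x assume x: "x \<in> E"
        show "\<bar>g m x\<bar> \<le> 1" using g0[OF x, of m] gf[OF x, of m] f01[OF x] by simp
      qed
      show "integrable \<gamma> f" using fm[OF \<gamma>] f01 by (intro M1_bounded_integrable[OF \<gamma>, of _ 1]) auto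
    qed (use gf M1_space[OF \<gamma>] in auto)
    ultimately show "(\<integral>x. f x \<partial>\<rho>) - \<epsilon> < (\<integral>x. f x \<partial>\<gamma>)" using mm by linarith
  qed
qed

text \<open>Two-sided control from the one-sided \<open>lsc_integral\<close>, applied to f and to -f
  after the affine rescaling (f + C) / (2 C) into [0, 1].\<close>

lemma continuous_integral_\<beta>_BL:
  fixes f :: "'a \<Rightarrow> real"
  assumes c: "continuous_on E f" and b: "bounded (f ` E)" and \<rho>: "\<rho> \<in> M1 E" and \<epsilon>: "\<epsilon> > 0"
  shows "\<exists>\<eta>>0. \<forall>\<gamma>\<in>M1 E. \<beta>_BL E \<delta> \<gamma> \<rho> < \<eta> \<longrightarrow> \<bar>(\<integral>x. f x \<partial>\<gamma>) - (\<integral>x. f x \<partial>\<rho>)\<bar> < \<epsilon>"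
proof -
  obtain C where C: "C > 0" "\<And>x. x \<in> E \<Longrightarrow> \<bar>f x\<bar> \<le> C"
    using b unfolding bounded_pos by (auto simp: image_iff)
  have one: "\<exists>\<eta>>0. \<forall>\<gamma>\<in>M1 E. \<beta>_BL E \<delta> \<gamma> \<rho> < \<eta> \<longrightarrow> (\<integral>x. g x \<partial>\<rho>) - \<epsilon> < (\<integral>x. g x \<partial>\<gamma>)"
    if g: "continuous_on E g" "\<And>x. x \<in> E \<Longrightarrow> \<bar>g x\<bar> \<le> C" for g :: "'a \<Rightarrow> real"
  proof -
    define h where "h x = (g x + C) / (2 * C)" for x
    have hc: "continuous_on E h" unfolding h_def using C by (intro continuous_intros g) auto
    have h01: "0 \<le> h x \<and> h x \<le> 1" if "x \<in> E" for x using g(2)[OF that] C by (auto simp: h_def field_simps)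
    have "\<exists>\<eta>>0. \<forall>\<gamma>\<in>M1 E. \<beta>_BL E \<delta> \<gamma> \<rho> < \<eta> \<longrightarrow> (\<integral>x. h x \<partial>\<rho>) - \<epsilon> / (2 * C) < (\<integral>x. h x \<partial>\<gamma>)"
    proof (rule lsc_integral[OF _ h01 _ \<rho>])
      show "h \<in> borel_measurable (borel_on E)" using hc by (rule borel_measurable_continuous_on_restrict)
      fix x e assume x: "x \<in> E" "(e::real) > 0"
      obtain r where "r > 0" "\<forall>y\<in>E. \<delta> x y < r \<longrightarrow> \<bar>h y - h x\<bar> < e" using continuous_at_ball[OF hc x] by blast
      then show "\<exists>r>0. \<forall>y\<in>E. \<delta> x y < r \<longrightarrow> h x - e < h y" by (intro exI[of _ r]) force
    qed (use \<epsilon> C in auto)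
    then obtain \<eta> where \<eta>: "\<eta> > 0" "\<forall>\<gamma>\<in>M1 E. \<beta>_BL E \<delta> \<gamma> \<rho> < \<eta> \<longrightarrow> (\<integral>x. h x \<partial>\<rho>) - \<epsilon> / (2 * C) < (\<integral>x. h x \<partial>\<gamma>)" by blast
    have int: "(\<integral>x. h x \<partial>\<kappa>) = ((\<integral>x. g x \<partial>\<kappa>) + C) / (2 * C)" if "\<kappa> \<in> M1 E" for \<kappa>
    proof -
      interpret prob_space \<kappa> by (rule M1_prob[OF that])
      have "integrable \<kappa> g" using g by (intro M1_bounded_integrable[OF that, of _ C] M1_continuous_measurable[OF that])
      then show ?thesis unfolding h_def by (simp add: prob_space)
    qed
    have "(\<integral>x. g x \<partial>\<rho>) - \<epsilon> < (\<integral>x. g x \<partial>\<gamma>)" if "\<gamma> \<in> M1 E" "\<beta>_BL E \<delta> \<gamma> \<rho> < \<eta>" for \<gamma>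
    proof -
      have "((\<integral>x. g x \<partial>\<rho>) + C) / (2 * C) - \<epsilon> / (2 * C) < ((\<integral>x. g x \<partial>\<gamma>) + C) / (2 * C)"
        using \<eta>(2) that int[OF that(1)] int[OF \<rho>] by auto
      then have "((\<integral>x. g x \<partial>\<rho>) + C - \<epsilon>) / (2 * C) < ((\<integral>x. g x \<partial>\<gamma>) + C) / (2 * C)"
        by (simp add: diff_divide_distrib)
      then show ?thesis using C by (simp add: divide_less_cancel)
    qed
    then show ?thesis using \<eta>(1) by blast
  qed
  obtain \<eta>1 where \<eta>1: "\<eta>1 > 0" "\<forall>\<gamma>\<in>M1 E. \<beta>_BL E \<delta> \<gamma> \<rho> < \<eta>1 \<longrightarrow> (\<integral>x. f x \<partial>\<rho>) - \<epsilon> < (\<integral>x. f x \<partial>\<gamma>)"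
    using one[OF c C(2)] by blast
  have c': "continuous_on E (\<lambda>x. - f x)" using c by (intro continuous_intros)
  obtain \<eta>2 where \<eta>2: "\<eta>2 > 0" "\<forall>\<gamma>\<in>M1 E. \<beta>_BL E \<delta> \<gamma> \<rho> < \<eta>2 \<longrightarrow> (\<integral>x. - f x \<partial>\<rho>) - \<epsilon> < (\<integral>x. - f x \<partial>\<gamma>)"
    using one[OF c'] C(2) by auto
  have "\<bar>(\<integral>x. f x \<partial>\<gamma>) - (\<integral>x. f x \<partial>\<rho>)\<bar> < \<epsilon>" if "\<gamma> \<in> M1 E" "\<beta>_BL E \<delta> \<gamma> \<rho> < min \<eta>1 \<eta>2" for \<gamma>
    using \<eta>1(2)[rule_format, OF that(1)] \<eta>2(2)[rule_format, OF that(1)] that(2) by simp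
  then show ?thesis using \<eta>1(1) \<eta>2(1) by (intro exI[of _ "min \<eta>1 \<eta>2"]) auto
qed

text \<open>The indicator of an open set is lower semicontinuous: the portmanteau inequality with an
  explicit neighbourhood.\<close>

lemma measure_open_lsc:
  assumes U: "open U" and \<rho>: "\<rho> \<in> M1 E" and \<epsilon>: "\<epsilon> > 0"
  shows "\<exists>\<eta>>0. \<forall>\<gamma>\<in>M1 E. \<beta>_BL E \<delta> \<gamma> \<rho> < \<eta> \<longrightarrow> measure \<rho> (E \<inter> U) - \<epsilon> < measure \<gamma> (E \<inter> U)"
proof -
  have i: "(\<integral>x. indicator (E \<inter> U) x \<partial>\<kappa>) = measure \<kappa> (E \<inter> U)" if "\<kappa> \<in> M1 E" for \<kappa>
    using M1_space[OF that] by (simp add: Int_absorb2)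
  have "\<exists>\<eta>>0. \<forall>\<gamma>\<in>M1 E. \<beta>_BL E \<delta> \<gamma> \<rho> < \<eta> \<longrightarrow> (\<integral>x. indicator (E \<inter> U) x \<partial>\<rho>) - \<epsilon> < (\<integral>x. indicator (E \<inter> U) x \<partial>\<gamma>)"
  proof (rule lsc_integral[OF _ _ _ \<rho> \<epsilon>])
    show "indicator (E \<inter> U) \<in> borel_measurable (borel_on E)"
      using U by (intro borel_measurable_indicator) (auto simp: sets_restrict_space)
    fix x e assume x: "x \<in> E" "(e::real) > 0"
    show "\<exists>r>0. \<forall>y\<in>E. \<delta> x y < r \<longrightarrow> indicator (E \<inter> U) x - e < (indicator (E \<inter> U) y :: real)"
    proof (cases "x \<in> U")
      case True
      then obtain r where "r > 0" "\<forall>y\<in>E. \<delta> x y < r \<longrightarrow> y \<in> U" using open_ball_in[OF U x(1)] by blast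
      then show ?thesis using x by (intro exI[of _ r]) (auto simp: indicator_def)
    next
      case False
      then show ?thesis using x by (intro exI[of _ 1]) (auto simp: indicator_def)
    qed
  qed (auto simp: indicator_def)
  then show ?thesis using i \<rho> by simp
qed

text \<open>At distance 0 each measure dominates the other on open sets, by
  \<open>measure_open_lsc\<close>, and open sets determine the measure.\<close>

lemma \<beta>_BL_zero_imp_eq:
  assumes "\<rho> \<in> M1 E" "\<gamma> \<in> M1 E" "\<beta>_BL E \<delta> \<rho> \<gamma> = 0"
  shows "\<rho> = \<gamma>"
proof (rule M1_eqI_open[OF assms(1,2)])
  fix U :: "'a set" assume U: "open U"
  have "measure \<kappa> (E \<inter> U) \<le> measure \<kappa>' (E \<inter> U)" if k: "\<kappa> \<in> M1 E" "\<kappa>' \<in> M1 E" "\<beta>_BL E \<delta> \<kappa>' \<kappa> = 0" for \<kappa> \<kappa>'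
  proof (rule field_le_epsilon)
    fix e :: real assume "e > 0"
    then obtain \<eta> where "\<eta> > 0" "\<forall>\<gamma>\<in>M1 E. \<beta>_BL E \<delta> \<gamma> \<kappa> < \<eta> \<longrightarrow> measure \<kappa> (E \<inter> U) - e < measure \<gamma> (E \<inter> U)"
      using measure_open_lsc[OF U k(1)] by blast
    then have "measure \<kappa> (E \<inter> U) - e < measure \<kappa>' (E \<inter> U)" using k by auto
    then show "measure \<kappa> (E \<inter> U) \<le> measure \<kappa>' (E \<inter> U) + e" by simp
  qed
  then show "measure \<rho> (E \<inter> U) = measure \<gamma> (E \<inter> U)"
    using assms \<beta>_BL_commute[of \<rho> \<gamma>] by (intro antisym) auto
qed

lemma \<beta>_BL_triangle:
  assumes "\<rho> \<in> M1 E" "\<gamma> \<in> M1 E" "\<kappa> \<in> M1 E"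
  shows "\<beta>_BL E \<delta> \<rho> \<kappa> \<le> \<beta>_BL E \<delta> \<rho> \<gamma> + \<beta>_BL E \<delta> \<gamma> \<kappa>"
proof (rule \<beta>_BL_le)
  fix f assume "f \<in> BL E \<delta>"
  then show "\<bar>(\<integral>x. f x \<partial>\<rho>) - (\<integral>x. f x \<partial>\<kappa>)\<bar> \<le> \<beta>_BL E \<delta> \<rho> \<gamma> + \<beta>_BL E \<delta> \<gamma> \<kappa>"
    using \<beta>_BL_ge[OF assms(1,2)] \<beta>_BL_ge[OF assms(2,3)] by fastforce
qed (simp add: \<beta>_BL_nonneg)

end

section \<open>The spaces of measures\<close>

abbreviation halfspace :: "(real \<times> 's::topological_space) set" where "halfspace \<equiv> {0..} \<times> UNIV"

lemma marg_measurable: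
  "fst \<in> measurable (borel_on (halfspace :: (real \<times> 's::topological_space) set)) (borel_on {0..})"
  "snd \<in> measurable (borel_on (halfspace :: (real \<times> 's::topological_space) set)) borel"
  "snd \<in> measurable (borel_on (halfspace :: (real \<times> 's::topological_space) set)) (borel_on UNIV)"
proof -
  show "fst \<in> measurable (borel_on (halfspace :: (real \<times> 's) set)) (borel_on {0..})"
    by (intro continuous_measurable_borel_on continuous_intros) auto
  show "snd \<in> measurable (borel_on (halfspace :: (real \<times> 's) set)) borel"
    by (intro borel_measurable_continuous_on_restrict continuous_intros)
  show "snd \<in> measurable (borel_on (halfspace :: (real \<times> 's) set)) (borel_on UNIV)"
    by (intro continuous_measurable_borel_on continuous_intros) auto
qed

lemma marg2_alt: "marg2 \<rho> = distr \<rho> (borel_on UNIV) snd"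
  unfolding marg2_def by (intro distr_cong) auto

lemma marg1_M1: "\<rho> \<in> M1 halfspace \<Longrightarrow> marg1 \<rho> \<in> M1 {0..}"
  unfolding marg1_def using marg_measurable(1) by (intro distr_in_M1 M1_prob) (auto simp: M1_measurable)

lemma marg2_M1: "\<rho> \<in> M1 halfspace \<Longrightarrow> marg2 \<rho> \<in> M1 UNIV"
  unfolding marg2_alt using marg_measurable(3) by (intro distr_in_M1 M1_prob) (auto simp: M1_measurable)

lemma M11_prod_D:
  assumes "\<rho> \<in> M11_prod"
  shows "\<rho> \<in> M1 halfspace" "marg1 \<rho> \<in> M11" "marg2 \<rho> \<in> M1 UNIV"
  using assms marg1_M1[of \<rho>] marg2_M1[of \<rho>] by (auto simp: M11_prod_def M11_def)

lemma M11_prodI: "\<rho> \<in> M1 halfspace \<Longrightarrow> marg1 \<rho> \<in> M11 \<Longrightarrow> \<rho> \<in> M11_prod"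
  by (auto simp: M11_prod_def M11_def)

lemma Metric_space_\<Delta>:
  assumes "compatible_metric (halfspace :: (real \<times> 's::topological_space) set) \<delta>"
  shows "Metric_space M11_prod (\<Delta> \<delta>)"
proof -
  interpret compat "halfspace :: (real \<times> 's) set" \<delta> by unfold_locales (rule assms)
  interpret W: Metric_space M11 W1 by (rule Metric_space_W1)
  show ?thesis
  proof
    fix \<rho> \<gamma> :: "(real \<times> 's) measure"
    show "0 \<le> \<Delta> \<delta> \<rho> \<gamma>" by (simp add: \<Delta>_def W1_nonneg \<beta>_BL_nonneg)
    show "\<Delta> \<delta> \<rho> \<gamma> = \<Delta> \<delta> \<gamma> \<rho>"
      unfolding \<Delta>_def using W1_commute[of "marg1 \<rho>" "marg1 \<gamma>"] \<beta>_BL_commute[of \<rho> \<gamma>] by simp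
  next
    fix \<rho> \<gamma> :: "(real \<times> 's) measure" assume a: "\<rho> \<in> M11_prod" "\<gamma> \<in> M11_prod"
    show "\<Delta> \<delta> \<rho> \<gamma> = 0 \<longleftrightarrow> \<rho> = \<gamma>"
    proof
      assume "\<Delta> \<delta> \<rho> \<gamma> = 0"
      then have "\<beta>_BL halfspace \<delta> \<rho> \<gamma> = 0"
        unfolding \<Delta>_def using W1_nonneg[of "marg1 \<rho>" "marg1 \<gamma>"] \<beta>_BL_nonneg[of \<rho> \<gamma>] by linarith
      then show "\<rho> = \<gamma>" using \<beta>_BL_zero_imp_eq a M11_prod_D by blast
    next
      assume e: "\<rho> = \<gamma>"
      have "\<beta>_BL halfspace \<delta> \<gamma> \<gamma> \<le> 0" by (rule \<beta>_BL_le) auto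
      then show "\<Delta> \<delta> \<rho> \<gamma> = 0"
        unfolding \<Delta>_def e using \<beta>_BL_nonneg[of \<gamma> \<gamma>] W.mdist_zero[OF M11_prod_D(2)[OF a(2)]] by simp
    qed
  next
    fix \<rho> \<gamma> \<kappa> :: "(real \<times> 's) measure" assume a: "\<rho> \<in> M11_prod" "\<gamma> \<in> M11_prod" "\<kappa> \<in> M11_prod"
    show "\<Delta> \<delta> \<rho> \<kappa> \<le> \<Delta> \<delta> \<rho> \<gamma> + \<Delta> \<delta> \<gamma> \<kappa>"
      unfolding \<Delta>_def
      using \<beta>_BL_triangle[OF a[THEN M11_prod_D(1)]] W.triangle[OF a[THEN M11_prod_D(2)]] by simp
  qed
qed

lemma topspace_W1: "topspace topology_W1 = M11"
  unfolding topology_W1_def by (rule Metric_space.topspace_mtopology[OF Metric_space_W1])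

lemma openin_weak_topology:
  fixes f :: "'a::topological_space \<Rightarrow> real"
  assumes "continuous_on E f" "bounded (f ` E)" "open U"
  shows "openin (weak_topology E) {\<rho> \<in> M1 E. (\<integral>x. f x \<partial>\<rho>) \<in> U}"
  unfolding weak_topology_def using assms by (intro topology_generated_by_Basis) blast

text \<open>The marginal upper bounds hold for closed sets, whereas localisation produces open
  neighbourhoods; a closed set in between joins the two. The induction follows the generation of
  open sets, and for a subbasic set a ball of values of the integral sits inside a closed
  ball.\<close>

lemma weak_topology_regular:
  fixes E :: "'a::topological_space set"
  assumes "openin (weak_topology E) U" "\<nu> \<in> U"
  shows "\<exists>V C. openin (weak_topology E) V \<and> closedin (weak_topology E) C \<and> \<nu> \<in> V \<and> V \<subseteq> C \<and> C \<subseteq> U"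
proof -
  have "generate_topology_on {{\<rho> \<in> M1 E. (\<integral>x. f x \<partial>\<rho>) \<in> U} | (f :: 'a \<Rightarrow> real) U.
      continuous_on E f \<and> bounded (f ` E) \<and> open U} U"
    using assms(1) unfolding weak_topology_def openin_topology_generated_by_iff .
  then show ?thesis using assms(2)
proof (induction U arbitrary: \<nu> rule: generate_topology_on.induct)
  case Empty
  then show ?case by simp
next
  case (Int a b)
  from Int.IH(1)[of \<nu>] Int.IH(2)[of \<nu>] Int.prems obtain V C V' C' where
    "openin (weak_topology E) V \<and> closedin (weak_topology E) C \<and> \<nu> \<in> V \<and> V \<subseteq> C \<and> C \<subseteq> a"
    "openin (weak_topology E) V' \<and> closedin (weak_topology E) C' \<and> \<nu> \<in> V' \<and> V' \<subseteq> C' \<and> C' \<subseteq> b" by blast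
  then show ?case by (intro exI[of _ "V \<inter> V'"] exI[of _ "C \<inter> C'"]) auto
next
  case (UN K)
  then obtain k where "k \<in> K" "\<nu> \<in> k" by blast
  from UN.IH[OF this] \<open>k \<in> K\<close> show ?case by blast
next
  case (Basis s)
  then obtain f :: "'a \<Rightarrow> real" and U where s: "s = {\<rho> \<in> M1 E. (\<integral>x. f x \<partial>\<rho>) \<in> U}" "continuous_on E f" "bounded (f ` E)" "open U" by blast
  let ?c = "\<integral>x. f x \<partial>\<nu>"
  have "?c \<in> U" using Basis s by auto
  then obtain e where e: "e > 0" "cball ?c e \<subseteq> U" using s(4) open_contains_cball by blast
  let ?V = "{\<rho> \<in> M1 E. (\<integral>x. f x \<partial>\<rho>) \<in> ball ?c e}" and ?C = "{\<rho> \<in> M1 E. (\<integral>x. f x \<partial>\<rho>) \<in> cball ?c e}"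
  have "openin (weak_topology E) ?V" using s by (intro openin_weak_topology) auto
  moreover have "closedin (weak_topology E) ?C"
  proof -
    have "openin (weak_topology E) {\<rho> \<in> M1 E. (\<integral>x. f x \<partial>\<rho>) \<in> - cball ?c e}" using s by (intro openin_weak_topology) (auto simp: open_Compl)
    moreover have "{\<rho> \<in> M1 E. (\<integral>x. f x \<partial>\<rho>) \<in> - cball ?c e} = topspace (weak_topology E) - ?C"
      by (auto simp: topspace_weak_topology)
    ultimately show ?thesis by (auto simp: closedin_def topspace_weak_topology)
  qed
  moreover have "\<nu> \<in> ?V" using Basis s e by auto
  moreover have "?V \<subseteq> ?C" by auto
  moreover have "?C \<subseteq> s" using s e by auto
  ultimately show ?case by blast
qed
qed

lemma W1_topology_regular:
  assumes "openin topology_W1 U" "\<mu> \<in> U"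
  shows "\<exists>V C. openin topology_W1 V \<and> closedin topology_W1 C \<and> \<mu> \<in> V \<and> V \<subseteq> C \<and> C \<subseteq> U"
proof -
  interpret W: Metric_space M11 W1 by (rule Metric_space_W1)
  obtain r where r: "r > 0" "W.mball \<mu> r \<subseteq> U" using assms unfolding topology_W1_def W.openin_mtopology by blast
  have \<mu>: "\<mu> \<in> M11" using assms openin_subset[OF assms(1)] topspace_W1 by auto
  moreover have "W.mcball \<mu> (r/2) \<subseteq> U"
  proof
    fix \<gamma> assume "\<gamma> \<in> W.mcball \<mu> (r/2)"
    then have "\<mu> \<in> M11" "\<gamma> \<in> M11" "W1 \<mu> \<gamma> \<le> r/2" unfolding W.in_mcball by blast+
    then have "\<gamma> \<in> W.mball \<mu> r" using r(1) by (simp add: W.in_mball)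
    then show "\<gamma> \<in> U" using r(2) by blast
  qed
  moreover have "openin W.mtopology (W.mball \<mu> (r/2))" "closedin W.mtopology (W.mcball \<mu> (r/2))"
    by (rule W.openin_mball, rule W.closedin_mcball)
  moreover have "W.mball \<mu> (r/2) \<subseteq> W.mcball \<mu> (r/2)" by (rule W.mball_subset_mcball)
  moreover have "\<mu> \<in> W.mball \<mu> (r/2)" using \<mu> r(1) by (simp add: W.in_mball)
  ultimately show ?thesis unfolding topology_W1_def by blast
qed

lemma marg1_continuous:
  assumes "compatible_metric (halfspace :: (real \<times> 's::topological_space) set) \<delta>"
  shows "continuous_map (topology_\<Delta> \<delta>) topology_W1 (marg1 :: (real \<times> 's) measure \<Rightarrow> _)"
proof -
  interpret compat "halfspace :: (real \<times> 's) set" \<delta> by unfold_locales (rule assms)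
  interpret W: Metric_space M11 W1 by (rule Metric_space_W1)
  interpret D: Metric_space "M11_prod :: (real \<times> 's) measure set" "\<Delta> \<delta>" by (rule Metric_space_\<Delta>[OF assms])
  have "openin D.mtopology {\<rho> \<in> M11_prod. marg1 \<rho> \<in> U}" if U: "openin W.mtopology U" for U
    unfolding D.openin_mtopology
  proof (intro conjI allI impI)
    fix \<rho> :: "(real \<times> 's) measure" assume "\<rho> \<in> {\<rho> \<in> M11_prod. marg1 \<rho> \<in> U}"
    then have \<rho>: "\<rho> \<in> M11_prod" "marg1 \<rho> \<in> U" by auto
    obtain r where r: "r > 0" "W.mball (marg1 \<rho>) r \<subseteq> U" using U \<rho> unfolding W.openin_mtopology by blast
    have "D.mball \<rho> r \<subseteq> {\<rho> \<in> M11_prod. marg1 \<rho> \<in> U}"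
    proof
      fix \<gamma> assume "\<gamma> \<in> D.mball \<rho> r"
      then have g: "\<gamma> \<in> M11_prod" "\<Delta> \<delta> \<rho> \<gamma> < r" by (auto simp: D.in_mball)
      then have "W1 (marg1 \<rho>) (marg1 \<gamma>) < r" using \<beta>_BL_nonneg[of \<rho> \<gamma>] by (simp add: \<Delta>_def)
      then have "marg1 \<gamma> \<in> W.mball (marg1 \<rho>) r" using g \<rho> M11_prod_D(2) unfolding W.in_mball by blast
      then show "\<gamma> \<in> {\<rho> \<in> M11_prod. marg1 \<rho> \<in> U}" using g r by blast
    qed
    then show "\<exists>r>0. D.mball \<rho> r \<subseteq> {\<rho> \<in> M11_prod. marg1 \<rho> \<in> U}" using r by blast
  qed auto
  then show ?thesis unfolding continuous_map_def topology_\<Delta>_def topology_W1_def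
    using M11_prod_D(2) by auto
qed

text \<open>A bounded continuous function of the label is also one of the pair, so
  \<open>continuous_integral_\<beta>_BL\<close> handles each subbasic set.\<close>

lemma marg2_continuous:
  assumes "compatible_metric (halfspace :: (real \<times> 's::topological_space) set) \<delta>"
  shows "continuous_map (topology_\<Delta> \<delta>) (weak_topology UNIV) (marg2 :: (real \<times> 's) measure \<Rightarrow> _)"
proof -
  interpret compat "halfspace :: (real \<times> 's) set" \<delta> by unfold_locales (rule assms)
  interpret D: Metric_space "M11_prod :: (real \<times> 's) measure set" "\<Delta> \<delta>" by (rule Metric_space_\<Delta>[OF assms])
  show ?thesis unfolding weak_topology_def
  proof (rule continuous_on_generated_topo)
    fix S assume "S \<in> {{\<rho> \<in> M1 UNIV. integral\<^sup>L \<rho> f \<in> U} |(f :: 's \<Rightarrow> real) U. continuous_on UNIV f \<and> bounded (range f) \<and> open U}"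
    then obtain f :: "'s \<Rightarrow> real" and U where S: "S = {\<rho> \<in> M1 UNIV. (\<integral>x. f x \<partial>\<rho>) \<in> U}" "continuous_on UNIV f" "bounded (range f)" "open U" by blast
    have int: "(\<integral>x. f x \<partial>marg2 \<rho>) = (\<integral>z. f (snd z) \<partial>\<rho>)" if "\<rho> \<in> M11_prod" for \<rho> :: "(real \<times> 's) measure"
      unfolding marg2_def using marg_measurable(2) S(2) M11_prod_D(1)[OF that]
      by (intro integral_distr borel_measurable_continuous_onI) (auto simp: M1_measurable)
    have c: "continuous_on halfspace (\<lambda>z :: real \<times> 's. f (snd z))"
      by (rule continuous_on_compose2[OF S(2)]) (auto intro: continuous_intros)
    have b: "bounded ((\<lambda>z :: real \<times> 's. f (snd z)) ` halfspace)" by (rule bounded_subset[OF S(3)]) auto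
    have "openin (topology_\<Delta> \<delta>) {\<rho> \<in> M11_prod. marg2 \<rho> \<in> S}" unfolding topology_\<Delta>_def D.openin_mtopology
    proof (intro conjI allI impI)
      fix \<rho> :: "(real \<times> 's) measure" assume "\<rho> \<in> {\<rho> \<in> M11_prod. marg2 \<rho> \<in> S}"
      then have \<rho>: "\<rho> \<in> M11_prod" "(\<integral>z. f (snd z) \<partial>\<rho>) \<in> U" using S(1) int by auto
      obtain e where e: "e > 0" "ball (\<integral>z. f (snd z) \<partial>\<rho>) e \<subseteq> U" using \<rho>(2) S(4) open_contains_ball by blast
      obtain \<eta> where \<eta>: "\<eta> > 0" "\<forall>\<gamma>\<in>M1 halfspace. \<beta>_BL halfspace \<delta> \<gamma> \<rho> < \<eta> \<longrightarrow> \<bar>(\<integral>z. f (snd z) \<partial>\<gamma>) - (\<integral>z. f (snd z) \<partial>\<rho>)\<bar> < e"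
        using continuous_integral_\<beta>_BL[OF c b M11_prod_D(1)[OF \<rho>(1)] e(1)] by blast
      have "D.mball \<rho> \<eta> \<subseteq> {\<rho> \<in> M11_prod. marg2 \<rho> \<in> S}"
      proof
        fix \<gamma> assume "\<gamma> \<in> D.mball \<rho> \<eta>"
        then have g: "\<gamma> \<in> M11_prod" "\<Delta> \<delta> \<rho> \<gamma> < \<eta>" by (auto simp: D.in_mball)
        then have "\<beta>_BL halfspace \<delta> \<gamma> \<rho> < \<eta>" using W1_nonneg[of "marg1 \<rho>" "marg1 \<gamma>"] \<beta>_BL_commute[of \<rho> \<gamma>] by (simp add: \<Delta>_def)
        then have "(\<integral>z. f (snd z) \<partial>\<gamma>) \<in> ball (\<integral>z. f (snd z) \<partial>\<rho>) e"
          using \<eta>(2) M11_prod_D(1)[OF g(1)] by (auto simp: dist_real_def abs_minus_commute)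
        then show "\<gamma> \<in> {\<rho> \<in> M11_prod. marg2 \<rho> \<in> S}" using g(1) e(2) S(1) int M11_prod_D(3) by auto
      qed
      then show "\<exists>r>0. D.mball \<rho> r \<subseteq> {\<rho> \<in> M11_prod. marg2 \<rho> \<in> S}" using \<eta>(1) by blast
    qed auto
    moreover have "marg2 -` S \<inter> topspace (topology_\<Delta> \<delta>) = {\<rho> \<in> M11_prod. marg2 \<rho> \<in> S}"
      unfolding topology_\<Delta>_def by auto
    ultimately show "openin (topology_\<Delta> \<delta>) (marg2 -` S \<inter> topspace (topology_\<Delta> \<delta>))" by simp
  next
    show "marg2 ` topspace (topology_\<Delta> \<delta>) \<subseteq> \<Union> {{\<rho> \<in> M1 UNIV. integral\<^sup>L \<rho> f \<in> U} |(f :: 's \<Rightarrow> real) U. continuous_on UNIV f \<and> bounded (range f) \<and> open U}"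
    proof -
      have "marg2 ` topspace (topology_\<Delta> \<delta>) \<subseteq> topspace (weak_topology UNIV)"
        unfolding topspace_weak_topology topology_\<Delta>_def using M11_prod_D(3) by auto
      then show ?thesis unfolding weak_topology_def topology_generated_by_topspace by simp
    qed
  qed
qed

section \<open>Relative entropy and Young's inequality\<close>

lemma enn2ereal_le_iff_real: "0 \<le> c \<Longrightarrow> enn2ereal x \<le> ereal c \<longleftrightarrow> x \<le> ennreal c"
  by (metis enn2ereal_ennreal less_eq_ennreal.rep_eq)

locale prob_pair =
  R: prob_space \<rho> + T: prob_space \<tau> for \<rho> \<tau> :: "'a measure" +
  assumes sets_eq: "sets \<rho> = sets \<tau>"
begin

lemma space_eq: "space \<rho> = space \<tau>" using sets_eq by (rule sets_eq_imp_space_eq)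

lemma measurable_eq: "measurable \<rho> N = measurable \<tau> N"
  using sets_eq by (intro measurable_cong_sets) auto

text \<open>A real-valued density replaces the \<open>ennreal\<close>-valued derivative. The
  negative part of the entropy integral is at most 1 because g (- ln g) \<le> 1, so the difference
  in \<open>rel_entropy\<close> is never \<infinity> - \<infinity>.\<close>

lemma density_obtain:
  assumes ac: "absolutely_continuous \<tau> \<rho>"
  obtains g where "g \<in> borel_measurable \<tau>" "\<And>x. g x \<ge> 0" "AE x in \<rho>. g x > 0" "\<rho> = density \<tau> (\<lambda>x. ennreal (g x))"
    "rel_entropy \<rho> \<tau> = enn2ereal (\<integral>\<^sup>+x. ennreal (ln (g x)) \<partial>\<rho>) - enn2ereal (\<integral>\<^sup>+x. ennreal (- ln (g x)) \<partial>\<rho>)"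
    "(\<integral>\<^sup>+x. ennreal (- ln (g x)) \<partial>\<rho>) \<le> 1"
    "integrable \<tau> g" "(\<integral>x. g x \<partial>\<tau>) = 1"
proof -
  obtain g where g: "g \<in> borel_measurable \<tau>" "AE x in \<tau>. RN_deriv \<tau> \<rho> x = ennreal (g x)"
    "AE x in \<rho>. 0 < g x" "\<And>x. 0 \<le> g x"
    using T.real_RN_deriv[OF R.finite_measure_axioms ac sets_eq] by metis
  have d: "\<rho> = density \<tau> (\<lambda>x. ennreal (g x))"
    using T.density_RN_deriv[OF ac sets_eq] g by (metis density_cong borel_measurable_RN_deriv measurable_compose[OF g(1) measurable_ennreal])
  have ae: "AE x in \<rho>. RN_deriv \<tau> \<rho> x = ennreal (g x)"
    using absolutely_continuous_AE[OF sets_eq ac g(2)] .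
  have 1: "(\<integral>\<^sup>+x. ennreal (ln (enn2real (RN_deriv \<tau> \<rho> x))) \<partial>\<rho>) = (\<integral>\<^sup>+x. ennreal (ln (g x)) \<partial>\<rho>)"
    by (rule nn_integral_cong_AE) (use ae in eventually_elim, simp add: g(4))
  have 2: "(\<integral>\<^sup>+x. ennreal (- ln (enn2real (RN_deriv \<tau> \<rho> x))) \<partial>\<rho>) = (\<integral>\<^sup>+x. ennreal (- ln (g x)) \<partial>\<rho>)"
    by (rule nn_integral_cong_AE) (use ae in eventually_elim, simp add: g(4))
  have rel: "rel_entropy \<rho> \<tau> = enn2ereal (\<integral>\<^sup>+x. ennreal (ln (g x)) \<partial>\<rho>) - enn2ereal (\<integral>\<^sup>+x. ennreal (- ln (g x)) \<partial>\<rho>)"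
    unfolding rel_entropy_def 1 2 using ac by simp
  have lnm: "(\<lambda>x. ennreal (- ln (g x))) \<in> borel_measurable \<tau>" using g(1) by measurable
  have "(\<integral>\<^sup>+x. ennreal (- ln (g x)) \<partial>\<rho>) = (\<integral>\<^sup>+x. ennreal (g x) * ennreal (- ln (g x)) \<partial>\<tau>)"
    unfolding d using g(1) lnm by (subst nn_integral_density) auto
  also have "\<dots> \<le> (\<integral>\<^sup>+x. 1 \<partial>\<tau>)"
  proof (rule nn_integral_mono)
    fix x
    show "ennreal (g x) * ennreal (- ln (g x)) \<le> 1"
    proof (cases "g x = 0")
      case False
      then have gp: "g x > 0" using g(4)[of x] by simp
      have "ln (1 / g x) \<le> 1 / g x - 1" using gp by (intro ln_le_minus_one) auto
      then have "g x * (- ln (g x)) \<le> g x * (1 / g x)" using gp by (intro mult_left_mono) (auto simp: ln_div)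
      then have "g x * (- ln (g x)) \<le> 1" using gp by simp
      then have "ennreal (g x * (- ln (g x))) \<le> ennreal 1" by (rule ennreal_leI)
      then show ?thesis using gp by (simp only: ennreal_mult'[OF g(4), symmetric] ennreal_1)
    qed simp
  qed
  also have "\<dots> = 1" by (simp add: T.emeasure_space_1)
  finally have neg: "(\<integral>\<^sup>+x. ennreal (- ln (g x)) \<partial>\<rho>) \<le> 1" .
  have "(\<integral>\<^sup>+x. ennreal (g x) \<partial>\<tau>) = emeasure \<rho> (space \<rho>)"
    using g(1) space_eq by (subst d) (simp add: emeasure_density cong: nn_integral_cong)
  also have "\<dots> = 1" by (rule R.emeasure_space_1)
  finally have n1: "(\<integral>\<^sup>+x. ennreal (g x) \<partial>\<tau>) = 1" .
  then have "integrable \<tau> g" using g by (intro integrableI_nonneg) auto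
  moreover have "(\<integral>x. g x \<partial>\<tau>) = 1" using n1 g by (simp add: integral_eq_nn_integral)
  ultimately show ?thesis using that g d rel neg by blast
qed

text \<open>Donsker--Varadhan, in linearised form.\<close>

lemma young_le_rel_entropy:
  assumes f: "f \<in> borel_measurable \<tau>" and C: "\<And>x. x \<in> space \<tau> \<Longrightarrow> \<bar>f x\<bar> \<le> C"
  shows "ereal ((\<integral>x. f x \<partial>\<rho>) - (\<integral>x. exp (f x) \<partial>\<tau>) + 1) \<le> rel_entropy \<rho> \<tau>"
proof (cases "absolutely_continuous \<tau> \<rho>")
  case False
  then show ?thesis by (simp add: rel_entropy_def)
next
  case True
  then obtain g where g: "g \<in> borel_measurable \<tau>" "\<And>x. g x \<ge> 0" "AE x in \<rho>. g x > 0" "\<rho> = density \<tau> (\<lambda>x. ennreal (g x))"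
    "rel_entropy \<rho> \<tau> = enn2ereal (\<integral>\<^sup>+x. ennreal (ln (g x)) \<partial>\<rho>) - enn2ereal (\<integral>\<^sup>+x. ennreal (- ln (g x)) \<partial>\<rho>)"
    "(\<integral>\<^sup>+x. ennreal (- ln (g x)) \<partial>\<rho>) \<le> 1"
    "integrable \<tau> g" "(\<integral>x. g x \<partial>\<tau>) = 1"
    using density_obtain by metis
  show ?thesis
  proof (cases "(\<integral>\<^sup>+x. ennreal (ln (g x)) \<partial>\<rho>) = \<infinity>")
    case True
    have "enn2ereal (\<integral>\<^sup>+x. ennreal (- ln (g x)) \<partial>\<rho>) \<le> ereal 1" using g(6) by (simp add: enn2ereal_le_iff_real)
    then have "enn2ereal (\<integral>\<^sup>+x. ennreal (- ln (g x)) \<partial>\<rho>) \<noteq> \<infinity>" by auto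
    then have "rel_entropy \<rho> \<tau> = \<infinity>" unfolding g(5) True
      by (cases "enn2ereal (\<integral>\<^sup>+x. ennreal (- ln (g x)) \<partial>\<rho>)") auto
    then show ?thesis by simp
  next
    case False
    have gr: "g \<in> borel_measurable \<rho>" "f \<in> borel_measurable \<rho>" using g(1) f measurable_eq by auto
    have lnm: "(\<lambda>x. ln (g x)) \<in> borel_measurable \<rho>" using gr by measurable
    have ilp: "integrable \<rho> (\<lambda>x. max 0 (ln (g x)))" "integrable \<rho> (\<lambda>x. max 0 (- ln (g x)))"
    proof -
      have mx: "(\<integral>\<^sup>+x. ennreal (max 0 (h x)) \<partial>\<rho>) = (\<integral>\<^sup>+x. ennreal (h x) \<partial>\<rho>)" for h :: "'a \<Rightarrow> real"
        by (intro nn_integral_cong) (auto simp: max_def ennreal_neg)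
      show "integrable \<rho> (\<lambda>x. max 0 (ln (g x)))"
        using False lnm by (intro integrableI_nonneg) (auto simp: mx less_top)
      show "integrable \<rho> (\<lambda>x. max 0 (- ln (g x)))"
        using order_le_less_trans[OF g(6) ennreal_one_less_top] lnm by (intro integrableI_nonneg) (auto simp: mx)
    qed
    have il: "integrable \<rho> (\<lambda>x. ln (g x))"
    proof -
      have "integrable \<rho> (\<lambda>x. max 0 (ln (g x)) - max 0 (- ln (g x)))" using ilp by (rule Bochner_Integration.integrable_diff)
      moreover have "(\<lambda>x. max 0 (ln (g x)) - max 0 (- ln (g x))) = (\<lambda>x. ln (g x))" by (auto simp: max_def)
      ultimately show ?thesis by simp
    qed
    have "(\<integral>x. ln (g x) \<partial>\<rho>) = enn2real (\<integral>\<^sup>+x. ennreal (ln (g x)) \<partial>\<rho>) - enn2real (\<integral>\<^sup>+x. ennreal (- ln (g x)) \<partial>\<rho>)"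
      using il by (rule real_lebesgue_integral_def)
    moreover have "enn2ereal u = ereal (enn2real u)" if "u \<noteq> \<infinity>" for u
      using that by (cases u) auto
    moreover have "(\<integral>\<^sup>+x. ennreal (- ln (g x)) \<partial>\<rho>) \<noteq> \<infinity>" using g(6) by (auto simp: top_unique)
    ultimately have rel: "rel_entropy \<rho> \<tau> = ereal (\<integral>x. ln (g x) \<partial>\<rho>)" unfolding g(5) using False by simp
    have C': "\<bar>f x\<bar> \<le> C" if "x \<in> space \<rho>" for x using C that space_eq by simp
    have if': "integrable \<rho> f" using gr C' by (intro R.integrable_const_bound[of _ C]) auto
    have ie: "integrable \<tau> (\<lambda>x. exp (f x))" using f C
      by (intro T.integrable_const_bound[of _ "exp C"]) (auto simp: abs_le_iff)
    \<comment> \<open>Young's inequality pointwise: ln t \<le> t - 1 at t = exp f / g.\<close>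
    have pos: "AE x in \<rho>. f x + 1 - exp (f x) / g x \<le> ln (g x)"
      using g(3)
    proof eventually_elim
      case (elim x)
      have "ln (exp (f x) / g x) \<le> exp (f x) / g x - 1" using elim by (intro ln_le_minus_one) auto
      then show ?case using elim by (simp add: ln_div)
    qed
    have eg: "(\<lambda>x. g x * (exp (f x) / g x)) \<in> borel_measurable \<tau>" using g(1) f by measurable
    \<comment> \<open>Only an inequality: where g vanishes, division by zero makes the left side
      0.\<close>
    have le: "g x * (exp (f x) / g x) \<le> exp (f x)" "0 \<le> g x * (exp (f x) / g x)" for x using g(2)[of x] by auto
    have i1: "integrable \<tau> (\<lambda>x. g x * (exp (f x) / g x))"
      by (rule Bochner_Integration.integrable_bound[OF ie eg]) (use le in auto)
    have dm: "(\<lambda>x. exp (f x) / g x) \<in> borel_measurable \<tau>" using g(1) f by measurable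
    have i2: "integrable \<rho> (\<lambda>x. exp (f x) / g x)"
      using i1 dm g(1,2) by (subst g(4)) (subst integrable_density, auto)
    have e2: "(\<integral>x. exp (f x) / g x \<partial>\<rho>) = (\<integral>x. g x * (exp (f x) / g x) \<partial>\<tau>)"
      using dm g(1,2) by (subst g(4)) (subst integral_density, auto)
    have "(\<integral>x. g x * (exp (f x) / g x) \<partial>\<tau>) \<le> (\<integral>x. exp (f x) \<partial>\<tau>)"
      using i1 ie le by (intro integral_mono) auto
    moreover have "(\<integral>x. f x + 1 - exp (f x) / g x \<partial>\<rho>) \<le> (\<integral>x. ln (g x) \<partial>\<rho>)"
      using if' i2 il pos by (intro integral_mono_AE) auto
    moreover have "(\<integral>x. f x + 1 - exp (f x) / g x \<partial>\<rho>) = (\<integral>x. f x \<partial>\<rho>) + 1 - (\<integral>x. exp (f x) / g x \<partial>\<rho>)"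
      using if' i2 by (simp add: R.prob_space)
    ultimately show ?thesis unfolding rel using e2 by simp
  qed
qed

text \<open>The optimal test function ln g may be unbounded, so its truncations are inserted.
  Truncation from below raises the exponential integral by at most 1 / (m + 1), and Fatou's lemma on
  the positive parts removes the truncation.\<close>

lemma rel_entropy_le_of_young:
  assumes ac: "absolutely_continuous \<tau> \<rho>"
    and Y: "\<And>f C. f \<in> borel_measurable \<tau> \<Longrightarrow> (\<And>x. \<bar>f x\<bar> \<le> C) \<Longrightarrow> (\<integral>x. f x \<partial>\<rho>) - (\<integral>x. exp (f x) \<partial>\<tau>) + 1 \<le> \<alpha>"
  shows "rel_entropy \<rho> \<tau> \<le> ereal \<alpha>"
proof -
  obtain g where g: "g \<in> borel_measurable \<tau>" "\<And>x. g x \<ge> 0" "AE x in \<rho>. g x > 0" "\<rho> = density \<tau> (\<lambda>x. ennreal (g x))"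
    "rel_entropy \<rho> \<tau> = enn2ereal (\<integral>\<^sup>+x. ennreal (ln (g x)) \<partial>\<rho>) - enn2ereal (\<integral>\<^sup>+x. ennreal (- ln (g x)) \<partial>\<rho>)"
    "(\<integral>\<^sup>+x. ennreal (- ln (g x)) \<partial>\<rho>) \<le> 1"
    "integrable \<tau> g" "(\<integral>x. g x \<partial>\<tau>) = 1"
    using density_obtain[OF ac] by metis
  define N where "N = enn2real (\<integral>\<^sup>+x. ennreal (- ln (g x)) \<partial>\<rho>)"
  have Ne: "(\<integral>\<^sup>+x. ennreal (- ln (g x)) \<partial>\<rho>) = ennreal N" "N \<ge> 0"
    using ennreal_enn2real[OF order_le_less_trans[OF g(6) ennreal_one_less_top]] by (simp_all add: N_def)
  define u where "u m x = max (1 / (real m + 1)) (min (g x) (real m + 1))" for m x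
  have u: "u m x > 0" "1 / (real m + 1) \<le> u m x" "u m x \<le> real m + 1" "u m x \<le> g x + 1 / (real m + 1)" for m x
  proof -
    have aux: "max a (min y b) > 0 \<and> a \<le> max a (min y b) \<and> max a (min y b) \<le> b \<and> max a (min y b) \<le> y + a"
      if "a > 0" "a \<le> b" "y \<ge> 0" for a b y :: real
      using that by (auto simp: max_def min_def)
    have "1 / (real m + 1) > 0" by simp
    moreover have "1 / (real m + 1) \<le> real m + 1" by (simp add: divide_le_eq) (simp add: algebra_simps)
    ultimately show "u m x > 0" "1 / (real m + 1) \<le> u m x" "u m x \<le> real m + 1" "u m x \<le> g x + 1 / (real m + 1)"
      using aux[of "1 / (real m + 1)" "real m + 1" "g x"] g(2)[of x] unfolding u_def by auto
  qed
  have um: "u m \<in> borel_measurable \<tau>" for m unfolding u_def using g(1) by measurable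
  define f where "f m x = ln (u m x)" for m x
  have fm: "f m \<in> borel_measurable \<tau>" for m unfolding f_def using um by measurable
  have fb: "\<bar>f m x\<bar> \<le> ln (real m + 1)" for m x
  proof -
    have "ln (1 / (real m + 1)) \<le> f m x" unfolding f_def using u(1,2)[of m x] by (intro ln_mono) auto
    moreover have "f m x \<le> ln (real m + 1)" unfolding f_def using u(1,3)[of m x] by (intro ln_mono) auto
    ultimately show ?thesis by (simp add: ln_div abs_le_iff)
  qed
  have fmr: "f m \<in> borel_measurable \<rho>" for m unfolding measurable_eq by (rule fm)
  have bound: "(\<integral>\<^sup>+x. ennreal (f m x) \<partial>\<rho>) \<le> ennreal (\<alpha> + 1 / (real m + 1) + N)" for m
  proof -
    have ip: "integrable \<rho> (\<lambda>x. max 0 (f m x))" and iq: "integrable \<rho> (\<lambda>x. max 0 (- f m x))" and i0: "integrable \<rho> (f m)"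
      using fmr fb[of m] by (auto intro!: R.integrable_const_bound[of _ "ln (real m + 1)"] simp: abs_le_iff max_def)
    have "(\<integral>x. exp (f m x) \<partial>\<tau>) = (\<integral>x. u m x \<partial>\<tau>)" using u(1) by (simp add: f_def)
    also have "\<dots> \<le> (\<integral>x. g x + 1 / (real m + 1) \<partial>\<tau>)"
    proof (rule integral_mono)
      show "integrable \<tau> (u m)" using um[of m] u(3)[of m] by (intro T.integrable_const_bound[of _ "real m + 1"]) (auto simp: abs_of_pos[OF u(1)])
    qed (use g(7) u in auto)
    also have "\<dots> = 1 + 1 / (real m + 1)" using g(7,8) by (simp add: T.prob_space)
    finally have "(\<integral>x. f m x \<partial>\<rho>) \<le> \<alpha> + 1 / (real m + 1)" using Y[OF fm fb, of m] by linarith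
    moreover have "(\<integral>x. f m x \<partial>\<rho>) = (\<integral>x. max 0 (f m x) - max 0 (- f m x) \<partial>\<rho>)"
      by (intro Bochner_Integration.integral_cong) (auto simp: max_def)
    moreover have "\<dots> = (\<integral>x. max 0 (f m x) \<partial>\<rho>) - (\<integral>x. max 0 (- f m x) \<partial>\<rho>)" using ip iq by simp
    moreover have "(\<integral>x. max 0 (- f m x) \<partial>\<rho>) \<le> N"
    proof -
      have "ennreal (\<integral>x. max 0 (- f m x) \<partial>\<rho>) = (\<integral>\<^sup>+x. ennreal (max 0 (- f m x)) \<partial>\<rho>)"
        using iq by (intro nn_integral_eq_integral[symmetric]) auto
      \<comment> \<open>Truncation moves values towards 1, so it can only shrink the negative part
        of the logarithm.\<close>
      also have "\<dots> \<le> (\<integral>\<^sup>+x. ennreal (- ln (g x)) \<partial>\<rho>)"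
      proof (rule nn_integral_mono_AE, use g(3) in eventually_elim)
        case (elim x)
        show ?case
        proof (cases "u m x < 1")
          case True
          have "g x \<le> u m x \<or> u m x = real m + 1" using order_trans[OF u(2)[of m x] u(3)[of m x]] unfolding u_def by (auto simp: max_def min_def)
          then have "g x \<le> u m x" using True by auto
          then have "ln (g x) \<le> f m x" unfolding f_def using elim by (intro ln_mono) auto
          moreover have "f m x \<le> 0" unfolding f_def using True u(1)[of m x] by simp
          ultimately show ?thesis by (intro ennreal_leI) auto
        next
          case False
          then have "f m x \<ge> 0" unfolding f_def by simp
          then show ?thesis by (simp add: max_def)
        qed
      qed
      finally have "ennreal (\<integral>x. max 0 (- f m x) \<partial>\<rho>) \<le> ennreal N" using Ne by simp
      then show ?thesis using Ne(2) by simp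
    qed
    ultimately have "(\<integral>x. max 0 (f m x) \<partial>\<rho>) \<le> \<alpha> + 1 / (real m + 1) + N" by linarith
    moreover have "(\<integral>\<^sup>+x. ennreal (f m x) \<partial>\<rho>) = (\<integral>\<^sup>+x. ennreal (max 0 (f m x)) \<partial>\<rho>)"
      by (intro nn_integral_cong) (auto simp: max_def ennreal_neg)
    moreover have "\<dots> = ennreal (\<integral>x. max 0 (f m x) \<partial>\<rho>)" using ip by (intro nn_integral_eq_integral) auto
    ultimately show ?thesis by (simp add: ennreal_leI)
  qed
  have "(\<integral>\<^sup>+x. ennreal (ln (g x)) \<partial>\<rho>) \<le> (\<integral>\<^sup>+x. liminf (\<lambda>m. ennreal (f m x)) \<partial>\<rho>)"
  proof (rule nn_integral_mono_AE, use g(3) in eventually_elim)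
    case (elim x)
    \<comment> \<open>Once m exceeds g x and 1 / g x, the truncation is inactive at x.\<close>
    have "eventually (\<lambda>m. f m x = ln (g x)) sequentially"
    proof -
      obtain m1 where m1: "real m1 > g x" using reals_Archimedean2 by blast
      obtain m2 where m2: "real m2 > 1 / g x" using reals_Archimedean2 by blast
      have "u m x = g x" if "m \<ge> max m1 m2" for m
      proof -
        have "real m \<ge> real m1" "real m \<ge> real m2" using that by auto
        then have "g x \<le> real m + 1" "1 / g x \<le> real m + 1" using m1 m2 by linarith+
        moreover from this have "1 / (real m + 1) \<le> g x" using elim by (simp add: field_simps)
        ultimately show ?thesis unfolding u_def by (simp only: min_absorb1 max_absorb2)
      qed
      then show ?thesis unfolding f_def eventually_sequentially by (intro exI[of _ "max m1 m2"]) auto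
    qed
    then have "(\<lambda>m. ennreal (f m x)) \<longlonglongrightarrow> ennreal (ln (g x))"
      by (intro tendsto_eventually) (auto elim: eventually_mono)
    then have "liminf (\<lambda>m. ennreal (f m x)) = ennreal (ln (g x))" by (intro lim_imp_Liminf) auto
    then show ?case by simp
  qed
  also have "\<dots> \<le> liminf (\<lambda>m. \<integral>\<^sup>+x. ennreal (f m x) \<partial>\<rho>)"
    using fmr by (intro nn_integral_liminf) auto
  also have "\<dots> \<le> liminf (\<lambda>m. ennreal (\<alpha> + 1 / (real m + 1) + N))"
    using bound by (intro Liminf_mono) auto
  also have "\<dots> = ennreal (\<alpha> + 0 + N)"
  proof (rule lim_imp_Liminf)
    have "(\<lambda>m. 1 / (real m + 1)) \<longlonglongrightarrow> 0" using LIMSEQ_Suc[OF lim_1_over_n[where 'a=real]] by (simp add: add.commute)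
    then show "(\<lambda>m. ennreal (\<alpha> + 1 / (real m + 1) + N)) \<longlonglongrightarrow> ennreal (\<alpha> + 0 + N)"
      by (intro tendsto_ennrealI tendsto_add tendsto_const)
  qed simp
  finally have P: "(\<integral>\<^sup>+x. ennreal (ln (g x)) \<partial>\<rho>) \<le> ennreal (\<alpha> + N)" by simp
  have "\<alpha> \<ge> 0" using Y[of "\<lambda>_. 0" 0] by (simp add: T.prob_space)
  then have aN: "0 \<le> \<alpha> + N" using Ne by simp
  have "enn2ereal (\<integral>\<^sup>+x. ennreal (ln (g x)) \<partial>\<rho>) \<le> ereal (\<alpha> + N)" using P aN by (simp add: enn2ereal_le_iff_real)
  moreover have "enn2ereal (\<integral>\<^sup>+x. ennreal (- ln (g x)) \<partial>\<rho>) = ereal N" using Ne by simp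
  moreover have "x - y \<le> ereal \<alpha>" if "x \<le> ereal (\<alpha> + N)" "y = ereal N" for x y
    using that by (cases x) auto
  ultimately show ?thesis unfolding g(5) by blast
qed

end

section \<open>Refining sequences of finite partitions\<close>

text \<open>The sets that can be approximated form a \<sigma>-algebra. Working with the sum of the
  two measures gives one approximating set for both, which later allows null sets of \<tau> to be
  tested against \<rho>.\<close>

lemma algebra_approx:
  assumes alg: "algebra \<Omega> G" and R: "finite_measure \<rho>" and T: "finite_measure \<tau>"
    and s: "sets \<rho> = sigma_sets \<Omega> G" "sets \<tau> = sigma_sets \<Omega> G"
    and Z: "Z \<in> sigma_sets \<Omega> G" and e: "e > 0"
  shows "\<exists>A\<in>G. measure \<rho> (sym_diff Z A) + measure \<tau> (sym_diff Z A) < e"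
proof -
  interpret algebra \<Omega> G by (rule alg)
  interpret R: finite_measure \<rho> by (rule R)
  interpret T: finite_measure \<tau> by (rule T)
  define l where "l X = measure \<rho> X + measure \<tau> X" for X
  have mono: "l X \<le> l Y" if "X \<subseteq> Y" "Y \<in> sigma_sets \<Omega> G" for X Y
    using that s R.finite_measure_mono[of X Y] T.finite_measure_mono[of X Y] by (auto simp: l_def intro: add_mono)
  have sub: "l (X \<union> Y) \<le> l X + l Y" if "X \<in> sigma_sets \<Omega> G" "Y \<in> sigma_sets \<Omega> G" for X Y
    using that s measure_Un_le[of X \<rho> Y] measure_Un_le[of X \<tau> Y] by (auto simp: l_def)
  have basic: "A \<in> sigma_sets \<Omega> G" if "A \<in> G" for A using that by (rule sigma_sets.Basic)
  interpret SG: sigma_algebra \<Omega> "sigma_sets \<Omega> G" by (rule sigma_algebra_sigma_sets) (rule space_closed)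
  have "\<forall>e>0. \<exists>A\<in>G. l (sym_diff Z A) < e" using Z
  proof (induction rule: sigma_sets.induct)
    case (Basic a)
    then show ?case by (intro allI impI bexI[of _ a]) (auto simp: l_def)
  next
    case Empty
    show ?case by (intro allI impI bexI[of _ "{}"]) (auto simp: l_def)
  next
    case (Compl a)
    show ?case
    proof (intro allI impI)
      fix e :: real assume "e > 0"
      then obtain A where A: "A \<in> G" "l (sym_diff a A) < e" using Compl.IH by blast
      have "a \<subseteq> \<Omega>" using Compl.hyps SG.sets_into_space by blast
      moreover have "A \<subseteq> \<Omega>" using A sets_into_space by blast
      ultimately have "sym_diff (\<Omega> - a) (\<Omega> - A) = sym_diff a A" by blast
      then show "\<exists>A\<in>G. l (sym_diff (\<Omega> - a) A) < e" using A by (intro bexI[of _ "\<Omega> - A"]) auto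
    qed
  next
    case (Union a)
    show ?case
    proof (intro allI impI)
      fix e :: real assume e: "e > 0"
      have rs: "range a \<subseteq> sigma_sets \<Omega> G" using Union.hyps by auto
      define U where "U n = (\<Union>i<n. a i)" for n
      have Um: "U n \<in> sigma_sets \<Omega> G" for n using rs by (auto simp: U_def)
      have inc: "incseq U" by (force simp: incseq_def U_def)
      have UU: "(\<Union>n. U n) = (\<Union>i. a i)" by (auto simp: U_def)
      have "(\<lambda>n. l (U n)) \<longlonglongrightarrow> l (\<Union>i. a i)"
        unfolding l_def UU[symmetric] using Um inc s
        by (intro tendsto_add R.finite_Lim_measure_incseq T.finite_Lim_measure_incseq) auto
      then have "eventually (\<lambda>n. l (\<Union>i. a i) - e / 2 < l (U n)) sequentially"
        using e by (intro order_tendstoD(1)) auto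
      then obtain N where N: "l (\<Union>i. a i) - e / 2 < l (U N)" by (auto simp: eventually_sequentially)
      have Usub: "U N \<subseteq> (\<Union>i. a i)" by (auto simp: U_def)
      have am: "(\<Union>i. a i) \<in> sigma_sets \<Omega> G" using rs by auto
      have "l ((\<Union>i. a i) - U N) = l (\<Union>i. a i) - l (U N)"
        using s Um[of N] am Usub R.finite_measure_Diff[of "\<Union>i. a i" "U N"] T.finite_measure_Diff[of "\<Union>i. a i" "U N"]
        by (simp add: l_def)
      then have d: "l ((\<Union>i. a i) - U N) < e / 2" using N by simp
      \<comment> \<open>Half of e is spent on the tail of the union, the other half on the first N
        sets; the denominator N + 1 covers N = 0.\<close>
      define e' where "e' = e / (2 * (real N + 1))"
      have e': "e' > 0" using e by (simp add: e'_def)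
      have "\<forall>n. \<exists>A\<in>G. l (sym_diff (a n) A) < e'" using Union.IH e' by blast
      then obtain A where A: "\<And>n. A n \<in> G" "\<And>n. l (sym_diff (a n) (A n)) < e'" by metis
      have sm: "sym_diff (a n) (A n) \<in> sigma_sets \<Omega> G" for n using rs basic[OF A(1)[of n]] by auto
      have fin: "l (\<Union>i<n. sym_diff (a i) (A i)) \<le> real n * e' \<and> (\<Union>i<n. sym_diff (a i) (A i)) \<in> sigma_sets \<Omega> G" for n
      proof (induction n)
        case 0 then show ?case by (simp add: l_def)
      next
        case (Suc n)
        have eq: "(\<Union>i<Suc n. sym_diff (a i) (A i)) = (\<Union>i<n. sym_diff (a i) (A i)) \<union> sym_diff (a n) (A n)"
          by (simp add: lessThan_Suc Un_commute)
        have "l (\<Union>i<Suc n. sym_diff (a i) (A i)) \<le> l (\<Union>i<n. sym_diff (a i) (A i)) + l (sym_diff (a n) (A n))"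
          unfolding eq by (rule sub[OF conjunct2[OF Suc.IH] sm])
        also have "\<dots> \<le> real n * e' + e'" using Suc A(2)[of n] by (intro add_mono) auto
        finally have "l (\<Union>i<Suc n. sym_diff (a i) (A i)) \<le> real (Suc n) * e'" by (simp add: algebra_simps)
        moreover have "(\<Union>i<Suc n. sym_diff (a i) (A i)) \<in> sigma_sets \<Omega> G"
          unfolding eq by (rule SG.Un[OF conjunct2[OF Suc.IH] sm])
        ultimately show ?case by blast
      qed
      let ?B = "\<Union>i<N. A i"
      have "sym_diff (\<Union>i. a i) ?B \<subseteq> ((\<Union>i. a i) - U N) \<union> (\<Union>i<N. sym_diff (a i) (A i))"
        by (auto simp: U_def)
      then have "l (sym_diff (\<Union>i. a i) ?B) \<le> l (((\<Union>i. a i) - U N) \<union> (\<Union>i<N. sym_diff (a i) (A i)))"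
        by (rule mono) (use am Um fin[of N] in \<open>intro SG.Un SG.Diff, auto\<close>)
      also have "\<dots> \<le> l ((\<Union>i. a i) - U N) + l (\<Union>i<N. sym_diff (a i) (A i))"
        using am Um fin[of N] by (intro sub) auto
      also have "\<dots> < e / 2 + e / 2"
      proof -
        have "real N * e' \<le> e / 2" using e by (simp add: e'_def field_simps)
        then show ?thesis using d fin[of N] by linarith
      qed
      finally have "l (sym_diff (\<Union>i. a i) ?B) < e" by simp
      moreover have "?B \<in> G" using A(1) by (intro finite_UN) auto
      ultimately show "\<exists>A\<in>G. l (sym_diff (\<Union>i. a i) A) < e" by blast
    qed
  qed
  then show ?thesis using e by (simp add: l_def)
qed

text \<open>A partition is given by a label map, so refinement is a factorisation of label maps and
  integrals of cell functions are sums over labels, empty cells included. By \<open>shrink\<close>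
  the cells around a point eventually enter every neighbourhood, which makes them generate the Borel
  sets.\<close>

locale partition_seq =
  fixes E :: "'a::topological_space set" and \<L> :: "nat \<Rightarrow> 'a \<Rightarrow> 'l" and Lab :: "nat \<Rightarrow> 'l set"
  assumes fin: "\<And>i. finite (Lab i)" and inL: "\<And>i x. x \<in> E \<Longrightarrow> \<L> i x \<in> Lab i"
    and refine: "\<And>i j x y. i \<le> j \<Longrightarrow> x \<in> E \<Longrightarrow> y \<in> E \<Longrightarrow> \<L> j x = \<L> j y \<Longrightarrow> \<L> i x = \<L> i y"
    and cell_sets: "\<And>i c. {x\<in>E. \<L> i x = c} \<in> sets (borel_on E)"
    and shrink: "\<And>x U. x \<in> E \<Longrightarrow> open U \<Longrightarrow> x \<in> U \<Longrightarrow> \<exists>i. \<forall>y\<in>E. \<L> i y = \<L> i x \<longrightarrow> y \<in> U"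
begin

definition cell :: "nat \<Rightarrow> 'l \<Rightarrow> 'a set" where "cell i c = {x\<in>E. \<L> i x = c}"

definition alg :: "'a set set" where "alg = {{x\<in>E. \<L> i x \<in> T} | i T. True}"

lemma algI: "{x\<in>E. \<L> i x \<in> T} \<in> alg" by (auto simp: alg_def)

text \<open>Any representative of a fine cell determines the coarse label.\<close>

lemma lift: "i \<le> j \<Longrightarrow> \<exists>h. \<forall>x\<in>E. \<L> i x = h (\<L> j x)"
proof -
  assume ij: "i \<le> j"
  define h where "h c = \<L> i (SOME x. x \<in> E \<and> \<L> j x = c)" for c
  have "\<L> i x = h (\<L> j x)" if "x \<in> E" for x
  proof -
    have "(SOME y. y \<in> E \<and> \<L> j y = \<L> j x) \<in> E \<and> \<L> j (SOME y. y \<in> E \<and> \<L> j y = \<L> j x) = \<L> j x"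
      by (rule someI[of "\<lambda>y. y \<in> E \<and> \<L> j y = \<L> j x" x]) (use that in simp)
    then show ?thesis unfolding h_def using refine[OF ij] that by metis
  qed
  then show ?thesis by blast
qed

lemma algebra_alg: "algebra E alg"
  unfolding algebra_iff_Un
proof (intro conjI ballI)
  show "alg \<subseteq> Pow E" by (auto simp: alg_def)
  show "{} \<in> alg" using algI[of 0 "{}"] by simp
  fix a assume "a \<in> alg"
  then obtain i T where a: "a = {x\<in>E. \<L> i x \<in> T}" by (auto simp: alg_def)
  have "E - a = {x\<in>E. \<L> i x \<in> - T}" by (auto simp: a)
  then show "E - a \<in> alg" using algI by metis
  fix b assume "b \<in> alg"
  then obtain j T' where b: "b = {x\<in>E. \<L> j x \<in> T'}" by (auto simp: alg_def)
  obtain h where h: "\<And>x. x \<in> E \<Longrightarrow> \<L> i x = h (\<L> (max i j) x)" using lift[of i "max i j"] by auto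
  obtain h' where h': "\<And>x. x \<in> E \<Longrightarrow> \<L> j x = h' (\<L> (max i j) x)" using lift[of j "max i j"] by auto
  have "a \<union> b = {x\<in>E. \<L> (max i j) x \<in> {c. h c \<in> T \<or> h' c \<in> T'}}" using h h' by (auto simp: a b)
  then show "a \<union> b \<in> alg" using algI by metis
qed

lemma level_sets: "{x\<in>E. \<L> i x \<in> T} \<in> sets (borel_on E)"
proof -
  have "{x\<in>E. \<L> i x \<in> T} = (\<Union>c\<in>T \<inter> Lab i. {x\<in>E. \<L> i x = c})" using inL by auto
  also have "\<dots> \<in> sets (borel_on E)" using fin cell_sets by (intro sets.finite_UN) auto
  finally show ?thesis .
qed

text \<open>An open set is the union of the cells it contains, and these are finitely many nonempty
  ones per level.\<close>

lemma sets_borel_on: "sets (borel_on E) = sigma_sets E alg"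
proof (rule antisym)
  interpret algebra E alg by (rule algebra_alg)
  interpret SG: sigma_algebra E "sigma_sets E alg" by (rule sigma_algebra_sigma_sets) (rule space_closed)
  have "E \<inter> B \<in> sigma_sets E alg" if "B \<in> sigma_sets UNIV {U. open U}" for B
    using that
  proof (induction rule: sigma_sets.induct)
    case (Basic U)
    define T where "T i = {c. cell i c \<subseteq> U}" for i
    have eq: "E \<inter> U = (\<Union>i. {x\<in>E. \<L> i x \<in> T i})"
    proof (intro equalityI subsetI)
      fix x assume x: "x \<in> E \<inter> U"
      then obtain i where "\<forall>y\<in>E. \<L> i y = \<L> i x \<longrightarrow> y \<in> U" using shrink[of x U] Basic by auto
      then have "x \<in> {x\<in>E. \<L> i x \<in> T i}" using x by (auto simp: T_def cell_def)
      then show "x \<in> (\<Union>i. {x\<in>E. \<L> i x \<in> T i})" by blast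
    qed (auto simp: T_def cell_def)
    show ?case unfolding eq by (intro sigma_sets.Union sigma_sets.Basic algI)
  next
    case Empty
    show ?case by simp
  next
    case (Compl a)
    have "E \<inter> (UNIV - a) = E - (E \<inter> a)" by blast
    then show ?case using Compl.IH by (metis sigma_sets.Compl)
  next
    case (Union a)
    have "E \<inter> (\<Union>i. a i) = (\<Union>i. E \<inter> a i)" by blast
    then show ?case using Union.IH by (metis sigma_sets.Union)
  qed
  then show "sets (borel_on E) \<subseteq> sigma_sets E alg" by (auto simp: sets_restrict_space borel_def)
  have "alg \<subseteq> sets (borel_on E)" using level_sets by (auto simp: alg_def)
  then show "sigma_sets E alg \<subseteq> sets (borel_on E)"
    using sets.sigma_sets_subset[of alg "borel_on E"] by (simp add: space_restrict_space)
qed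

lemma measure_level:
  assumes "\<rho> \<in> M1 E"
  shows "measure \<rho> {x\<in>E. \<L> i x \<in> T} = (\<Sum>c\<in>T \<inter> Lab i. measure \<rho> (cell i c))"
proof -
  interpret prob_space \<rho> by (rule M1_prob[OF assms])
  have "{x\<in>E. \<L> i x \<in> T} = (\<Union>c\<in>T \<inter> Lab i. cell i c)" using inL by (auto simp: cell_def)
  also have "measure \<rho> \<dots> = (\<Sum>c\<in>T \<inter> Lab i. measure \<rho> (cell i c))"
    using fin cell_sets M1_sets[OF assms] by (intro finite_measure_finite_Union) (auto simp: cell_def disjoint_family_on_def)
  finally show ?thesis .
qed

lemma sum_cells: "\<rho> \<in> M1 E \<Longrightarrow> (\<Sum>c\<in>Lab i. measure \<rho> (cell i c)) = 1"
proof -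
  assume \<rho>: "\<rho> \<in> M1 E"
  have "measure \<rho> E = 1" using prob_space.prob_space[OF M1_prob[OF \<rho>]] M1_space[OF \<rho>] by simp
  then show ?thesis using measure_level[OF \<rho>, of i UNIV] by simp
qed

lemma label_measurable: "(\<lambda>x. F (\<L> i x) :: real) \<in> borel_measurable (borel_on E)"
proof -
  have "(\<lambda>x. \<Sum>c\<in>Lab i. F c * indicator (cell i c) x) \<in> borel_measurable (borel_on E)"
    using cell_sets by (intro borel_measurable_sum borel_measurable_times borel_measurable_const borel_measurable_indicator) (auto simp: cell_def)
  moreover have "(\<Sum>c\<in>Lab i. F c * indicator (cell i c) x) = F (\<L> i x)" if "x \<in> space (borel_on E)" for x
  proof -
    have x: "x \<in> E" using that by (simp add: space_restrict_space)
    have "(\<Sum>c\<in>Lab i. F c * indicator (cell i c) x) = (\<Sum>c\<in>Lab i. if c = \<L> i x then F c else 0)"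
      using x by (intro sum.cong) (auto simp: cell_def indicator_def)
    then show ?thesis using fin inL[OF x] by simp
  qed
  ultimately show ?thesis by (subst (asm) measurable_cong)
qed

lemma label_integral:
  assumes "\<rho> \<in> M1 E"
  shows "integrable \<rho> (\<lambda>x. F (\<L> i x) :: real)" "(\<integral>x. F (\<L> i x) \<partial>\<rho>) = (\<Sum>c\<in>Lab i. F c * measure \<rho> (cell i c))"
proof -
  interpret prob_space \<rho> by (rule M1_prob[OF assms])
  have sp: "space \<rho> = E" by (rule M1_space[OF assms])
  have e: "F (\<L> i x) = (\<Sum>c\<in>Lab i. F c * indicator (cell i c) x)" if "x \<in> space \<rho>" for x
  proof -
    have x: "x \<in> E" using that sp by simp
    have "(\<Sum>c\<in>Lab i. F c * indicator (cell i c) x) = (\<Sum>c\<in>Lab i. if c = \<L> i x then F c else 0)"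
      using x by (intro sum.cong) (auto simp: cell_def indicator_def)
    then show ?thesis using fin inL[OF x] by simp
  qed
  have cs: "cell i c \<in> sets \<rho>" for c using cell_sets M1_sets[OF assms] by (simp add: cell_def)
  have i: "integrable \<rho> (\<lambda>x. F c * indicator (cell i c) x)" for c
    using cs by (intro integrable_mult_right integrable_real_indicator) (auto simp: less_top[symmetric])
  show "integrable \<rho> (\<lambda>x. F (\<L> i x) :: real)"
    by (subst Bochner_Integration.integrable_cong[OF refl e]) (auto intro!: Bochner_Integration.integrable_sum i)
  have "(\<integral>x. F (\<L> i x) \<partial>\<rho>) = (\<integral>x. (\<Sum>c\<in>Lab i. F c * indicator (cell i c) x) \<partial>\<rho>)"
    by (rule Bochner_Integration.integral_cong[OF refl e])
  also have "\<dots> = (\<Sum>c\<in>Lab i. \<integral>x. F c * indicator (cell i c) x \<partial>\<rho>)" using i by (rule Bochner_Integration.integral_sum)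
  also have "\<dots> = (\<Sum>c\<in>Lab i. F c * measure \<rho> (cell i c))"
    using cs by (intro sum.cong refl) (simp add: sets.Int_space_eq2)
  finally show "(\<integral>x. F (\<L> i x) \<partial>\<rho>) = (\<Sum>c\<in>Lab i. F c * measure \<rho> (cell i c))" .
qed

text \<open>Most of the mass of \<rho> sits in cells of small \<delta>-diameter, where a test
  function in \<open>BL\<close> is nearly constant. Cell masses close to those of \<rho> leave the
  other cells almost as light under \<gamma>. Convergence in \<open>\<beta>_BL\<close> is thereby
  reduced to finitely many cell masses.\<close>

lemma cells_control_\<beta>_BL:
  assumes c: "compatible_metric E \<delta>" and \<rho>: "\<rho> \<in> M1 E" and \<epsilon>: "\<epsilon> > 0"
  shows "\<exists>i. \<exists>r>0. \<forall>\<gamma>\<in>M1 E. (\<Sum>c\<in>Lab i. \<bar>measure \<gamma> (cell i c) - measure \<rho> (cell i c)\<bar>) < r \<longrightarrow> \<beta>_BL E \<delta> \<gamma> \<rho> < \<epsilon>"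
proof -
  interpret compat E \<delta> by unfold_locales (rule c)
  interpret R: prob_space \<rho> by (rule M1_prob[OF \<rho>])
  \<comment> \<open>Oscillation and bad cells cost 4 e for \<gamma> and 3 e for \<rho>, the change
    of cell masses e: 8 e in all, rounded up to 10 e below.\<close>
  define e where "e = \<epsilon> / 20"
  have e: "e > 0" using \<epsilon> by (simp add: e_def)
  define Good where "Good i = {c. \<forall>y\<in>cell i c. \<forall>y'\<in>cell i c. \<delta> y y' < 2 * e}" for i
  define U where "U i = {x\<in>E. \<L> i x \<in> Good i}" for i
  have Us: "U i \<in> sets \<rho>" for i using level_sets M1_sets[OF \<rho>] by (simp add: U_def)
  have "incseq U"
  proof (rule incseq_SucI, rule subsetI)
    fix i x assume "x \<in> U i"
    then have x: "x \<in> E" "\<forall>y\<in>cell i (\<L> i x). \<forall>y'\<in>cell i (\<L> i x). \<delta> y y' < 2 * e" by (auto simp: U_def Good_def)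
    have "cell (Suc i) (\<L> (Suc i) x) \<subseteq> cell i (\<L> i x)"
    proof
      fix y assume "y \<in> cell (Suc i) (\<L> (Suc i) x)"
      then have "y \<in> E" "\<L> (Suc i) y = \<L> (Suc i) x" by (simp_all add: cell_def)
      then show "y \<in> cell i (\<L> i x)" using refine[of i "Suc i" y x] x(1) by (simp add: cell_def)
    qed
    then show "x \<in> U (Suc i)" using x by (auto simp: U_def Good_def)
  qed
  moreover have "(\<Union>i. U i) = E"
  proof (intro equalityI subsetI)
    fix x assume x: "x \<in> E"
    obtain O' where O': "open O'" "{y\<in>E. \<delta> x y < e} = E \<inter> O'" using ball_is_open[OF x] by blast
    have "x \<in> {y\<in>E. \<delta> x y < e}" using x e by simp
    then have "x \<in> O'" unfolding O'(2) by simp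
    then obtain i where i: "\<forall>y\<in>E. \<L> i y = \<L> i x \<longrightarrow> y \<in> O'" using shrink[OF x O'(1)] by blast
    have "\<delta> y y' < 2 * e" if "y \<in> cell i (\<L> i x)" "y' \<in> cell i (\<L> i x)" for y y'
    proof -
      have "y \<in> E" "y' \<in> E" "\<delta> x y < e" "\<delta> x y' < e" using that i O'(2) by (auto simp: cell_def)
      then show ?thesis using MS.triangle[of y x y'] MS.commute[of x y] x by simp
    qed
    then have "x \<in> U i" using x by (auto simp: U_def Good_def)
    then show "x \<in> (\<Union>i. U i)" by blast
  qed (auto simp: U_def)
  ultimately have "(\<lambda>i. measure \<rho> (U i)) \<longlonglongrightarrow> measure \<rho> E"
    using R.finite_Lim_measure_incseq[of U] Us by auto
  then have "(\<lambda>i. measure \<rho> (U i)) \<longlonglongrightarrow> 1" using R.prob_space M1_space[OF \<rho>] by simp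
  then have "eventually (\<lambda>i. measure \<rho> (U i) > 1 - e) sequentially" using e by (intro order_tendstoD(1)) auto
  then obtain i where i: "measure \<rho> (U i) > 1 - e" by (auto simp: eventually_sequentially)
  have "\<beta>_BL E \<delta> \<gamma> \<rho> < \<epsilon>"
    if \<gamma>: "\<gamma> \<in> M1 E" and close: "(\<Sum>c\<in>Lab i. \<bar>measure \<gamma> (cell i c) - measure \<rho> (cell i c)\<bar>) < e" for \<gamma>
  proof -
    interpret G: prob_space \<gamma> by (rule M1_prob[OF \<gamma>])
    have "\<bar>measure \<gamma> (U i) - measure \<rho> (U i)\<bar> \<le> e"
    proof -
      have "measure \<gamma> (U i) - measure \<rho> (U i) = (\<Sum>c\<in>Good i \<inter> Lab i. measure \<gamma> (cell i c) - measure \<rho> (cell i c))"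
        unfolding U_def measure_level[OF \<gamma>] measure_level[OF \<rho>] by (simp add: sum_subtractf)
      also have "\<bar>\<dots>\<bar> \<le> (\<Sum>c\<in>Good i \<inter> Lab i. \<bar>measure \<gamma> (cell i c) - measure \<rho> (cell i c)\<bar>)" by (rule sum_abs)
      also have "\<dots> \<le> (\<Sum>c\<in>Lab i. \<bar>measure \<gamma> (cell i c) - measure \<rho> (cell i c)\<bar>)" using fin by (intro sum_mono2) auto
      finally show ?thesis using close by linarith
    qed
    then have gi: "measure \<gamma> (U i) > 1 - 2 * e" using i by linarith
    have "\<beta>_BL E \<delta> \<gamma> \<rho> \<le> 10 * e"
    proof (rule \<beta>_BL_le)
      fix f assume f: "f \<in> BL E \<delta>"
      \<comment> \<open>The value at a representative on small cells; on the others 0, where |f|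
        \<le> 1 bounds the error.\<close>
      define F where "F c = (if c \<in> Good i \<and> cell i c \<noteq> {} then f (SOME y. y \<in> cell i c) else 0)" for c
      have F1: "\<bar>F c\<bar> \<le> 1" for c
      proof (cases "c \<in> Good i \<and> cell i c \<noteq> {}")
        case True
        then have "(SOME y. y \<in> cell i c) \<in> cell i c" by (simp add: some_in_eq)
        then show ?thesis using BL_D(2)[OF f] True by (auto simp: F_def cell_def)
      next
        case False
        then show ?thesis unfolding F_def by (simp only: if_False) 
      qed
      have near: "\<bar>f x - F (\<L> i x)\<bar> \<le> 2 * e + indicator (E - U i) x" if x: "x \<in> E" for x
      proof (cases "x \<in> U i")
        case True
        then have g: "\<L> i x \<in> Good i" "x \<in> cell i (\<L> i x)" by (auto simp: U_def cell_def)
        then have y: "(SOME y. y \<in> cell i (\<L> i x)) \<in> cell i (\<L> i x)" by (intro someI[of "\<lambda>y. y \<in> cell i (\<L> i x)" x])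
        define y0 where "y0 = (SOME y. y \<in> cell i (\<L> i x))"
        have y0: "y0 \<in> cell i (\<L> i x)" using y by (simp only: y0_def)
        then have "y0 \<in> E" by (simp add: cell_def)
        then have "\<bar>f x - f y0\<bar> \<le> \<delta> x y0" using x by (intro BL_D(3)[OF f])
        also have "\<dots> \<le> 2 * e" using g y0 unfolding Good_def by (simp add: less_imp_le)
        finally have "\<bar>f x - f y0\<bar> \<le> 2 * e" .
        moreover have "F (\<L> i x) = f y0" using g unfolding F_def y0_def by auto
        ultimately show ?thesis using True by simp
      next
        case False
        then have "F (\<L> i x) = 0" using x by (auto simp: F_def U_def)
        then show ?thesis using BL_D(2)[OF f x] False x e by simp
      qed
      have int: "\<bar>(\<integral>x. f x \<partial>\<kappa>) - (\<Sum>c\<in>Lab i. F c * measure \<kappa> (cell i c))\<bar> \<le> 2 * e + (1 - measure \<kappa> (U i))"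
        if \<kappa>: "\<kappa> \<in> M1 E" for \<kappa>
      proof -
        interpret K: prob_space \<kappa> by (rule M1_prob[OF \<kappa>])
        have sp: "space \<kappa> = E" by (rule M1_space[OF \<kappa>])
        have UK: "E - U i \<in> sets \<kappa>" using Us M1_sets[OF \<rho>] M1_sets[OF \<kappa>] sp by (metis sets.compl_sets)
        have i1: "integrable \<kappa> f" by (rule BL_integrable[OF \<kappa> f])
        have "(\<integral>x. f x \<partial>\<kappa>) - (\<Sum>c\<in>Lab i. F c * measure \<kappa> (cell i c)) = (\<integral>x. f x - F (\<L> i x) \<partial>\<kappa>)"
          using label_integral[OF \<kappa>, of F i] i1 by simp
        also have "\<bar>\<dots>\<bar> \<le> (\<integral>x. \<bar>f x - F (\<L> i x)\<bar> \<partial>\<kappa>)"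
          using integral_norm_bound[of \<kappa> "\<lambda>x. f x - F (\<L> i x)"] by simp
        also have "\<dots> \<le> (\<integral>x. 2 * e + indicator (E - U i) x \<partial>\<kappa>)"
        proof (rule integral_mono)
          show "integrable \<kappa> (\<lambda>x. \<bar>f x - F (\<L> i x)\<bar>)"
            by (intro integrable_abs Bochner_Integration.integrable_diff i1 label_integral(1)[OF \<kappa>])
          show "integrable \<kappa> (\<lambda>x. 2 * e + indicator (E - U i) x)"
            using UK by (intro Bochner_Integration.integrable_add K.integrable_const integrable_real_indicator) (auto simp: less_top[symmetric])
        qed (use near sp in auto)
        also have "\<dots> = (\<integral>x. 2 * e \<partial>\<kappa>) + (\<integral>x. indicator (E - U i) x \<partial>\<kappa>)"
          using UK by (intro Bochner_Integration.integral_add K.integrable_const integrable_real_indicator) (auto simp: less_top[symmetric])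
        also have "\<dots> = 2 * e + measure \<kappa> (E - U i)" using UK sp K.prob_space by (simp add: Int_absorb2)
        also have "measure \<kappa> (E - U i) = 1 - measure \<kappa> (U i)"
          using K.prob_compl[of "U i"] Us M1_sets[OF \<rho>] M1_sets[OF \<kappa>] sp by simp
        finally show ?thesis .
      qed
      have "\<bar>(\<Sum>c\<in>Lab i. F c * measure \<gamma> (cell i c)) - (\<Sum>c\<in>Lab i. F c * measure \<rho> (cell i c))\<bar>
         = \<bar>\<Sum>c\<in>Lab i. F c * (measure \<gamma> (cell i c) - measure \<rho> (cell i c))\<bar>"
        by (simp add: sum_subtractf right_diff_distrib)
      also have "\<dots> \<le> (\<Sum>c\<in>Lab i. \<bar>F c * (measure \<gamma> (cell i c) - measure \<rho> (cell i c))\<bar>)" by (rule sum_abs)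
      also have "\<dots> \<le> (\<Sum>c\<in>Lab i. \<bar>measure \<gamma> (cell i c) - measure \<rho> (cell i c)\<bar>)"
        using F1 by (intro sum_mono) (simp add: abs_mult mult_left_le_one_le)
      finally have "\<bar>(\<Sum>c\<in>Lab i. F c * measure \<gamma> (cell i c)) - (\<Sum>c\<in>Lab i. F c * measure \<rho> (cell i c))\<bar> < e"
        using close by linarith
      then show "\<bar>(\<integral>x. f x \<partial>\<gamma>) - (\<integral>x. f x \<partial>\<rho>)\<bar> \<le> 10 * e"
        using int[OF \<gamma>] int[OF \<rho>] gi i by (simp add: abs_le_iff abs_less_iff)
    qed (use e in simp)
    then show ?thesis using e by (simp add: e_def)
  qed
  then show ?thesis using e by blast
qed

end

section \<open>Cell functions as test functions for the entropy\<close>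

context partition_seq begin

text \<open>Indicators are handled by \<open>algebra_approx\<close>, sums on a common refinement,
  limits by dominated convergence. Clipping at C afterwards does not increase the error, since f
  itself lies in [-C, C].\<close>

lemma L1_approx:
  assumes \<tau>: "\<tau> \<in> M1 E" and f: "f \<in> borel_measurable \<tau>" and C: "\<And>x. \<bar>f x\<bar> \<le> C" and e: "e > (0::real)"
  shows "\<exists>i F. (\<forall>c. \<bar>F c\<bar> \<le> C) \<and> (\<integral>x. \<bar>f x - F (\<L> i x)\<bar> \<partial>\<tau>) < e"
proof -
  interpret T: prob_space \<tau> by (rule M1_prob[OF \<tau>])
  have sp: "space \<tau> = E" by (rule M1_space[OF \<tau>])
  have st: "sets \<tau> = sigma_sets E alg" using M1_sets[OF \<tau>] sets_borel_on by simp
  note li = label_integral(1)[OF \<tau>]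
  have iF: "integrable \<tau> f" using f C by (intro M1_bounded_integrable[OF \<tau>, of _ C])
  have "\<forall>e>0. \<exists>i F. (\<integral>x. \<bar>f x - F (\<L> i x)\<bar> \<partial>\<tau>) < e"
    using iF
  proof (induction rule: integrable_induct)
    case (base A c)
    show ?case
    proof (intro allI impI)
      fix e :: real assume e: "e > 0"
      define e' where "e' = e / (\<bar>c\<bar> + 1)"
      have e': "e' > 0" using e by (simp add: e'_def)
      \<comment> \<open>\<open>algebra_approx\<close> is used with \<tau> in both places.\<close>
      obtain B where B: "B \<in> alg" "measure \<tau> (sym_diff A B) + measure \<tau> (sym_diff A B) < e'"
        using algebra_approx[OF algebra_alg T.finite_measure_axioms T.finite_measure_axioms st st _ e', of A] base(1) st by auto
      then obtain i T where T: "B = {x\<in>E. \<L> i x \<in> T}" by (auto simp: alg_def)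
      have "B \<in> sets \<tau>" unfolding st using B(1) by (rule sigma_sets.Basic)
      then have Bs: "sym_diff A B \<in> sets \<tau>" using base(1) by (intro sets.Un sets.Diff)
      have sub: "sym_diff A B \<subseteq> E" using Bs sets.sets_into_space sp by blast
      have "(\<integral>x. \<bar>indicator A x *\<^sub>R c - indicator T (\<L> i x) * c\<bar> \<partial>\<tau>) = (\<integral>x. \<bar>c\<bar> * indicator (sym_diff A B) x \<partial>\<tau>)"
      proof (rule Bochner_Integration.integral_cong[OF refl])
        fix x assume "x \<in> space \<tau>"
        then have "x \<in> B \<longleftrightarrow> \<L> i x \<in> T" using sp by (simp add: T)
        then show "\<bar>indicator A x *\<^sub>R c - indicator T (\<L> i x) * c\<bar> = \<bar>c\<bar> * indicator (sym_diff A B) x"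
          by (cases "x \<in> A"; cases "x \<in> B") simp_all
      qed
      also have "\<dots> = \<bar>c\<bar> * measure \<tau> (sym_diff A B)" using Bs sub sp by (simp add: Int_absorb2)
      also have "\<dots> \<le> \<bar>c\<bar> * e'" using B(2) measure_nonneg[of \<tau> "sym_diff A B"] by (intro mult_left_mono) linarith+
      also have "\<dots> < (\<bar>c\<bar> + 1) * e'" using e' by simp
      also have "\<dots> = e" by (simp add: e'_def)
      finally show "\<exists>i F. (\<integral>x. \<bar>indicator A x *\<^sub>R c - F (\<L> i x)\<bar> \<partial>\<tau>) < e"
        by (intro exI[of _ i] exI[of _ "\<lambda>l. indicator T l * c"])
    qed
  next
    case (add f g)
    show ?case
    proof (intro allI impI)
      fix e :: real assume e: "e > 0"
      obtain i F where F: "(\<integral>x. \<bar>f x - F (\<L> i x)\<bar> \<partial>\<tau>) < e / 2" using add.IH(1) e by (meson half_gt_zero)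
      obtain j G where G: "(\<integral>x. \<bar>g x - G (\<L> j x)\<bar> \<partial>\<tau>) < e / 2" using add.IH(2) e by (meson half_gt_zero)
      obtain h where h: "\<And>x. x \<in> E \<Longrightarrow> \<L> i x = h (\<L> (max i j) x)" using lift[of i "max i j"] by auto
      obtain h' where h': "\<And>x. x \<in> E \<Longrightarrow> \<L> j x = h' (\<L> (max i j) x)" using lift[of j "max i j"] by auto
      define H where "H c = F (h c) + G (h' c)" for c
      have I1: "integrable \<tau> (\<lambda>x. \<bar>f x - F (\<L> i x)\<bar>)" by (intro integrable_abs Bochner_Integration.integrable_diff add li)
      have I2: "integrable \<tau> (\<lambda>x. \<bar>g x - G (\<L> j x)\<bar>)" by (intro integrable_abs Bochner_Integration.integrable_diff add li)
      have "(\<integral>x. \<bar>f x + g x - H (\<L> (max i j) x)\<bar> \<partial>\<tau>) \<le> (\<integral>x. \<bar>f x - F (\<L> i x)\<bar> + \<bar>g x - G (\<L> j x)\<bar> \<partial>\<tau>)"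
      proof (rule integral_mono)
        show "integrable \<tau> (\<lambda>x. \<bar>f x + g x - H (\<L> (max i j) x)\<bar>)"
          by (intro integrable_abs Bochner_Integration.integrable_diff Bochner_Integration.integrable_add add li)
        show "integrable \<tau> (\<lambda>x. \<bar>f x - F (\<L> i x)\<bar> + \<bar>g x - G (\<L> j x)\<bar>)" by (intro Bochner_Integration.integrable_add I1 I2)
        fix x assume "x \<in> space \<tau>"
        then have "H (\<L> (max i j) x) = F (\<L> i x) + G (\<L> j x)" using h[of x] h'[of x] sp by (simp add: H_def)
        then show "\<bar>f x + g x - H (\<L> (max i j) x)\<bar> \<le> \<bar>f x - F (\<L> i x)\<bar> + \<bar>g x - G (\<L> j x)\<bar>" by linarith
      qed
      also have "\<dots> = (\<integral>x. \<bar>f x - F (\<L> i x)\<bar> \<partial>\<tau>) + (\<integral>x. \<bar>g x - G (\<L> j x)\<bar> \<partial>\<tau>)"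
        using I1 I2 by (rule Bochner_Integration.integral_add)
      also have "\<dots> < e" using F G by linarith
      finally show "\<exists>i F. (\<integral>x. \<bar>f x + g x - F (\<L> i x)\<bar> \<partial>\<tau>) < e" by blast
    qed
  next
    case (lim f s)
    show ?case
    proof (intro allI impI)
      fix e :: real assume e: "e > 0"
      have "(\<lambda>n. \<integral>x. \<bar>f x - s n x\<bar> \<partial>\<tau>) \<longlonglongrightarrow> (\<integral>x. 0 \<partial>\<tau>)"
      proof (rule integral_dominated_convergence[where w="\<lambda>x. 3 * \<bar>f x\<bar>"])
        show "integrable \<tau> (\<lambda>x. 3 * \<bar>f x\<bar>)" using lim by (intro integrable_mult_right integrable_abs)
        show "AE x in \<tau>. (\<lambda>n. \<bar>f x - s n x\<bar>) \<longlonglongrightarrow> 0"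
        proof (rule AE_I2)
          fix x assume "x \<in> space \<tau>"
          then have "(\<lambda>n. \<bar>f x - s n x\<bar>) \<longlonglongrightarrow> \<bar>f x - f x\<bar>" using lim by (intro tendsto_intros)
          then show "(\<lambda>n. \<bar>f x - s n x\<bar>) \<longlonglongrightarrow> 0" by simp
        qed
        show "AE x in \<tau>. norm \<bar>f x - s n x\<bar> \<le> 3 * \<bar>f x\<bar>" for n
        proof (rule AE_I2)
          fix x assume "x \<in> space \<tau>"
          then have "\<bar>s n x\<bar> \<le> 2 * \<bar>f x\<bar>" using lim.hyps by auto
          then show "norm \<bar>f x - s n x\<bar> \<le> 3 * \<bar>f x\<bar>" by simp
        qed
      qed (use lim in \<open>auto intro!: borel_measurable_abs borel_measurable_diff borel_measurable_integrable\<close>)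
      then have "eventually (\<lambda>n. (\<integral>x. \<bar>f x - s n x\<bar> \<partial>\<tau>) < e / 2) sequentially"
        using e by (intro order_tendstoD(2)) auto
      then obtain n where n: "(\<integral>x. \<bar>f x - s n x\<bar> \<partial>\<tau>) < e / 2" by (auto simp: eventually_sequentially)
      obtain i F where F: "(\<integral>x. \<bar>s n x - F (\<L> i x)\<bar> \<partial>\<tau>) < e / 2" using lim.IH[of n] e by (meson half_gt_zero)
      have I1: "integrable \<tau> (\<lambda>x. \<bar>f x - s n x\<bar>)" using lim by (intro integrable_abs Bochner_Integration.integrable_diff)
      have I2: "integrable \<tau> (\<lambda>x. \<bar>s n x - F (\<L> i x)\<bar>)" by (intro integrable_abs Bochner_Integration.integrable_diff lim li)
      have "(\<integral>x. \<bar>f x - F (\<L> i x)\<bar> \<partial>\<tau>) \<le> (\<integral>x. \<bar>f x - s n x\<bar> + \<bar>s n x - F (\<L> i x)\<bar> \<partial>\<tau>)"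
        by (rule integral_mono) (auto intro!: integrable_abs Bochner_Integration.integrable_diff Bochner_Integration.integrable_add I1 I2 lim li)
      also have "\<dots> = (\<integral>x. \<bar>f x - s n x\<bar> \<partial>\<tau>) + (\<integral>x. \<bar>s n x - F (\<L> i x)\<bar> \<partial>\<tau>)"
        using I1 I2 by (rule Bochner_Integration.integral_add)
      also have "\<dots> < e" using F n by linarith
      finally show "\<exists>i F. (\<integral>x. \<bar>f x - F (\<L> i x)\<bar> \<partial>\<tau>) < e" by blast
    qed
  qed
  then obtain i F where F: "(\<integral>x. \<bar>f x - F (\<L> i x)\<bar> \<partial>\<tau>) < e" using e by blast
  have C0: "C \<ge> 0" using C[of undefined] by linarith
  define G where "G c = max (- C) (min (F c) C)" for c
  have "(\<integral>x. \<bar>f x - G (\<L> i x)\<bar> \<partial>\<tau>) \<le> (\<integral>x. \<bar>f x - F (\<L> i x)\<bar> \<partial>\<tau>)"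
  proof (rule integral_mono)
    fix x show "\<bar>f x - G (\<L> i x)\<bar> \<le> \<bar>f x - F (\<L> i x)\<bar>"
      using C[of x] unfolding G_def by (auto simp: max_def min_def abs_if split: if_splits)
  qed (intro integrable_abs Bochner_Integration.integrable_diff iF li)+
  moreover have "\<bar>G c\<bar> \<le> C" for c using C0 unfolding G_def by (auto simp: max_def min_def)
  ultimately show ?thesis using F by (intro exI[of _ i] exI[of _ G]) auto
qed

text \<open>The test function is K on T and 0 elsewhere. For large K this is uniform absolute
  continuity: sets of small \<tau>-mass carry little weight of t, with a modulus depending on
  \<alpha> only. The weights t may be mere limits of cell masses.\<close>

lemma level_young_bound:
  assumes \<tau>: "\<tau> \<in> M1 E"
    and Y: "\<And>F. (\<Sum>c\<in>Lab i. F c * t c) - (\<Sum>c\<in>Lab i. exp (F c) * measure \<tau> (cell i c)) + 1 \<le> \<alpha>"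
  shows "K * (\<Sum>c\<in>T \<inter> Lab i. t c) \<le> \<alpha> + exp K * measure \<tau> {x\<in>E. \<L> i x \<in> T}"
proof -
  let ?F = "\<lambda>c. if c \<in> T then K else 0"
  have restr: "(\<Sum>c\<in>Lab i. if c \<in> T then g c else 0) = (\<Sum>c\<in>T \<inter> Lab i. g c)" for g :: "'l \<Rightarrow> real"
    using sum.inter_restrict[OF fin[of i], of g T] by (simp add: Int_commute)
  have "(\<Sum>c\<in>Lab i. ?F c * t c) = (\<Sum>c\<in>Lab i. if c \<in> T then K * t c else 0)"
    by (intro sum.cong) auto
  also have "\<dots> = K * (\<Sum>c\<in>T \<inter> Lab i. t c)" unfolding restr by (simp add: sum_distrib_left)
  finally have 1: "(\<Sum>c\<in>Lab i. ?F c * t c) = K * (\<Sum>c\<in>T \<inter> Lab i. t c)" .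
  have "(\<Sum>c\<in>Lab i. exp (?F c) * measure \<tau> (cell i c))
      \<le> (\<Sum>c\<in>Lab i. (if c \<in> T then exp K * measure \<tau> (cell i c) else 0) + measure \<tau> (cell i c))"
    by (intro sum_mono) auto
  also have "\<dots> = (\<Sum>c\<in>T \<inter> Lab i. exp K * measure \<tau> (cell i c)) + 1"
    unfolding sum.distrib restr sum_cells[OF \<tau>] ..
  also have "\<dots> = exp K * measure \<tau> {x\<in>E. \<L> i x \<in> T} + 1"
    unfolding measure_level[OF \<tau>] by (simp add: sum_distrib_left)
  finally show ?thesis using Y[of ?F] 1 by linarith
qed

text \<open>Cell functions decide the entropy. Absolute continuity comes first, from
  \<open>level_young_bound\<close> and the approximation of null sets by cells; it lets cell
  functions that converge \<tau>-almost everywhere to a bounded f converge \<rho>-almost everywhere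
  as well.\<close>

lemma young_extend:
  assumes \<tau>: "\<tau> \<in> M1 E" and \<rho>: "\<rho> \<in> M1 E"
    and Y: "\<And>i F. (\<Sum>c\<in>Lab i. F c * measure \<rho> (cell i c)) - (\<Sum>c\<in>Lab i. exp (F c) * measure \<tau> (cell i c)) + 1 \<le> \<alpha>"
  shows "rel_entropy \<rho> \<tau> \<le> ereal \<alpha>"
proof -
  interpret prob_pair \<rho> \<tau>
    unfolding prob_pair_def prob_pair_axioms_def using M1_prob[OF \<tau>] M1_prob[OF \<rho>] M1_sets[OF \<tau>] M1_sets[OF \<rho>] by auto
  have st: "sets \<tau> = sigma_sets E alg" "sets \<rho> = sigma_sets E alg" using M1_sets \<tau> \<rho> sets_borel_on by auto
  have \<alpha>0: "\<alpha> \<ge> 0" using Y[where F="\<lambda>_. 0"] sum_cells[OF \<tau>] by simp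
  have bnd: "K * measure \<rho> A \<le> \<alpha> + exp K * measure \<tau> A" if "A \<in> alg" for A K
  proof -
    obtain i T where A: "A = {x\<in>E. \<L> i x \<in> T}" using \<open>A \<in> alg\<close> by (auto simp: alg_def)
    show ?thesis using level_young_bound[OF \<tau> Y, where K=K and T=T and i=i] unfolding A measure_level[OF \<rho>] .
  qed
  have ac: "absolutely_continuous \<tau> \<rho>" unfolding absolutely_continuous_def
  proof
    fix Z assume "Z \<in> null_sets \<tau>"
    then have Z: "Z \<in> sets \<tau>" "measure \<tau> Z = 0" by (auto simp: null_sets_def measure_def)
    have "measure \<rho> Z \<le> e" if e: "e > 0" for e :: real
    proof -
      \<comment> \<open>K makes (\<alpha> + 1) / K equal to e / 2, and d below ensures that exp K
        times the \<tau>-mass of A is at most 1.\<close>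
      define K where "K = 2 * (\<alpha> + 1) / e"
      have K: "K > 0" using \<alpha>0 e by (simp add: K_def)
      define d where "d = min (e / 2) (1 / exp K)"
      have d: "d > 0" using e by (simp add: d_def)
      obtain A where A: "A \<in> alg" "measure \<rho> (sym_diff Z A) + measure \<tau> (sym_diff Z A) < d"
        using algebra_approx[OF algebra_alg R.finite_measure_axioms T.finite_measure_axioms st(2,1) _ d, of Z] Z st by auto
      have As: "A \<in> sets \<tau>" "A \<in> sets \<rho>" "Z \<in> sets \<rho>" using A(1) st Z by auto
      have D: "sym_diff Z A \<in> sets \<tau>" "sym_diff Z A \<in> sets \<rho>" using As Z(1) by auto
      have "measure \<tau> A \<le> measure \<tau> (Z \<union> sym_diff Z A)" using As Z D by (intro T.finite_measure_mono) auto
      also have "\<dots> \<le> measure \<tau> Z + measure \<tau> (sym_diff Z A)" using Z D by (intro measure_Un_le) auto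
      also have "\<dots> \<le> d" using Z(2) A(2) measure_nonneg[of \<rho> "sym_diff Z A"] by linarith
      finally have tA: "measure \<tau> A \<le> 1 / exp K" by (simp add: d_def)
      have "exp K * measure \<tau> A \<le> exp K * (1 / exp K)" using tA by (intro mult_left_mono) auto
      then have "K * measure \<rho> A \<le> \<alpha> + 1" using bnd[OF A(1), of K] by simp
      then have "measure \<rho> A \<le> (\<alpha> + 1) / K" using K by (simp add: pos_le_divide_eq mult.commute)
      moreover have "x / (2 * x / e) = e / 2" if "x > 0" for x using that e by simp
      from this[of "\<alpha> + 1"] have "(\<alpha> + 1) / K = e / 2" using \<alpha>0 by (simp only: K_def)
      ultimately have rA: "measure \<rho> A \<le> e / 2" by simp
      have "measure \<rho> Z \<le> measure \<rho> (A \<union> sym_diff Z A)" using As Z D by (intro R.finite_measure_mono) auto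
      also have "\<dots> \<le> measure \<rho> A + measure \<rho> (sym_diff Z A)" using As D by (intro measure_Un_le) auto
      also have "\<dots> \<le> e / 2 + e / 2"
      proof (rule add_mono[OF rA])
        have "d \<le> e / 2" by (simp add: d_def)
        then show "measure \<rho> (sym_diff Z A) \<le> e / 2" using A(2) measure_nonneg[of \<tau> "sym_diff Z A"] by linarith
      qed
      finally show ?thesis by simp
    qed
    then have "measure \<rho> Z \<le> 0" by (rule field_le_epsilon[of _ 0, simplified])
    then have "measure \<rho> Z = 0" using measure_nonneg[of \<rho> Z] by linarith
    then show "Z \<in> null_sets \<rho>" using Z(1) st by (auto simp: null_sets_def R.emeasure_eq_measure)
  qed
  show ?thesis
  proof (rule rel_entropy_le_of_young[OF ac])
    fix f C assume f: "f \<in> borel_measurable \<tau>" and C: "\<And>x. \<bar>f x\<bar> \<le> (C::real)"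
    have "\<forall>n. \<exists>p. (\<forall>c. \<bar>snd p c\<bar> \<le> C) \<and> (\<integral>x. \<bar>f x - snd p (\<L> (fst p) x)\<bar> \<partial>\<tau>) < 1 / real (Suc n)"
    proof
      fix n
      have "1 / real (Suc n) > 0" by simp
      from L1_approx[OF \<tau> f C this] obtain i F where
        "\<forall>c. \<bar>F c\<bar> \<le> C" "(\<integral>x. \<bar>f x - F (\<L> i x)\<bar> \<partial>\<tau>) < 1 / real (Suc n)" by blast
      then show "\<exists>p. (\<forall>c. \<bar>snd p c\<bar> \<le> C) \<and> (\<integral>x. \<bar>f x - snd p (\<L> (fst p) x)\<bar> \<partial>\<tau>) < 1 / real (Suc n)"
        by (intro exI[of _ "(i, F)"]) simp
    qed
    from choice[OF this] obtain p where
      p: "\<forall>n. (\<forall>c. \<bar>snd (p n) c\<bar> \<le> C) \<and> (\<integral>x. \<bar>f x - snd (p n) (\<L> (fst (p n)) x)\<bar> \<partial>\<tau>) < 1 / real (Suc n)" by blast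
    define i where "i n = fst (p n)" for n
    define F where "F n = snd (p n)" for n
    have F: "\<bar>F n c\<bar> \<le> C" "(\<integral>x. \<bar>f x - F n (\<L> (i n) x)\<bar> \<partial>\<tau>) < 1 / real (Suc n)" for n c
      using p unfolding i_def F_def by blast+
    define u where "u n x = F n (\<L> (i n) x)" for n x
    have uT: "integrable \<tau> (u n)" and uR: "integrable \<rho> (u n)" for n
      unfolding u_def by (rule label_integral[OF \<tau>], rule label_integral[OF \<rho>])
    have iT: "integrable \<tau> f" using f C by (intro M1_bounded_integrable[OF \<tau>, of _ C])
    have "(\<lambda>n. \<integral>x. norm (u n x - f x) \<partial>\<tau>) \<longlonglongrightarrow> 0"
    proof (rule tendsto_sandwich[OF _ _ tendsto_const])
      show "(\<lambda>n. 1 / real (Suc n)) \<longlonglongrightarrow> 0" using LIMSEQ_Suc[OF lim_1_over_n[where 'a=real]] by simp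
      show "eventually (\<lambda>n. (\<integral>x. norm (u n x - f x) \<partial>\<tau>) \<le> 1 / real (Suc n)) sequentially"
        using F(2) by (intro always_eventually allI) (simp add: u_def abs_minus_commute less_imp_le del: of_nat_Suc)
    qed (simp add: always_eventually)
    then obtain r where r: "strict_mono r" "AE x in \<tau>. (\<lambda>n. u (r n) x - f x) \<longlonglongrightarrow> 0"
      using tendsto_L1_AE_subseq[of \<tau> "\<lambda>n x. u n x - f x"] uT iT by auto
    have aT: "AE x in \<tau>. (\<lambda>n. u (r n) x) \<longlonglongrightarrow> f x" using r(2) by eventually_elim (rule LIM_zero_cancel)
    have aR: "AE x in \<rho>. (\<lambda>n. u (r n) x) \<longlonglongrightarrow> f x" by (rule absolutely_continuous_AE[OF sets_eq ac aT])
    have "(\<lambda>n. \<integral>x. u (r n) x \<partial>\<rho>) \<longlonglongrightarrow> (\<integral>x. f x \<partial>\<rho>)"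
    proof (rule integral_dominated_convergence[where w="\<lambda>_. C"])
      show "f \<in> borel_measurable \<rho>" unfolding measurable_eq by (rule f)
      show "u (r n) \<in> borel_measurable \<rho>" for n by (rule borel_measurable_integrable[OF uR])
      show "AE x in \<rho>. norm (u (r n) x) \<le> C" for n using F(1) by (intro AE_I2) (simp add: u_def)
    qed (use aR in auto)
    moreover have "(\<lambda>n. \<integral>x. exp (u (r n) x) \<partial>\<tau>) \<longlonglongrightarrow> (\<integral>x. exp (f x) \<partial>\<tau>)"
    proof (rule integral_dominated_convergence[where w="\<lambda>_. exp C"])
      show "AE x in \<tau>. (\<lambda>n. exp (u (r n) x)) \<longlonglongrightarrow> exp (f x)" using aT by eventually_elim (rule tendsto_exp)
      show "AE x in \<tau>. norm (exp (u (r n) x)) \<le> exp C" for n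
        using F(1) by (intro AE_I2) (auto simp: u_def abs_le_iff)
    qed (use f uT in \<open>auto intro: borel_measurable_integrable\<close>)
    ultimately have "(\<lambda>n. (\<integral>x. u (r n) x \<partial>\<rho>) - (\<integral>x. exp (u (r n) x) \<partial>\<tau>) + 1) \<longlonglongrightarrow> (\<integral>x. f x \<partial>\<rho>) - (\<integral>x. exp (f x) \<partial>\<tau>) + 1"
      by (intro tendsto_intros)
    moreover have "(\<integral>x. u n x \<partial>\<rho>) - (\<integral>x. exp (u n x) \<partial>\<tau>) + 1 \<le> \<alpha>" for n
      unfolding u_def using label_integral(2)[OF \<rho>, of "F n" "i n"] label_integral(2)[OF \<tau>, of "\<lambda>c. exp (F n c)" "i n"] Y[of "F n" "i n"] by simp
    ultimately show "(\<integral>x. f x \<partial>\<rho>) - (\<integral>x. exp (f x) \<partial>\<tau>) + 1 \<le> \<alpha>"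
      by (intro LIMSEQ_le_const2) auto
  qed
qed

text \<open>
  The limits of the cell masses define a finitely additive set function on the algebra of cells;
  the entropy bound makes it continuous at the empty set.
\<close>

lemma limit_measure_exists:
  assumes \<tau>: "\<tau> \<in> M1 E" and \<rho>: "\<And>j. \<rho> j \<in> M1 E"
    and conv: "\<And>i c. c \<in> Lab i \<Longrightarrow> (\<lambda>j. measure (\<rho> j) (cell i c)) \<longlonglongrightarrow> t i c"
    and Y: "\<And>i F. (\<Sum>c\<in>Lab i. F c * t i c) - (\<Sum>c\<in>Lab i. exp (F c) * measure \<tau> (cell i c)) + 1 \<le> \<alpha>"
  shows "\<exists>\<kappa>\<in>M1 E. (\<forall>i. \<forall>c\<in>Lab i. measure \<kappa> (cell i c) = t i c) \<and> rel_entropy \<kappa> \<tau> \<le> ereal \<alpha>"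
proof -
  interpret T: prob_space \<tau> by (rule M1_prob[OF \<tau>])
  interpret A: algebra E alg by (rule algebra_alg)
  \<comment> \<open>On the algebra of cells the limits exist, because each of its members is a
    finite union of cells of one level.\<close>
  define m where "m A = lim (\<lambda>j. measure (\<rho> j) A)" for A
  have lev: "(\<lambda>j. measure (\<rho> j) {x\<in>E. \<L> i x \<in> T}) \<longlonglongrightarrow> (\<Sum>c\<in>T \<inter> Lab i. t i c)" for i T
    unfolding measure_level[OF \<rho>] by (intro tendsto_sum conv) auto
  then have mlev: "m {x\<in>E. \<L> i x \<in> T} = (\<Sum>c\<in>T \<inter> Lab i. t i c)" for i T unfolding m_def by (rule limI)
  have mconv: "(\<lambda>j. measure (\<rho> j) A) \<longlonglongrightarrow> m A" if "A \<in> alg" for A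
    using that lev mlev by (auto simp: alg_def)
  have m0: "m A \<ge> 0" if "A \<in> alg" for A using mconv[OF that] by (rule LIMSEQ_le_const) auto
  have algs: "A \<in> sets (\<rho> j)" if "A \<in> alg" for A j using that M1_sets[OF \<rho>] sets_borel_on by auto
  have add: "m (A \<union> B) = m A + m B" if "A \<in> alg" "B \<in> alg" "A \<inter> B = {}" for A B
  proof -
    have "measure (\<rho> j) (A \<union> B) = measure (\<rho> j) A + measure (\<rho> j) B" for j
    proof -
      interpret P: prob_space "\<rho> j" by (rule M1_prob[OF \<rho>])
      show ?thesis using that algs by (intro P.finite_measure_Union) auto
    qed
    then have "(\<lambda>j. measure (\<rho> j) A + measure (\<rho> j) B) \<longlonglongrightarrow> m (A \<union> B)" using mconv[of "A \<union> B"] that by auto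
    moreover have "(\<lambda>j. measure (\<rho> j) A + measure (\<rho> j) B) \<longlonglongrightarrow> m A + m B" using mconv that by (intro tendsto_add)
    ultimately show ?thesis by (rule LIMSEQ_unique)
  qed
  have bnd: "K * m A \<le> \<alpha> + exp K * measure \<tau> A" if "A \<in> alg" for A K
  proof -
    obtain i T where A: "A = {x\<in>E. \<L> i x \<in> T}" using \<open>A \<in> alg\<close> by (auto simp: alg_def)
    show ?thesis using level_young_bound[OF \<tau> Y, where K=K and T=T and i=i] unfolding A mlev .
  qed
  have m1: "m E = 1"
  proof -
    have "measure (\<rho> j) E = 1" for j using prob_space.prob_space[OF M1_prob[OF \<rho>], of j] M1_space[OF \<rho>, of j] by simp
    then show ?thesis unfolding m_def by simp
  qed
  have \<alpha>0: "\<alpha> \<ge> 0"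
    using Y[where F="\<lambda>_. 0"] sum_cells[OF \<tau>] by simp
  \<comment> \<open>Along sets decreasing to the empty set the \<tau>-mass tends to 0, and the bound
    \<open>bnd\<close> with large K forces m to follow. This is the continuity that Caratheodory's
    theorem asks for.\<close>
  have cont: "(\<lambda>i. ennreal (m (S i))) \<longlonglongrightarrow> 0" if S: "range S \<subseteq> alg" "decseq S" "(\<Inter>i. S i) = {}" for S
  proof -
    have Ss: "range S \<subseteq> sets \<tau>" using S(1) M1_sets[OF \<tau>] sets_borel_on by auto
    have tS: "(\<lambda>i. measure \<tau> (S i)) \<longlonglongrightarrow> 0" using T.finite_Lim_measure_decseq[OF Ss S(2)] S(3) by simp
    have "(\<lambda>i. m (S i)) \<longlonglongrightarrow> 0"
    proof (rule LIMSEQ_I)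
      fix e :: real assume e: "e > 0"
      define K where "K = 2 * (\<alpha> + 1) / e"
      have K: "K > 0" using \<alpha>0 e by (simp add: K_def)
      have "eventually (\<lambda>i. measure \<tau> (S i) < 1 / exp K) sequentially" using tS by (intro order_tendstoD(2)) auto
      then obtain N where N: "\<And>i. i \<ge> N \<Longrightarrow> measure \<tau> (S i) < 1 / exp K" by (auto simp: eventually_sequentially)
      have "norm (m (S i) - 0) < e" if i: "i \<ge> N" for i
      proof -
        have Si: "S i \<in> alg" using S(1) by auto
        have "exp K * measure \<tau> (S i) \<le> exp K * (1 / exp K)" using N[OF i] by (intro mult_left_mono) auto
        then have "K * m (S i) \<le> \<alpha> + 1" using bnd[OF Si, of K] by simp
        then have "m (S i) \<le> (\<alpha> + 1) / K" using K by (simp add: pos_le_divide_eq mult.commute)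
        moreover have "x / (2 * x / e) = e / 2" if "x > 0" for x using that e by simp
      from this[of "\<alpha> + 1"] have "(\<alpha> + 1) / K = e / 2" using \<alpha>0 by (simp only: K_def)
        ultimately have "m (S i) \<le> e / 2" by simp
        then show ?thesis using m0[OF Si] e by simp
      qed
      then show "\<exists>no. \<forall>n\<ge>no. norm (m (S n) - 0) < e" by blast
    qed
    then show ?thesis using tendsto_ennrealI by fastforce
  qed
  have "\<exists>\<mu>. (\<forall>s\<in>alg. \<mu> s = ennreal (m s)) \<and> measure_space E (sigma_sets E alg) \<mu>"
  proof (rule A.caratheodory_empty_continuous[OF _ _ _ cont])
    have "m {} = 0" using mlev[of 0 "{}"] by simp
    then show "positive alg (\<lambda>A. ennreal (m A))" by (simp add: positive_def)
    show "additive alg (\<lambda>A. ennreal (m A))" using add m0 by (auto simp: additive_def)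
  qed auto
  then obtain \<mu> where \<mu>: "\<And>s. s \<in> alg \<Longrightarrow> \<mu> s = ennreal (m s)" "measure_space E (sigma_sets E alg) \<mu>" by blast
  define \<kappa> where "\<kappa> = measure_of E alg \<mu>"
  have sk: "sets \<kappa> = sigma_sets E alg" "space \<kappa> = E"
    unfolding \<kappa>_def using A.space_closed by (auto simp: sets_measure_of space_measure_of)
  have ek: "emeasure \<kappa> s = \<mu> s" if "s \<in> sigma_sets E alg" for s
    using \<mu>(2) that sk(1) A.space_closed unfolding measure_space_def
    by (intro emeasure_measure_of[OF \<kappa>_def]) auto
  have mk: "measure \<kappa> s = m s" if "s \<in> alg" for s
    using ek[of s] \<mu>(1)[OF that] m0[OF that] that by (simp add: measure_def sigma_sets.Basic)
  have "emeasure \<kappa> (space \<kappa>) = 1" using ek[of E] \<mu>(1)[OF A.top] m1 sk by (simp add: sigma_sets_top)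
  then have k: "\<kappa> \<in> M1 E" using sk sets_borel_on by (auto simp: M1_def intro!: prob_spaceI)
  have kt: "measure \<kappa> (cell i c) = t i c" if "c \<in> Lab i" for i c
  proof -
    have e: "cell i c = {x\<in>E. \<L> i x \<in> {c}}" by (auto simp: cell_def)
    then have "measure \<kappa> (cell i c) = (\<Sum>c\<in>{c} \<inter> Lab i. t i c)" using mk[OF algI[of i "{c}"]] mlev[of i "{c}"] by simp
    then show ?thesis using that by simp
  qed
  have "rel_entropy \<kappa> \<tau> \<le> ereal \<alpha>"
  proof (rule young_extend[OF \<tau> k])
    fix i F
    show "(\<Sum>c\<in>Lab i. F c * measure \<kappa> (cell i c)) - (\<Sum>c\<in>Lab i. exp (F c) * measure \<tau> (cell i c)) + 1 \<le> \<alpha>"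
      using Y[of F i] by (simp add: kt)
  qed
  then show ?thesis using k kt by blast
qed

end

section \<open>Partitions into continuity sets\<close>

text \<open>Spheres about a fixed centre are disjoint, so at most countably many carry mass and
  every interval (q, 2 q) contains a good radius. Centres in a countable dense set and q = 1 / (n +
  1) give a countable base.\<close>

lemma exists_continuity_base:
  fixes \<nu> :: "'s::{metric_space, second_countable_topology} measure"
  assumes "finite_measure \<nu>" "sets \<nu> = sets borel"
  shows "\<exists>B :: nat \<Rightarrow> 's set. (\<forall>k. open (B k) \<and> measure \<nu> (frontier (B k)) = 0) \<and>
    (\<forall>x U. open U \<longrightarrow> x \<in> U \<longrightarrow> (\<exists>k. x \<in> B k \<and> B k \<subseteq> U))"
proof -
  interpret N: finite_measure \<nu> by (rule assms(1))
  obtain D :: "'s set" where D: "countable D" "\<And>X. open X \<Longrightarrow> X \<noteq> {} \<Longrightarrow> \<exists>d\<in>D. d \<in> X"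
    using countable_dense_setE by blast
  have ex: "\<exists>r. q < r \<and> r < 2 * q \<and> measure \<nu> (frontier (ball x r)) = 0" if q: "q > 0" for x :: 's and q :: real
  proof -
    have dm: "dist x \<in> measurable \<nu> borel" using assms(2) by (subst measurable_cong_sets[OF assms(2) refl]) (intro borel_measurable_continuous_onI continuous_intros)
    interpret P: finite_measure "distr \<nu> borel (dist x)" by (rule N.finite_measure_distr[OF dm])
    have "uncountable {q<..<2*q}" using q by (simp add: uncountable_open_interval)
    then have "{q<..<2*q} - {r. measure (distr \<nu> borel (dist x)) {r} \<noteq> 0} \<noteq> {}"
      using P.countable_support by (metis countable_subset Diff_eq_empty_iff)
    then obtain r where r: "q < r" "r < 2 * q" "measure (distr \<nu> borel (dist x)) {r} = 0" by auto
    have "closure (ball x r) \<subseteq> cball x r" by (rule closure_minimal[OF ball_subset_cball closed_cball])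
    then have "frontier (ball x r) \<subseteq> dist x -` {r} \<inter> space \<nu>"
      using sets_eq_imp_space_eq[OF assms(2)] by (auto simp: frontier_def interior_open)
    then have "measure \<nu> (frontier (ball x r)) \<le> measure \<nu> (dist x -` {r} \<inter> space \<nu>)"
      using measurable_sets[OF dm, of "{r}"] by (intro N.finite_measure_mono) auto
    also have "\<dots> = 0" using r(3) dm by (simp add: measure_distr)
    finally have "measure \<nu> (frontier (ball x r)) = 0" using measure_nonneg[of \<nu> "frontier (ball x r)"] by linarith
    then show ?thesis using r by blast
  qed
  define rad where "rad x q = (SOME r. q < r \<and> r < 2 * q \<and> measure \<nu> (frontier (ball x r)) = 0)" for x :: 's and q :: real
  have rad: "q < rad x q \<and> rad x q < 2 * q \<and> measure \<nu> (frontier (ball x (rad x q))) = 0" if "q > 0" for x q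
    unfolding rad_def by (rule someI_ex[OF ex[OF that]])
  define P where "P = D \<times> (range (\<lambda>n. 1 / real (Suc n)))"
  have Pc: "countable P" using D(1) by (auto simp: P_def)
  obtain d0 where "d0 \<in> D" using D(2)[of UNIV] by auto
  then have Pne: "P \<noteq> {}" by (auto simp: P_def)
  define p where "p k = from_nat_into P k" for k
  have pP: "p k \<in> P" for k unfolding p_def by (rule from_nat_into[OF Pne])
  define B where "B k = ball (fst (p k)) (rad (fst (p k)) (snd (p k)))" for k
  have "open (B k) \<and> measure \<nu> (frontier (B k)) = 0" for k
  proof -
    have "snd (p k) > 0" using pP[of k] by (auto simp: P_def)
    then show ?thesis using rad[of "snd (p k)" "fst (p k)"] by (simp add: B_def)
  qed
  moreover have "\<exists>k. x \<in> B k \<and> B k \<subseteq> U" if U: "open U" "x \<in> U" for x U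
  proof -
    obtain e where e: "e > 0" "ball x e \<subseteq> U" using U open_contains_ball by blast
    \<comment> \<open>The point x lies within q of the centre d and the radius is below 2 q, so the
      ball stays within 3 q < e of x.\<close>
    obtain n where n: "inverse (real (Suc n)) < e / 3" using reals_Archimedean[of "e/3"] e by auto
    define q where "q = 1 / real (Suc n)"
    have q: "q > 0" "q < e / 3" using n by (auto simp: q_def inverse_eq_divide)
    obtain d where d: "d \<in> D" "d \<in> ball x q" using D(2)[of "ball x q"] q by auto
    have "(d, q) \<in> P" using d by (auto simp: P_def q_def)
    then obtain k where k: "p k = (d, q)" unfolding p_def using Pc by (metis from_nat_into_surj)
    have r: "q < rad d q" "rad d q < 2 * q" using rad[OF q(1), of d] by auto
    have "x \<in> B k" using d r k by (simp add: B_def dist_commute)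
    moreover have "B k \<subseteq> ball x e"
    proof
      fix y assume "y \<in> B k"
      then have "dist d y < 2 * q" using r k by (simp add: B_def)
      moreover have "dist x d < q" using d by simp
      ultimately have "dist x y < 3 * q" using dist_triangle[of x y d] by linarith
      then show "y \<in> ball x e" using q by simp
    qed
    ultimately show ?thesis using e by blast
  qed
  ultimately show ?thesis by blast
qed

section \<open>Partitions generated by finitely many open sets\<close>

text \<open>The label records which of the first j sets contain x. This gives at most 2^j cells, and
  passing to a coarser level is intersection with an initial segment.\<close>

definition lab :: "(nat \<Rightarrow> 'a set) \<Rightarrow> nat \<Rightarrow> 'a \<Rightarrow> nat set" where "lab A j x = {k. k < j \<and> x \<in> A k}"

lemma lab_in: "lab A j x \<in> Pow {..<j}" by (auto simp: lab_def)

lemma lab_restrict: "i \<le> j \<Longrightarrow> lab A i x = lab A j x \<inter> {..<i}" by (auto simp: lab_def)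

lemma lab_cell_step:
  "c \<subseteq> {..<Suc i} \<Longrightarrow> {x. lab A (Suc i) x = c} = {x. lab A i x = c \<inter> {..<i}} \<inter> (if i \<in> c then A i else - A i)"
proof (rule set_eqI)
  fix x assume c: "c \<subseteq> {..<Suc i}"
  have l: "lab A i x \<subseteq> {..<i}" using lab_in[of A i x] by simp
  have s: "lab A (Suc i) x = (if x \<in> A i then insert i (lab A i x) else lab A i x)"
    by (auto simp: lab_def less_Suc_eq)
  have i: "i \<notin> lab A i x" by (simp add: lab_def)
  show "x \<in> {x. lab A (Suc i) x = c} \<longleftrightarrow> x \<in> {x. lab A i x = c \<inter> {..<i}} \<inter> (if i \<in> c then A i else - A i)"
  proof (cases "x \<in> A i")
    case True
    have "insert i (lab A i x) = c \<longleftrightarrow> lab A i x = c \<inter> {..<i} \<and> i \<in> c"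
      using l i c unfolding lessThan_Suc by auto
    then show ?thesis using True s by simp
  next
    case False
    have "lab A i x = c \<longleftrightarrow> lab A i x = c \<inter> {..<i} \<and> i \<notin> c"
      using l i c unfolding lessThan_Suc by auto
    then show ?thesis using False s by auto
  qed
qed

text \<open>The frontier of a finite intersection of sets and complements lies in the union of their
  frontiers. Z stands for the union of all frontiers, a countable union of null sets in the
  application.\<close>

lemma lab_cell_borel_frontier:
  assumes "\<And>k. open (A k)" "\<And>k. frontier (A k) \<subseteq> Z"
  shows "{x. lab A i x = c} \<in> sets borel \<and> frontier {x. lab A i x = c} \<subseteq> Z"
proof (induction i arbitrary: c)
  case 0
  have "{x. lab A 0 x = c} = (if c = {} then UNIV else {})" by (auto simp: lab_def)
  then show ?case by simp
next
  case (Suc i)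
  show ?case
  proof (cases "c \<subseteq> {..<Suc i}")
    case True
    let ?S = "{x. lab A i x = c \<inter> {..<i}}" and ?T = "if i \<in> c then A i else - A i"
    have "frontier (?S \<inter> ?T) \<subseteq> frontier ?S \<union> frontier ?T" by (rule frontier_Int_subset)
    moreover have "frontier ?T \<subseteq> Z" using assms(2)[of i] by (simp add: frontier_complement)
    moreover have "?T \<in> sets borel" using assms(1)[of i] by auto
    ultimately show ?thesis unfolding lab_cell_step[OF True] using Suc.IH[of "c \<inter> {..<i}"] by auto
  next
    case False
    moreover have "lab A (Suc i) x \<subseteq> {..<Suc i}" for x using lab_in[of A "Suc i" x] by simp
    ultimately have "{x. lab A (Suc i) x = c} = {}" by auto
    then show ?thesis by simp
  qed
qed

lemma partition_seq_lab:
  assumes o: "\<And>k. open (A k)" and b: "\<And>x U. x \<in> E \<Longrightarrow> open U \<Longrightarrow> x \<in> U \<Longrightarrow> \<exists>k. x \<in> A k \<and> A k \<subseteq> U"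
  shows "partition_seq E (lab A) (\<lambda>i. Pow {..<i})"
proof
  show "finite (Pow {..<i})" for i :: nat by simp
  show "lab A i x \<in> Pow {..<i}" for i x by (rule lab_in)
  show "lab A i x = lab A i y" if "i \<le> j" "lab A j x = lab A j y" for i j x y
    using that lab_restrict[of i j A] by simp
  show "{x\<in>E. lab A i x = c} \<in> sets (borel_on E)" for i c
  proof -
    have "{x\<in>E. lab A i x = c} = E \<inter> {x. lab A i x = c}" by auto
    moreover have "{x. lab A i x = c} \<in> sets borel" using lab_cell_borel_frontier[of A UNIV] o by auto
    ultimately show ?thesis by (auto simp: sets_restrict_space)
  qed
  show "\<exists>i. \<forall>y\<in>E. lab A i y = lab A i x \<longrightarrow> y \<in> U" if x: "x \<in> E" "open U" "x \<in> U" for x U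
  proof -
    obtain k where k: "x \<in> A k" "A k \<subseteq> U" using b[OF x] by blast
    have "y \<in> U" if "lab A (Suc k) y = lab A (Suc k) x" for y
    proof -
      have "k \<in> lab A (Suc k) y" using that k(1) by (simp add: lab_def)
      then show ?thesis using k(2) by (auto simp: lab_def)
    qed
    then show ?thesis by blast
  qed
qed

section \<open>Product measures and grids of rectangles\<close>

lemma product_sets:
  assumes "\<mu> \<in> M1 {0..}" "\<nu> \<in> M1 (UNIV :: 's::second_countable_topology set)"
  shows "sets (\<mu> \<Otimes>\<^sub>M \<nu>) = sets (borel_on (halfspace :: (real \<times> 's) set))"
proof -
  \<comment> \<open>A point mass supplies the joint law that \<open>sets_marginals\<close> speaks
    about.\<close>
  obtain \<rho> :: "(real \<times> 's) measure" where \<rho>: "\<rho> \<in> M1 halfspace"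
    using empirical_in_M1[of 1 "\<lambda>_. (0, undefined)" "halfspace :: (real \<times> 's) set"] by auto
  have "sets (\<mu> \<Otimes>\<^sub>M \<nu>) = sets (marg1 \<rho> \<Otimes>\<^sub>M marg2 \<rho>)"
    using M1_sets[OF assms(1)] M1_sets[OF assms(2)] by (intro sets_pair_measure_cong) (auto simp: marg1_def marg2_def)
  also have "\<dots> = sets \<rho>" by (rule sets_marginals[OF \<rho>])
  finally show ?thesis using M1_sets[OF \<rho>] by simp
qed

lemma product_M1:
  assumes "\<mu> \<in> M1 {0..}" "\<nu> \<in> M1 (UNIV :: 's::second_countable_topology set)"
  shows "\<mu> \<Otimes>\<^sub>M \<nu> \<in> M1 halfspace"
proof -
  interpret A: prob_space \<mu> by (rule M1_prob[OF assms(1)])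
  interpret B: prob_space \<nu> by (rule M1_prob[OF assms(2)])
  interpret pair_prob_space \<mu> \<nu> ..
  show ?thesis using product_sets[OF assms] prob_space_axioms by (simp add: M1_def)
qed

lemma product_rect:
  assumes "\<mu> \<in> M1 {0..}" "\<nu> \<in> M1 (UNIV :: 's::second_countable_topology set)" "K \<in> sets \<mu>" "L \<in> sets \<nu>"
  shows "measure (\<mu> \<Otimes>\<^sub>M \<nu>) (K \<times> L) = measure \<mu> K * measure \<nu> L"
proof -
  interpret A: prob_space \<mu> by (rule M1_prob[OF assms(1)])
  interpret B: prob_space \<nu> by (rule M1_prob[OF assms(2)])
  show ?thesis using B.emeasure_pair_measure_Times[OF assms(3,4)] by (simp add: measure_def enn2real_mult)
qed

abbreviation mutual_entropy :: "(real \<times> 's::topological_space) measure \<Rightarrow> ereal" where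
  "mutual_entropy \<rho> \<equiv> rel_entropy \<rho> (marg1 \<rho> \<Otimes>\<^sub>M marg2 \<rho>)"

abbreviation labels2 :: "nat \<Rightarrow> (nat set \<times> nat set) set" where
  "labels2 i \<equiv> Pow {..<i} \<times> Pow {..<i}"

text \<open>At level i both factors are cut by their first i sets. The joint cells are rectangles,
  so the product of the margins is evaluated on them as a product of marginal cell masses.\<close>

locale grid =
  fixes A :: "nat \<Rightarrow> real set" and B :: "nat \<Rightarrow> 's::second_countable_topology set"
  assumes oA: "\<And>k. open (A k)" and bA: "\<And>x U. open U \<Longrightarrow> x \<in> U \<Longrightarrow> \<exists>k. x \<in> A k \<and> A k \<subseteq> U"
    and oB: "\<And>k. open (B k)" and bB: "\<And>x U. open U \<Longrightarrow> x \<in> U \<Longrightarrow> \<exists>k. x \<in> B k \<and> B k \<subseteq> U"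
begin

sublocale PA: partition_seq "{0..}" "lab A" "\<lambda>i. Pow {..<i}" using oA bA by (intro partition_seq_lab)
sublocale PB: partition_seq UNIV "lab B" "\<lambda>i. Pow {..<i}" using oB bB by (intro partition_seq_lab)

lemma rect_cell: "{z\<in>halfspace. (lab A i (fst z), lab B i (snd z)) = c} = PA.cell i (fst c) \<times> PB.cell i (snd c)"
  by (cases c) (auto simp: PA.cell_def PB.cell_def)

lemma cellA_sets: "\<mu> \<in> M1 {0..} \<Longrightarrow> PA.cell i c \<in> sets \<mu>"
  unfolding PA.cell_def using PA.cell_sets by (subst M1_sets)

lemma cellB_sets: "\<nu> \<in> M1 UNIV \<Longrightarrow> PB.cell i c \<in> sets \<nu>"
  unfolding PB.cell_def using PB.cell_sets by (subst M1_sets)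

sublocale P: partition_seq halfspace "\<lambda>i z. (lab A i (fst z), lab B i (snd z))" "\<lambda>i. labels2 i"
proof
  show "finite (labels2 i)" for i :: nat by simp
  show "(lab A i (fst z), lab B i (snd z)) \<in> labels2 i" for i and z :: "real \<times> 's"
    using lab_in[of A i "fst z"] lab_in[of B i "snd z"] by auto
  show "(lab A i (fst x), lab B i (snd x)) = (lab A i (fst y), lab B i (snd y))"
    if "i \<le> j" "(lab A j (fst x), lab B j (snd x)) = (lab A j (fst y), lab B j (snd y))" for i j and x y :: "real \<times> 's"
    using that lab_restrict[of i j A] lab_restrict[of i j B] by simp
  show "{z\<in>halfspace. (lab A i (fst z), lab B i (snd z)) = c} \<in> sets (borel_on halfspace)" for i c
  proof -
    obtain \<rho> :: "(real \<times> 's) measure" where \<rho>: "\<rho> \<in> M1 halfspace"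
      using empirical_in_M1[of 1 "\<lambda>_. (0, undefined)" "halfspace :: (real \<times> 's) set"] by auto
    show ?thesis unfolding rect_cell product_sets[OF marg1_M1[OF \<rho>] marg2_M1[OF \<rho>], symmetric]
      using cellA_sets[OF marg1_M1[OF \<rho>]] cellB_sets[OF marg2_M1[OF \<rho>]] by (intro pair_measureI)
  qed
  show "\<exists>i. \<forall>y\<in>halfspace. (lab A i (fst y), lab B i (snd y)) = (lab A i (fst x), lab B i (snd x)) \<longrightarrow> y \<in> U"
    if x: "x \<in> halfspace" "open U" "x \<in> U" for x :: "real \<times> 's" and U
  proof -
    obtain S T where ST: "open S" "open T" "x \<in> S \<times> T" "S \<times> T \<subseteq> U" using x open_prod_elim by metis
    obtain i where i: "\<forall>y\<in>{0..}. lab A i y = lab A i (fst x) \<longrightarrow> y \<in> S" using PA.shrink[of "fst x" S] ST x by auto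
    obtain j where j: "\<forall>y\<in>UNIV. lab B j y = lab B j (snd x) \<longrightarrow> y \<in> T" using PB.shrink[of "snd x" T] ST by auto
    have "y \<in> U" if y: "y \<in> halfspace" "lab A (max i j) (fst y) = lab A (max i j) (fst x)" "lab B (max i j) (snd y) = lab B (max i j) (snd x)" for y
    proof -
      have "lab A i (fst y) = lab A i (fst x)" using lab_restrict[of i "max i j" A] y(2) by simp
      moreover have "lab B j (snd y) = lab B j (snd x)" using lab_restrict[of j "max i j" B] y(3) by simp
      ultimately have "fst y \<in> S" "snd y \<in> T" using i j y(1) by auto
      then show ?thesis using ST(4) by (metis mem_Sigma_iff prod.collapse subsetD)
    qed
    then show ?thesis by (intro exI[of _ "max i j"]) auto
  qed
qed

definition mtab :: "(real \<times> 's) measure \<Rightarrow> nat \<Rightarrow> nat set \<Rightarrow> nat set \<Rightarrow> real" where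
  "mtab \<rho> i K L = measure \<rho> (P.cell i (K, L))"

text \<open>The mutual information, under \<rho>, of the two labels at level i.\<close>

definition ment :: "nat \<Rightarrow> (real \<times> 's) measure \<Rightarrow> real" where
  "ment i \<rho> = tent (Pow {..<i}) (Pow {..<i}) (mtab \<rho> i)"

lemma P_cell: "P.cell i (K, L) = PA.cell i K \<times> PB.cell i L"
  unfolding P.cell_def rect_cell by simp

lemma mtab_nonneg: "mtab \<rho> i K L \<ge> 0" by (simp add: mtab_def)

lemma mtab_rows:
  assumes \<rho>: "\<rho> \<in> M1 halfspace"
  shows "(\<Sum>L\<in>Pow {..<i}. mtab \<rho> i K L) = measure (marg1 \<rho>) (PA.cell i K)"
proof -
  interpret prob_space \<rho> by (rule M1_prob[OF \<rho>])
  have cs: "P.cell i (K, L) \<in> sets \<rho>" for L using P.cell_sets M1_sets[OF \<rho>] unfolding P.cell_def by auto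
  have "measure (marg1 \<rho>) (PA.cell i K) = measure \<rho> (fst -` PA.cell i K \<inter> halfspace)"
    unfolding marg1_def using marg_measurable(1) cellA_sets[OF marg1_M1[OF \<rho>]] M1_space[OF \<rho>]
    by (subst measure_distr) (auto simp: M1_measurable[OF \<rho>] marg1_def)
  also have "fst -` PA.cell i K \<inter> halfspace = (\<Union>L\<in>Pow {..<i}. P.cell i (K, L))"
  proof (intro equalityI subsetI)
    fix z :: "real \<times> 's" assume z: "z \<in> fst -` PA.cell i K \<inter> halfspace"
    then have "z \<in> P.cell i (K, lab B i (snd z))" by (auto simp: P_cell PB.cell_def mem_Times_iff)
    then show "z \<in> (\<Union>L\<in>Pow {..<i}. P.cell i (K, L))" by (intro UN_I[OF lab_in])
  qed (auto simp: P_cell PA.cell_def)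
  also have "measure \<rho> \<dots> = (\<Sum>L\<in>Pow {..<i}. measure \<rho> (P.cell i (K, L)))"
    using cs by (intro finite_measure_finite_Union) (auto simp: P.cell_def disjoint_family_on_def)
  finally show ?thesis by (simp add: mtab_def)
qed

lemma mtab_cols:
  assumes \<rho>: "\<rho> \<in> M1 halfspace"
  shows "(\<Sum>K\<in>Pow {..<i}. mtab \<rho> i K L) = measure (marg2 \<rho>) (PB.cell i L)"
proof -
  interpret prob_space \<rho> by (rule M1_prob[OF \<rho>])
  have cs: "P.cell i (K, L) \<in> sets \<rho>" for K using P.cell_sets M1_sets[OF \<rho>] unfolding P.cell_def by auto
  have "measure (marg2 \<rho>) (PB.cell i L) = measure \<rho> (snd -` PB.cell i L \<inter> halfspace)"
    unfolding marg2_def using marg_measurable(2) cellB_sets[OF marg2_M1[OF \<rho>]] M1_space[OF \<rho>]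
    by (subst measure_distr) (auto simp: M1_measurable[OF \<rho>] marg2_def)
  also have "snd -` PB.cell i L \<inter> halfspace = (\<Union>K\<in>Pow {..<i}. P.cell i (K, L))"
  proof (intro equalityI subsetI)
    fix z :: "real \<times> 's" assume z: "z \<in> snd -` PB.cell i L \<inter> halfspace"
    then have "z \<in> P.cell i (lab A i (fst z), L)" by (auto simp: P_cell PA.cell_def mem_Times_iff)
    then show "z \<in> (\<Union>K\<in>Pow {..<i}. P.cell i (K, L))" by (intro UN_I[OF lab_in])
  qed (auto simp: P_cell PA.cell_def)
  also have "measure \<rho> \<dots> = (\<Sum>K\<in>Pow {..<i}. measure \<rho> (P.cell i (K, L)))"
    using cs by (intro finite_measure_finite_Union) (auto simp: P.cell_def disjoint_family_on_def)
  finally show ?thesis by (simp add: mtab_def)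
qed

lemma mtab_total: "\<rho> \<in> M1 halfspace \<Longrightarrow> (\<Sum>K\<in>Pow {..<i}. \<Sum>L\<in>Pow {..<i}. mtab \<rho> i K L) = 1"
  using P.sum_cells[of \<rho> i] by (simp add: mtab_def sum.cartesian_product split_beta)

lemma product_cell:
  assumes "\<mu> \<in> M1 {0..}" "\<nu> \<in> M1 UNIV"
  shows "measure (\<mu> \<Otimes>\<^sub>M \<nu>) (P.cell i (K, L)) = measure \<mu> (PA.cell i K) * measure \<nu> (PB.cell i L)"
  unfolding P_cell using assms cellA_sets cellB_sets by (intro product_rect)

text \<open>Row and column sums of the table are marginal cell masses, so \<open>tent_young\<close>
  compares \<rho> with the product of its margins.\<close>

lemma ment_young:
  assumes \<rho>: "\<rho> \<in> M1 halfspace"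
  shows "(\<Sum>c\<in>labels2 i. F c * measure \<rho> (P.cell i c))
     - (\<Sum>c\<in>labels2 i. exp (F c) * measure (marg1 \<rho> \<Otimes>\<^sub>M marg2 \<rho>) (P.cell i c)) + 1 \<le> ment i \<rho>"
proof -
  have "(\<Sum>k\<in>Pow {..<i}. \<Sum>l\<in>Pow {..<i}. mtab \<rho> i k l * F (k, l))
    - (\<Sum>k\<in>Pow {..<i}. \<Sum>l\<in>Pow {..<i}. (\<Sum>l\<in>Pow {..<i}. mtab \<rho> i k l) * (\<Sum>k\<in>Pow {..<i}. mtab \<rho> i k l) * exp (F (k, l))) + 1 \<le> ment i \<rho>"
    unfolding ment_def by (rule tent_young) (auto simp: mtab_nonneg mtab_total[OF \<rho>])
  then show ?thesis unfolding mtab_rows[OF \<rho>] mtab_cols[OF \<rho>] product_cell[OF marg1_M1[OF \<rho>] marg2_M1[OF \<rho>], symmetric]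
    by (simp add: mtab_def sum.cartesian_product split_beta mult.commute)
qed

text \<open>The extremal function \<open>ln (p / (r c))\<close> is truncated at \<open>-N\<close> on the cells of mass zero.\<close>

lemma ment_le_rel_entropy:
  assumes \<rho>: "\<rho> \<in> M1 halfspace"
  shows "ereal (ment i \<rho>) \<le> mutual_entropy \<rho>"
proof -
  let ?\<tau> = "marg1 \<rho> \<Otimes>\<^sub>M marg2 \<rho>"
  have \<tau>: "?\<tau> \<in> M1 halfspace" by (rule product_M1[OF marg1_M1[OF \<rho>] marg2_M1[OF \<rho>]])
  interpret prob_pair \<rho> ?\<tau>
    unfolding prob_pair_def prob_pair_axioms_def using M1_prob[OF \<tau>] M1_prob[OF \<rho>] sets_marginals[OF \<rho>] by auto
  let ?L = "Pow {..<i}"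
  define p where "p c = measure \<rho> (P.cell i c)" for c
  define q where "q c = measure ?\<tau> (P.cell i c)" for c
  have pq: "p c \<ge> 0" "q c \<ge> 0" for c by (auto simp: p_def q_def)
  have qrc: "q (k, l) = measure (marg1 \<rho>) (PA.cell i k) * measure (marg2 \<rho>) (PB.cell i l)" for k l
    unfolding q_def by (rule product_cell[OF marg1_M1[OF \<rho>] marg2_M1[OF \<rho>]])
  have ment: "ment i \<rho> = (\<Sum>c\<in>?L\<times>?L. p c * ln (p c / q c))"
  proof -
    define r where "r k = (\<Sum>l\<in>?L. mtab \<rho> i k l)" for k
    define c where "c l = (\<Sum>k\<in>?L. mtab \<rho> i k l)" for l
    have "ment i \<rho> = (\<Sum>k\<in>?L. \<Sum>l\<in>?L. xlnx (mtab \<rho> i k l)) - (\<Sum>k\<in>?L. \<Sum>l\<in>?L. mtab \<rho> i k l * ln (r k)) - (\<Sum>l\<in>?L. \<Sum>k\<in>?L. mtab \<rho> i k l * ln (c l))"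
      unfolding ment_def tent_def r_def c_def xlnx_def by (simp add: sum_distrib_right)
    also have "(\<Sum>l\<in>?L. \<Sum>k\<in>?L. mtab \<rho> i k l * ln (c l)) = (\<Sum>k\<in>?L. \<Sum>l\<in>?L. mtab \<rho> i k l * ln (c l))" by (rule sum.swap)
    finally have "ment i \<rho> = (\<Sum>k\<in>?L. \<Sum>l\<in>?L. xlnx (mtab \<rho> i k l) - mtab \<rho> i k l * ln (r k) - mtab \<rho> i k l * ln (c l))"
      by (simp add: sum_subtractf)
    also have "\<dots> = (\<Sum>k\<in>?L. \<Sum>l\<in>?L. p (k, l) * ln (p (k, l) / q (k, l)))"
    proof (intro sum.cong refl)
      fix k l assume kl: "k \<in> ?L" "l \<in> ?L"
      show "xlnx (mtab \<rho> i k l) - mtab \<rho> i k l * ln (r k) - mtab \<rho> i k l * ln (c l) = p (k, l) * ln (p (k, l) / q (k, l))"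
      proof (cases "mtab \<rho> i k l = 0")
        case True
        then show ?thesis by (simp add: p_def mtab_def xlnx_def)
      next
        case False
        then have m: "mtab \<rho> i k l > 0" using mtab_nonneg[of \<rho> i k l] by linarith
        have "mtab \<rho> i k l \<le> r k" unfolding r_def using kl mtab_nonneg by (intro member_le_sum) auto
        moreover have "mtab \<rho> i k l \<le> c l" unfolding c_def using kl mtab_nonneg by (intro member_le_sum[where f="\<lambda>k. mtab \<rho> i k l"]) auto
        ultimately have rc: "r k > 0" "c l > 0" using m by auto
        have "q (k, l) = r k * c l" unfolding qrc r_def c_def mtab_rows[OF \<rho>] mtab_cols[OF \<rho>] ..
        moreover have "p (k, l) = mtab \<rho> i k l" by (simp add: p_def mtab_def)
        ultimately show ?thesis using m rc by (simp add: xlnx_def ln_div ln_mult algebra_simps)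
      qed
    qed
    finally show ?thesis by (simp add: sum.cartesian_product split_beta)
  qed
  \<comment> \<open>A cell that is null for the product has a null row or a null column and hence
    carries no mass.\<close>
  have q0: "p c = 0" if qc: "q c = 0" "c \<in> ?L \<times> ?L" for c
  proof -
    obtain k l where c: "c = (k, l)" "k \<in> ?L" "l \<in> ?L" using qc by auto
    have a: "p c \<le> measure (marg1 \<rho>) (PA.cell i k)"
      unfolding mtab_rows[OF \<rho>, symmetric] c p_def mtab_def[symmetric] using c mtab_nonneg by (intro member_le_sum) auto
    have b: "p c \<le> measure (marg2 \<rho>) (PB.cell i l)"
      unfolding mtab_cols[OF \<rho>, symmetric] c p_def mtab_def[symmetric] using c mtab_nonneg by (intro member_le_sum[where f="\<lambda>k. mtab \<rho> i k l"]) auto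
    show ?thesis using qc(1) a b pq(1)[of c] unfolding c(1) qrc by auto
  qed
  have bound: "ereal (ment i \<rho> - exp (- real N)) \<le> rel_entropy \<rho> ?\<tau>" for N
  proof -
    define F where "F c = (if p c = 0 then - real N else ln (p c / q c))" for c
    define C where "C = (\<Sum>c\<in>?L\<times>?L. \<bar>F c\<bar>)"
    have FC: "\<bar>F (lab A i (fst z), lab B i (snd z))\<bar> \<le> C" for z
      unfolding C_def using lab_in[of A i "fst z"] lab_in[of B i "snd z"]
      by (intro member_le_sum[where f="\<lambda>c. \<bar>F c\<bar>"]) auto
    have "(\<Sum>c\<in>?L\<times>?L. F c * p c) = ment i \<rho>" unfolding ment by (intro sum.cong) (auto simp: F_def)
    \<comment> \<open>Charged cells contribute exp (F c) q c = p c; the others contribute exp (-N) q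
      c in place of the 0 that the value -\<infinity> would give.\<close>
    moreover have "(\<Sum>c\<in>?L\<times>?L. exp (F c) * q c) \<le> 1 + exp (- real N)"
    proof -
      have "(\<Sum>c\<in>?L\<times>?L. exp (F c) * q c) \<le> (\<Sum>c\<in>?L\<times>?L. p c + exp (- real N) * q c)"
      proof (rule sum_mono)
        fix c assume c: "c \<in> ?L \<times> ?L"
        show "exp (F c) * q c \<le> p c + exp (- real N) * q c"
        proof (cases "p c = 0")
          case False
          then have "p c > 0" "q c > 0" using q0[OF _ c] pq[of c] by (auto simp: less_le)
          then show ?thesis by (simp add: F_def)
        qed (simp add: F_def)
      qed
      also have "\<dots> = 1 + exp (- real N)"
        using P.sum_cells[OF \<rho>, of i] P.sum_cells[OF \<tau>, of i] by (simp add: sum.distrib sum_distrib_left[symmetric] p_def q_def)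
      finally show ?thesis .
    qed
    moreover have "ereal ((\<integral>z. F (lab A i (fst z), lab B i (snd z)) \<partial>\<rho>) - (\<integral>z. exp (F (lab A i (fst z), lab B i (snd z))) \<partial>?\<tau>) + 1) \<le> rel_entropy \<rho> ?\<tau>"
      using P.label_measurable[of F i] by (intro young_le_rel_entropy[OF _ FC]) (simp add: M1_measurable[OF \<tau>])
    ultimately have "ereal (ment i \<rho> - exp (- real N)) \<le> ereal ((\<integral>z. F (lab A i (fst z), lab B i (snd z)) \<partial>\<rho>) - (\<integral>z. exp (F (lab A i (fst z), lab B i (snd z))) \<partial>?\<tau>) + 1)"
      using P.label_integral(2)[OF \<rho>, of F i] P.label_integral(2)[OF \<tau>, of "\<lambda>c. exp (F c)" i] by (simp add: p_def q_def)
    also note \<open>\<dots> \<le> rel_entropy \<rho> ?\<tau>\<close>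
    finally show ?thesis .
  qed
  have "(\<lambda>N. exp (- real N)) \<longlonglongrightarrow> 0"
    by (intro filterlim_compose[OF exp_at_bot] filterlim_compose[OF filterlim_uminus_at_bot_at_top] filterlim_real_sequentially)
  then have "(\<lambda>N. ment i \<rho> - exp (- real N)) \<longlonglongrightarrow> ment i \<rho> - 0" by (intro tendsto_intros)
  then have lim: "(\<lambda>N. ereal (ment i \<rho> - exp (- real N))) \<longlonglongrightarrow> ereal (ment i \<rho>)" by simp
  show ?thesis by (rule LIMSEQ_le_const2[OF lim]) (use bound in blast)
qed

end

section \<open>Neighbourhoods controlling cell masses\<close>

text \<open>The functions max 0 (1 - m \<open>infdist\<close>) decrease to the indicator of the
  closed set as m grows.\<close>

lemma lipschitz_upper_approx:
  fixes C :: "'a::metric_space set"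
  assumes "finite_measure \<nu>" "sets \<nu> = sets borel" "closed C" "\<epsilon> > 0"
  shows "\<exists>(f :: 'a \<Rightarrow> real) L. L \<ge> 0 \<and> (\<forall>x y. \<bar>f x - f y\<bar> \<le> L * dist x y) \<and> (\<forall>x. 0 \<le> f x \<and> f x \<le> 1)
     \<and> (\<forall>x\<in>C. f x = 1) \<and> (\<integral>x. f x \<partial>\<nu>) < measure \<nu> C + \<epsilon>"
proof (cases "C = {}")
  \<comment> \<open>\<open>infdist\<close> to the empty set is 0 by convention, so the construction
    below would give the constant 1.\<close>
  case True
  then show ?thesis using assms(4) by (intro exI[of _ "\<lambda>_. 0"] exI[of _ 0]) auto
next
  case False
  interpret N: finite_measure \<nu> by (rule assms(1))
  define f where "f m x = max 0 (1 - real m * infdist x C)" for m x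
  have f01: "0 \<le> f m x \<and> f m x \<le> 1" for m x by (simp add: f_def infdist_nonneg)
  have f1: "f m x = 1" if "x \<in> C" for m x using that by (simp add: f_def)
  have fl: "\<bar>f m x - f m y\<bar> \<le> real m * dist x y" for m x y
  proof -
    have "\<bar>f m x - f m y\<bar> \<le> \<bar>real m * infdist x C - real m * infdist y C\<bar>" unfolding f_def by (auto simp: max_def)
    also have "\<dots> = real m * \<bar>infdist x C - infdist y C\<bar>" by (simp add: abs_mult right_diff_distrib[symmetric])
    also have "\<dots> \<le> real m * dist x y" using infdist_triangle_abs[of x C y] by (intro mult_left_mono) auto
    finally show ?thesis .
  qed
  have fm: "f m \<in> borel_measurable \<nu>" for m
    unfolding measurable_cong_sets[OF assms(2) refl] f_def
    by (intro borel_measurable_continuous_onI continuous_intros)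
  have ind: "indicator C \<in> borel_measurable \<nu>"
    using assms(2,3) by (intro borel_measurable_indicator) auto
  have "(\<lambda>m. \<integral>x. f m x \<partial>\<nu>) \<longlonglongrightarrow> (\<integral>x. indicator C x \<partial>\<nu>)"
  proof (rule integral_dominated_convergence[where w="\<lambda>_. 1"])
    show "AE x in \<nu>. (\<lambda>m. f m x) \<longlonglongrightarrow> indicator C x"
    proof (rule AE_I2)
      fix x
      show "(\<lambda>m. f m x) \<longlonglongrightarrow> indicator C x"
      proof (cases "x \<in> C")
        case True
        then show ?thesis using f1 by simp
      next
        case False
        then have d: "infdist x C > 0"
          using in_closed_iff_infdist_zero[OF assms(3) \<open>C \<noteq> {}\<close>, of x] infdist_nonneg[of x C] by linarith
        obtain N where N: "real N > 1 / infdist x C" using reals_Archimedean2 by blast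
        have "f m x = 0" if "m \<ge> N" for m
        proof -
          have "1 < real N * infdist x C" using N d by (simp add: divide_less_eq)
          also have "\<dots> \<le> real m * infdist x C" using that d by (intro mult_right_mono) auto
          finally show ?thesis by (simp add: f_def)
        qed
        then have "eventually (\<lambda>m. f m x = 0) sequentially" by (auto simp: eventually_sequentially)
        then show ?thesis using False by (simp add: tendsto_eventually)
      qed
    qed
    show "AE x in \<nu>. norm (f m x) \<le> 1" for m using f01[of m] by auto
  qed (use fm ind in auto)
  moreover have "(\<integral>x. indicator C x \<partial>\<nu>) = measure \<nu> C"
    using sets_eq_imp_space_eq[OF assms(2)] by simp
  ultimately have "eventually (\<lambda>m. (\<integral>x. f m x \<partial>\<nu>) < measure \<nu> C + \<epsilon>) sequentially"
    using assms(4) by (intro order_tendstoD(2)) auto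
  then obtain m where "(\<integral>x. f m x \<partial>\<nu>) < measure \<nu> C + \<epsilon>" by (auto simp: eventually_sequentially)
  then show ?thesis using f01 f1 fl by (intro exI[of _ "f m"] exI[of _ "real m"]) auto
qed

lemma lipschitz_borel:
  fixes f :: "'a::metric_space \<Rightarrow> real"
  assumes "L \<ge> 0" "\<And>x y. \<bar>f x - f y\<bar> \<le> L * dist x y"
  shows "continuous_on UNIV f"
proof -
  have "L-lipschitz_on UNIV f" using assms by (intro lipschitz_onI) (auto simp: dist_real_def)
  then show ?thesis by (rule lipschitz_on_continuous_on)
qed

text \<open>Two Lipschitz functions control the mass of a continuity set: f bounds B from above, g
  bounds its complement and thereby B from below. Lipschitz tests serve both topologies: W1 controls
  their integrals, and being bounded and continuous they define weakly open sets.\<close>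

lemma continuity_set_tests:
  fixes B :: "'a::metric_space set"
  assumes \<nu>: "\<nu> \<in> M1 E" and B: "B \<in> sets borel" "measure \<nu> (E \<inter> frontier B) = 0" and \<epsilon>: "\<epsilon> > 0"
  shows "\<exists>(f :: 'a \<Rightarrow> real) g L. L \<ge> 0 \<and> (\<forall>x y. \<bar>f x - f y\<bar> \<le> L * dist x y \<and> \<bar>g x - g y\<bar> \<le> L * dist x y)
     \<and> (\<forall>x. 0 \<le> f x \<and> f x \<le> 1 \<and> 0 \<le> g x \<and> g x \<le> 1)
     \<and> (\<forall>\<gamma>\<in>M1 E. \<bar>(\<integral>x. f x \<partial>\<gamma>) - (\<integral>x. f x \<partial>\<nu>)\<bar> < \<epsilon> \<longrightarrow> \<bar>(\<integral>x. g x \<partial>\<gamma>) - (\<integral>x. g x \<partial>\<nu>)\<bar> < \<epsilon> \<longrightarrow>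
          \<bar>measure \<gamma> (E \<inter> B) - measure \<nu> (E \<inter> B)\<bar> < 2 * \<epsilon>)"
proof -
  interpret N: prob_space \<nu> by (rule M1_prob[OF \<nu>])
  let ?\<nu> = "distr \<nu> borel (\<lambda>x. x)"
  have id: "(\<lambda>x. x) \<in> borel_measurable \<kappa>" if "\<kappa> \<in> M1 E" for \<kappa> using that by (rule M1_continuous_measurable) (intro continuous_intros)
  interpret D: prob_space ?\<nu> by (rule N.prob_space_distr[OF id[OF \<nu>]])
  have md: "measure ?\<nu> S = measure \<nu> (E \<inter> S)" if "S \<in> sets borel" for S
    using M1_emeasure_borel[OF \<nu> that] by (simp add: measure_def)
  have up: "\<exists>(f :: 'a \<Rightarrow> real) L. L \<ge> 0 \<and> (\<forall>x y. \<bar>f x - f y\<bar> \<le> L * dist x y) \<and> (\<forall>x. 0 \<le> f x \<and> f x \<le> 1)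
     \<and> (\<forall>\<gamma>\<in>M1 E. \<bar>(\<integral>x. f x \<partial>\<gamma>) - (\<integral>x. f x \<partial>\<nu>)\<bar> < \<epsilon> \<longrightarrow> measure \<gamma> (E \<inter> S) < measure \<nu> (E \<inter> S) + 2 * \<epsilon>)"
    if S: "S \<in> sets borel" "measure \<nu> (E \<inter> frontier S) = 0" for S
  proof -
    from lipschitz_upper_approx[OF D.finite_measure_axioms sets_distr closed_closure \<epsilon>, of S]
    obtain f :: "'a \<Rightarrow> real" and L where f0: "L \<ge> 0 \<and> (\<forall>x y. \<bar>f x - f y\<bar> \<le> L * dist x y) \<and> (\<forall>x. 0 \<le> f x \<and> f x \<le> 1)
       \<and> (\<forall>x\<in>closure S. f x = 1) \<and> (\<integral>x. f x \<partial>?\<nu>) < measure ?\<nu> (closure S) + \<epsilon>" by blast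
    then have f: "L \<ge> 0" "\<And>x y. \<bar>f x - f y\<bar> \<le> L * dist x y" "\<And>x. 0 \<le> f x \<and> f x \<le> 1"
       "\<And>x. x \<in> closure S \<Longrightarrow> f x = 1" "(\<integral>x. f x \<partial>?\<nu>) < measure ?\<nu> (closure S) + \<epsilon>" by simp_all
    have fc: "continuous_on UNIV f" by (rule lipschitz_borel[OF f(1,2)])
    have fb: "f \<in> borel_measurable borel" using fc by (rule borel_measurable_continuous_onI)
    have fE: "f \<in> borel_measurable \<kappa>" if "\<kappa> \<in> M1 E" for \<kappa>
      by (rule M1_continuous_measurable[OF that continuous_on_subset[OF fc]]) simp
    have "measure ?\<nu> (closure S) \<le> measure ?\<nu> (S \<union> frontier S)"
      using S(1) by (intro D.finite_measure_mono) (auto simp: closure_Un_frontier)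
    also have "\<dots> \<le> measure ?\<nu> S + measure ?\<nu> (frontier S)" using S(1) by (intro measure_Un_le) auto
    also have "\<dots> = measure \<nu> (E \<inter> S)" using S md[of S] md[of "frontier S"] by simp
    finally have c: "measure ?\<nu> (closure S) \<le> measure \<nu> (E \<inter> S)" .
    have i: "(\<integral>x. f x \<partial>?\<nu>) = (\<integral>x. f x \<partial>\<nu>)" using id[OF \<nu>] fb by (rule integral_distr)
    have "measure \<gamma> (E \<inter> S) < measure \<nu> (E \<inter> S) + 2 * \<epsilon>" if \<gamma>: "\<gamma> \<in> M1 E" "\<bar>(\<integral>x. f x \<partial>\<gamma>) - (\<integral>x. f x \<partial>\<nu>)\<bar> < \<epsilon>" for \<gamma>
    proof -
      interpret G: prob_space \<gamma> by (rule M1_prob[OF \<gamma>(1)])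
      have ES: "E \<inter> S \<in> sets \<gamma>" using S(1) M1_sets[OF \<gamma>(1)] by (auto simp: sets_restrict_space)
      have "measure \<gamma> (E \<inter> S) = (\<integral>x. indicator (E \<inter> S) x \<partial>\<gamma>)"
        using M1_space[OF \<gamma>(1)] by (simp add: Int_absorb2)
      also have "\<dots> \<le> (\<integral>x. f x \<partial>\<gamma>)"
      proof (rule integral_mono)
        show "integrable \<gamma> (indicator (E \<inter> S) :: 'a \<Rightarrow> real)" using ES by (intro integrable_real_indicator) (auto simp: less_top[symmetric])
        show "integrable \<gamma> f" using f(3) fE[OF \<gamma>(1)] by (intro M1_bounded_integrable[OF \<gamma>(1), of _ 1]) (auto simp: abs_le_iff intro: order_trans[of _ 0])
        fix x
        have "f x = 1" if "x \<in> S" using f(4) that closure_subset by blast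
        then show "indicator (E \<inter> S) x \<le> f x" using f(3)[of x] by (auto simp: indicator_def)
      qed
      finally show ?thesis using \<gamma>(2) f(5) c i by linarith
    qed
    then show ?thesis using f(1-3) by blast
  qed
  obtain f :: "'a \<Rightarrow> real" and L where f: "L \<ge> 0" "\<forall>x y. \<bar>f x - f y\<bar> \<le> L * dist x y" "\<forall>x. 0 \<le> f x \<and> f x \<le> 1"
    "\<forall>\<gamma>\<in>M1 E. \<bar>(\<integral>x. f x \<partial>\<gamma>) - (\<integral>x. f x \<partial>\<nu>)\<bar> < \<epsilon> \<longrightarrow> measure \<gamma> (E \<inter> B) < measure \<nu> (E \<inter> B) + 2 * \<epsilon>"
    using up[OF B] by blast
  have mB: "measure \<nu> (E \<inter> frontier (- B)) = 0" "- B \<in> sets borel" using B by (auto simp: frontier_complement)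
  obtain g :: "'a \<Rightarrow> real" and L' where g: "L' \<ge> 0" "\<forall>x y. \<bar>g x - g y\<bar> \<le> L' * dist x y" "\<forall>x. 0 \<le> g x \<and> g x \<le> 1"
    "\<forall>\<gamma>\<in>M1 E. \<bar>(\<integral>x. g x \<partial>\<gamma>) - (\<integral>x. g x \<partial>\<nu>)\<bar> < \<epsilon> \<longrightarrow> measure \<gamma> (E \<inter> - B) < measure \<nu> (E \<inter> - B) + 2 * \<epsilon>"
    using up[OF mB(2,1)] by blast
  have compl: "measure \<kappa> (E \<inter> - B) = 1 - measure \<kappa> (E \<inter> B)" if \<kappa>: "\<kappa> \<in> M1 E" for \<kappa>
  proof -
    interpret K: prob_space \<kappa> by (rule M1_prob[OF \<kappa>])
    have "E \<inter> B \<in> sets \<kappa>" using B(1) M1_sets[OF \<kappa>] by (auto simp: sets_restrict_space)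
    then have "measure \<kappa> (E - (E \<inter> B)) = 1 - measure \<kappa> (E \<inter> B)" using K.prob_compl[of "E \<inter> B"] M1_space[OF \<kappa>] by simp
    moreover have "E - (E \<inter> B) = E \<inter> - B" by auto
    ultimately show ?thesis by simp
  qed
  show ?thesis
  proof (rule exI[of _ f], rule exI[of _ g], intro exI[of _ "max L L'"] conjI allI ballI impI)
    show "0 \<le> max L L'" using f(1) by simp
    show "\<bar>f x - f y\<bar> \<le> max L L' * dist x y" for x y
      using f(2)[rule_format, of x y] mult_right_mono[of L "max L L'" "dist x y"] by simp
    show "\<bar>g x - g y\<bar> \<le> max L L' * dist x y" for x y
      using g(2)[rule_format, of x y] mult_right_mono[of L' "max L L'" "dist x y"] by simp
    fix \<gamma> assume \<gamma>: "\<gamma> \<in> M1 E" "\<bar>(\<integral>x. f x \<partial>\<gamma>) - (\<integral>x. f x \<partial>\<nu>)\<bar> < \<epsilon>" "\<bar>(\<integral>x. g x \<partial>\<gamma>) - (\<integral>x. g x \<partial>\<nu>)\<bar> < \<epsilon>"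
    show "\<bar>measure \<gamma> (E \<inter> B) - measure \<nu> (E \<inter> B)\<bar> < 2 * \<epsilon>"
      using f(4)[rule_format, OF \<gamma>(1,2)] g(4)[rule_format, OF \<gamma>(1,3)] compl[OF \<gamma>(1)] compl[OF \<nu>] by (simp add: abs_less_iff)
  qed (use f g in auto)
qed

lemma W1_nbhd_continuity_set:
  assumes \<mu>: "\<mu> \<in> M11" and B: "B \<in> sets borel" "measure \<mu> ({0..} \<inter> frontier B) = 0" and \<epsilon>: "\<epsilon> > 0"
  shows "\<exists>N. openin topology_W1 N \<and> \<mu> \<in> N \<and> (\<forall>\<gamma>\<in>N. \<bar>measure \<gamma> ({0..} \<inter> B) - measure \<mu> ({0..} \<inter> B)\<bar> < \<epsilon>)"
proof -
  interpret W: Metric_space M11 W1 by (rule Metric_space_W1)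
  have e2: "\<epsilon> / 2 > 0" using \<epsilon> by simp
  obtain f g :: "real \<Rightarrow> real" and L where fg: "L \<ge> 0" "\<forall>x y. \<bar>f x - f y\<bar> \<le> L * dist x y \<and> \<bar>g x - g y\<bar> \<le> L * dist x y"
     "\<forall>x. 0 \<le> f x \<and> f x \<le> 1 \<and> 0 \<le> g x \<and> g x \<le> 1"
     "\<forall>\<gamma>\<in>M1 {0..}. \<bar>(\<integral>x. f x \<partial>\<gamma>) - (\<integral>x. f x \<partial>\<mu>)\<bar> < \<epsilon> / 2 \<longrightarrow> \<bar>(\<integral>x. g x \<partial>\<gamma>) - (\<integral>x. g x \<partial>\<mu>)\<bar> < \<epsilon> / 2 \<longrightarrow>
          \<bar>measure \<gamma> ({0..} \<inter> B) - measure \<mu> ({0..} \<inter> B)\<bar> < 2 * (\<epsilon> / 2)"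
    using continuity_set_tests[OF M11_D(1)[OF \<mu>] B e2] by blast
  \<comment> \<open>Within distance r the integrals of these tests move by less than (L + 1) r =
    \<epsilon> / 2; L + 1 keeps the quotient meaningful for L = 0.\<close>
  define r where "r = \<epsilon> / (2 * (L + 1))"
  have r: "r > 0" using \<epsilon> fg(1) by (simp add: r_def)
  have lip: "\<bar>(\<integral>x. h x \<partial>\<gamma>) - (\<integral>x. h x \<partial>\<mu>)\<bar> < \<epsilon> / 2"
    if h: "\<And>x y. \<bar>h x - h y\<bar> \<le> L * dist x y" "\<And>x. 0 \<le> h x \<and> h x \<le> 1" and \<gamma>: "\<gamma> \<in> M11" "W1 \<mu> \<gamma> < r" for h :: "real \<Rightarrow> real" and \<gamma>
  proof -
    have "h \<in> borel_measurable borel" by (rule borel_measurable_continuous_onI[OF lipschitz_borel[OF fg(1) h(1)]])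
    then have "\<bar>(\<integral>x. h x \<partial>\<gamma>) - (\<integral>x. h x \<partial>\<mu>)\<bar> \<le> L * W1 \<gamma> \<mu>"
      using h fg(1) by (intro lipschitz_integral_diff_le_W1[OF \<gamma>(1) \<mu>, where C=1]) (auto simp: dist_real_def abs_le_iff intro: order_trans[of _ 0])
    also have "\<dots> \<le> (L + 1) * W1 \<gamma> \<mu>" using W1_nonneg by (intro mult_right_mono) auto
    also have "\<dots> < (L + 1) * r" using \<gamma>(2) fg(1) W1_commute[of \<gamma> \<mu>] by (intro mult_strict_left_mono) auto
    also have "\<dots> = \<epsilon> / 2" using fg(1) by (simp add: r_def field_simps)
    finally show ?thesis .
  qed
  show ?thesis
  proof (intro exI[of _ "W.mball \<mu> r"] conjI ballI)
    show "openin topology_W1 (W.mball \<mu> r)" unfolding topology_W1_def by (rule W.openin_mball)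
    show "\<mu> \<in> W.mball \<mu> r" using \<mu> r by (simp add: W.in_mball)
    fix \<gamma> assume "\<gamma> \<in> W.mball \<mu> r"
    then have \<gamma>: "\<gamma> \<in> M11" "W1 \<mu> \<gamma> < r" by (auto simp: W.in_mball)
    have "\<bar>(\<integral>x. f x \<partial>\<gamma>) - (\<integral>x. f x \<partial>\<mu>)\<bar> < \<epsilon> / 2" by (rule lip[OF _ _ \<gamma>]) (use fg in auto)
    moreover have "\<bar>(\<integral>x. g x \<partial>\<gamma>) - (\<integral>x. g x \<partial>\<mu>)\<bar> < \<epsilon> / 2" by (rule lip[OF _ _ \<gamma>]) (use fg in auto)
    ultimately show "\<bar>measure \<gamma> ({0..} \<inter> B) - measure \<mu> ({0..} \<inter> B)\<bar> < \<epsilon>"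
      using fg(4)[rule_format, OF M11_D(1)[OF \<gamma>(1)]] by simp
  qed
qed

lemma weak_nbhd_continuity_set:
  fixes B :: "'s::metric_space set"
  assumes \<nu>: "\<nu> \<in> M1 UNIV" and B: "B \<in> sets borel" "measure \<nu> (frontier B) = 0" and \<epsilon>: "\<epsilon> > 0"
  shows "\<exists>N. openin (weak_topology UNIV) N \<and> \<nu> \<in> N \<and> (\<forall>\<gamma>\<in>N. \<bar>measure \<gamma> B - measure \<nu> B\<bar> < \<epsilon>)"
proof -
  have e2: "\<epsilon> / 2 > 0" using \<epsilon> by simp
  have B': "measure \<nu> (UNIV \<inter> frontier B) = 0" using B by simp
  obtain f g :: "'s \<Rightarrow> real" and L where fg: "L \<ge> 0" "\<forall>x y. \<bar>f x - f y\<bar> \<le> L * dist x y \<and> \<bar>g x - g y\<bar> \<le> L * dist x y"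
     "\<forall>x. 0 \<le> f x \<and> f x \<le> 1 \<and> 0 \<le> g x \<and> g x \<le> 1"
     "\<forall>\<gamma>\<in>M1 UNIV. \<bar>(\<integral>x. f x \<partial>\<gamma>) - (\<integral>x. f x \<partial>\<nu>)\<bar> < \<epsilon> / 2 \<longrightarrow> \<bar>(\<integral>x. g x \<partial>\<gamma>) - (\<integral>x. g x \<partial>\<nu>)\<bar> < \<epsilon> / 2 \<longrightarrow>
          \<bar>measure \<gamma> (UNIV \<inter> B) - measure \<nu> (UNIV \<inter> B)\<bar> < 2 * (\<epsilon> / 2)"
    using continuity_set_tests[OF \<nu> B(1) B' e2] by blast
  let ?N = "\<lambda>h :: 's \<Rightarrow> real. {\<rho> \<in> M1 UNIV. (\<integral>x. h x \<partial>\<rho>) \<in> ball (\<integral>x. h x \<partial>\<nu>) (\<epsilon> / 2)}"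
  have oN: "openin (weak_topology UNIV) (?N h)" if h: "\<And>x y. \<bar>h x - h y\<bar> \<le> L * dist x y" "\<And>x. 0 \<le> h x \<and> h x \<le> 1" for h :: "'s \<Rightarrow> real"
  proof (rule openin_weak_topology)
    show "continuous_on UNIV h" by (rule lipschitz_borel[OF fg(1) h(1)])
    show "bounded (h ` UNIV)" using h(2) by (intro boundedI[of _ 1]) (auto simp: abs_le_iff intro: order_trans[of _ 0])
  qed simp
  have "openin (weak_topology UNIV) (?N f \<inter> ?N g)"
    by (intro openin_Int oN) (use fg in auto)
  moreover have "\<nu> \<in> ?N f \<inter> ?N g" using \<nu> \<epsilon> by auto
  moreover have "\<bar>measure \<gamma> B - measure \<nu> B\<bar> < \<epsilon>" if "\<gamma> \<in> ?N f \<inter> ?N g" for \<gamma>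
    using fg(4)[rule_format, of \<gamma>] that by (auto simp: dist_real_def abs_minus_commute)
  ultimately show ?thesis by blast
qed

lemma finite_nbhd:
  assumes "finite S" "x \<in> topspace T" "\<And>c. c \<in> S \<Longrightarrow> \<exists>N. openin T N \<and> x \<in> N \<and> (\<forall>y\<in>N. P c y)"
  shows "\<exists>N. openin T N \<and> x \<in> N \<and> (\<forall>c\<in>S. \<forall>y\<in>N. P c y)"
  using assms(1,3)
proof (induction S rule: finite_induct)
  case empty
  then show ?case using assms(2) by (intro exI[of _ "topspace T"]) auto
next
  case (insert c S)
  then obtain N where "openin T N" "x \<in> N" "\<forall>c\<in>S. \<forall>y\<in>N. P c y" by auto
  moreover obtain N' where "openin T N'" "x \<in> N'" "\<forall>y\<in>N'. P c y" using insert.prems[of c] by auto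
  ultimately show ?case by (intro exI[of _ "N \<inter> N'"]) auto
qed

text \<open>Cantor's diagonal argument along an enumeration of S.\<close>

lemma exists_convergent_subsequence:
  fixes f :: "nat \<Rightarrow> 'x \<Rightarrow> real"
  assumes S: "countable S" and b: "\<And>j x. x \<in> S \<Longrightarrow> \<bar>f j x\<bar> \<le> M"
  shows "\<exists>r. strict_mono r \<and> (\<forall>x\<in>S. convergent (\<lambda>j. f (r j) x))"
proof (cases "S = {}")
  case True
  then show ?thesis by (intro exI[of _ id]) (auto simp: strict_mono_def)
next
  case False
  define e where "e n = from_nat_into S n" for n
  have eS: "e n \<in> S" for n unfolding e_def by (rule from_nat_into[OF False])
  let ?P = "\<lambda>n s. convergent (\<lambda>k. f (s k) (e n))"
  interpret nat: subseqs ?P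
  proof (unfold convergent_def, unfold subseqs_def, auto)
    fix n :: nat and s :: "nat \<Rightarrow> nat" assume s: "strict_mono s"
    have M: "\<forall>k. f (s k) (e n) \<in> {-M..M}" using b[OF eS] by (simp add: abs_le_iff minus_le_iff)
    have "\<forall>g :: nat \<Rightarrow> real. (\<forall>k. g k \<in> {-M..M}) \<longrightarrow> (\<exists>l\<in>{-M..M}. \<exists>r. strict_mono r \<and> (g \<circ> r) \<longlonglongrightarrow> l)"
      using compact_imp_seq_compact[OF compact_Icc[of "-M" M]] unfolding seq_compact_def .
    from mp[OF spec[OF this, of "\<lambda>k. f (s k) (e n)"] M]
    have "\<exists>l s'. strict_mono s' \<and> ((\<lambda>k. f (s k) (e n)) \<circ> s') \<longlonglongrightarrow> l" by auto
    then show "\<exists>s'. strict_mono (s'::nat\<Rightarrow>nat) \<and> (\<exists>l. (\<lambda>k. f (s (s' k)) (e n)) \<longlonglongrightarrow> l)"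
      by (auto simp: comp_def)
  qed
  have d: "strict_mono nat.diagseq" using nat.subseq_diagseq by auto
  have "?P n nat.diagseq" for n
  proof -
    have "?P n (nat.diagseq \<circ> ((+) (Suc n)))"
    proof (rule nat.diagseq_holds)
      fix r s :: "nat \<Rightarrow> nat" and n assume "strict_mono r" "?P n s"
      then show "?P n (s \<circ> r)" using convergent_subseq_convergent[of "\<lambda>k. f (s k) (e n)" r] by (simp add: comp_def)
    qed
    then obtain L where "(\<lambda>na. f (nat.diagseq (na + Suc n)) (e n)) \<longlonglongrightarrow> L"
      by (auto simp: add.commute comp_def dest: convergentD)
    then have "(\<lambda>k. f (nat.diagseq k) (e n)) \<longlonglongrightarrow> L" by (rule LIMSEQ_offset)
    then show ?thesis by (auto simp: convergent_def)
  qed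
  then have "convergent (\<lambda>j. f (nat.diagseq j) x)" if "x \<in> S" for x
    using that S unfolding e_def by (metis from_nat_into_surj)
  then show ?thesis using d by blast
qed

section \<open>Grids adapted to a pair of margins\<close>

text \<open>Base sets with frontiers null for \<mu> and \<nu> make the masses of marginal cells
  continuous at these two measures, for W1 and for the weak topology. At other margins continuity
  may fail, so the grid changes with the margins.\<close>

locale ngrid = grid A B for A :: "nat \<Rightarrow> real set" and B :: "nat \<Rightarrow> 's::{metric_space, second_countable_topology} set" +
  fixes \<mu> :: "real measure" and \<nu> :: "'s measure" and \<delta> :: "real \<times> 's \<Rightarrow> real \<times> 's \<Rightarrow> real"
  assumes \<mu>: "\<mu> \<in> M11" and \<nu>: "\<nu> \<in> M1 UNIV"
    and fA: "\<And>k. measure \<mu> ({0..} \<inter> frontier (A k)) = 0" and fB: "\<And>k. measure \<nu> (frontier (B k)) = 0"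
    and compat\<delta>: "compatible_metric (halfspace :: (real \<times> 's) set) \<delta>"
begin

lemma null_UN:
  assumes \<rho>: "\<rho> \<in> M1 E" and S: "\<And>k::nat. S k \<in> sets borel" "\<And>k. measure \<rho> (E \<inter> S k) = 0" and T: "T \<in> sets borel" "T \<subseteq> (\<Union>k. S k)"
  shows "measure \<rho> (E \<inter> T) = 0"
proof -
  interpret prob_space \<rho> by (rule M1_prob[OF \<rho>])
  have s: "E \<inter> X \<in> sets \<rho>" if "X \<in> sets borel" for X using that M1_sets[OF \<rho>] by (auto simp: sets_restrict_space)
  have "E \<inter> S k \<in> null_sets \<rho>" for k using s S by (auto simp: null_sets_def emeasure_eq_measure)
  then have "(\<Union>k. E \<inter> S k) \<in> null_sets \<rho>" by (rule null_sets_UN)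
  then have "E \<inter> T \<in> null_sets \<rho>" using s[OF T(1)] by (rule null_sets_subset) (use T in auto)
  then show ?thesis by (simp add: null_sets_def emeasure_eq_measure)
qed

lemma nbhdA:
  assumes \<epsilon>: "\<epsilon> > 0"
  shows "\<exists>N. openin topology_W1 N \<and> \<mu> \<in> N \<and> (\<forall>\<gamma>\<in>N. \<forall>K. K \<in> Pow {..<i} \<longrightarrow> \<bar>measure \<gamma> (PA.cell i K) - measure \<mu> (PA.cell i K)\<bar> < \<epsilon>)"
proof -
  have "\<exists>N. openin topology_W1 N \<and> \<mu> \<in> N \<and> (\<forall>\<gamma>\<in>N. \<bar>measure \<gamma> (PA.cell i K) - measure \<mu> (PA.cell i K)\<bar> < \<epsilon>)" for K
  proof -
    have c: "PA.cell i K = {0..} \<inter> {x. lab A i x = K}" by (auto simp: PA.cell_def)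
    have bf: "{x. lab A i x = K} \<in> sets borel \<and> frontier {x. lab A i x = K} \<subseteq> (\<Union>k. frontier (A k))"
      by (rule lab_cell_borel_frontier) (use oA in auto)
    have "measure \<mu> ({0..} \<inter> frontier {x. lab A i x = K}) = 0"
      by (rule null_UN[where S="\<lambda>k. frontier (A k)", OF M11_D(1)[OF \<mu>] _ fA _ conjunct2[OF bf]]) (auto intro: borel_closed)
    then show ?thesis unfolding c using bf by (intro W1_nbhd_continuity_set[OF \<mu> _ _ \<epsilon>]) auto
  qed
  then have "\<exists>N. openin topology_W1 N \<and> \<mu> \<in> N \<and> (\<forall>K\<in>Pow {..<i}. \<forall>\<gamma>\<in>N. \<bar>measure \<gamma> (PA.cell i K) - measure \<mu> (PA.cell i K)\<bar> < \<epsilon>)"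
    using \<mu> by (intro finite_nbhd) (simp_all add: topspace_W1)
  then show ?thesis by blast
qed

text \<open>All levels up to i are controlled at once, so that along neighbourhoods indexed by i the
  cell masses of every fixed level converge.\<close>

lemma nbhdB:
  assumes \<epsilon>: "\<epsilon> > 0"
  shows "\<exists>N. openin (weak_topology UNIV) N \<and> \<nu> \<in> N \<and>
     (\<forall>\<gamma>\<in>N. \<forall>j\<le>i. \<forall>L. L \<in> Pow {..<j} \<longrightarrow> \<bar>measure \<gamma> (PB.cell j L) - measure \<nu> (PB.cell j L)\<bar> < \<epsilon>)"
proof -
  have "\<exists>N. openin (weak_topology UNIV) N \<and> \<nu> \<in> N \<and> (\<forall>\<gamma>\<in>N. \<bar>measure \<gamma> (PB.cell (fst p) (snd p)) - measure \<nu> (PB.cell (fst p) (snd p))\<bar> < \<epsilon>)" for p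
  proof -
    have c: "PB.cell (fst p) (snd p) = {x. lab B (fst p) x = snd p}" by (auto simp: PB.cell_def)
    have bf: "{x. lab B (fst p) x = snd p} \<in> sets borel \<and> frontier {x. lab B (fst p) x = snd p} \<subseteq> (\<Union>k. frontier (B k))"
      by (rule lab_cell_borel_frontier) (use oB in auto)
    have "measure \<nu> (UNIV \<inter> frontier {x. lab B (fst p) x = snd p}) = 0"
      by (rule null_UN[where S="\<lambda>k. frontier (B k)", OF \<nu> _ _ _ conjunct2[OF bf]]) (auto intro: borel_closed simp: fB)
    then show ?thesis unfolding c using bf by (intro weak_nbhd_continuity_set[OF \<nu> _ _ \<epsilon>]) auto
  qed
  then have "\<exists>N. openin (weak_topology UNIV) N \<and> \<nu> \<in> N \<and> (\<forall>p\<in>(SIGMA j:{..i}. Pow {..<j}). \<forall>\<gamma>\<in>N.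
      \<bar>measure \<gamma> (PB.cell (fst p) (snd p)) - measure \<nu> (PB.cell (fst p) (snd p))\<bar> < \<epsilon>)"
    using \<nu> by (intro finite_nbhd) (simp_all add: topspace_weak_topology)
  then obtain N where N: "openin (weak_topology UNIV) N" "\<nu> \<in> N" "\<And>p \<gamma>. p \<in> (SIGMA j:{..i}. Pow {..<j}) \<Longrightarrow> \<gamma> \<in> N \<Longrightarrow>
      \<bar>measure \<gamma> (PB.cell (fst p) (snd p)) - measure \<nu> (PB.cell (fst p) (snd p))\<bar> < \<epsilon>" by auto
  show ?thesis
  proof (intro exI[of _ N] conjI ballI allI impI N(1,2))
    fix \<gamma> j L assume "\<gamma> \<in> N" "j \<le> i" "L \<in> Pow {..<j}"
    then show "\<bar>measure \<gamma> (PB.cell j L) - measure \<nu> (PB.cell j L)\<bar> < \<epsilon>" using N(3)[of "(j, L)" \<gamma>] by simp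
  qed
qed

sublocale D: Metric_space "M11_prod :: (real \<times> 's) measure set" "\<Delta> \<delta>" by (rule Metric_space_\<Delta>[OF compat\<delta>])
sublocale W: Metric_space M11 W1 by (rule Metric_space_W1)

text \<open>Only the level-j entropy of \<rho> j is bounded, but a test function at level i is also
  one at every level j \<ge> i, so each Young functional is eventually bounded. Along a diagonal
  subsequence the cell masses converge and \<open>limit_measure_exists\<close> supplies \<kappa>,
  whose margins are recognised on the generating cells. The W1 part of \<open>\<Delta>\<close>
  converges by hypothesis, the other by \<open>cells_control_\<beta>_BL\<close>.\<close>

lemma entropy_compactness:
  assumes \<rho>: "\<And>j. \<rho> j \<in> M11_prod" and c1: "(\<lambda>j. W1 (marg1 (\<rho> j)) \<mu>) \<longlonglongrightarrow> 0"
    and c2: "\<And>i L. L \<in> Pow {..<i} \<Longrightarrow> (\<lambda>j. measure (marg2 (\<rho> j)) (PB.cell i L)) \<longlonglongrightarrow> measure \<nu> (PB.cell i L)"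
    and H: "\<And>j. ment j (\<rho> j) \<le> \<alpha>"
  shows "\<exists>\<kappa>\<in>M11_prod. marg1 \<kappa> = \<mu> \<and> marg2 \<kappa> = \<nu> \<and> rel_entropy \<kappa> (\<mu> \<Otimes>\<^sub>M \<nu>) \<le> ereal \<alpha> \<and>
     (\<exists>r. strict_mono r \<and> (\<lambda>j. \<Delta> \<delta> (\<rho> (r j)) \<kappa>) \<longlonglongrightarrow> 0)"
proof -
  let ?\<tau> = "\<mu> \<Otimes>\<^sub>M \<nu>"
  have \<tau>: "?\<tau> \<in> M1 halfspace" using \<mu> \<nu> M11_D by (intro product_M1)
  have \<rho>M: "\<rho> j \<in> M1 halfspace" and \<rho>1: "marg1 (\<rho> j) \<in> M11" and \<rho>2: "marg2 (\<rho> j) \<in> M1 UNIV" for j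
    using M11_prod_D[OF \<rho>] by auto
  have c1': "(\<lambda>j. measure (marg1 (\<rho> j)) (PA.cell i K)) \<longlonglongrightarrow> measure \<mu> (PA.cell i K)" if K: "K \<in> Pow {..<i}" for i K
  proof (rule LIMSEQ_I)
    fix e :: real assume "e > 0"
    then obtain N where N: "openin topology_W1 N" "\<mu> \<in> N" "\<And>\<gamma>. \<gamma> \<in> N \<Longrightarrow> \<bar>measure \<gamma> (PA.cell i K) - measure \<mu> (PA.cell i K)\<bar> < e"
      using nbhdA[of e i] K by blast
    obtain r where r: "r > 0" "W.mball \<mu> r \<subseteq> N" using N(1,2) unfolding topology_W1_def W.openin_mtopology by blast
    have "eventually (\<lambda>j. W1 (marg1 (\<rho> j)) \<mu> < r) sequentially" using c1 r(1) by (intro order_tendstoD(2))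
    then obtain no where no: "\<And>j. j \<ge> no \<Longrightarrow> W1 (marg1 (\<rho> j)) \<mu> < r" by (auto simp: eventually_sequentially)
    have "norm (measure (marg1 (\<rho> j)) (PA.cell i K) - measure \<mu> (PA.cell i K)) < e" if "j \<ge> no" for j
    proof -
      have "marg1 (\<rho> j) \<in> W.mball \<mu> r" using no[OF that] \<mu> \<rho>1 W1_commute[of \<mu> "marg1 (\<rho> j)"] by (simp add: W.in_mball)
      then show ?thesis using N(3) r(2) by auto
    qed
    then show "\<exists>no. \<forall>n\<ge>no. norm (measure (marg1 (\<rho> n)) (PA.cell i K) - measure \<mu> (PA.cell i K)) < e" by blast
  qed
  define S where "S = (SIGMA i:(UNIV :: nat set). labels2 i)"
  have "countable S" unfolding S_def by (intro countable_SIGMA) (auto intro: countable_finite)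
  from exists_convergent_subsequence[OF this, of "\<lambda>j p. measure (\<rho> j) (P.cell (fst p) (snd p))" 1]
  obtain r where r: "strict_mono r" "\<And>p. p \<in> S \<Longrightarrow> convergent (\<lambda>j. measure (\<rho> (r j)) (P.cell (fst p) (snd p)))"
    using prob_space.prob_le_1[OF M1_prob[OF \<rho>M]] by auto
  define t where "t i c = lim (\<lambda>j. measure (\<rho> (r j)) (P.cell i c))" for i c
  have conv: "(\<lambda>j. measure (\<rho> (r j)) (P.cell i c)) \<longlonglongrightarrow> t i c" if "c \<in> labels2 i" for i c
    using r(2)[of "(i, c)"] that by (simp add: S_def t_def convergent_LIMSEQ_iff)
  have sub: "(\<lambda>j. f (r j)) \<longlonglongrightarrow> l" if "f \<longlonglongrightarrow> l" for f :: "nat \<Rightarrow> real" and l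
    using LIMSEQ_subseq_LIMSEQ[OF that r(1)] by (simp add: comp_def)
  have tauconv: "(\<lambda>j. measure (marg1 (\<rho> (r j)) \<Otimes>\<^sub>M marg2 (\<rho> (r j))) (P.cell i c)) \<longlonglongrightarrow> measure ?\<tau> (P.cell i c)"
    if c: "c \<in> labels2 i" for i c
  proof -
    obtain K L where KL: "c = (K, L)" "K \<in> Pow {..<i}" "L \<in> Pow {..<i}" using c by auto
    show ?thesis unfolding KL(1) product_cell[OF M11_D(1)[OF \<rho>1] \<rho>2] product_cell[OF M11_D(1)[OF \<mu>] \<nu>]
      by (intro tendsto_mult sub[OF c1'[OF KL(2)]] sub[OF c2[OF KL(3)]])
  qed
  have Y: "(\<Sum>c\<in>labels2 i. F c * t i c) - (\<Sum>c\<in>labels2 i. exp (F c) * measure ?\<tau> (P.cell i c)) + 1 \<le> \<alpha>" for i F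
  proof (rule LIMSEQ_le_const2)
    show "(\<lambda>j. (\<Sum>c\<in>labels2 i. F c * measure (\<rho> (r j)) (P.cell i c))
       - (\<Sum>c\<in>labels2 i. exp (F c) * measure (marg1 (\<rho> (r j)) \<Otimes>\<^sub>M marg2 (\<rho> (r j))) (P.cell i c)) + 1)
      \<longlonglongrightarrow> (\<Sum>c\<in>labels2 i. F c * t i c) - (\<Sum>c\<in>labels2 i. exp (F c) * measure ?\<tau> (P.cell i c)) + 1"
      by (intro tendsto_intros tendsto_sum conv tauconv)
    \<comment> \<open>G is F composed with the projection of labels from level j to level i, so the
      sums at the two levels are the same integral.\<close>
    have lvl: "(\<Sum>c\<in>labels2 i. F c * measure (\<rho> j) (P.cell i c))
       - (\<Sum>c\<in>labels2 i. exp (F c) * measure (marg1 (\<rho> j) \<Otimes>\<^sub>M marg2 (\<rho> j)) (P.cell i c)) + 1 \<le> \<alpha>" if ij: "i \<le> j" for j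
    proof -
      have \<tau>j: "marg1 (\<rho> j) \<Otimes>\<^sub>M marg2 (\<rho> j) \<in> M1 halfspace" by (rule product_M1[OF M11_D(1)[OF \<rho>1] \<rho>2])
      define G where "G c = F (fst c \<inter> {..<i}, snd c \<inter> {..<i})" for c
      have G: "G (lab A j (fst z), lab B j (snd z)) = F (lab A i (fst z), lab B i (snd z))" for z
        by (simp add: G_def lab_restrict[OF ij, symmetric])
      have e1: "(\<Sum>c\<in>labels2 i. F c * measure \<kappa> (P.cell i c)) = (\<Sum>c\<in>labels2 j. G c * measure \<kappa> (P.cell j c))" if "\<kappa> \<in> M1 halfspace" for \<kappa>
        unfolding P.label_integral(2)[OF that, symmetric] G ..
      have e2: "(\<Sum>c\<in>labels2 i. exp (F c) * measure \<kappa> (P.cell i c)) = (\<Sum>c\<in>labels2 j. exp (G c) * measure \<kappa> (P.cell j c))" if "\<kappa> \<in> M1 halfspace" for \<kappa>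
        unfolding P.label_integral(2)[OF that, of "\<lambda>c. exp (F c)", symmetric] P.label_integral(2)[OF that, of "\<lambda>c. exp (G c)", symmetric] G ..
      show ?thesis unfolding e1[OF \<rho>M] e2[OF \<tau>j] using ment_young[OF \<rho>M, of G j j] H[of j] by linarith
    qed
    then show "\<exists>N. \<forall>n\<ge>N. (\<Sum>c\<in>labels2 i. F c * measure (\<rho> (r n)) (P.cell i c))
       - (\<Sum>c\<in>labels2 i. exp (F c) * measure (marg1 (\<rho> (r n)) \<Otimes>\<^sub>M marg2 (\<rho> (r n))) (P.cell i c)) + 1 \<le> \<alpha>"
      by (intro exI[of _ i] allI impI) (erule lvl[OF order_trans[OF _ seq_suble[OF r(1)]]])
  qed
  obtain \<kappa> where \<kappa>: "\<kappa> \<in> M1 halfspace" "\<And>i c. c \<in> labels2 i \<Longrightarrow> measure \<kappa> (P.cell i c) = t i c" "rel_entropy \<kappa> ?\<tau> \<le> ereal \<alpha>"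
    using P.limit_measure_exists[where \<rho>="\<lambda>j. \<rho> (r j)", OF \<tau> \<rho>M conv Y] by auto
  have mt: "(\<lambda>j. mtab (\<rho> (r j)) i K L) \<longlonglongrightarrow> mtab \<kappa> i K L" if "K \<in> Pow {..<i}" "L \<in> Pow {..<i}" for i K L
    using conv[of "(K, L)" i] \<kappa>(2)[of "(K, L)" i] that by (simp add: mtab_def)
  have k1: "measure (marg1 \<kappa>) (PA.cell i K) = measure \<mu> (PA.cell i K)" if K: "K \<in> Pow {..<i}" for i K
  proof -
    have "(\<lambda>j. \<Sum>L\<in>Pow {..<i}. mtab (\<rho> (r j)) i K L) \<longlonglongrightarrow> (\<Sum>L\<in>Pow {..<i}. mtab \<kappa> i K L)"
      by (intro tendsto_sum mt K)
    then show ?thesis unfolding mtab_rows[OF \<rho>M] mtab_rows[OF \<kappa>(1)] using sub[OF c1'[OF K]] by (rule LIMSEQ_unique)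
  qed
  have k2: "measure (marg2 \<kappa>) (PB.cell i L) = measure \<nu> (PB.cell i L)" if L: "L \<in> Pow {..<i}" for i L
  proof -
    have "(\<lambda>j. \<Sum>K\<in>Pow {..<i}. mtab (\<rho> (r j)) i K L) \<longlonglongrightarrow> (\<Sum>K\<in>Pow {..<i}. mtab \<kappa> i K L)"
      by (intro tendsto_sum mt L)
    then show ?thesis unfolding mtab_cols[OF \<rho>M] mtab_cols[OF \<kappa>(1)] using sub[OF c2[OF L]] by (rule LIMSEQ_unique)
  qed
  have m1: "marg1 \<kappa> = \<mu>"
  proof (rule M1_eqI_generator[OF marg1_M1[OF \<kappa>(1)] M11_D(1)[OF \<mu>], of PA.alg])
    interpret AA: algebra "{0..}" PA.alg by (rule PA.algebra_alg)
    show "Int_stable PA.alg" by (simp add: Int_stable_def AA.Int)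
    show "PA.alg \<subseteq> Pow {0..}" by (rule AA.space_closed)
    show "sets (borel_on {0..}) = sigma_sets {0..} PA.alg" by (rule PA.sets_borel_on)
    fix a assume "a \<in> PA.alg"
    then obtain i T where a: "a = {x\<in>{0..}. lab A i x \<in> T}" by (auto simp: PA.alg_def)
    show "measure (marg1 \<kappa>) a = measure \<mu> a"
      unfolding a PA.measure_level[OF marg1_M1[OF \<kappa>(1)]] PA.measure_level[OF M11_D(1)[OF \<mu>]]
      by (intro sum.cong refl k1) auto
  qed
  have m2: "marg2 \<kappa> = \<nu>"
  proof (rule M1_eqI_generator[OF marg2_M1[OF \<kappa>(1)] \<nu>, of PB.alg])
    interpret AA: algebra UNIV PB.alg by (rule PB.algebra_alg)
    show "Int_stable PB.alg" by (simp add: Int_stable_def AA.Int)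
    show "PB.alg \<subseteq> Pow UNIV" by (rule AA.space_closed)
    show "sets (borel_on UNIV) = sigma_sets UNIV PB.alg" by (rule PB.sets_borel_on)
    fix a assume "a \<in> PB.alg"
    then obtain i T where a: "a = {x\<in>UNIV. lab B i x \<in> T}" by (auto simp: PB.alg_def)
    show "measure (marg2 \<kappa>) a = measure \<nu> a"
      unfolding a PB.measure_level[OF marg2_M1[OF \<kappa>(1)]] PB.measure_level[OF \<nu>]
      by (intro sum.cong refl k2) auto
  qed
  have kp: "\<kappa> \<in> M11_prod" using \<kappa>(1) m1 \<mu> by (intro M11_prodI) auto
  have bl: "(\<lambda>j. \<beta>_BL halfspace \<delta> (\<rho> (r j)) \<kappa>) \<longlonglongrightarrow> 0"
  proof (rule LIMSEQ_I)
    fix e :: real assume "e > 0"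
    then obtain i s where s: "s > 0" "\<forall>\<gamma>\<in>M1 halfspace. (\<Sum>c\<in>labels2 i. \<bar>measure \<gamma> (P.cell i c) - measure \<kappa> (P.cell i c)\<bar>) < s \<longrightarrow> \<beta>_BL halfspace \<delta> \<gamma> \<kappa> < e"
      using P.cells_control_\<beta>_BL[OF compat\<delta> \<kappa>(1)] by blast
    have "(\<lambda>j. \<Sum>c\<in>labels2 i. \<bar>measure (\<rho> (r j)) (P.cell i c) - measure \<kappa> (P.cell i c)\<bar>) \<longlonglongrightarrow> (\<Sum>c\<in>labels2 i. \<bar>t i c - measure \<kappa> (P.cell i c)\<bar>)"
      by (intro tendsto_intros tendsto_sum conv)
    moreover have "(\<Sum>c\<in>labels2 i. \<bar>t i c - measure \<kappa> (P.cell i c)\<bar>) = 0" using \<kappa>(2) by (intro sum.neutral) auto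
    ultimately have "eventually (\<lambda>j. (\<Sum>c\<in>labels2 i. \<bar>measure (\<rho> (r j)) (P.cell i c) - measure \<kappa> (P.cell i c)\<bar>) < s) sequentially"
      using s(1) by (intro order_tendstoD(2)) auto
    then obtain no where no: "\<And>j. j \<ge> no \<Longrightarrow> (\<Sum>c\<in>labels2 i. \<bar>measure (\<rho> (r j)) (P.cell i c) - measure \<kappa> (P.cell i c)\<bar>) < s"
      by (auto simp: eventually_sequentially)
    have "norm (\<beta>_BL halfspace \<delta> (\<rho> (r j)) \<kappa> - 0) < e" if "j \<ge> no" for j
      using s(2)[rule_format, OF \<rho>M no[OF that]] by (simp add: \<beta>_BL_def)
    then show "\<exists>no. \<forall>n\<ge>no. norm (\<beta>_BL halfspace \<delta> (\<rho> (r n)) \<kappa> - 0) < e" by blast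
  qed
  have "(\<lambda>j. W1 (marg1 (\<rho> (r j))) \<mu> + \<beta>_BL halfspace \<delta> (\<rho> (r j)) \<kappa>) \<longlonglongrightarrow> 0 + 0"
    by (intro tendsto_add sub[OF c1] bl)
  then have "(\<lambda>j. \<Delta> \<delta> (\<rho> (r j)) \<kappa>) \<longlonglongrightarrow> 0" unfolding \<Delta>_def m1 by simp
  then show ?thesis using kp m1 m2 \<kappa>(3) r(1) by blast
qed

lemma limitin_of_\<Delta>:
  assumes "\<kappa> \<in> M11_prod" "\<And>j. \<rho> j \<in> M11_prod" "(\<lambda>j. \<Delta> \<delta> (\<rho> j) \<kappa>) \<longlonglongrightarrow> 0"
  shows "limitin D.mtopology \<rho> \<kappa> sequentially"
  unfolding D.limit_metric_sequentially
proof (intro conjI allI impI assms(1))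
  fix e :: real assume "e > 0"
  then have "eventually (\<lambda>j. \<Delta> \<delta> (\<rho> j) \<kappa> < e) sequentially" using assms(3) by (intro order_tendstoD(2))
  then show "\<exists>N. \<forall>n\<ge>N. \<rho> n \<in> M11_prod \<and> \<Delta> \<delta> (\<rho> n) \<kappa> < e" using assms(2) by (auto simp: eventually_sequentially)
qed

text \<open>Otherwise there are \<rho> j in F whose margins are within 1 / (j + 1) of \<mu> and
  \<nu>, in W1 and in cell masses, and whose level-j entropy is at most \<beta>. By
  \<open>entropy_compactness\<close> a subsequence converges to a point of F with margins \<mu> and
  \<nu> and entropy at most \<beta>.\<close>

lemma upper_local:
  assumes F: "closedin (topology_\<Delta> \<delta>) F"
    and no: "\<And>\<kappa>. \<kappa> \<in> F \<Longrightarrow> marg1 \<kappa> = \<mu> \<Longrightarrow> marg2 \<kappa> = \<nu> \<Longrightarrow> rel_entropy \<kappa> (\<mu> \<Otimes>\<^sub>M \<nu>) > ereal \<beta>"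
  shows "\<exists>i N1 N2. openin topology_W1 N1 \<and> \<mu> \<in> N1 \<and> openin (weak_topology UNIV) N2 \<and> \<nu> \<in> N2 \<and>
     (\<forall>\<rho>\<in>F. marg1 \<rho> \<in> N1 \<longrightarrow> marg2 \<rho> \<in> N2 \<longrightarrow> ment i \<rho> > \<beta>)"
proof (rule ccontr)
  assume neg: "\<not> ?thesis"
  have FM: "F \<subseteq> M11_prod" using closedin_subset[OF F] by (simp add: topology_\<Delta>_def)
  have "\<exists>\<rho>\<in>F. W1 \<mu> (marg1 \<rho>) < 1 / real (Suc j) \<and> ment j \<rho> \<le> \<beta> \<and>
    (\<forall>i\<le>j. \<forall>L. L \<in> Pow {..<i} \<longrightarrow> \<bar>measure (marg2 \<rho>) (PB.cell i L) - measure \<nu> (PB.cell i L)\<bar> < 1 / real (Suc j))" for j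
  proof -
    have j: "1 / real (Suc j) > 0" by simp
    obtain N2 where N2: "openin (weak_topology UNIV) N2" "\<nu> \<in> N2"
      "\<forall>\<gamma>\<in>N2. \<forall>i\<le>j. \<forall>L. L \<in> Pow {..<i} \<longrightarrow> \<bar>measure \<gamma> (PB.cell i L) - measure \<nu> (PB.cell i L)\<bar> < 1 / real (Suc j)"
      using nbhdB[OF j, of j] by blast
    have "openin topology_W1 (W.mball \<mu> (1 / real (Suc j)))" unfolding topology_W1_def by (rule W.openin_mball)
    moreover have "\<mu> \<in> W.mball \<mu> (1 / real (Suc j))" using \<mu> by (simp add: W.in_mball)
    ultimately obtain \<rho> where "\<rho> \<in> F" "marg1 \<rho> \<in> W.mball \<mu> (1 / real (Suc j))" "marg2 \<rho> \<in> N2" "ment j \<rho> \<le> \<beta>"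
      using neg N2(1,2) by (meson not_le)
    then show ?thesis using N2(3) by (intro bexI[of _ \<rho>]) (auto simp: W.in_mball)
  qed
  then have "\<forall>j. \<exists>\<rho>. \<rho> \<in> F \<and> W1 \<mu> (marg1 \<rho>) < 1 / real (Suc j) \<and> ment j \<rho> \<le> \<beta> \<and>
    (\<forall>i\<le>j. \<forall>L. L \<in> Pow {..<i} \<longrightarrow> \<bar>measure (marg2 \<rho>) (PB.cell i L) - measure \<nu> (PB.cell i L)\<bar> < 1 / real (Suc j))" by blast
  from choice[OF this] obtain \<rho> where \<rho>: "\<And>j. \<rho> j \<in> F" "\<And>j. W1 \<mu> (marg1 (\<rho> j)) < 1 / real (Suc j)" "\<And>j. ment j (\<rho> j) \<le> \<beta>"
    "\<And>j i L. i \<le> j \<Longrightarrow> L \<in> Pow {..<i} \<Longrightarrow> \<bar>measure (marg2 (\<rho> j)) (PB.cell i L) - measure \<nu> (PB.cell i L)\<bar> < 1 / real (Suc j)" by blast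
  have l0: "(\<lambda>j. 1 / real (Suc j)) \<longlonglongrightarrow> 0" using LIMSEQ_Suc[OF lim_1_over_n[where 'a=real]] by simp
  have c1: "(\<lambda>j. W1 (marg1 (\<rho> j)) \<mu>) \<longlonglongrightarrow> 0"
  proof (rule tendsto_sandwich[OF _ _ tendsto_const l0])
    show "eventually (\<lambda>j. 0 \<le> W1 (marg1 (\<rho> j)) \<mu>) sequentially" by (simp add: W1_nonneg)
    show "eventually (\<lambda>j. W1 (marg1 (\<rho> j)) \<mu> \<le> 1 / real (Suc j)) sequentially"
      by (intro always_eventually allI) (metis \<rho>(2) W1_commute less_imp_le)
  qed
  have c2: "(\<lambda>j. measure (marg2 (\<rho> j)) (PB.cell i L)) \<longlonglongrightarrow> measure \<nu> (PB.cell i L)" if L: "L \<in> Pow {..<i}" for i L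
  proof -
    have "eventually (\<lambda>j. norm (measure (marg2 (\<rho> j)) (PB.cell i L) - measure \<nu> (PB.cell i L)) \<le> 1 / real (Suc j)) sequentially"
      using eventually_ge_at_top[of i] by eventually_elim (use \<rho>(4)[OF _ L] in \<open>auto simp: less_imp_le simp del: of_nat_Suc\<close>)
    from Lim_null_comparison[OF this l0] show ?thesis by (rule LIM_zero_cancel)
  qed
  obtain \<kappa> r where \<kappa>: "\<kappa> \<in> M11_prod" "marg1 \<kappa> = \<mu>" "marg2 \<kappa> = \<nu>" "rel_entropy \<kappa> (\<mu> \<Otimes>\<^sub>M \<nu>) \<le> ereal \<beta>"
    "strict_mono r" "(\<lambda>j. \<Delta> \<delta> (\<rho> (r j)) \<kappa>) \<longlonglongrightarrow> 0"
    using entropy_compactness[of \<rho> \<beta>, OF _ c1 c2 \<rho>(3)] \<rho>(1) FM by blast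
  have "limitin D.mtopology (\<lambda>j. \<rho> (r j)) \<kappa> sequentially"
    by (rule limitin_of_\<Delta>[OF \<kappa>(1) _ \<kappa>(6)]) (use \<rho>(1) FM in blast)
  then have "\<kappa> \<in> F" using F \<rho>(1) unfolding topology_\<Delta>_def
    by (intro limitin_closedin[of D.mtopology "\<lambda>j. \<rho> (r j)" \<kappa> sequentially F]) auto
  then show False using no[OF _ \<kappa>(2,3)] \<kappa>(4) by simp
qed

text \<open>The W1 part of \<open>\<Delta>\<close> depends on the first margin and is left to N1;
  the remaining part is governed by finitely many cells. Permuting the weights acts on the latter
  alone.\<close>

lemma lower_local:
  assumes U: "openin (topology_\<Delta> \<delta>) U" and \<kappa>: "\<kappa> \<in> U" "marg1 \<kappa> = \<mu>"
  shows "\<exists>i r N1. r > 0 \<and> openin topology_W1 N1 \<and> \<mu> \<in> N1 \<and>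
     (\<forall>\<gamma>\<in>M11_prod. marg1 \<gamma> \<in> N1 \<longrightarrow> (\<Sum>K\<in>Pow {..<i}. \<Sum>L\<in>Pow {..<i}. \<bar>mtab \<gamma> i K L - mtab \<kappa> i K L\<bar>) < r \<longrightarrow> \<gamma> \<in> U)"
proof -
  obtain e where e: "e > 0" "D.mball \<kappa> e \<subseteq> U" using U \<kappa>(1) unfolding topology_\<Delta>_def D.openin_mtopology by blast
  have kp: "\<kappa> \<in> M11_prod" using openin_subset[OF U] \<kappa>(1) by (auto simp: topology_\<Delta>_def)
  have e2: "e / 2 > 0" using e by simp
  obtain i r where r: "r > 0" "\<forall>\<gamma>\<in>M1 halfspace. (\<Sum>c\<in>labels2 i. \<bar>measure \<gamma> (P.cell i c) - measure \<kappa> (P.cell i c)\<bar>) < r \<longrightarrow> \<beta>_BL halfspace \<delta> \<gamma> \<kappa> < e / 2"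
    using P.cells_control_\<beta>_BL[OF compat\<delta> M11_prod_D(1)[OF kp] e2] by blast
  have "\<gamma> \<in> U" if \<gamma>: "\<gamma> \<in> M11_prod" "marg1 \<gamma> \<in> W.mball \<mu> (e / 2)" "(\<Sum>K\<in>Pow {..<i}. \<Sum>L\<in>Pow {..<i}. \<bar>mtab \<gamma> i K L - mtab \<kappa> i K L\<bar>) < r" for \<gamma>
  proof -
    have "(\<Sum>c\<in>labels2 i. \<bar>measure \<gamma> (P.cell i c) - measure \<kappa> (P.cell i c)\<bar>) < r"
      using \<gamma>(3) by (simp add: mtab_def sum.cartesian_product split_beta)
    then have "\<beta>_BL halfspace \<delta> \<gamma> \<kappa> < e / 2" using r(2) M11_prod_D(1)[OF \<gamma>(1)] by blast
    moreover have "W1 (marg1 \<gamma>) \<mu> < e / 2" using \<gamma>(2) W1_commute[of \<mu> "marg1 \<gamma>"] by (simp add: W.in_mball)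
    ultimately have "\<Delta> \<delta> \<gamma> \<kappa> < e" by (simp add: \<Delta>_def \<kappa>(2))
    then have "\<gamma> \<in> D.mball \<kappa> e" using kp \<gamma>(1) D.commute[of \<gamma> \<kappa>] by (simp add: D.in_mball)
    then show ?thesis using e(2) by blast
  qed
  moreover have "openin topology_W1 (W.mball \<mu> (e / 2))" unfolding topology_W1_def by (rule W.openin_mball)
  moreover have "\<mu> \<in> W.mball \<mu> (e / 2)" using \<mu> e2 by (simp add: W.in_mball)
  ultimately show ?thesis using r(1) by blast
qed

end

lemma exists_ngrid:
  fixes \<nu> :: "'s::{metric_space, second_countable_topology} measure"
  assumes \<mu>: "\<mu> \<in> M11" and \<nu>: "\<nu> \<in> M1 UNIV" and "compatible_metric (halfspace :: (real \<times> 's) set) \<delta>"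
  obtains A B where "ngrid A B \<mu> \<nu> \<delta>"
proof -
  interpret U: prob_space \<mu> by (rule M1_prob[OF M11_D(1)[OF \<mu>]])
  interpret V: prob_space \<nu> by (rule M1_prob[OF \<nu>])
  have id: "(\<lambda>x. x) \<in> borel_measurable \<mu>" by (rule M1_continuous_measurable[OF M11_D(1)[OF \<mu>]]) (intro continuous_intros)
  interpret U': prob_space "distr \<mu> borel (\<lambda>x. x)" by (rule U.prob_space_distr[OF id])
  obtain A :: "nat \<Rightarrow> real set" where A: "\<forall>k. open (A k) \<and> measure (distr \<mu> borel (\<lambda>x. x)) (frontier (A k)) = 0"
     "\<forall>x U. open U \<longrightarrow> x \<in> U \<longrightarrow> (\<exists>k. x \<in> A k \<and> A k \<subseteq> U)"
    using exists_continuity_base[OF U'.finite_measure_axioms] by auto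
  obtain B :: "nat \<Rightarrow> 's set" where B: "\<forall>k. open (B k) \<and> measure \<nu> (frontier (B k)) = 0"
     "\<forall>x U. open U \<longrightarrow> x \<in> U \<longrightarrow> (\<exists>k. x \<in> B k \<and> B k \<subseteq> U)"
    using exists_continuity_base[OF V.finite_measure_axioms] M1_sets[OF \<nu>] by auto
  have "measure \<mu> ({0..} \<inter> frontier (A k)) = 0" for k
    using A(1)[rule_format, of k] M1_emeasure_borel[OF M11_D(1)[OF \<mu>], of "frontier (A k)"] by (simp add: measure_def)
  then have "ngrid A B \<mu> \<nu> \<delta>" using A B assms by unfold_locales auto
  then show ?thesis by (rule that)
qed

section \<open>Exchangeability\<close>

text \<open>By second countability S is, inside C, a countable union of boxes. Openness is taken
  relative to C because configurations with a prescribed sum do not form an open set.\<close>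

lemma box_measurable:
  fixes S :: "('i \<Rightarrow> 'a::second_countable_topology) set"
  assumes I: "finite I" and C: "C \<in> sets (PiM I (\<lambda>_. borel))"
    and nb: "\<And>z. z \<in> C \<Longrightarrow> z \<in> S \<Longrightarrow> \<exists>O'. (\<forall>i\<in>I. open (O' i) \<and> z i \<in> O' i) \<and> (\<forall>z'\<in>C. (\<forall>i\<in>I. z' i \<in> O' i) \<longrightarrow> z' \<in> S)"
  shows "C \<inter> S \<in> sets (PiM I (\<lambda>_. borel))"
proof -
  obtain \<B> :: "'a set set" where B: "countable \<B>" "topological_basis \<B>" using ex_countable_basis by blast
  define G where "G = {c \<in> PiE I (\<lambda>_. \<B>). C \<inter> PiE I c \<subseteq> S}"
  have "countable (PiE I (\<lambda>_. \<B>))" using I B(1) by (intro countable_PiE)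
  then have Gc: "countable G" unfolding G_def by (rule countable_subset[rotated]) blast
  have CP: "C \<subseteq> PiE I (\<lambda>_. UNIV)" using sets.sets_into_space[OF C] by (simp add: space_PiM)
  have "C \<inter> S = (\<Union>c\<in>G. C \<inter> PiE I c)"
  proof (intro equalityI subsetI)
    fix z assume z: "z \<in> C \<inter> S"
    then obtain O' where O': "\<forall>i\<in>I. open (O' i) \<and> z i \<in> O' i" "\<forall>z'\<in>C. (\<forall>i\<in>I. z' i \<in> O' i) \<longrightarrow> z' \<in> S" using nb by blast
    have "\<forall>i\<in>I. \<exists>b. b \<in> \<B> \<and> z i \<in> b \<and> b \<subseteq> O' i"
    proof
      fix i assume "i \<in> I"
      then have "open (O' i)" "z i \<in> O' i" using O'(1) by auto
      then show "\<exists>b. b \<in> \<B> \<and> z i \<in> b \<and> b \<subseteq> O' i" by (rule topological_basisE[OF B(2)]) blast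
    qed
    from bchoice[OF this] obtain c where c: "\<forall>i\<in>I. c i \<in> \<B> \<and> z i \<in> c i \<and> c i \<subseteq> O' i" by blast
    have "restrict c I \<in> PiE I (\<lambda>_. \<B>)" using c by (intro restrict_PiE_iff[THEN iffD2]) blast
    moreover have "C \<inter> PiE I (restrict c I) \<subseteq> S"
    proof
      fix z' assume z': "z' \<in> C \<inter> PiE I (restrict c I)"
      have "z' i \<in> O' i" if i: "i \<in> I" for i
      proof -
        have "z' \<in> PiE I (restrict c I)" using z' by blast
        then have "z' i \<in> restrict c I i" using i by (rule PiE_mem)
        then show ?thesis using c i by auto
      qed
      then show "z' \<in> S" using O'(2) z' by blast
    qed
    ultimately have "restrict c I \<in> G" unfolding G_def by blast
    moreover have "z \<in> PiE I (restrict c I)" using c z CP by (auto simp: PiE_iff)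
    ultimately show "z \<in> (\<Union>c\<in>G. C \<inter> PiE I c)" using z by blast
  qed (auto simp: G_def)
  also have "\<dots> \<in> sets (PiM I (\<lambda>_. borel))"
  proof (rule sets.countable_UN'[OF Gc], rule image_subsetI)
    fix c assume c: "c \<in> G"
    have "c i \<in> sets borel" if "i \<in> I" for i
      using c that topological_basis_open[OF B(2)] by (auto simp: G_def PiE_iff)
    then show "C \<inter> PiE I c \<in> sets (PiM I (\<lambda>_. borel))" using C I by (intro sets.Int sets_PiM_I_finite) auto
  qed
  finally show ?thesis .
qed

lemma empirical_cong: "(\<And>i. i \<in> {1..n} \<Longrightarrow> x i = y i) \<Longrightarrow> empirical E n x = empirical E n y"
  unfolding empirical_def by (intro arg_cong[where f="measure_of E (sets (borel_on E))"] ext arg_cong[where f="\<lambda>t. t / of_nat n"] sum.cong) auto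

lemma empirical_permute:
  assumes "\<sigma> permutes {1..n}"
  shows "empirical E n (\<lambda>i. x (\<sigma> i)) = empirical E n x"
proof -
  have "(\<Sum>i=1..n. g (x (\<sigma> i))) = (\<Sum>i=1..n. g (x i))" for g :: "'a \<Rightarrow> ennreal"
    using sum.permute[OF assms, of "\<lambda>i. g (x i)"] by (simp add: comp_def)
  then show ?thesis unfolding empirical_def
    by (intro arg_cong[where f="measure_of E (sets (borel_on E))"] ext arg_cong[where f="\<lambda>t. t / of_nat n"])
qed

section \<open>Configurations and measurability of their empirical measures\<close>

text \<open>Functions extensional on {1..n}, as points of the product space are; the constraints on
  the first coordinates put the empirical measure into \<open>M11_prod\<close>.\<close>

definition conf :: "nat \<Rightarrow> (nat \<Rightarrow> real \<times> 's::topological_space) set" where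
  "conf n = {z \<in> PiE {1..n} (\<lambda>_. UNIV). (\<forall>i\<in>{1..n}. fst (z i) \<ge> 0) \<and> (\<Sum>i=1..n. fst (z i)) = real n}"

lemma conf_sets: "conf n \<in> sets (PiM {1..n} (\<lambda>_. borel :: (real \<times> 's::second_countable_topology) measure))"
proof -
  let ?M = "PiM {1..n} (\<lambda>_. borel :: (real \<times> 's) measure)"
  have m: "(\<lambda>z. fst (z i)) \<in> borel_measurable ?M" if "i \<in> {1..n}" for i
  proof (rule measurable_compose[of "\<lambda>z. z i" _ borel])
    show "(\<lambda>z. z i) \<in> measurable ?M borel" using that by (rule measurable_component_singleton)
    show "fst \<in> borel_measurable (borel :: (real \<times> 's) measure)"
      by (intro borel_measurable_continuous_onI continuous_intros)
  qed
  have s: "(\<lambda>z. \<Sum>i=1..n. fst (z i)) \<in> borel_measurable ?M" using m by (intro borel_measurable_sum)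
  have 1: "{z\<in>space ?M. \<forall>i\<in>{1..n}. fst (z i) \<ge> 0} \<in> sets ?M"
    by (intro sets.sets_Collect_finite_All borel_measurable_le m) auto
  have 2: "{z\<in>space ?M. (\<Sum>i=1..n. fst (z i)) = real n} \<in> sets ?M"
    by (intro borel_measurable_eq s) auto
  have "conf n = {z\<in>space ?M. \<forall>i\<in>{1..n}. fst (z i) \<ge> 0} \<inter> {z\<in>space ?M. (\<Sum>i=1..n. fst (z i)) = real n}"
    by (auto simp: conf_def space_PiM)
  then show ?thesis using 1 2 by simp
qed

lemma conf_empirical:
  assumes z: "z \<in> conf n" and n: "n \<ge> 1"
  shows "empirical halfspace n z \<in> M11_prod"
    "marg1 (empirical halfspace n z) = empirical {0..} n (\<lambda>i. fst (z i))"
    "marg2 (empirical halfspace n z) = empirical UNIV n (\<lambda>i. snd (z i))"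
proof -
  have zh: "z i \<in> halfspace" if "i \<in> {1..n}" for i using z that by (auto simp: conf_def mem_Times_iff)
  show m1: "marg1 (empirical halfspace n z) = empirical {0..} n (\<lambda>i. fst (z i))"
    unfolding marg1_def by (rule distr_empirical[OF n zh marg_measurable(1)])
  show "marg2 (empirical halfspace n z) = empirical UNIV n (\<lambda>i. snd (z i))"
    unfolding marg2_alt by (rule distr_empirical[OF n zh marg_measurable(3)])
  have "empirical {0..} n (\<lambda>i. fst (z i)) \<in> M11" using z by (intro empirical_in_M11[OF n]) (auto simp: conf_def)
  then show "empirical halfspace n z \<in> M11_prod"
    using empirical_in_M1[OF n zh] m1 by (intro M11_prodI) auto
qed

lemma sets_borel_of: "sets (borel_of T) = sigma_sets (topspace T) {U. openin T U}" "space (borel_of T) = topspace T"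
  unfolding borel_of_def using openin_subset by (auto intro!: sets_measure_of space_measure_of)

lemma openin_borel_of: "openin T U \<Longrightarrow> U \<in> sets (borel_of T)"
  unfolding sets_borel_of by (intro sigma_sets.Basic) simp

lemma closedin_borel_of: "closedin T C \<Longrightarrow> C \<in> sets (borel_of T)"
proof -
  assume C: "closedin T C"
  then have "topspace T - (topspace T - C) = C" using closedin_subset by blast
  moreover have "topspace T - (topspace T - C) \<in> sets (borel_of T)"
    unfolding sets_borel_of using C by (intro sigma_sets.Compl sigma_sets.Basic) auto
  ultimately show ?thesis by simp
qed

text \<open>On \<open>conf n\<close> the empirical measure depends continuously on the
  configuration: moving every point by less than e / 3, in \<delta> and in the weight, changes W1
  and \<open>\<beta>_BL\<close> by at most e / 3 each. This settles open sets, and an induction over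
  \<open>sigma_sets\<close> the Borel sets.\<close>

lemma empirical_preimage_measurable:
  fixes \<delta> :: "real \<times> 's::second_countable_topology \<Rightarrow> real \<times> 's \<Rightarrow> real"
  assumes compat: "compatible_metric halfspace \<delta>" and n: "n \<ge> 1" and Q: "Q \<in> sets (borel_of (topology_\<Delta> \<delta>))"
  shows "conf n \<inter> {z. empirical halfspace n z \<in> Q} \<in> sets (PiM {1..n} (\<lambda>_. borel))"
proof -
  interpret compat "halfspace :: (real \<times> 's) set" \<delta> by unfold_locales (rule compat)
  interpret D: Metric_space "M11_prod :: (real \<times> 's) measure set" "\<Delta> \<delta>" by (rule Metric_space_\<Delta>[OF compat])
  have op: "conf n \<inter> {z. empirical halfspace n z \<in> U} \<in> sets (PiM {1..n} (\<lambda>_. borel))" if U: "openin (topology_\<Delta> \<delta>) U" for U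
  proof (rule box_measurable[OF _ conf_sets])
    fix z0 :: "nat \<Rightarrow> real \<times> 's" assume z0: "z0 \<in> conf n" "z0 \<in> {z. empirical halfspace n z \<in> U}"
    have mU: "\<forall>x. x \<in> U \<longrightarrow> (\<exists>r>0. D.mball x r \<subseteq> U)"
      using U unfolding topology_\<Delta>_def D.openin_mtopology by (rule conjunct2)
    have "empirical halfspace n z0 \<in> U" using z0(2) by (rule CollectD)
    from mp[OF spec[OF mU] this] obtain e where e: "e > 0" "D.mball (empirical halfspace n z0) e \<subseteq> U" by (elim exE conjE)
    have zh: "z i \<in> halfspace" if "z \<in> conf n" "i \<in> {1..n}" for z :: "nat \<Rightarrow> real \<times> 's" and i
      using that by (auto simp: conf_def mem_Times_iff)
    have "\<forall>i\<in>{1..n}. \<exists>O'. open O' \<and> {y\<in>halfspace. \<delta> (z0 i) y < e / 3} = halfspace \<inter> O'"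
      by (rule ballI, rule ball_is_open, rule zh[OF z0(1)])
    from bchoice[OF this] obtain O' where O': "\<forall>i\<in>{1..n}. open (O' i) \<and> {y\<in>halfspace. \<delta> (z0 i) y < e / 3} = halfspace \<inter> O' i" by blast
    have O'2: "{y\<in>halfspace. \<delta> (z0 i) y < e / 3} = halfspace \<inter> O' i" if "i \<in> {1..n}" for i
      by (rule conjunct2[OF bspec[OF O' that]])
    define P where "P i = O' i \<inter> (ball (fst (z0 i)) (e / 3) \<times> UNIV)" for i
    show "\<exists>O'. (\<forall>i\<in>{1..n}. open (O' i) \<and> z0 i \<in> O' i) \<and> (\<forall>z'\<in>conf n. (\<forall>i\<in>{1..n}. z' i \<in> O' i) \<longrightarrow> z' \<in> {z. empirical halfspace n z \<in> U})"
    proof (intro exI[of _ P] conjI ballI impI)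
      fix i assume i: "i \<in> {1..n}"
      show "open (P i)" unfolding P_def by (intro open_Int open_Times conjunct1[OF bspec[OF O' i]]) auto
      have "z0 i \<in> {y\<in>halfspace. \<delta> (z0 i) y < e / 3}" using zh[OF z0(1) i] e(1) by simp
      then have "z0 i \<in> O' i" unfolding O'2[OF i] by (rule IntD2)
      then show "z0 i \<in> P i" using e(1) by (simp add: P_def mem_Times_iff)
    next
      fix z assume z: "z \<in> conf n" "\<forall>i\<in>{1..n}. z i \<in> P i"
      have d: "\<delta> (z0 i) (z i) < e / 3" if "i \<in> {1..n}" for i
      proof -
        have "z i \<in> halfspace \<inter> O' i" using z(2) that zh[OF z(1) that] by (auto simp: P_def)
        then have "z i \<in> {y\<in>halfspace. \<delta> (z0 i) y < e / 3}" unfolding O'2[OF that] .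
        then show ?thesis by simp
      qed
      have w: "\<bar>fst (z0 i) - fst (z i)\<bar> < e / 3" if "i \<in> {1..n}" for i
        using z(2) that by (auto simp: P_def mem_Times_iff dist_real_def)
      have avg: "(\<Sum>i=1..n. g i) / real n \<le> e / 3" if "\<And>i. i \<in> {1..n} \<Longrightarrow> g i < e / 3" for g :: "nat \<Rightarrow> real"
      proof -
        have "(\<Sum>i=1..n. g i) \<le> real (card {1..n}) * (e / 3)" using that by (intro sum_bounded_above) (auto intro: less_imp_le)
        then show ?thesis using n by (simp add: divide_le_eq mult.commute)
      qed
      note m0 = conf_empirical[OF z0(1) n] and m = conf_empirical[OF z(1) n]
      have "W1 (marg1 (empirical halfspace n z0)) (marg1 (empirical halfspace n z)) \<le> (\<Sum>i=1..n. \<bar>fst (z0 i) - fst (z i)\<bar>) / real n"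
        unfolding m0(2) m(2) using z0 z by (intro W1_empirical_le[OF n]) (auto simp: conf_def)
      also have "\<dots> \<le> e / 3" using w by (rule avg)
      finally have 1: "W1 (marg1 (empirical halfspace n z0)) (marg1 (empirical halfspace n z)) \<le> e / 3" .
      have 2: "\<beta>_BL halfspace \<delta> (empirical halfspace n z0) (empirical halfspace n z) \<le> e / 3"
      proof (rule \<beta>_BL_le)
        fix f assume f: "f \<in> BL halfspace \<delta>"
        have fm: "f \<in> borel_measurable (borel_on halfspace)" using BL_D(1)[OF f] by (rule borel_measurable_continuous_on_restrict)
        have "(\<integral>x. f x \<partial>empirical halfspace n z0) - (\<integral>x. f x \<partial>empirical halfspace n z) = (\<Sum>i=1..n. f (z0 i) - f (z i)) / real n"
          using integral_empirical[OF n zh[OF z0(1)] fm] integral_empirical[OF n zh[OF z(1)] fm]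
          by (simp add: sum_subtractf diff_divide_distrib)
        also have "\<bar>\<dots>\<bar> \<le> (\<Sum>i=1..n. \<bar>f (z0 i) - f (z i)\<bar>) / real n"
          by (simp add: abs_divide divide_right_mono sum_abs)
        also have "\<dots> \<le> e / 3"
        proof (rule avg)
          fix i assume i: "i \<in> {1..n}"
          show "\<bar>f (z0 i) - f (z i)\<bar> < e / 3"
            using BL_D(3)[OF f zh[OF z0(1) i] zh[OF z(1) i]] d[OF i] by linarith
        qed
        finally show "\<bar>(\<integral>x. f x \<partial>empirical halfspace n z0) - (\<integral>x. f x \<partial>empirical halfspace n z)\<bar> \<le> e / 3" .
      qed (use e in simp)
      have "\<Delta> \<delta> (empirical halfspace n z0) (empirical halfspace n z) < e" using 1 2 e(1) by (simp add: \<Delta>_def)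
      then have "empirical halfspace n z \<in> D.mball (empirical halfspace n z0) e" using m0(1) m(1) by (simp add: D.in_mball)
      then show "z \<in> {z. empirical halfspace n z \<in> U}" using e(2) by blast
    qed
  qed simp
  have top: "empirical halfspace n z \<in> topspace (topology_\<Delta> \<delta>)" if "z \<in> conf n" for z :: "nat \<Rightarrow> real \<times> 's"
    using conf_empirical(1)[OF that n] by (simp add: topology_\<Delta>_def)
  show ?thesis using Q unfolding sets_borel_of
  proof (induction rule: sigma_sets.induct)
    case (Basic a)
    then show ?case using op by simp
  next
    case Empty
    show ?case by simp
  next
    case (Compl a)
    have eq: "conf n \<inter> {z. empirical halfspace n z \<in> topspace (topology_\<Delta> \<delta>) - a} = conf n - (conf n \<inter> {z. empirical halfspace n z \<in> a})"
      using top by auto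
    show ?case unfolding eq by (rule sets.Diff[OF conf_sets Compl.IH])
  next
    case (Union a)
    have "conf n \<inter> {z. empirical halfspace n z \<in> (\<Union>i. a i)} = (\<Union>i. conf n \<inter> {z. empirical halfspace n z \<in> a i})" by auto
    also have "\<dots> \<in> sets (PiM {1..n} (\<lambda>_. borel))" using Union.IH by (intro sets.countable_UN) auto
    finally show ?case .
  qed
qed

section \<open>Exchangeable weights at a fixed n\<close>

locale exch_step = prob_space M for M :: "'w measure" +
  fixes n :: nat and W :: "nat \<Rightarrow> 'w \<Rightarrow> real" and X :: "nat \<Rightarrow> 'w \<Rightarrow> 's::second_countable_topology"
    and \<delta> :: "real \<times> 's \<Rightarrow> real \<times> 's \<Rightarrow> real"
  assumes n: "n \<ge> 1" and compat\<delta>: "compatible_metric (halfspace :: (real \<times> 's) set) \<delta>"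
    and Wm: "\<And>i. i \<in> {1..n} \<Longrightarrow> W i \<in> measurable M (borel_on {0..})"
    and Xm: "\<And>i. i \<in> {1..n} \<Longrightarrow> X i \<in> measurable M borel"
    and Wsum: "\<And>\<omega>. \<omega> \<in> space M \<Longrightarrow> (\<Sum>i=1..n. W i \<omega>) = real n"
    and exch: "exchangeable M (borel_on {0..}) n W"
    and indep: "independent_rvs M (PiM {1..n} (\<lambda>_. borel)) (\<lambda>\<omega>. \<lambda>i\<in>{1..n}. X i \<omega>)
           (PiM {1..n} (\<lambda>_. borel_on {0..})) (\<lambda>\<omega>. \<lambda>i\<in>{1..n}. W i \<omega>)"
begin

abbreviation "I \<equiv> {1..n}"
abbreviation "SX \<equiv> PiM I (\<lambda>_. borel :: 's measure)"
abbreviation "SW \<equiv> PiM I (\<lambda>_. borel_on {0..} :: real measure)"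
abbreviation "SZ \<equiv> PiM I (\<lambda>_. borel :: (real \<times> 's) measure)"
definition "XV \<omega> = (\<lambda>i\<in>I. X i \<omega>)"
definition "WV \<sigma> \<omega> = (\<lambda>i\<in>I. W (\<sigma> i) \<omega>)"
definition "ZV \<sigma> \<omega> = (\<lambda>i\<in>I. (W (\<sigma> i) \<omega>, X i \<omega>))"
definition "perm \<sigma> w = (\<lambda>i\<in>I. w (\<sigma> i) :: real)"

lemma XV_m: "XV \<in> measurable M SX" unfolding XV_def by (intro measurable_restrict Xm)

lemma WV_m: "\<sigma> permutes I \<Longrightarrow> WV \<sigma> \<in> measurable M SW"
  unfolding WV_def by (intro measurable_restrict Wm) (simp only: permutes_in_image)

lemma perm_m: "\<sigma> permutes I \<Longrightarrow> perm \<sigma> \<in> measurable SW SW"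
  unfolding perm_def by (intro measurable_restrict measurable_component_singleton) (simp only: permutes_in_image)

lemma WV_perm: "\<sigma> permutes I \<Longrightarrow> WV \<sigma> \<omega> = perm \<sigma> (WV id \<omega>)"
  unfolding WV_def perm_def by (rule ext) (simp add: permutes_in_image del: atLeastAtMost_iff)

lemma WV_law: "\<sigma> permutes I \<Longrightarrow> distr M SW (WV \<sigma>) = distr M SW (WV id)"
  using exch unfolding exchangeable_def WV_def by simp

lemma indep_prob:
  assumes "A \<in> sets SX" "B \<in> sets SW"
  shows "prob ((XV -` A \<inter> space M) \<inter> (WV id -` B \<inter> space M)) = prob (XV -` A \<inter> space M) * prob (WV id -` B \<inter> space M)"
proof -
  have "indep_set {XV -` A \<inter> space M | A. A \<in> sets SX} {WV id -` B \<inter> space M | B. B \<in> sets SW}"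
    using indep unfolding independent_rvs_def XV_def WV_def by simp
  then show ?thesis by (rule indep_setD) (use assms in auto)
qed

text \<open>Permuting the weights preserves their law, by exchangeability, and their independence of
  the labels; so the joint law is the same product for every \<sigma>.\<close>

lemma pair_law:
  assumes s: "\<sigma> permutes I"
  shows "distr M (SX \<Otimes>\<^sub>M SW) (\<lambda>\<omega>. (XV \<omega>, WV \<sigma> \<omega>)) = distr M SX XV \<Otimes>\<^sub>M distr M SW (WV id)"
proof (rule pair_measure_eqI[symmetric])
  have idp: "id permutes I" by simp
  interpret A: prob_space "distr M SX XV" by (rule prob_space_distr[OF XV_m])
  interpret B: prob_space "distr M SW (WV id)" by (rule prob_space_distr[OF WV_m[OF idp]])
  show "sigma_finite_measure (distr M SX XV)" "sigma_finite_measure (distr M SW (WV id))" by unfold_locales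
  show "sets (distr M SX XV \<Otimes>\<^sub>M distr M SW (WV id)) = sets (distr M (SX \<Otimes>\<^sub>M SW) (\<lambda>\<omega>. (XV \<omega>, WV \<sigma> \<omega>)))"
    by (simp cong: sets_pair_measure_cong)
  fix A B assume "A \<in> sets (distr M SX XV)" "B \<in> sets (distr M SW (WV id))"
  then have AB: "A \<in> sets SX" "B \<in> sets SW" by auto
  have pm: "(\<lambda>\<omega>. (XV \<omega>, WV \<sigma> \<omega>)) \<in> measurable M (SX \<Otimes>\<^sub>M SW)" using XV_m WV_m[OF s] by (rule measurable_Pair)
  have B': "perm \<sigma> -` B \<inter> space SW \<in> sets SW" by (rule measurable_sets[OF perm_m[OF s] AB(2)])
  have WS: "WV \<sigma> -` B \<inter> space M = WV id -` (perm \<sigma> -` B \<inter> space SW) \<inter> space M"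
    using measurable_space[OF WV_m[OF idp]] WV_perm[OF s] by auto
  have "emeasure (distr M (SX \<Otimes>\<^sub>M SW) (\<lambda>\<omega>. (XV \<omega>, WV \<sigma> \<omega>))) (A \<times> B)
     = emeasure M ((XV -` A \<inter> space M) \<inter> (WV \<sigma> -` B \<inter> space M))"
    using AB pm by (subst emeasure_distr) (auto intro!: arg_cong[where f="emeasure M"])
  also have "\<dots> = ennreal (prob (XV -` A \<inter> space M) * prob (WV \<sigma> -` B \<inter> space M))"
    unfolding emeasure_eq_measure WS by (subst indep_prob[OF AB(1) B']) simp
  also have "\<dots> = ennreal (prob (XV -` A \<inter> space M)) * ennreal (prob (WV \<sigma> -` B \<inter> space M))" by (simp add: ennreal_mult)
  also have "\<dots> = emeasure (distr M SX XV) A * emeasure (distr M SW (WV \<sigma>)) B"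
    using AB XV_m WV_m[OF s] by (simp add: emeasure_distr emeasure_eq_measure)
  finally show "emeasure (distr M SX XV) A * emeasure (distr M SW (WV id)) B
     = emeasure (distr M (SX \<Otimes>\<^sub>M SW) (\<lambda>\<omega>. (XV \<omega>, WV \<sigma> \<omega>))) (A \<times> B)" unfolding WV_law[OF s] by simp
qed

lemma glue_m: "(\<lambda>(x, w). \<lambda>i\<in>I. (w i, x i)) \<in> measurable (SX \<Otimes>\<^sub>M SW) SZ"
proof -
  have "(\<lambda>p. (snd p i, fst p i)) \<in> borel_measurable (SX \<Otimes>\<^sub>M SW)" if i: "i \<in> I" for i
  proof (rule borel_measurable_Pair)
    have "(\<lambda>p. snd p i) \<in> measurable (SX \<Otimes>\<^sub>M SW) (borel_on {0..})"
      by (rule measurable_compose[OF measurable_snd measurable_component_singleton[OF i]])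
    moreover have "(\<lambda>x::real. x) \<in> borel_measurable (borel_on {0..})" by (intro measurable_restrict_space1) simp
    ultimately show "(\<lambda>p. snd p i) \<in> borel_measurable (SX \<Otimes>\<^sub>M SW)" by (rule measurable_compose)
    show "(\<lambda>p. fst p i) \<in> borel_measurable (SX \<Otimes>\<^sub>M SW)"
      by (rule measurable_compose[OF measurable_fst measurable_component_singleton[OF i]])
  qed
  then show ?thesis unfolding split_beta by (rule measurable_restrict)
qed

lemma ZV_glue: "ZV \<sigma> \<omega> = (\<lambda>(x, w). \<lambda>i\<in>I. (w i, x i)) (XV \<omega>, WV \<sigma> \<omega>)"
  by (rule ext) (simp add: ZV_def XV_def WV_def)

lemma ZV_m: "\<sigma> permutes I \<Longrightarrow> ZV \<sigma> \<in> measurable M SZ"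
proof -
  assume s: "\<sigma> permutes I"
  have "(\<lambda>\<omega>. (\<lambda>(x, w). \<lambda>i\<in>I. (w i, x i)) (XV \<omega>, WV \<sigma> \<omega>)) \<in> measurable M SZ"
    using measurable_Pair[OF XV_m WV_m[OF s]] glue_m by (rule measurable_compose)
  moreover have "(\<lambda>\<omega>. (\<lambda>(x, w). \<lambda>i\<in>I. (w i, x i)) (XV \<omega>, WV \<sigma> \<omega>)) = ZV \<sigma>" by (rule ext) (rule ZV_glue[symmetric])
  ultimately show ?thesis by (simp only:)
qed

lemma ZV_law:
  assumes s: "\<sigma> permutes I" and D: "D \<in> sets SZ"
  shows "prob (ZV \<sigma> -` D \<inter> space M) = prob (ZV id -` D \<inter> space M)"
proof -
  let ?g = "\<lambda>(x, w). \<lambda>i\<in>I. (w i, x i)"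
  have e: "distr M SZ (ZV \<tau>) = distr (distr M SX XV \<Otimes>\<^sub>M distr M SW (WV id)) SZ ?g" if t: "\<tau> permutes I" for \<tau>
  proof -
    have "distr M SZ (ZV \<tau>) = distr M SZ (?g \<circ> (\<lambda>\<omega>. (XV \<omega>, WV \<tau> \<omega>)))"
      by (intro distr_cong) (auto simp: ZV_glue)
    also have "\<dots> = distr (distr M (SX \<Otimes>\<^sub>M SW) (\<lambda>\<omega>. (XV \<omega>, WV \<tau> \<omega>))) SZ ?g"
      by (rule distr_distr[symmetric, OF glue_m measurable_Pair[OF XV_m WV_m[OF t]]])
    finally show ?thesis unfolding pair_law[OF t] .
  qed
  have "measure (distr M SZ (ZV \<sigma>)) D = measure (distr M SZ (ZV id)) D" unfolding e[OF s] e[OF permutes_id] ..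
  then show ?thesis using D ZV_m[OF s] ZV_m[OF permutes_id] by (simp add: measure_distr)
qed

lemma ZV_conf:
  assumes s: "\<sigma> permutes I" and \<omega>: "\<omega> \<in> space M"
  shows "ZV \<sigma> \<omega> \<in> conf n"
proof -
  have "W i \<omega> \<ge> 0" if "i \<in> I" for i using measurable_space[OF Wm[OF that] \<omega>] by (simp add: space_restrict_space)
  then have "\<forall>i\<in>I. W (\<sigma> i) \<omega> \<ge> 0" using s by (simp add: permutes_in_image del: atLeastAtMost_iff)
  moreover have "(\<Sum>i\<in>I. W (\<sigma> i) \<omega>) = real n"
    using sum.permute[OF s, of "\<lambda>i. W i \<omega>"] Wsum[OF \<omega>] by (simp add: comp_def)
  ultimately show ?thesis by (simp add: conf_def ZV_def)
qed

definition "LW \<omega> = empirical {0..} n (\<lambda>i. W i \<omega>)"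
definition "LX \<omega> = empirical UNIV n (\<lambda>i. X i \<omega>)"
definition "V \<sigma> \<omega> = empirical halfspace n (\<lambda>i. (W (\<sigma> i) \<omega>, X i \<omega>))"

abbreviation "p_margins N1 N2 \<equiv> prob {\<omega>\<in>space M. LW \<omega> \<in> N1} * prob {\<omega>\<in>space M. LX \<omega> \<in> N2}"
abbreviation "hits Q \<omega> \<equiv> real (card {\<sigma>. \<sigma> permutes I \<and> V \<sigma> \<omega> \<in> Q})"

lemma V_ZV: "V \<sigma> \<omega> = empirical halfspace n (ZV \<sigma> \<omega>)"
  unfolding V_def by (rule empirical_cong) (simp add: ZV_def)

text \<open>A permutation changes the pairing of weights with labels but neither margin. Hence an
  event about the margins can be imposed before averaging over permutations.\<close>

lemma V_marg:
  assumes s: "\<sigma> permutes I" and \<omega>: "\<omega> \<in> space M"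
  shows "V \<sigma> \<omega> \<in> M11_prod" "marg1 (V \<sigma> \<omega>) = LW \<omega>" "marg2 (V \<sigma> \<omega>) = LX \<omega>"
proof -
  note c = conf_empirical[OF ZV_conf[OF s \<omega>] n]
  show "V \<sigma> \<omega> \<in> M11_prod" unfolding V_ZV by (rule c(1))
  have "empirical {0..} n (\<lambda>i. fst (ZV \<sigma> \<omega> i)) = empirical {0..} n (\<lambda>i. W (\<sigma> i) \<omega>)"
    by (rule empirical_cong) (simp add: ZV_def)
  also have "\<dots> = LW \<omega>" unfolding LW_def by (rule empirical_permute[OF s])
  finally show "marg1 (V \<sigma> \<omega>) = LW \<omega>" unfolding V_ZV c(2) .
  have "empirical UNIV n (\<lambda>i. snd (ZV \<sigma> \<omega> i)) = LX \<omega>"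
    unfolding LX_def by (rule empirical_cong) (simp add: ZV_def)
  then show "marg2 (V \<sigma> \<omega>) = LX \<omega>" unfolding V_ZV c(3) .
qed

text \<open>Configurations outside \<open>conf n\<close> do not occur, which puts the event into the
  form treated by \<open>empirical_preimage_measurable\<close>.\<close>

lemma V_vimage:
  assumes s: "\<sigma> permutes I"
  shows "{\<omega>\<in>space M. V \<sigma> \<omega> \<in> Q} = ZV \<sigma> -` (conf n \<inter> {z. empirical halfspace n z \<in> Q}) \<inter> space M"
  using ZV_conf[OF s] by (auto simp: V_ZV)

lemma V_sets:
  assumes "\<sigma> permutes I" "Q \<in> sets (borel_of (topology_\<Delta> \<delta>))"
  shows "{\<omega>\<in>space M. V \<sigma> \<omega> \<in> Q} \<in> events"
  unfolding V_vimage[OF assms(1)]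
  by (rule measurable_sets[OF ZV_m[OF assms(1)] empirical_preimage_measurable[OF compat\<delta> n assms(2)]])

lemma V_prob:
  assumes "\<sigma> permutes I" "Q \<in> sets (borel_of (topology_\<Delta> \<delta>))"
  shows "prob {\<omega>\<in>space M. V \<sigma> \<omega> \<in> Q} = prob {\<omega>\<in>space M. V id \<omega> \<in> Q}"
  unfolding V_vimage[OF assms(1)] V_vimage[OF permutes_id]
  by (rule ZV_law[OF assms(1) empirical_preimage_measurable[OF compat\<delta> n assms(2)]])

lemma V_measurable: "V id \<in> measurable M (borel_of (topology_\<Delta> \<delta>))"
proof (rule measurableI)
  fix \<omega> assume "\<omega> \<in> space M"
  then show "V id \<omega> \<in> space (borel_of (topology_\<Delta> \<delta>))"
    unfolding sets_borel_of using V_marg(1)[OF permutes_id] Metric_space.topspace_mtopology[OF Metric_space_\<Delta>[OF compat\<delta>]] by (simp add: topology_\<Delta>_def)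
next
  fix Q assume "Q \<in> sets (borel_of (topology_\<Delta> \<delta>))"
  then show "V id -` Q \<inter> space M \<in> events" using V_sets[OF permutes_id, of Q] by (simp add: vimage_def Int_def conj_commute)
qed

text \<open>Marginal constraints written as sets of joint measures, so that events about the margins
  become events about \<open>V\<close>.\<close>

definition "cyl1 N = {\<rho> \<in> M11_prod. marg1 \<rho> \<in> (N :: real measure set)}"
definition "cyl2 N = {\<rho> \<in> M11_prod. marg2 \<rho> \<in> (N :: 's measure set)}"

lemma topspace_\<Delta>: "topspace (topology_\<Delta> \<delta>) = M11_prod"
  unfolding topology_\<Delta>_def by (rule Metric_space.topspace_mtopology[OF Metric_space_\<Delta>[OF compat\<delta>]])

lemma cyl_borel:
  assumes "openin topology_W1 N1" "openin (weak_topology UNIV) N2"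
  shows "cyl1 N1 \<in> sets (borel_of (topology_\<Delta> \<delta>))" "cyl2 N2 \<in> sets (borel_of (topology_\<Delta> \<delta>))"
  using openin_continuous_map_preimage[OF marg1_continuous[OF compat\<delta>] assms(1)]
    openin_continuous_map_preimage[OF marg2_continuous[OF compat\<delta>] assms(2)]
  unfolding topspace_\<Delta> cyl1_def cyl2_def by (auto intro: openin_borel_of)

definition "R N1 N2 = {\<omega>\<in>space M. LW \<omega> \<in> N1 \<and> LX \<omega> \<in> N2}"

text \<open>The margins are continuous for \<open>\<Delta>\<close>, so this is an event about
  \<open>V id\<close> cut out by two open cylinders.\<close>

lemma R_sets:
  assumes "openin topology_W1 N1" "openin (weak_topology UNIV) N2"
  shows "R N1 N2 \<in> events"
proof -
  have "R N1 N2 = {\<omega>\<in>space M. V id \<omega> \<in> cyl1 N1 \<inter> cyl2 N2}"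
    using V_marg[OF permutes_id] by (auto simp: R_def cyl1_def cyl2_def)
  then show ?thesis using V_sets[OF permutes_id, of "cyl1 N1 \<inter> cyl2 N2"] cyl_borel[OF assms] by auto
qed

text \<open>Events of one marginal are cut out by freezing the other coordinate at an arbitrary value.\<close>

lemma R_prob:
  assumes N1: "openin topology_W1 N1" and N2: "openin (weak_topology UNIV) N2"
  shows "prob (R N1 N2) = p_margins N1 N2"
proof -
  note cb = cyl_borel[OF N1 N2]
  note D1 = empirical_preimage_measurable[OF compat\<delta> n cb(1)] and D2 = empirical_preimage_measurable[OF compat\<delta> n cb(2)]
  define g1 where "g1 w = (\<lambda>i\<in>I. (w i :: real, undefined :: 's))" for w
  \<comment> \<open>Frozen weights equal to 1 sum to n, which keeps the configuration in
    \<open>conf n\<close>; in g1 any label will do.\<close>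
  define g2 where "g2 x = (\<lambda>i\<in>I. (1 :: real, x i :: 's))" for x
  have g1m: "g1 \<in> measurable SW SZ" unfolding g1_def
  proof (intro measurable_restrict borel_measurable_Pair)
    fix i assume i: "i \<in> I"
    have "(\<lambda>x::real. x) \<in> borel_measurable (borel_on {0..})" by (intro measurable_restrict_space1) simp
    then show "(\<lambda>w. w i) \<in> borel_measurable SW" by (rule measurable_compose[OF measurable_component_singleton[OF i]])
  qed simp
  have g2m: "g2 \<in> measurable SX SZ" unfolding g2_def
    by (intro measurable_restrict borel_measurable_Pair measurable_component_singleton) auto
  define B where "B = g1 -` (conf n \<inter> {z. empirical halfspace n z \<in> cyl1 N1}) \<inter> space SW"
  define A where "A = g2 -` (conf n \<inter> {z. empirical halfspace n z \<in> cyl2 N2}) \<inter> space SX"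
  have B: "B \<in> sets SW" unfolding B_def by (rule measurable_sets[OF g1m D1])
  have A: "A \<in> sets SX" unfolding A_def by (rule measurable_sets[OF g2m D2])
  have eB: "WV id -` B \<inter> space M = {\<omega>\<in>space M. LW \<omega> \<in> N1}"
  proof -
    have "WV id \<omega> \<in> B \<longleftrightarrow> LW \<omega> \<in> N1" if \<omega>: "\<omega> \<in> space M" for \<omega>
    proof -
      have c: "g1 (WV id \<omega>) \<in> conf n" using ZV_conf[OF permutes_id \<omega>] by (simp add: conf_def g1_def WV_def ZV_def)
      have "marg1 (empirical halfspace n (g1 (WV id \<omega>))) = LW \<omega>"
        unfolding conf_empirical(2)[OF c n] LW_def by (rule empirical_cong) (simp add: g1_def WV_def)
      then show ?thesis using c conf_empirical(1)[OF c n] measurable_space[OF WV_m[OF permutes_id] \<omega>] by (simp add: B_def cyl1_def)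
    qed
    then show ?thesis by auto
  qed
  have eA: "XV -` A \<inter> space M = {\<omega>\<in>space M. LX \<omega> \<in> N2}"
  proof -
    have "XV \<omega> \<in> A \<longleftrightarrow> LX \<omega> \<in> N2" if \<omega>: "\<omega> \<in> space M" for \<omega>
    proof -
      have c: "g2 (XV \<omega>) \<in> conf n" by (simp add: conf_def g2_def)
      have "marg2 (empirical halfspace n (g2 (XV \<omega>))) = LX \<omega>"
        unfolding conf_empirical(3)[OF c n] LX_def by (rule empirical_cong) (simp add: g2_def XV_def)
      then show ?thesis using c conf_empirical(1)[OF c n] measurable_space[OF XV_m \<omega>] by (simp add: A_def cyl2_def)
    qed
    then show ?thesis by auto
  qed
  have "R N1 N2 = {\<omega>\<in>space M. LX \<omega> \<in> N2} \<inter> {\<omega>\<in>space M. LW \<omega> \<in> N1}" by (auto simp: R_def)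
  then show ?thesis using indep_prob[OF A B] unfolding eA eB by simp
qed

lemma sum_indicator_hits:
  assumes "\<omega> \<in> space M"
  shows "(\<Sum>\<sigma> | \<sigma> permutes I. indicator ({\<omega>\<in>space M. V \<sigma> \<omega> \<in> Q} \<inter> R N1 N2) \<omega>)
    = hits Q \<omega> * indicator (R N1 N2) \<omega>"
proof -
  have "(\<Sum>\<sigma> | \<sigma> permutes I. indicator ({\<omega>\<in>space M. V \<sigma> \<omega> \<in> Q} \<inter> R N1 N2) \<omega>)
      = (\<Sum>\<sigma> | \<sigma> permutes I. (if V \<sigma> \<omega> \<in> Q then 1 else 0)) * (indicator (R N1 N2) \<omega> :: real)"
    using assms unfolding sum_distrib_right by (intro sum.cong) (auto simp: indicator_def)
  also have "(\<Sum>\<sigma> | \<sigma> permutes I. (if V \<sigma> \<omega> \<in> Q then 1 else 0 :: real)) = hits Q \<omega>"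
    using finite_permutations[of I] by (simp add: sum.If_cases Int_def)
  finally show ?thesis .
qed

text \<open>Averaging over all permutations replaces the event by its conditional probability given both empirical measures.\<close>

lemma fact_prob_eq:
  assumes Q: "Q \<in> sets (borel_of (topology_\<Delta> \<delta>))" and N1: "openin topology_W1 N1" and N2: "openin (weak_topology UNIV) N2"
  shows "fact n * prob {\<omega>\<in>R N1 N2. V id \<omega> \<in> Q}
     = (\<integral>\<omega>. hits Q \<omega> * indicator (R N1 N2) \<omega> \<partial>M)"
proof -
  \<comment> \<open>The cylinders encode the event \<open>R\<close>, which is common to all
    \<sigma>, inside the event about \<open>V \<sigma>\<close>; this makes \<open>V_prob\<close>
    applicable to the joint event.\<close>
  let ?Q = "Q \<inter> (cyl1 N1 \<inter> cyl2 N2)"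
  let ?P = "{\<sigma>. \<sigma> permutes I}"
  have Qs: "?Q \<in> sets (borel_of (topology_\<Delta> \<delta>))" using Q cyl_borel[OF N1 N2] by auto
  have fP: "finite ?P" by (rule finite_permutations) simp
  have ev: "{\<omega>\<in>space M. V \<sigma> \<omega> \<in> ?Q} = {\<omega>\<in>R N1 N2. V \<sigma> \<omega> \<in> Q}" if "\<sigma> permutes I" for \<sigma>
    using V_marg[OF that] by (auto simp: R_def cyl1_def cyl2_def)
  have cP: "card ?P = fact n" using card_permutations[of I n] by simp
  have "fact n * prob {\<omega>\<in>R N1 N2. V id \<omega> \<in> Q} = (\<Sum>\<sigma>\<in>?P. prob {\<omega>\<in>space M. V id \<omega> \<in> ?Q})"
    unfolding sum_constant cP ev[OF permutes_id] of_nat_fact ..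
  also have "\<dots> = (\<Sum>\<sigma>\<in>?P. prob {\<omega>\<in>space M. V \<sigma> \<omega> \<in> ?Q})"
  proof (rule sum.cong[OF refl])
    fix \<sigma> assume "\<sigma> \<in> ?P"
    then have "\<sigma> permutes I" by (rule CollectD)
    then show "prob {\<omega>\<in>space M. V id \<omega> \<in> ?Q} = prob {\<omega>\<in>space M. V \<sigma> \<omega> \<in> ?Q}" by (rule V_prob[OF _ Qs, symmetric])
  qed
  also have "\<dots> = (\<Sum>\<sigma>\<in>?P. (\<integral>\<omega>. indicator {\<omega>\<in>space M. V \<sigma> \<omega> \<in> ?Q} \<omega> \<partial>M))"
  proof (rule sum.cong[OF refl])
    fix \<sigma>
    have "{\<omega>\<in>space M. V \<sigma> \<omega> \<in> ?Q} \<inter> space M = {\<omega>\<in>space M. V \<sigma> \<omega> \<in> ?Q}" by auto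
    then show "prob {\<omega>\<in>space M. V \<sigma> \<omega> \<in> ?Q} = (\<integral>\<omega>. indicator {\<omega>\<in>space M. V \<sigma> \<omega> \<in> ?Q} \<omega> \<partial>M)" by simp
  qed
  also have "\<dots> = (\<integral>\<omega>. (\<Sum>\<sigma>\<in>?P. indicator {\<omega>\<in>space M. V \<sigma> \<omega> \<in> ?Q} \<omega>) \<partial>M)"
    using V_sets[OF _ Qs] by (intro Bochner_Integration.integral_sum[symmetric] integrable_real_indicator) (auto simp: less_top[symmetric])
  also have "\<dots> = (\<integral>\<omega>. hits Q \<omega> * indicator (R N1 N2) \<omega> \<partial>M)"
  proof (rule Bochner_Integration.integral_cong[OF refl])
    fix \<omega> assume "\<omega> \<in> space M"
    have "{\<omega>\<in>space M. V \<sigma> \<omega> \<in> ?Q} = {\<omega>\<in>space M. V \<sigma> \<omega> \<in> Q} \<inter> R N1 N2" if "\<sigma> \<in> ?P" for \<sigma>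
      using ev that by (auto simp: R_def)
    then have "(\<Sum>\<sigma>\<in>?P. indicator {\<omega>\<in>space M. V \<sigma> \<omega> \<in> ?Q} \<omega>) = (\<Sum>\<sigma>\<in>?P. indicator ({\<omega>\<in>space M. V \<sigma> \<omega> \<in> Q} \<inter> R N1 N2) \<omega> :: real)"
      by (rule sum.cong[OF refl arg_cong[where f="\<lambda>A. indicator A \<omega>"]])
    then show "(\<Sum>\<sigma>\<in>?P. indicator {\<omega>\<in>space M. V \<sigma> \<omega> \<in> ?Q} \<omega>) = hits Q \<omega> * indicator (R N1 N2) \<omega>"
      unfolding sum_indicator_hits[OF \<open>\<omega> \<in> space M\<close>] .
  qed
  finally show ?thesis .
qed

lemma card_integrable:
  assumes Q: "Q \<in> sets (borel_of (topology_\<Delta> \<delta>))" and N1: "openin topology_W1 N1" and N2: "openin (weak_topology UNIV) N2"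
  shows "integrable M (\<lambda>\<omega>. hits Q \<omega> * indicator (R N1 N2) \<omega>)"
proof -
  let ?P = "{\<sigma>. \<sigma> permutes I}"
  have fP: "finite ?P" by (rule finite_permutations) simp
  have "integrable M (\<lambda>\<omega>. (\<Sum>\<sigma>\<in>?P. indicator ({\<omega>\<in>space M. V \<sigma> \<omega> \<in> Q} \<inter> R N1 N2) \<omega> :: real))"
    using V_sets[OF _ Q] R_sets[OF N1 N2]
    by (intro Bochner_Integration.integrable_sum integrable_real_indicator) (auto simp: less_top[symmetric])
  then show ?thesis by (subst (asm) Bochner_Integration.integrable_cong[OF refl sum_indicator_hits])
qed

text \<open>b bounds, uniformly on \<open>R\<close>, the proportion of permutations that hit Q;
  independence splits the probability of \<open>R\<close> into its marginal factors.\<close>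

lemma prob_le_of_card:
  assumes Q: "Q \<in> sets (borel_of (topology_\<Delta> \<delta>))" and N1: "openin topology_W1 N1" and N2: "openin (weak_topology UNIV) N2"
    and b: "\<And>\<omega>. \<omega> \<in> R N1 N2 \<Longrightarrow> hits Q \<omega> \<le> fact n * b"
  shows "prob {\<omega>\<in>R N1 N2. V id \<omega> \<in> Q} \<le> b * p_margins N1 N2"
proof -
  have RM: "R N1 N2 \<subseteq> space M" by (auto simp: R_def)
  have "fact n * prob {\<omega>\<in>R N1 N2. V id \<omega> \<in> Q} \<le> (\<integral>\<omega>. fact n * b * indicator (R N1 N2) \<omega> \<partial>M)"
    unfolding fact_prob_eq[OF Q N1 N2]
  proof (rule integral_mono[OF card_integrable[OF Q N1 N2]])
    show "integrable M (\<lambda>\<omega>. fact n * b * indicator (R N1 N2) \<omega>)"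
      using R_sets[OF N1 N2] by (intro integrable_mult_right integrable_real_indicator) (auto simp: less_top[symmetric])
  qed (use b in \<open>auto simp: indicator_def\<close>)
  also have "\<dots> = fact n * (b * prob (R N1 N2))" using RM by (simp add: Int_absorb2)
  finally have "prob {\<omega>\<in>R N1 N2. V id \<omega> \<in> Q} \<le> b * prob (R N1 N2)" by (simp add: mult_le_cancel_left_pos)
  then show ?thesis unfolding R_prob[OF N1 N2] .
qed

text \<open>The same average bounded from below; the constraint \<open>R\<close> is dropped only at
  the end, by monotonicity.\<close>

lemma prob_ge_of_card:
  assumes Q: "Q \<in> sets (borel_of (topology_\<Delta> \<delta>))" and N1: "openin topology_W1 N1" and N2: "openin (weak_topology UNIV) N2"
    and b: "\<And>\<omega>. \<omega> \<in> R N1 N2 \<Longrightarrow> fact n * b \<le> hits Q \<omega>"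
  shows "b * p_margins N1 N2 \<le> prob {\<omega>\<in>space M. V id \<omega> \<in> Q}"
proof -
  have RM: "R N1 N2 \<subseteq> space M" by (auto simp: R_def)
  have "fact n * (b * prob (R N1 N2)) = (\<integral>\<omega>. fact n * b * indicator (R N1 N2) \<omega> \<partial>M)" using RM by (simp add: Int_absorb2)
  also have "\<dots> \<le> fact n * prob {\<omega>\<in>R N1 N2. V id \<omega> \<in> Q}"
    unfolding fact_prob_eq[OF Q N1 N2]
  proof (rule integral_mono[OF _ card_integrable[OF Q N1 N2]])
    show "integrable M (\<lambda>\<omega>. fact n * b * indicator (R N1 N2) \<omega>)"
      using R_sets[OF N1 N2] by (intro integrable_mult_right integrable_real_indicator) (auto simp: less_top[symmetric])
  qed (use b in \<open>auto simp: indicator_def\<close>)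
  finally have "b * prob (R N1 N2) \<le> prob {\<omega>\<in>R N1 N2. V id \<omega> \<in> Q}" by (simp add: mult_le_cancel_left_pos)
  also have "\<dots> \<le> prob {\<omega>\<in>space M. V id \<omega> \<in> Q}"
    using RM V_sets[OF permutes_id Q] by (intro finite_measure_mono) auto
  finally show ?thesis unfolding R_prob[OF N1 N2] .
qed

end

section \<open>Counting permutations on a grid\<close>

locale step_grid = exch_step M n W X \<delta> + ngrid A B \<mu> \<nu> \<delta>
  for M :: "'w measure" and n W and X :: "nat \<Rightarrow> 'w \<Rightarrow> 's::{metric_space, second_countable_topology}" and \<delta> A B \<mu> \<nu>
begin

lemma labellings:
  "two_labellings I (\<lambda>k. lab A i (W k \<omega>)) (\<lambda>k. lab B i (X k \<omega>)) (Pow {..<i}) (Pow {..<i}) n"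
  by unfold_locales (use n lab_in in \<open>auto simp: lab_def\<close>)

lemma cell_P_sets: "P.cell i c \<in> sets (borel_on halfspace)" unfolding P.cell_def by (rule P.cell_sets)

lemma W_nonneg: "\<omega> \<in> space M \<Longrightarrow> k \<in> I \<Longrightarrow> W k \<omega> \<ge> 0"
  using measurable_space[OF Wm] by (simp add: space_restrict_space)

text \<open>The cell masses of \<open>V \<sigma> \<omega>\<close> form the contingency table of the
  two labellings under \<sigma>. Here the measure-theoretic problem becomes the counting
  problem.\<close>

lemma mtab_V:
  assumes s: "\<sigma> permutes I" and \<omega>: "\<omega> \<in> space M"
  shows "mtab (V \<sigma> \<omega>) i K L = two_labellings.tab I (\<lambda>k. lab A i (W k \<omega>)) (\<lambda>k. lab B i (X k \<omega>)) n \<sigma> K L"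
proof -
  interpret T: two_labellings I "\<lambda>k. lab A i (W k \<omega>)" "\<lambda>k. lab B i (X k \<omega>)" "Pow {..<i}" "Pow {..<i}" n by (rule labellings)
  have "{k\<in>I. (W (\<sigma> k) \<omega>, X k \<omega>) \<in> P.cell i (K, L)} = {k\<in>I. lab A i (W (\<sigma> k) \<omega>) = K \<and> lab B i (X k \<omega>) = L}"
  proof (rule Collect_cong, rule conj_cong[OF refl])
    fix k assume "k \<in> I"
    then have "\<sigma> k \<in> I" using permutes_in_image[OF s] by blast
    then have "W (\<sigma> k) \<omega> \<ge> 0" by (rule W_nonneg[OF \<omega>])
    then show "(W (\<sigma> k) \<omega>, X k \<omega>) \<in> P.cell i (K, L) \<longleftrightarrow> lab A i (W (\<sigma> k) \<omega>) = K \<and> lab B i (X k \<omega>) = L"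
      by (simp add: P.cell_def)
  qed
  then show ?thesis unfolding mtab_def V_def measure_empirical[OF n cell_P_sets] T.tab_def contingency_def by simp
qed

lemma ment_V:
  assumes "\<sigma> permutes I" "\<omega> \<in> space M"
  shows "ment i (V \<sigma> \<omega>) = tent (Pow {..<i}) (Pow {..<i}) (two_labellings.tab I (\<lambda>k. lab A i (W k \<omega>)) (\<lambda>k. lab B i (X k \<omega>)) n \<sigma>)"
  unfolding ment_def by (rule tent_cong) (rule mtab_V[OF assms])

text \<open>Every permutation that hits Q has a table of entropy above \<beta>, so
  \<open>card_entropy_ge\<close> bounds their number; 2 ^ i is the number of labels on each
  side.\<close>

lemma upper_step:
  assumes Q: "Q \<in> sets (borel_of (topology_\<Delta> \<delta>))" and N1: "openin topology_W1 N1" and N2: "openin (weak_topology UNIV) N2"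
    and b: "\<And>\<rho>. \<rho> \<in> Q \<Longrightarrow> marg1 \<rho> \<in> N1 \<Longrightarrow> marg2 \<rho> \<in> N2 \<Longrightarrow> ment i \<rho> > \<beta>"
  shows "prob {\<omega>\<in>R N1 N2. V id \<omega> \<in> Q}
    \<le> (real n + 1) ^ (2 ^ i * 2 ^ i) * exp (corr (2 ^ i) (2 ^ i) n) * exp (- real n * \<beta>)
       * p_margins N1 N2"
proof (rule prob_le_of_card[OF Q N1 N2])
  fix \<omega> assume "\<omega> \<in> R N1 N2"
  then have \<omega>: "\<omega> \<in> space M" "LW \<omega> \<in> N1" "LX \<omega> \<in> N2" by (auto simp: R_def)
  interpret T: two_labellings I "\<lambda>k. lab A i (W k \<omega>)" "\<lambda>k. lab B i (X k \<omega>)" "Pow {..<i}" "Pow {..<i}" n by (rule labellings)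
  have "{\<sigma>. \<sigma> permutes I \<and> V \<sigma> \<omega> \<in> Q} \<subseteq> {\<sigma>. \<sigma> permutes I \<and> \<beta> \<le> tent (Pow {..<i}) (Pow {..<i}) (T.tab \<sigma>)}"
  proof
    fix \<sigma> assume "\<sigma> \<in> {\<sigma>. \<sigma> permutes I \<and> V \<sigma> \<omega> \<in> Q}"
    then have s: "\<sigma> permutes I" "V \<sigma> \<omega> \<in> Q" by auto
    have "ment i (V \<sigma> \<omega>) > \<beta>" by (rule b[OF s(2)]) (use V_marg[OF s(1) \<omega>(1)] \<omega> in auto)
    then show "\<sigma> \<in> {\<sigma>. \<sigma> permutes I \<and> \<beta> \<le> tent (Pow {..<i}) (Pow {..<i}) (T.tab \<sigma>)}"
      using s(1) ment_V[OF s(1) \<omega>(1), of i] by simp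
  qed
  then have "card {\<sigma>. \<sigma> permutes I \<and> V \<sigma> \<omega> \<in> Q} \<le> card {\<sigma>. \<sigma> permutes I \<and> \<beta> \<le> tent (Pow {..<i}) (Pow {..<i}) (T.tab \<sigma>)}"
    by (rule card_mono[rotated]) (auto intro: finite_subset[OF _ finite_permutations[of I]])
  then show "hits Q \<omega>
     \<le> fact n * ((real n + 1) ^ (2 ^ i * 2 ^ i) * exp (corr (2 ^ i) (2 ^ i) n) * exp (- real n * \<beta>))"
    using T.card_entropy_ge[of \<beta>] by (simp add: card_Pow mult.assoc)
qed

lemma LW_cell:
  assumes \<omega>: "\<omega> \<in> space M"
  shows "measure (LW \<omega>) (PA.cell i K) = real (card {k\<in>I. lab A i (W k \<omega>) = K}) / real n"
proof -
  have c: "PA.cell i K \<in> sets (borel_on {0..})" unfolding PA.cell_def by (rule PA.cell_sets)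
  have "{k\<in>I. W k \<omega> \<in> PA.cell i K} = {k\<in>I. lab A i (W k \<omega>) = K}"
    using W_nonneg[OF \<omega>] by (auto simp: PA.cell_def)
  then show ?thesis unfolding LW_def measure_empirical[OF n c] by simp
qed

lemma LX_cell: "measure (LX \<omega>) (PB.cell i L) = real (card {k\<in>I. lab B i (X k \<omega>) = L}) / real n"
proof -
  have c: "PB.cell i L \<in> sets (borel_on UNIV)" unfolding PB.cell_def by (rule PB.cell_sets)
  show ?thesis unfolding LX_def measure_empirical[OF n c] by (simp add: PB.cell_def)
qed

end

section \<open>Exponential rates\<close>

abbreviation rate :: "nat \<Rightarrow> real \<Rightarrow> ereal" where
  "rate n p \<equiv> ereal (1 / real n) * log_prob p"

lemma rate_le_iff:
  assumes "n \<ge> 1" "p \<ge> 0"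
  shows "rate n p \<le> ereal y \<longleftrightarrow> p \<le> exp (y * real n)"
proof (cases "p = 0")
  case True
  then show ?thesis using assms(1) by (simp add: log_prob_def)
next
  case False
  then have p: "p > 0" using assms by simp
  have "ln p / real n \<le> y \<longleftrightarrow> ln p \<le> y * real n" using assms by (simp add: divide_le_eq)
  moreover have "ln p \<le> y * real n \<longleftrightarrow> p \<le> exp (y * real n)" using p exp_le_cancel_iff[of "ln p" "y * real n"] by simp
  ultimately show ?thesis using p by (simp add: log_prob_def)
qed

lemma rate_ge_iff:
  assumes "n \<ge> 1" "p \<ge> 0"
  shows "ereal y \<le> rate n p \<longleftrightarrow> exp (y * real n) \<le> p"
proof (cases "p = 0")
  case True
  then show ?thesis using assms(1) by (simp add: log_prob_def)
next
  case False
  then have p: "p > 0" using assms by simp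
  have "y \<le> ln p / real n \<longleftrightarrow> y * real n \<le> ln p" using assms by (simp add: le_divide_eq)
  moreover have "y * real n \<le> ln p \<longleftrightarrow> exp (y * real n) \<le> p" using p by (rule ln_ge_iff)
  ultimately show ?thesis using p by (simp add: log_prob_def)
qed

text \<open>Logarithmic asymptotics are exchanged for exponential bounds with real exponents.
  Quantifying over all real \<alpha> below c treats finite and infinite c alike.\<close>

lemma limsup_rate_le:
  assumes p: "\<And>n. p n \<ge> 0"
    and H: "\<And>\<alpha>. ereal \<alpha> < c \<Longrightarrow> eventually (\<lambda>n. p n \<le> exp (- \<alpha> * real n)) sequentially"
  shows "limsup (\<lambda>n. rate n (p n)) \<le> - c"
  unfolding Limsup_le_iff
proof (intro allI impI)
  fix y assume "- c < y"
  then obtain z where z: "- c < ereal z" "ereal z < y" using ereal_dense2 by blast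
  have "ereal (- z) < c" using z(1) by (simp add: ereal_uminus_less_reorder[of c "ereal z"])
  from H[OF this] eventually_ge_at_top[of 1]
  show "eventually (\<lambda>n. rate n (p n) < y) sequentially"
  proof eventually_elim
    case (elim n)
    then have "rate n (p n) \<le> ereal z" by (simp add: rate_le_iff[OF _ p])
    then show ?case using z(2) by (rule le_less_trans)
  qed
qed

lemma le_liminf_rate:
  assumes p: "\<And>n. p n \<ge> 0"
    and H: "\<And>\<alpha>. c < ereal \<alpha> \<Longrightarrow> eventually (\<lambda>n. exp (- \<alpha> * real n) \<le> p n) sequentially"
  shows "- c \<le> liminf (\<lambda>n. rate n (p n))"
  unfolding le_Liminf_iff
proof (intro allI impI)
  fix y assume "y < - c"
  then obtain z where z: "y < ereal z" "ereal z < - c" using ereal_dense2 by blast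
  have "c < ereal (- z)" using z(2) by (simp add: ereal_less_uminus_reorder[of "ereal z" c])
  from H[OF this] eventually_ge_at_top[of 1]
  show "eventually (\<lambda>n. y < rate n (p n)) sequentially"
  proof eventually_elim
    case (elim n)
    then have "ereal z \<le> rate n (p n)" by (simp add: rate_ge_iff[OF _ p])
    then show ?case using z(1) by (rule less_le_trans[rotated])
  qed
qed

lemma eventually_le_of_limsup_rate:
  assumes p: "\<And>n. p n \<ge> 0" and L: "limsup (\<lambda>n. rate n (p n)) \<le> - c" and \<alpha>: "ereal \<alpha> < c"
  shows "eventually (\<lambda>n. p n \<le> exp (- \<alpha> * real n)) sequentially"
proof -
  have "- c < ereal (- \<alpha>)" using \<alpha> by (simp add: ereal_uminus_less_reorder[of c "ereal (- \<alpha>)"])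
  then have "eventually (\<lambda>n. rate n (p n) < ereal (- \<alpha>)) sequentially"
    using L unfolding Limsup_le_iff by blast
  then show ?thesis using eventually_ge_at_top[of 1]
  proof eventually_elim
    case (elim n)
    show ?case using less_imp_le[OF elim(1)] unfolding rate_le_iff[OF elim(2) p] .
  qed
qed

lemma eventually_ge_of_liminf_rate:
  assumes p: "\<And>n. p n \<ge> 0" and L: "- c \<le> liminf (\<lambda>n. rate n (p n))" and \<alpha>: "c < ereal \<alpha>"
  shows "eventually (\<lambda>n. exp (- \<alpha> * real n) \<le> p n) sequentially"
proof -
  have "ereal (- \<alpha>) < - c" using \<alpha> by (simp add: ereal_less_uminus_reorder[of "ereal (- \<alpha>)" c])
  then have "eventually (\<lambda>n. ereal (- \<alpha>) < rate n (p n)) sequentially"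
    using L unfolding le_Liminf_iff by blast
  then show ?thesis using eventually_ge_at_top[of 1]
  proof eventually_elim
    case (elim n)
    show ?case using less_imp_le[OF elim(1)] unfolding rate_ge_iff[OF elim(2) p] .
  qed
qed

text \<open>The strict inequality \<alpha> < a turns the limsup bound into one that holds for all
  large n.\<close>

lemma LDP_upper_closed:
  assumes L: "LDP T P I" and C: "closedin T C" and I: "\<And>x. x \<in> C \<Longrightarrow> ereal a \<le> I x" and \<alpha>: "\<alpha> < a"
  shows "eventually (\<lambda>n. measure (P n) C \<le> exp (- \<alpha> * real n)) sequentially"
proof (rule eventually_le_of_limsup_rate)
  have "limsup (\<lambda>n. rate n (measure (P n) C)) \<le> - (INF x\<in>T closure_of C. I x)"
    using L closedin_borel_of[OF C] unfolding LDP_def by blast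
  then show "limsup (\<lambda>n. rate n (measure (P n) C)) \<le> - (INF x\<in>C. I x)"
    by (simp add: closure_of_closedin[OF C])
  have "ereal \<alpha> < ereal a" using \<alpha> by simp
  also have "\<dots> \<le> (INF x\<in>C. I x)" using I by (rule INF_greatest)
  finally show "ereal \<alpha> < (INF x\<in>C. I x)" .
qed simp

lemma LDP_lower_open:
  assumes L: "LDP T P I" and U: "openin T U" and x: "x \<in> U" "I x < ereal \<alpha>"
  shows "eventually (\<lambda>n. exp (- \<alpha> * real n) \<le> measure (P n) U) sequentially"
proof (rule eventually_ge_of_liminf_rate)
  have "- (INF x\<in>T interior_of U. I x) \<le> liminf (\<lambda>n. rate n (measure (P n) U))"
    using L openin_borel_of[OF U] unfolding LDP_def by blast
  then show "- (INF x\<in>U. I x) \<le> liminf (\<lambda>n. rate n (measure (P n) U))"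
    by (simp add: interior_of_openin[OF U])
  have "(INF x\<in>U. I x) \<le> I x" using x(1) by (rule INF_lower)
  then show "(INF x\<in>U. I x) < ereal \<alpha>" using x(2) by (rule le_less_trans)
qed simp

context prob_space
begin

lemma event: "f \<in> measurable M N \<Longrightarrow> Q \<in> sets N \<Longrightarrow> {\<omega>\<in>space M. f \<omega> \<in> Q} \<in> events"
  using measurable_sets[of f M N Q] by (simp add: vimage_def Int_def conj_commute)

lemma measure_distr_event: "f \<in> measurable M N \<Longrightarrow> Q \<in> sets N \<Longrightarrow> measure (distr M N f) Q = prob {\<omega>\<in>space M. f \<omega> \<in> Q}"
  by (simp add: measure_distr vimage_def Int_def conj_commute)

lemma LDP_rv_measurable: "LDP_rv M T Y I \<Longrightarrow> n \<ge> 1 \<Longrightarrow> Y n \<in> measurable M (borel_of T)"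
  unfolding LDP_rv_def by blast

lemma LDP_rv_upper:
  assumes L: "LDP_rv M T Y I" and C: "closedin T C" "\<And>x. x \<in> C \<Longrightarrow> ereal a \<le> I x" "\<alpha> < a"
  shows "eventually (\<lambda>n. prob {\<omega>\<in>space M. Y n \<omega> \<in> C} \<le> exp (- \<alpha> * real n)) sequentially"
proof -
  have "eventually (\<lambda>n. measure (distr M (borel_of T) (Y n)) C \<le> exp (- \<alpha> * real n)) sequentially"
    by (rule LDP_upper_closed[OF conjunct2[OF L[unfolded LDP_rv_def]] C(1) C(2) C(3)])
  then show ?thesis using eventually_ge_at_top[of 1]
    by eventually_elim (simp add: measure_distr_event[OF LDP_rv_measurable[OF L] closedin_borel_of[OF C(1)]])
qed

lemma LDP_rv_lower:
  assumes L: "LDP_rv M T Y I" and U: "openin T U" "x \<in> U" "I x < ereal \<alpha>"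
  shows "eventually (\<lambda>n. exp (- \<alpha> * real n) \<le> prob {\<omega>\<in>space M. Y n \<omega> \<in> U}) sequentially"
  using LDP_lower_open[OF conjunct2[OF L[unfolded LDP_rv_def]] U] eventually_ge_at_top[of 1]
  by eventually_elim (simp add: measure_distr_event[OF LDP_rv_measurable[OF L] openin_borel_of[OF U(1)]])

end

lemma eventually_poly_exp_le:
  assumes \<epsilon>: "\<epsilon> > 0"
  shows "eventually (\<lambda>n. (real n + 1) ^ m * exp (corr k l n) \<le> exp (\<epsilon> * real n)) sequentially"
proof -
  \<comment> \<open>d is such that m ln (n + 1) \<le> m d (n + 1) \<le> (m + 1) d 2 n = \<epsilon> n
    / 2; the other half of the exponent is for \<open>corr\<close>.\<close>
  define d where "d = \<epsilon> / (4 * (real m + 1))"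
  have d: "d > 0" using \<epsilon> by (simp add: d_def)
  have "(\<lambda>n. ln (real (Suc n)) / real (Suc n)) \<longlonglongrightarrow> 0" using LIMSEQ_Suc[OF lim_ln_over_n] by simp
  then have "eventually (\<lambda>n. ln (real (Suc n)) / real (Suc n) < d) sequentially" using d by (rule order_tendstoD(2))
  moreover have "eventually (\<lambda>n. corr k l n / real n < \<epsilon> / 2) sequentially" using corr_over_n \<epsilon> by (intro order_tendstoD(2)) auto
  ultimately show ?thesis using eventually_ge_at_top[of 1]
  proof eventually_elim
    case (elim n)
    have n: "real n \<ge> 1" using elim(3) by simp
    have "ln (real n + 1) \<le> d * (real n + 1)" using elim(1) by (simp add: divide_less_eq add.commute)
    then have "real m * ln (real n + 1) \<le> real m * (d * (real n + 1))" by (intro mult_left_mono) auto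
    also have "\<dots> \<le> (real m + 1) * (d * (2 * real n))" using d n by (intro mult_mono) auto
    also have "\<dots> = \<epsilon> / 2 * real n" by (simp add: d_def field_simps)
    finally have 1: "real m * ln (real n + 1) \<le> \<epsilon> / 2 * real n" .
    have 2: "corr k l n \<le> \<epsilon> / 2 * real n" using elim(2) n by (simp add: divide_less_eq)
    have "(real n + 1) ^ m = exp (real m * ln (real n + 1))" by (simp add: exp_of_nat_mult)
    then have "(real n + 1) ^ m * exp (corr k l n) = exp (real m * ln (real n + 1) + corr k l n)" by (simp add: exp_add)
    also have "\<dots> \<le> exp (\<epsilon> * real n)" using 1 2 by simp
    finally show ?case .
  qed
qed

section \<open>The rate function\<close>

text \<open>A strict lower bound on a sum is distributed over its terms, which reduces
  semicontinuity of the sum to that of each term. An infinite term takes q + 2 and compensates the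
  two values -1, which lie strictly below any nonnegative term; in the finite case the slack is
  shared in thirds.\<close>

lemma ereal_less_add3:
  fixes x y z :: ereal
  assumes "\<alpha> < x + y + z" "0 \<le> x" "0 \<le> y" "0 \<le> z"
  shows "\<exists>a b c. ereal a < x \<and> ereal b < y \<and> ereal c < z \<and> \<alpha> \<le> ereal (a + b + c)"
proof -
  obtain q where q: "\<alpha> < ereal q" "ereal q < x + y + z" using ereal_dense2[OF assms(1)] by blast
  have "\<exists>a b c. ereal a < x \<and> ereal b < y \<and> ereal c < z \<and> q \<le> a + b + c"
  proof -
    have neg: "ereal (-1) < t" if "0 \<le> t" for t using that by (rule less_le_trans[rotated]) simp
    consider "x = \<infinity>" | "y = \<infinity>" | "z = \<infinity>" | x' y' z' where "x = ereal x'" "y = ereal y'" "z = ereal z'"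
      using assms(2-4) by (cases x; cases y; cases z) auto
    then show ?thesis
    proof cases
      case 1
      then have "ereal (q + 2) < x \<and> ereal (-1) < y \<and> ereal (-1) < z \<and> q \<le> (q + 2) + -1 + -1" using neg assms by simp
      then show ?thesis by blast
    next
      case 2
      then have "ereal (-1) < x \<and> ereal (q + 2) < y \<and> ereal (-1) < z \<and> q \<le> -1 + (q + 2) + -1" using neg assms by simp
      then show ?thesis by blast
    next
      case 3
      then have "ereal (-1) < x \<and> ereal (-1) < y \<and> ereal (q + 2) < z \<and> q \<le> -1 + -1 + (q + 2)" using neg assms by simp
      then show ?thesis by blast
    next
      case 4
      define d where "d = (x' + y' + z' - q) / 3"
      have "d > 0" using q(2) 4 by (simp add: d_def)
      moreover have "q = (x' - d) + (y' - d) + (z' - d)" by (simp add: d_def field_simps)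
      ultimately have "ereal (x' - d) < x \<and> ereal (y' - d) < y \<and> ereal (z' - d) < z \<and> q \<le> (x' - d) + (y' - d) + (z' - d)"
        using 4 by simp
      then show ?thesis by blast
    qed
  qed
  then obtain a b c where abc: "ereal a < x" "ereal b < y" "ereal c < z" "q \<le> a + b + c" by blast
  have "\<alpha> \<le> ereal q" using q(1) by (rule less_imp_le)
  also have "\<dots> \<le> ereal (a + b + c)" using abc(4) by simp
  finally show ?thesis using abc(1-3) by blast
qed

text \<open>Young's inequality with the test function 0.\<close>

lemma rel_entropy_nonneg:
  assumes "\<rho> \<in> M1 (halfspace :: (real \<times> 's::second_countable_topology) set)"
  shows "0 \<le> mutual_entropy \<rho>"
proof -
  have \<tau>: "marg1 \<rho> \<Otimes>\<^sub>M marg2 \<rho> \<in> M1 halfspace" by (rule product_M1[OF marg1_M1[OF assms] marg2_M1[OF assms]])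
  interpret R: prob_space \<rho> by (rule M1_prob[OF assms])
  interpret T: prob_space "marg1 \<rho> \<Otimes>\<^sub>M marg2 \<rho>" by (rule M1_prob[OF \<tau>])
  interpret prob_pair \<rho> "marg1 \<rho> \<Otimes>\<^sub>M marg2 \<rho>" by unfold_locales (simp add: M1_sets[OF assms] M1_sets[OF \<tau>])
  show ?thesis using young_le_rel_entropy[of "\<lambda>_. 0" 0] by (simp add: R.prob_space T.prob_space zero_ereal_def)
qed

lemma (in ngrid) entropy_compactness_limitin:
  assumes \<rho>: "\<And>j. \<rho> j \<in> M11_prod" and l1: "limitin topology_W1 (\<lambda>j. marg1 (\<rho> j)) \<mu> sequentially"
    and c2: "\<And>i L. L \<in> Pow {..<i} \<Longrightarrow> (\<lambda>j. measure (marg2 (\<rho> j)) (PB.cell i L)) \<longlonglongrightarrow> measure \<nu> (PB.cell i L)"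
    and H: "\<And>j. mutual_entropy (\<rho> j) \<le> ereal \<alpha>"
  shows "\<exists>\<kappa>\<in>M11_prod. mutual_entropy \<kappa> \<le> ereal \<alpha> \<and>
     (\<exists>r. strict_mono r \<and> limitin (topology_\<Delta> \<delta>) (\<lambda>j. \<rho> (r j)) \<kappa> sequentially)"
proof -
  have c1: "(\<lambda>j. W1 (marg1 (\<rho> j)) \<mu>) \<longlonglongrightarrow> 0"
  proof (rule LIMSEQ_I)
    fix e :: real assume e: "e > 0"
    have "limitin W.mtopology (\<lambda>j. marg1 (\<rho> j)) \<mu> sequentially" using l1 unfolding topology_W1_def .
    then obtain N where N: "\<And>n. n \<ge> N \<Longrightarrow> W1 (marg1 (\<rho> n)) \<mu> < e" using e unfolding W.limit_metric_sequentially by blast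
    have "norm (W1 (marg1 (\<rho> n)) \<mu> - 0) < e" if "n \<ge> N" for n using N[OF that] W1_nonneg[of "marg1 (\<rho> n)" \<mu>] by simp
    then show "\<exists>no. \<forall>n\<ge>no. norm (W1 (marg1 (\<rho> n)) \<mu> - 0) < e" by blast
  qed
  have H': "ment j (\<rho> j) \<le> \<alpha>" for j
    using order_trans[OF ment_le_rel_entropy[OF M11_prod_D(1)[OF \<rho>]] H] by simp
  obtain \<kappa> r where \<kappa>: "\<kappa> \<in> M11_prod" "marg1 \<kappa> = \<mu>" "marg2 \<kappa> = \<nu>" "rel_entropy \<kappa> (\<mu> \<Otimes>\<^sub>M \<nu>) \<le> ereal \<alpha>"
    "strict_mono r" "(\<lambda>j. \<Delta> \<delta> (\<rho> (r j)) \<kappa>) \<longlonglongrightarrow> 0"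
    using entropy_compactness[of \<rho> \<alpha>, OF \<rho> c1 c2 H'] by blast
  have "limitin (topology_\<Delta> \<delta>) (\<lambda>j. \<rho> (r j)) \<kappa> sequentially"
    unfolding topology_\<Delta>_def by (rule limitin_of_\<Delta>[OF \<kappa>(1) \<rho> \<kappa>(6)])
  then show ?thesis using \<kappa> by (intro bexI[of _ \<kappa>]) auto
qed

text \<open>Along a sequence converging to l the margins converge to those of l, so
  \<open>entropy_compactness\<close> on a grid adapted to l yields a subsequential limit of entropy
  at most h. By uniqueness of limits it is l.\<close>

lemma entropy_sublevel_closed:
  fixes \<delta> :: "real \<times> 's::{metric_space, second_countable_topology} \<Rightarrow> real \<times> 's \<Rightarrow> real"
  assumes compat: "compatible_metric halfspace \<delta>"
  shows "closedin (topology_\<Delta> \<delta>) {\<rho>\<in>M11_prod. mutual_entropy \<rho> \<le> ereal h}"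
proof -
  interpret D: Metric_space "M11_prod :: (real \<times> 's) measure set" "\<Delta> \<delta>" by (rule Metric_space_\<Delta>[OF compat])
  show ?thesis unfolding topology_\<Delta>_def D.metric_closedin_iff_sequentially_closed
  proof (intro conjI allI impI)
    fix \<sigma> l assume "range \<sigma> \<subseteq> {\<rho>\<in>M11_prod. mutual_entropy \<rho> \<le> ereal h} \<and> limitin D.mtopology \<sigma> l sequentially"
    then have \<sigma>: "\<And>j. \<sigma> j \<in> M11_prod" "\<And>j. mutual_entropy (\<sigma> j) \<le> ereal h"
      and lim: "limitin D.mtopology \<sigma> l sequentially" by auto
    have l: "l \<in> M11_prod" using lim unfolding D.limit_metric_sequentially by blast
    obtain A B where "ngrid A B (marg1 l) (marg2 l) \<delta>" using exists_ngrid[OF M11_prod_D(2,3)[OF l] compat] .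
    then interpret G: ngrid A B "marg1 l" "marg2 l" \<delta> .
    have lim': "limitin (topology_\<Delta> \<delta>) \<sigma> l sequentially" using lim unfolding topology_\<Delta>_def .
    have l1: "limitin topology_W1 (\<lambda>j. marg1 (\<sigma> j)) (marg1 l) sequentially"
      using continuous_map_limit[OF marg1_continuous[OF compat] lim'] by (simp add: comp_def)
    have l2: "limitin (weak_topology UNIV) (\<lambda>j. marg2 (\<sigma> j)) (marg2 l) sequentially"
      using continuous_map_limit[OF marg2_continuous[OF compat] lim'] by (simp add: comp_def)
    have c2: "(\<lambda>j. measure (marg2 (\<sigma> j)) (G.PB.cell i L)) \<longlonglongrightarrow> measure (marg2 l) (G.PB.cell i L)" if L: "L \<in> Pow {..<i}" for i L
    proof (rule LIMSEQ_I)
      fix e :: real assume "e > 0"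
      then obtain N where N: "openin (weak_topology UNIV) N" "marg2 l \<in> N"
        "\<forall>\<gamma>\<in>N. \<forall>j\<le>i. \<forall>L. L \<in> Pow {..<j} \<longrightarrow> \<bar>measure \<gamma> (G.PB.cell j L) - measure (marg2 l) (G.PB.cell j L)\<bar> < e"
        using G.nbhdB[of e i] by blast
      have "eventually (\<lambda>j. marg2 (\<sigma> j) \<in> N) sequentially" using l2 N(1,2) unfolding limitin_def by blast
      then obtain no where "\<And>j. j \<ge> no \<Longrightarrow> marg2 (\<sigma> j) \<in> N" by (auto simp: eventually_sequentially)
      then show "\<exists>no. \<forall>n\<ge>no. norm (measure (marg2 (\<sigma> n)) (G.PB.cell i L) - measure (marg2 l) (G.PB.cell i L)) < e"
        using N(3) L by (intro exI[of _ no] allI impI) simp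
    qed
    obtain \<kappa> r where \<kappa>: "\<kappa> \<in> M11_prod" "mutual_entropy \<kappa> \<le> ereal h" "strict_mono r"
      "limitin (topology_\<Delta> \<delta>) (\<lambda>j. \<sigma> (r j)) \<kappa> sequentially"
      using G.entropy_compactness_limitin[of \<sigma> h, OF \<sigma>(1) l1 c2 \<sigma>(2)] by blast
    have "limitin (topology_\<Delta> \<delta>) (\<lambda>j. \<sigma> (r j)) l sequentially"
      using limitin_subsequence[OF \<kappa>(3) lim'] by (simp add: comp_def)
    then have "l = \<kappa>" using \<kappa>(4) unfolding topology_\<Delta>_def by (rule D.limitin_metric_unique) simp
    then show "l \<in> {\<rho>\<in>M11_prod. mutual_entropy \<rho> \<le> ereal h}" using \<kappa> by simp
  qed auto
qed

text \<open>All three terms are lower semicontinuous, the last two through continuity of the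
  margins; \<open>ereal_less_add3\<close> combines them.\<close>

lemma lower_semicontinuous_rate_J:
  fixes \<delta> :: "real \<times> 's::{metric_space, second_countable_topology} \<Rightarrow> real \<times> 's \<Rightarrow> real"
  assumes compat: "compatible_metric halfspace \<delta>"
    and W: "\<And>\<mu>. \<mu> \<in> M11 \<Longrightarrow> 0 \<le> IW \<mu>" "lower_semicontinuous topology_W1 IW"
    and X: "\<And>\<nu>. \<nu> \<in> M1 UNIV \<Longrightarrow> 0 \<le> IX \<nu>" "lower_semicontinuous (weak_topology UNIV) IX"
  shows "lower_semicontinuous (topology_\<Delta> \<delta>) (rate_J IW IX)"
  unfolding lower_semicontinuous_def
proof (intro allI, subst openin_subopen, intro ballI)
  fix \<alpha> \<rho> assume \<rho>': "\<rho> \<in> {\<rho> \<in> topspace (topology_\<Delta> \<delta>). \<alpha> < rate_J IW IX \<rho>}"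
  have top: "topspace (topology_\<Delta> \<delta>) = M11_prod"
    unfolding topology_\<Delta>_def by (rule Metric_space.topspace_mtopology[OF Metric_space_\<Delta>[OF compat]])
  have \<rho>: "\<rho> \<in> M11_prod" "\<alpha> < rate_J IW IX \<rho>" using \<rho>' by (auto simp: top)
  let ?H = "\<lambda>\<rho> :: (real \<times> 's) measure. mutual_entropy \<rho>"
  obtain a b c where abc: "ereal a < ?H \<rho>" "ereal b < IW (marg1 \<rho>)" "ereal c < IX (marg2 \<rho>)" "\<alpha> \<le> ereal (a + b + c)"
    using ereal_less_add3[OF \<rho>(2)[unfolded rate_J_def] rel_entropy_nonneg[OF M11_prod_D(1)[OF \<rho>(1)]] W(1)[OF M11_prod_D(2)[OF \<rho>(1)]] X(1)[OF M11_prod_D(3)[OF \<rho>(1)]]]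
    by blast
  let ?T1 = "{\<rho>\<in>M11_prod. ereal a < ?H \<rho>}"
  let ?T2 = "{\<rho>\<in>M11_prod. marg1 \<rho> \<in> {\<mu> \<in> topspace topology_W1. ereal b < IW \<mu>}}"
  let ?T3 = "{\<rho>\<in>M11_prod. marg2 \<rho> \<in> {\<nu> \<in> topspace (weak_topology UNIV). ereal c < IX \<nu>}}"
  have "?T1 = topspace (topology_\<Delta> \<delta>) - {\<rho>\<in>M11_prod. ?H \<rho> \<le> ereal a}" by (auto simp: top)
  then have o1: "openin (topology_\<Delta> \<delta>) ?T1" using entropy_sublevel_closed[OF compat, of a] by (simp only: openin_diff openin_topspace)
  have o2: "openin (topology_\<Delta> \<delta>) ?T2"
    using openin_continuous_map_preimage[OF marg1_continuous[OF compat], of "{\<mu> \<in> topspace topology_W1. ereal b < IW \<mu>}"] W(2)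
    unfolding lower_semicontinuous_def top by blast
  have o3: "openin (topology_\<Delta> \<delta>) ?T3"
    using openin_continuous_map_preimage[OF marg2_continuous[OF compat], of "{\<nu> \<in> topspace (weak_topology UNIV). ereal c < IX \<nu>}"] X(2)
    unfolding lower_semicontinuous_def top by blast
  show "\<exists>T. openin (topology_\<Delta> \<delta>) T \<and> \<rho> \<in> T \<and> T \<subseteq> {\<rho> \<in> topspace (topology_\<Delta> \<delta>). \<alpha> < rate_J IW IX \<rho>}"
  proof (intro exI[of _ "?T1 \<inter> (?T2 \<inter> ?T3)"] conjI)
    show "openin (topology_\<Delta> \<delta>) (?T1 \<inter> (?T2 \<inter> ?T3))" by (intro openin_Int o1 o2 o3)
    show "\<rho> \<in> ?T1 \<inter> (?T2 \<inter> ?T3)"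
      using \<rho>(1) abc M11_prod_D[OF \<rho>(1)] by (simp add: topspace_W1 topspace_weak_topology)
    show "?T1 \<inter> (?T2 \<inter> ?T3) \<subseteq> {\<rho> \<in> topspace (topology_\<Delta> \<delta>). \<alpha> < rate_J IW IX \<rho>}"
    proof
      fix \<gamma> assume "\<gamma> \<in> ?T1 \<inter> (?T2 \<inter> ?T3)"
      then have \<gamma>: "\<gamma> \<in> M11_prod" "ereal a < ?H \<gamma>" "ereal b < IW (marg1 \<gamma>)" "ereal c < IX (marg2 \<gamma>)" by auto
      have "ereal a + ereal b + ereal c < rate_J IW IX \<gamma>"
        unfolding rate_J_def by (intro ereal_add_strict_mono2 \<gamma>)
      then have "\<alpha> < rate_J IW IX \<gamma>" using abc(4) by (simp add: le_less_trans)
      then show "\<gamma> \<in> {\<rho> \<in> topspace (topology_\<Delta> \<delta>). \<alpha> < rate_J IW IX \<rho>}" using \<gamma>(1) by (simp add: top)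
    qed
  qed
qed

text \<open>If every point of K had a neighbourhood visited only finitely often, finitely many of
  these would cover K and account for only finitely many indices.\<close>

lemma compactin_cluster_point:
  assumes K: "compactin T K" and m: "\<And>j::nat. m j \<in> K"
  shows "\<exists>p\<in>K. \<forall>N. openin T N \<longrightarrow> p \<in> N \<longrightarrow> infinite {j. m j \<in> N}"
proof (rule ccontr)
  assume neg: "\<not> ?thesis"
  have "\<exists>\<F>. finite \<F> \<and> \<F> \<subseteq> {N. openin T N \<and> finite {j. m j \<in> N}} \<and> K \<subseteq> \<Union>\<F>"
    by (rule compactinD[OF K]) (use neg in blast)+
  then obtain \<F> where \<F>: "finite \<F>" "\<F> \<subseteq> {N. openin T N \<and> finite {j. m j \<in> N}}" "K \<subseteq> \<Union>\<F>" by blast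
  have "finite (\<Union>N\<in>\<F>. {j. m j \<in> N})" using \<F>(1,2) by blast
  moreover have "(\<Union>N\<in>\<F>. {j. m j \<in> N}) = UNIV" using m \<F>(3) by blast
  ultimately show False by simp
qed

text \<open>The margins of a sequence in a sublevel set stay in a compact set of pairs. At a cluster
  point only countably many convergences have to be extracted: that of the first margin in W1 and
  those of the cell masses of a grid adapted to this point. Bounded entropy then gives a limit in
  \<open>\<Delta>\<close>, and closedness keeps it in the sublevel set.\<close>

lemma good_rate_J:
  fixes \<delta> :: "real \<times> 's::{metric_space, second_countable_topology} \<Rightarrow> real \<times> 's \<Rightarrow> real"
  assumes compat: "compatible_metric halfspace \<delta>"
    and W: "\<And>\<mu>. \<mu> \<in> M11 \<Longrightarrow> 0 \<le> IW \<mu>" "lower_semicontinuous topology_W1 IW" "good_rate topology_W1 IW"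
    and X: "\<And>\<nu>. \<nu> \<in> M1 UNIV \<Longrightarrow> 0 \<le> IX \<nu>" "lower_semicontinuous (weak_topology UNIV) IX" "good_rate (weak_topology UNIV) IX"
  shows "good_rate (topology_\<Delta> \<delta>) (rate_J IW IX)"
  unfolding good_rate_def
proof
  fix \<alpha> :: real
  interpret D: Metric_space "M11_prod :: (real \<times> 's) measure set" "\<Delta> \<delta>" by (rule Metric_space_\<Delta>[OF compat])
  let ?H = "\<lambda>\<rho> :: (real \<times> 's) measure. mutual_entropy \<rho>"
  let ?S = "{\<rho> \<in> topspace (topology_\<Delta> \<delta>). rate_J IW IX \<rho> \<le> ereal \<alpha>}"
  have top: "topspace (topology_\<Delta> \<delta>) = M11_prod" unfolding topology_\<Delta>_def by simp
  have closed: "closedin (topology_\<Delta> \<delta>) ?S"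
  proof -
    have "?S = topspace (topology_\<Delta> \<delta>) - {\<rho> \<in> topspace (topology_\<Delta> \<delta>). ereal \<alpha> < rate_J IW IX \<rho>}" by auto
    also have "closedin (topology_\<Delta> \<delta>) \<dots>"
      using lower_semicontinuous_rate_J[OF compat W(1,2) X(1,2)] unfolding lower_semicontinuous_def
      by (intro closedin_diff closedin_topspace) blast
    finally show ?thesis .
  qed
  have parts: "?H \<rho> \<le> ereal \<alpha>" "IW (marg1 \<rho>) \<le> ereal \<alpha>" "IX (marg2 \<rho>) \<le> ereal \<alpha>" if "\<rho> \<in> ?S" for \<rho>
  proof -
    have \<rho>: "\<rho> \<in> M11_prod" "?H \<rho> + IW (marg1 \<rho>) + IX (marg2 \<rho>) \<le> ereal \<alpha>" using that by (auto simp: top rate_J_def)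
    have nn: "0 \<le> ?H \<rho>" "0 \<le> IW (marg1 \<rho>)" "0 \<le> IX (marg2 \<rho>)"
      using rel_entropy_nonneg[OF M11_prod_D(1)[OF \<rho>(1)]] W(1)[OF M11_prod_D(2)[OF \<rho>(1)]] X(1)[OF M11_prod_D(3)[OF \<rho>(1)]] by auto
    have "?H \<rho> \<le> ?H \<rho> + IW (marg1 \<rho>) + IX (marg2 \<rho>)" using add_mono[OF add_mono[OF order_refl nn(2)] nn(3), of "?H \<rho>"] by simp
    then show "?H \<rho> \<le> ereal \<alpha>" using \<rho>(2) by (rule order_trans)
    have "IW (marg1 \<rho>) \<le> ?H \<rho> + IW (marg1 \<rho>) + IX (marg2 \<rho>)" using add_mono[OF add_mono[OF nn(1) order_refl] nn(3), of "IW (marg1 \<rho>)"] by simp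
    then show "IW (marg1 \<rho>) \<le> ereal \<alpha>" using \<rho>(2) by (rule order_trans)
    have "IX (marg2 \<rho>) \<le> ?H \<rho> + IW (marg1 \<rho>) + IX (marg2 \<rho>)" using add_mono[OF add_mono[OF nn(1,2)] order_refl, of "IX (marg2 \<rho>)"] by simp
    then show "IX (marg2 \<rho>) \<le> ereal \<alpha>" using \<rho>(2) by (rule order_trans)
  qed
  let ?K1 = "{\<mu> \<in> topspace topology_W1. IW \<mu> \<le> ereal \<alpha>}" and ?K2 = "{\<nu> \<in> topspace (weak_topology UNIV). IX \<nu> \<le> ereal \<alpha>}"
  have K: "compactin (prod_topology topology_W1 (weak_topology UNIV)) (?K1 \<times> ?K2)"
    unfolding compactin_Times using W(3) X(3) unfolding good_rate_def by blast
  have "\<exists>l r. l \<in> ?S \<and> strict_mono r \<and> limitin D.mtopology (\<sigma> \<circ> r) l sequentially" if \<sigma>: "range \<sigma> \<subseteq> ?S" for \<sigma> :: "nat \<Rightarrow> (real \<times> 's) measure"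
  proof -
    have sS: "\<sigma> j \<in> ?S" for j using \<sigma> by blast
    then have sM: "\<sigma> j \<in> M11_prod" for j by (simp add: top)
    have "(marg1 (\<sigma> j), marg2 (\<sigma> j)) \<in> ?K1 \<times> ?K2" for j
      using parts(2,3)[OF sS] M11_prod_D[OF sM] by (simp add: topspace_W1 topspace_weak_topology)
    from compactin_cluster_point[where m="\<lambda>j. (marg1 (\<sigma> j), marg2 (\<sigma> j))", OF K this] obtain p where p: "p \<in> ?K1 \<times> ?K2"
      "\<forall>N. openin (prod_topology topology_W1 (weak_topology UNIV)) N \<longrightarrow> p \<in> N \<longrightarrow> infinite {j. (marg1 (\<sigma> j), marg2 (\<sigma> j)) \<in> N}"
      by (rule bexE)
    obtain \<mu> \<nu> where "p = (\<mu>, \<nu>)" by (cases p)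
    note mn = p[unfolded this]
    have \<mu>: "\<mu> \<in> M11" and \<nu>: "\<nu> \<in> M1 UNIV" using mn(1) by (auto simp: topspace_W1 topspace_weak_topology)
    obtain A B where "ngrid A B \<mu> \<nu> \<delta>" using exists_ngrid[OF \<mu> \<nu> compat] .
    then interpret G: ngrid A B \<mu> \<nu> \<delta> .
    let ?P = "\<lambda>j k. marg1 (\<sigma> k) \<in> G.W.mball \<mu> (1 / real (Suc j)) \<and>
      (\<forall>i\<le>j. \<forall>L. L \<in> Pow {..<i} \<longrightarrow> \<bar>measure (marg2 (\<sigma> k)) (G.PB.cell i L) - measure \<nu> (G.PB.cell i L)\<bar> < 1 / real (Suc j))"
    have inf: "infinite {k. ?P j k}" for j
    proof -
      have j: "1 / real (Suc j) > 0" by simp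
      obtain N2 where N2: "openin (weak_topology UNIV) N2" "\<nu> \<in> N2"
        "\<forall>\<gamma>\<in>N2. \<forall>i\<le>j. \<forall>L. L \<in> Pow {..<i} \<longrightarrow> \<bar>measure \<gamma> (G.PB.cell i L) - measure \<nu> (G.PB.cell i L)\<bar> < 1 / real (Suc j)"
        using G.nbhdB[OF j, of j] by blast
      have "openin topology_W1 (G.W.mball \<mu> (1 / real (Suc j)))" unfolding topology_W1_def by (rule G.W.openin_mball)
      then have "openin (prod_topology topology_W1 (weak_topology UNIV)) (G.W.mball \<mu> (1 / real (Suc j)) \<times> N2)"
        using N2(1) by (simp add: openin_prod_Times_iff)
      moreover have "(\<mu>, \<nu>) \<in> G.W.mball \<mu> (1 / real (Suc j)) \<times> N2" using \<mu> N2(2) by (simp add: G.W.in_mball)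
      ultimately have "infinite {k. (marg1 (\<sigma> k), marg2 (\<sigma> k)) \<in> G.W.mball \<mu> (1 / real (Suc j)) \<times> N2}" by (rule mn(2)[rule_format])
      then show ?thesis by (rule infinite_super[rotated]) (use N2(3) in blast)
    qed
    \<comment> \<open>Infinitely many visits to each neighbourhood allow the indices to be chosen
      strictly increasing.\<close>
    have "\<exists>s. \<forall>j. ?P j (s j) \<and> s j < s (Suc j)"
    proof (rule dependent_nat_choice)
      show "\<exists>k. ?P 0 k" using inf[of 0] not_finite_existsD by blast
      show "\<exists>k'. ?P (Suc j) k' \<and> k < k'" for k j
        using inf[of "Suc j"] unfolding infinite_nat_iff_unbounded by blast
    qed
    then obtain s where s: "\<And>j. ?P j (s j)" "\<And>j. s j < s (Suc j)" by blast
    have sm: "strict_mono s" using s(2) by (simp add: strict_mono_Suc_iff)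
    have l0: "(\<lambda>j. 1 / real (Suc j)) \<longlonglongrightarrow> 0" using LIMSEQ_Suc[OF lim_1_over_n[where 'a=real]] by simp
    have l1: "limitin topology_W1 (\<lambda>j. marg1 (\<sigma> (s j))) \<mu> sequentially"
      unfolding topology_W1_def G.W.limit_metric_sequentially
    proof (intro conjI allI impI \<mu>)
      fix e :: real assume "e > 0"
      then have "eventually (\<lambda>j. 1 / real (Suc j) < e) sequentially" using l0 by (intro order_tendstoD(2))
      then obtain N where N: "\<And>j. j \<ge> N \<Longrightarrow> 1 / real (Suc j) < e" by (auto simp: eventually_sequentially)
      have "marg1 (\<sigma> (s j)) \<in> M11 \<and> W1 (marg1 (\<sigma> (s j))) \<mu> < e" if "j \<ge> N" for j
      proof -
        have "W1 \<mu> (marg1 (\<sigma> (s j))) < 1 / real (Suc j)" using s(1)[of j] by (simp only: G.W.in_mball)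
        then show ?thesis using N[OF that] M11_prod_D(2)[OF sM] W1_commute[of \<mu> "marg1 (\<sigma> (s j))"] by simp
      qed
      then show "\<exists>N. \<forall>n\<ge>N. marg1 (\<sigma> (s n)) \<in> M11 \<and> W1 (marg1 (\<sigma> (s n))) \<mu> < e" by blast
    qed
    have c2: "(\<lambda>j. measure (marg2 (\<sigma> (s j))) (G.PB.cell i L)) \<longlonglongrightarrow> measure \<nu> (G.PB.cell i L)" if L: "L \<in> Pow {..<i}" for i L
    proof -
      have "eventually (\<lambda>j. norm (measure (marg2 (\<sigma> (s j))) (G.PB.cell i L) - measure \<nu> (G.PB.cell i L)) \<le> 1 / real (Suc j)) sequentially"
        using eventually_ge_at_top[of i]
      proof eventually_elim
        case (elim j)
        then have "\<bar>measure (marg2 (\<sigma> (s j))) (G.PB.cell i L) - measure \<nu> (G.PB.cell i L)\<bar> < 1 / real (Suc j)"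
          using conjunct2[OF s(1)[of j]] L by blast
        then show ?case by (simp only: real_norm_def less_imp_le)
      qed
      from Lim_null_comparison[OF this l0] show ?thesis by (rule LIM_zero_cancel)
    qed
    obtain \<kappa> r where \<kappa>: "\<kappa> \<in> M11_prod" "strict_mono r" "limitin (topology_\<Delta> \<delta>) (\<lambda>j. \<sigma> (s (r j))) \<kappa> sequentially"
      using G.entropy_compactness_limitin[of "\<lambda>j. \<sigma> (s j)" \<alpha>, OF sM l1 c2 parts(1)[OF sS]] by blast
    have "\<kappa> \<in> ?S" by (rule limitin_closedin[OF \<kappa>(3) closed]) (use sS in auto)
    moreover have "strict_mono (s \<circ> r)" using sm \<kappa>(2) by (rule strict_mono_o)
    moreover have "limitin D.mtopology (\<sigma> \<circ> (s \<circ> r)) \<kappa> sequentially" using \<kappa>(3) unfolding topology_\<Delta>_def by (simp add: comp_def)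
    ultimately show ?thesis by blast
  qed
  then show "compactin (topology_\<Delta> \<delta>) ?S"
    unfolding topology_\<Delta>_def[of \<delta>] D.compactin_sequentially by (auto simp: topology_\<Delta>_def)
qed

section \<open>The large deviation bounds\<close>

locale exch_ldp = prob_space M for M :: "'w measure" +
  fixes W :: "nat \<Rightarrow> nat \<Rightarrow> 'w \<Rightarrow> real" and X :: "nat \<Rightarrow> nat \<Rightarrow> 'w \<Rightarrow> 's::{metric_space, second_countable_topology}"
    and \<delta> :: "real \<times> 's \<Rightarrow> real \<times> 's \<Rightarrow> real" and IW IX
  assumes compat: "compatible_metric (halfspace :: (real \<times> 's) set) \<delta>"
    and step: "\<And>n. n \<ge> 1 \<Longrightarrow> exch_step M n (W n) (X n) \<delta>"
    and LDP_W: "LDP_rv M topology_W1 (\<lambda>n \<omega>. empirical {0..} n (\<lambda>i. W n i \<omega>)) IW"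
    and LDP_X: "LDP_rv M (weak_topology UNIV) (\<lambda>n \<omega>. empirical UNIV n (\<lambda>i. X n i \<omega>)) IX"
    and good_W: "good_rate topology_W1 IW" and good_X: "good_rate (weak_topology UNIV) IX"
begin

definition "VW n \<omega> = empirical {0..} n (\<lambda>i. W n i \<omega>)"
definition "VX n \<omega> = empirical UNIV n (\<lambda>i. X n i \<omega>)"
definition "VV n \<omega> = empirical halfspace n (\<lambda>i. (W n i \<omega>, X n i \<omega>))"

abbreviation "pW n N \<equiv> prob {\<omega>\<in>space M. VW n \<omega> \<in> N}"
abbreviation "pX n N \<equiv> prob {\<omega>\<in>space M. VX n \<omega> \<in> N}"
abbreviation "pV n Q \<equiv> prob {\<omega>\<in>space M. VV n \<omega> \<in> Q}"

lemma LDP_VW: "LDP_rv M topology_W1 VW IW"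
  using LDP_W unfolding VW_def[abs_def] .

lemma LDP_VX: "LDP_rv M (weak_topology UNIV) VX IX"
  using LDP_X unfolding VX_def[abs_def] .

lemmas VW_measurable = LDP_rv_measurable[OF LDP_VW] and VX_measurable = LDP_rv_measurable[OF LDP_VX]
  and pW_upper = LDP_rv_upper[OF LDP_VW] and pX_upper = LDP_rv_upper[OF LDP_VX]
  and pW_lower = LDP_rv_lower[OF LDP_VW] and pX_lower = LDP_rv_lower[OF LDP_VX]

lemma step_eqs:
  assumes "n \<ge> 1"
  shows "exch_step.LW n (W n) = VW n" "exch_step.LX n (X n) = VX n" "exch_step.V n (W n) (X n) id = VV n"
proof -
  interpret S: exch_step M n "W n" "X n" \<delta> by (rule step[OF assms])
  show "S.LW = VW n" by (rule ext) (simp add: S.LW_def VW_def)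
  show "S.LX = VX n" by (rule ext) (simp add: S.LX_def VX_def)
  show "S.V id = VV n" by (rule ext) (simp add: S.V_def VV_def)
qed

lemma VV_measurable: "n \<ge> 1 \<Longrightarrow> VV n \<in> measurable M (borel_of (topology_\<Delta> \<delta>))"
  using exch_step.V_measurable[OF step] step_eqs(3) by simp

lemma IW_nonneg: "\<mu> \<in> M11 \<Longrightarrow> 0 \<le> IW \<mu>" and IW_lsc: "lower_semicontinuous topology_W1 IW"
  using LDP_W unfolding LDP_rv_def LDP_def by (auto simp: topspace_W1)

lemma IX_nonneg: "\<nu> \<in> M1 UNIV \<Longrightarrow> 0 \<le> IX \<nu>" and IX_lsc: "lower_semicontinuous (weak_topology UNIV) IX"
  using LDP_X unfolding LDP_rv_def LDP_def by (auto simp: topspace_weak_topology)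

lemma J_nonneg: "\<rho> \<in> M11_prod \<Longrightarrow> 0 \<le> rate_J IW IX \<rho>"
  unfolding rate_J_def by (intro add_nonneg_nonneg rel_entropy_nonneg IW_nonneg IX_nonneg M11_prod_D)

text \<open>The margins enter a small neighbourhood of those of \<kappa> at exponential cost w + x,
  and there a proportion of at least about exp (- n h) of the permutations brings the empirical
  measure into U. The count is made at a finite level i; its exponent is harmless because
  \<open>ment_le_rel_entropy\<close> bounds it by h.\<close>

lemma lower_bound:
  assumes U: "openin (topology_\<Delta> \<delta>) U" and \<kappa>: "\<kappa> \<in> U" and \<alpha>: "rate_J IW IX \<kappa> < ereal \<alpha>"
  shows "eventually (\<lambda>n. exp (- \<alpha> * real n) \<le> pV n U) sequentially"
proof -
  let ?\<mu> = "marg1 \<kappa>" and ?\<nu> = "marg2 \<kappa>"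
  have \<kappa>p: "\<kappa> \<in> M11_prod"
    using openin_subset[OF U] \<kappa> Metric_space.topspace_mtopology[OF Metric_space_\<Delta>[OF compat]] by (auto simp: topology_\<Delta>_def)
  note \<kappa>D = M11_prod_D[OF \<kappa>p]
  have nn: "0 \<le> rel_entropy \<kappa> (?\<mu> \<Otimes>\<^sub>M ?\<nu>)" "0 \<le> IW ?\<mu>" "0 \<le> IX ?\<nu>"
    using rel_entropy_nonneg[OF \<kappa>D(1)] IW_nonneg[OF \<kappa>D(2)] IX_nonneg[OF \<kappa>D(3)] by auto
  obtain h w x where hwx: "rel_entropy \<kappa> (?\<mu> \<Otimes>\<^sub>M ?\<nu>) = ereal h" "IW ?\<mu> = ereal w" "IX ?\<nu> = ereal x"
    using nn \<alpha> unfolding rate_J_def by (cases "rel_entropy \<kappa> (?\<mu> \<Otimes>\<^sub>M ?\<nu>)"; cases "IW ?\<mu>"; cases "IX ?\<nu>") auto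
  \<comment> \<open>A quarter of the slack each for the entropy and the two margins; the last
    quarter is given away.\<close>
  define \<epsilon> where "\<epsilon> = (\<alpha> - (h + w + x)) / 4"
  have \<epsilon>: "\<epsilon> > 0" using \<alpha> hwx by (simp add: \<epsilon>_def rate_J_def)
  obtain A B where "ngrid A B ?\<mu> ?\<nu> \<delta>" using exists_ngrid[OF \<kappa>D(2,3) compat] .
  then interpret G: ngrid A B ?\<mu> ?\<nu> \<delta> .
  obtain i r N1 where loc: "r > 0" "openin topology_W1 N1" "?\<mu> \<in> N1"
    "\<forall>\<gamma>\<in>M11_prod. marg1 \<gamma> \<in> N1 \<longrightarrow> (\<Sum>K\<in>Pow {..<i}. \<Sum>L\<in>Pow {..<i}. \<bar>G.mtab \<gamma> i K L - G.mtab \<kappa> i K L\<bar>) < r \<longrightarrow> \<gamma> \<in> U"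
    using G.lower_local[OF U \<kappa> refl] by blast
  \<comment> \<open>e serves both as an error in the exponent and as the distance between tables,
    hence the minimum.\<close>
  define e where "e = min \<epsilon> r"
  have e: "e > 0" "e \<le> \<epsilon>" "e \<le> r" using \<epsilon> loc(1) by (auto simp: e_def)
  let ?L = "Pow {..<i}"
  have "\<exists>\<eta>>0. \<exists>n0. \<forall>n\<ge>n0. \<forall>(I :: nat set) a b. two_labellings I a b ?L ?L n \<longrightarrow>
      (\<forall>k\<in>?L. \<bar>card {i\<in>I. a i = k} / real n - (\<Sum>l\<in>?L. G.mtab \<kappa> i k l)\<bar> < \<eta>) \<longrightarrow>
      (\<forall>l\<in>?L. \<bar>card {i\<in>I. b i = l} / real n - (\<Sum>k\<in>?L. G.mtab \<kappa> i k l)\<bar> < \<eta>) \<longrightarrow>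
      fact n * exp (- real n * (tent ?L ?L (G.mtab \<kappa> i) + e)) \<le>
        real (card {\<sigma>. \<sigma> permutes I \<and> (\<Sum>k\<in>?L. \<Sum>l\<in>?L. \<bar>two_labellings.tab I a b n \<sigma> k l - G.mtab \<kappa> i k l\<bar>) < e})"
    by (rule card_near_table_ge) (simp_all add: G.mtab_nonneg G.mtab_total[OF \<kappa>D(1)] e(1))
  then obtain \<eta> n0 where \<eta>: "\<eta> > 0" and near: "\<And>n (I :: nat set) a b. n \<ge> n0 \<Longrightarrow> two_labellings I a b ?L ?L n \<Longrightarrow>
      \<forall>k\<in>?L. \<bar>card {i\<in>I. a i = k} / real n - (\<Sum>l\<in>?L. G.mtab \<kappa> i k l)\<bar> < \<eta> \<Longrightarrow>
      \<forall>l\<in>?L. \<bar>card {i\<in>I. b i = l} / real n - (\<Sum>k\<in>?L. G.mtab \<kappa> i k l)\<bar> < \<eta> \<Longrightarrow>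
      fact n * exp (- real n * (tent ?L ?L (G.mtab \<kappa> i) + e)) \<le>
        real (card {\<sigma>. \<sigma> permutes I \<and> (\<Sum>k\<in>?L. \<Sum>l\<in>?L. \<bar>two_labellings.tab I a b n \<sigma> k l - G.mtab \<kappa> i k l\<bar>) < e})"
    by (elim exE conjE) blast
  obtain N1' where N1': "openin topology_W1 N1'" "?\<mu> \<in> N1'"
    "\<forall>\<gamma>\<in>N1'. \<forall>K. K \<in> ?L \<longrightarrow> \<bar>measure \<gamma> (G.PA.cell i K) - measure ?\<mu> (G.PA.cell i K)\<bar> < \<eta>"
    using G.nbhdA[OF \<eta>, of i] by blast
  obtain N2 where N2: "openin (weak_topology UNIV) N2" "?\<nu> \<in> N2"
    "\<forall>\<gamma>\<in>N2. \<forall>j\<le>i. \<forall>L. L \<in> Pow {..<j} \<longrightarrow> \<bar>measure \<gamma> (G.PB.cell j L) - measure ?\<nu> (G.PB.cell j L)\<bar> < \<eta>"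
    using G.nbhdB[OF \<eta>, of i] by blast
  let ?N = "N1 \<inter> N1'"
  have oN: "openin topology_W1 ?N" using loc(2) N1'(1) by (rule openin_Int)
  have eW: "eventually (\<lambda>n. exp (- (w + \<epsilon>) * real n) \<le> pW n ?N) sequentially"
    by (rule pW_lower[OF oN, of ?\<mu>]) (use loc(3) N1'(2) hwx(2) \<epsilon> in auto)
  have eX: "eventually (\<lambda>n. exp (- (x + \<epsilon>) * real n) \<le> pX n N2) sequentially"
    by (rule pX_lower[OF N2(1,2)]) (use hwx(3) \<epsilon> in auto)
  show ?thesis using eW eX eventually_ge_at_top[of n0] eventually_ge_at_top[of 1]
  proof eventually_elim
    case (elim n)
    interpret S: exch_step M n "W n" "X n" \<delta> by (rule step[OF elim(4)])
    interpret T: step_grid M n "W n" "X n" \<delta> A B ?\<mu> ?\<nu> by unfold_locales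
    note eqs = step_eqs[OF elim(4)]
    have "exp (- real n * (G.ment i \<kappa> + e)) * (prob {\<omega>\<in>space M. S.LW \<omega> \<in> ?N} * prob {\<omega>\<in>space M. S.LX \<omega> \<in> N2})
      \<le> prob {\<omega>\<in>space M. S.V id \<omega> \<in> U}"
    proof (rule S.prob_ge_of_card[OF openin_borel_of[OF U] oN N2(1)])
      fix \<omega> assume "\<omega> \<in> S.R ?N N2"
      then have \<omega>: "\<omega> \<in> space M" "S.LW \<omega> \<in> N1" "S.LW \<omega> \<in> N1'" "S.LX \<omega> \<in> N2" by (auto simp: S.R_def)
      let ?a = "\<lambda>k. lab A i (W n k \<omega>)" and ?b = "\<lambda>k. lab B i (X n k \<omega>)"
      have rows: "\<forall>k\<in>?L. \<bar>card {j\<in>{1..n}. ?a j = k} / real n - (\<Sum>l\<in>?L. G.mtab \<kappa> i k l)\<bar> < \<eta>"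
        unfolding G.mtab_rows[OF \<kappa>D(1)] T.LW_cell[OF \<omega>(1), symmetric] using N1'(3) \<omega>(3) by blast
      have cols: "\<forall>l\<in>?L. \<bar>card {j\<in>{1..n}. ?b j = l} / real n - (\<Sum>k\<in>?L. G.mtab \<kappa> i k l)\<bar> < \<eta>"
        unfolding G.mtab_cols[OF \<kappa>D(1)] T.LX_cell[symmetric] using N2(3) \<omega>(4) by blast
      have "fact n * exp (- real n * (G.ment i \<kappa> + e)) \<le>
        real (card {\<sigma>. \<sigma> permutes {1..n} \<and> (\<Sum>k\<in>?L. \<Sum>l\<in>?L. \<bar>two_labellings.tab {1..n} ?a ?b n \<sigma> k l - G.mtab \<kappa> i k l\<bar>) < e})"
        unfolding G.ment_def by (rule near[OF elim(3) T.labellings rows cols])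
      also have "\<dots> \<le> real (card {\<sigma>. \<sigma> permutes {1..n} \<and> S.V \<sigma> \<omega> \<in> U})"
      proof (rule of_nat_mono, rule card_mono)
        show "finite {\<sigma>. \<sigma> permutes {1..n} \<and> S.V \<sigma> \<omega> \<in> U}" by (rule finite_subset[OF _ finite_permutations[of "{1..n}"]]) auto
        show "{\<sigma>. \<sigma> permutes {1..n} \<and> (\<Sum>k\<in>?L. \<Sum>l\<in>?L. \<bar>two_labellings.tab {1..n} ?a ?b n \<sigma> k l - G.mtab \<kappa> i k l\<bar>) < e}
          \<subseteq> {\<sigma>. \<sigma> permutes {1..n} \<and> S.V \<sigma> \<omega> \<in> U}"
        proof (intro subsetI, elim CollectE conjE, intro CollectI conjI)
          fix \<sigma> assume \<sigma>: "\<sigma> permutes {1..n}" "(\<Sum>k\<in>?L. \<Sum>l\<in>?L. \<bar>two_labellings.tab {1..n} ?a ?b n \<sigma> k l - G.mtab \<kappa> i k l\<bar>) < e"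
          have "(\<Sum>K\<in>?L. \<Sum>L\<in>?L. \<bar>G.mtab (S.V \<sigma> \<omega>) i K L - G.mtab \<kappa> i K L\<bar>) < r"
            unfolding T.mtab_V[OF \<sigma>(1) \<omega>(1)] using \<sigma>(2) e(3) by (rule less_le_trans)
          then show "S.V \<sigma> \<omega> \<in> U" using loc(4) S.V_marg[OF \<sigma>(1) \<omega>(1)] \<omega>(2) by simp
        qed
      qed
      finally show "fact n * exp (- real n * (G.ment i \<kappa> + e)) \<le> real (card {\<sigma>. \<sigma> permutes {1..n} \<and> S.V \<sigma> \<omega> \<in> U})" .
    qed
    then have step: "exp (- real n * (G.ment i \<kappa> + e)) * (pW n ?N * pX n N2) \<le> pV n U" unfolding eqs .
    have "G.ment i \<kappa> \<le> h" using G.ment_le_rel_entropy[OF \<kappa>D(1), of i] hwx(1) by simp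
    then have "real n * (G.ment i \<kappa> + e) \<le> real n * (h + \<epsilon>)" using e(2) by (intro mult_left_mono) auto
    then have a: "exp (- (h + \<epsilon>) * real n) \<le> exp (- real n * (G.ment i \<kappa> + e))" by (simp add: algebra_simps)
    have b: "exp (- (w + \<epsilon>) * real n) * exp (- (x + \<epsilon>) * real n) \<le> pW n ?N * pX n N2"
      using elim(1,2) by (intro mult_mono) auto
    have "exp (- (h + \<epsilon>) * real n) * (exp (- (w + \<epsilon>) * real n) * exp (- (x + \<epsilon>) * real n))
      \<le> exp (- real n * (G.ment i \<kappa> + e)) * (pW n ?N * pX n N2)" by (rule mult_mono[OF a b]) auto
    then have "exp (- (h + \<epsilon>) * real n) * (exp (- (w + \<epsilon>) * real n) * exp (- (x + \<epsilon>) * real n)) \<le> pV n U"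
      using step by (rule order_trans)
    moreover have "exp (- \<alpha> * real n) \<le> exp (- (h + \<epsilon>) * real n) * (exp (- (w + \<epsilon>) * real n) * exp (- (x + \<epsilon>) * real n))"
    proof -
      have "\<alpha> = (h + \<epsilon>) + (w + \<epsilon>) + (x + \<epsilon>) + \<epsilon>" by (simp add: \<epsilon>_def field_simps)
      then have "- \<alpha> * real n = (- (h + \<epsilon>) * real n) + ((- (w + \<epsilon>) * real n) + (- (x + \<epsilon>) * real n)) - \<epsilon> * real n"
        by (simp add: algebra_simps)
      also have "\<dots> \<le> (- (h + \<epsilon>) * real n) + ((- (w + \<epsilon>) * real n) + (- (x + \<epsilon>) * real n))" using \<epsilon> by simp
      finally show ?thesis by (simp only: exp_add[symmetric] exp_le_cancel_iff)
    qed
    ultimately show ?case by linarith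
  qed
qed

text \<open>By \<open>upper_local\<close> every element of F with margins near (\<mu>, \<nu>) has
  level-i entropy above \<alpha> - w - x, while the margins cost w and x. The three losses
  \<epsilon> are for the two marginal bounds, read off on closed neighbourhoods, and for the
  polynomial factor. Measurability is part of the conclusion because the events are united
  later.\<close>

lemma upper_bound_local:
  assumes F: "closedin (topology_\<Delta> \<delta>) F" and J: "\<And>\<kappa>. \<kappa> \<in> F \<Longrightarrow> ereal \<alpha> < rate_J IW IX \<kappa>"
    and \<mu>: "\<mu> \<in> M11" "IW \<mu> \<le> ereal \<alpha>" and \<nu>: "\<nu> \<in> M1 UNIV" "IX \<nu> \<le> ereal \<alpha>" and \<epsilon>: "\<epsilon> > 0"
  shows "\<exists>N1 N2. openin topology_W1 N1 \<and> \<mu> \<in> N1 \<and> openin (weak_topology UNIV) N2 \<and> \<nu> \<in> N2 \<and>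
    (\<forall>n\<ge>1. {\<omega>\<in>space M. VV n \<omega> \<in> F \<and> VW n \<omega> \<in> N1 \<and> VX n \<omega> \<in> N2} \<in> events) \<and>
    eventually (\<lambda>n. prob {\<omega>\<in>space M. VV n \<omega> \<in> F \<and> VW n \<omega> \<in> N1 \<and> VX n \<omega> \<in> N2} \<le> exp (- (\<alpha> - 3 * \<epsilon>) * real n)) sequentially"
proof -
  obtain w where w: "IW \<mu> = ereal w" using \<mu>(2) IW_nonneg[OF \<mu>(1)] by (cases "IW \<mu>") auto
  obtain x where x: "IX \<nu> = ereal x" using \<nu>(2) IX_nonneg[OF \<nu>(1)] by (cases "IX \<nu>") auto
  define \<beta> where "\<beta> = \<alpha> - w - x"
  obtain A B where "ngrid A B \<mu> \<nu> \<delta>" using exists_ngrid[OF \<mu>(1) \<nu>(1) compat] .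
  then interpret G: ngrid A B \<mu> \<nu> \<delta> .
  have "rel_entropy \<kappa> (\<mu> \<Otimes>\<^sub>M \<nu>) > ereal \<beta>" if "\<kappa> \<in> F" "marg1 \<kappa> = \<mu>" "marg2 \<kappa> = \<nu>" for \<kappa>
    using J[OF that(1)] unfolding rate_J_def that(2,3) w x \<beta>_def by (cases "rel_entropy \<kappa> (\<mu> \<Otimes>\<^sub>M \<nu>)") auto
  from G.upper_local[OF F this] obtain i N1 N2 where loc: "openin topology_W1 N1" "\<mu> \<in> N1" "openin (weak_topology UNIV) N2" "\<nu> \<in> N2"
    "\<forall>\<rho>\<in>F. marg1 \<rho> \<in> N1 \<longrightarrow> marg2 \<rho> \<in> N2 \<longrightarrow> G.ment i \<rho> > \<beta>" by blast
  \<comment> \<open>The level w - \<epsilon> / 2 leaves room for the exponent w - \<epsilon>, since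
    \<open>LDP_rv_upper\<close> asks for a strict inequality; the same holds for x.\<close>
  let ?S1 = "{\<mu>' \<in> topspace topology_W1. ereal (w - \<epsilon> / 2) < IW \<mu>'}"
  let ?S2 = "{\<nu>' \<in> topspace (weak_topology UNIV). ereal (x - \<epsilon> / 2) < IX \<nu>'}"
  have "openin topology_W1 ?S1" using IW_lsc unfolding lower_semicontinuous_def by (rule spec)
  moreover have "\<mu> \<in> ?S1" using \<mu>(1) w \<epsilon> by (simp add: topspace_W1)
  ultimately have "\<exists>V C. openin topology_W1 V \<and> closedin topology_W1 C \<and> \<mu> \<in> V \<and> V \<subseteq> C \<and> C \<subseteq> ?S1" by (rule W1_topology_regular)
  then obtain V1 C1 where V1: "openin topology_W1 V1" "closedin topology_W1 C1" "\<mu> \<in> V1" "V1 \<subseteq> C1" "C1 \<subseteq> ?S1" by blast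
  have "openin (weak_topology UNIV) ?S2" using IX_lsc unfolding lower_semicontinuous_def by (rule spec)
  moreover have "\<nu> \<in> ?S2" using \<nu>(1) x \<epsilon> by (simp add: topspace_weak_topology)
  ultimately have "\<exists>V C. openin (weak_topology UNIV) V \<and> closedin (weak_topology UNIV) C \<and> \<nu> \<in> V \<and> V \<subseteq> C \<and> C \<subseteq> ?S2" by (rule weak_topology_regular)
  then obtain V2 C2 where V2: "openin (weak_topology UNIV) V2" "closedin (weak_topology UNIV) C2" "\<nu> \<in> V2" "V2 \<subseteq> C2" "C2 \<subseteq> ?S2" by blast
  let ?N1 = "N1 \<inter> V1" and ?N2 = "N2 \<inter> V2"
  have o1: "openin topology_W1 ?N1" using loc(1) V1(1) by (rule openin_Int)
  have o2: "openin (weak_topology UNIV) ?N2" using loc(3) V2(1) by (rule openin_Int)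
  have uW: "eventually (\<lambda>n. pW n C1 \<le> exp (- (w - \<epsilon>) * real n)) sequentially"
    by (rule pW_upper[OF V1(2), of "w - \<epsilon> / 2"]) (use V1(5) \<epsilon> in \<open>auto intro: less_imp_le\<close>)
  have uX: "eventually (\<lambda>n. pX n C2 \<le> exp (- (x - \<epsilon>) * real n)) sequentially"
    by (rule pX_upper[OF V2(2), of "x - \<epsilon> / 2"]) (use V2(5) \<epsilon> in \<open>auto intro: less_imp_le\<close>)
  have ev: "{\<omega>\<in>space M. VV n \<omega> \<in> F \<and> VW n \<omega> \<in> ?N1 \<and> VX n \<omega> \<in> ?N2} \<in> events" if n: "n \<ge> 1" for n
  proof -
    have "{\<omega>\<in>space M. VV n \<omega> \<in> F \<and> VW n \<omega> \<in> ?N1 \<and> VX n \<omega> \<in> ?N2}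
       = {\<omega>\<in>space M. VV n \<omega> \<in> F} \<inter> ({\<omega>\<in>space M. VW n \<omega> \<in> ?N1} \<inter> {\<omega>\<in>space M. VX n \<omega> \<in> ?N2})" by blast
    also have "\<dots> \<in> events"
      by (intro sets.Int event[OF VV_measurable[OF n] closedin_borel_of[OF F]]
          event[OF VW_measurable[OF n] openin_borel_of[OF o1]] event[OF VX_measurable[OF n] openin_borel_of[OF o2]])
    finally show ?thesis .
  qed
  have "eventually (\<lambda>n. prob {\<omega>\<in>space M. VV n \<omega> \<in> F \<and> VW n \<omega> \<in> ?N1 \<and> VX n \<omega> \<in> ?N2} \<le> exp (- (\<alpha> - 3 * \<epsilon>) * real n)) sequentially"
    using uW uX eventually_poly_exp_le[OF \<epsilon>, of "2 ^ i * 2 ^ i" "2 ^ i" "2 ^ i"] eventually_ge_at_top[of 1]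
  proof eventually_elim
    case (elim n)
    interpret S: exch_step M n "W n" "X n" \<delta> by (rule step[OF elim(4)])
    interpret T: step_grid M n "W n" "X n" \<delta> A B \<mu> \<nu> by unfold_locales
    note eqs = step_eqs[OF elim(4)]
    have "prob {\<omega>\<in>S.R ?N1 ?N2. S.V id \<omega> \<in> F}
      \<le> (real n + 1) ^ (2 ^ i * 2 ^ i) * exp (corr (2 ^ i) (2 ^ i) n) * exp (- real n * \<beta>)
       * (prob {\<omega>\<in>space M. S.LW \<omega> \<in> ?N1} * prob {\<omega>\<in>space M. S.LX \<omega> \<in> ?N2})"
      by (rule T.upper_step[OF closedin_borel_of[OF F] o1 o2]) (use loc(5) in blast)
    moreover have "{\<omega>\<in>S.R ?N1 ?N2. S.V id \<omega> \<in> F} = {\<omega>\<in>space M. VV n \<omega> \<in> F \<and> VW n \<omega> \<in> ?N1 \<and> VX n \<omega> \<in> ?N2}"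
      unfolding S.R_def eqs by blast
    ultimately have 1: "prob {\<omega>\<in>space M. VV n \<omega> \<in> F \<and> VW n \<omega> \<in> ?N1 \<and> VX n \<omega> \<in> ?N2}
      \<le> (real n + 1) ^ (2 ^ i * 2 ^ i) * exp (corr (2 ^ i) (2 ^ i) n) * exp (- real n * \<beta>) * (pW n ?N1 * pX n ?N2)"
      unfolding eqs by simp
    have "pW n ?N1 \<le> pW n C1"
      using V1(4) by (intro finite_measure_mono event[OF VW_measurable[OF elim(4)] closedin_borel_of[OF V1(2)]]) auto
    then have a: "pW n ?N1 \<le> exp (- (w - \<epsilon>) * real n)" using elim(1) by linarith
    have "pX n ?N2 \<le> pX n C2"
      using V2(4) by (intro finite_measure_mono event[OF VX_measurable[OF elim(4)] closedin_borel_of[OF V2(2)]]) auto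
    then have b: "pX n ?N2 \<le> exp (- (x - \<epsilon>) * real n)" using elim(2) by linarith
    have "(real n + 1) ^ (2 ^ i * 2 ^ i) * exp (corr (2 ^ i) (2 ^ i) n) * exp (- real n * \<beta>) * (pW n ?N1 * pX n ?N2)
      \<le> exp (\<epsilon> * real n) * exp (- real n * \<beta>) * (exp (- (w - \<epsilon>) * real n) * exp (- (x - \<epsilon>) * real n))"
      using elim(3) a b by (intro mult_mono) auto
    also have "\<dots> = exp (\<epsilon> * real n + - real n * \<beta> + (- (w - \<epsilon>) * real n + - (x - \<epsilon>) * real n))" by (simp only: exp_add)
    also have "\<epsilon> * real n + - real n * \<beta> + (- (w - \<epsilon>) * real n + - (x - \<epsilon>) * real n) = - (\<alpha> - 3 * \<epsilon>) * real n"
      by (simp add: \<beta>_def algebra_simps)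
    finally show ?case using 1 by linarith
  qed
  then show ?thesis using loc(2,4) V1(3) V2(3) ev
    by (intro exI[of _ ?N1] exI[of _ ?N2] conjI o1 o2) auto
qed

text \<open>Pairs of margins with both rates at most \<alpha>' form a compact rectangle covered by
  finitely many local bounds. Wallace's theorem fits an open rectangle between it and the cover, so
  what lies outside splits into two closed marginal events, each improbable by the marginal upper
  bounds.\<close>

lemma upper_bound:
  assumes F: "closedin (topology_\<Delta> \<delta>) F" and \<alpha>: "ereal \<alpha> < (INF \<kappa>\<in>F. rate_J IW IX \<kappa>)"
  shows "eventually (\<lambda>n. pV n F \<le> exp (- \<alpha> * real n)) sequentially"
proof -
  obtain \<alpha>' where \<alpha>': "ereal \<alpha> < ereal \<alpha>'" "ereal \<alpha>' < (INF \<kappa>\<in>F. rate_J IW IX \<kappa>)" using ereal_dense2[OF \<alpha>] by blast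
  have J: "ereal \<alpha>' < rate_J IW IX \<kappa>" if "\<kappa> \<in> F" for \<kappa> using \<alpha>'(2) that by (rule less_INF_D)
  \<comment> \<open>Three \<epsilon> are lost in the local bounds; the fourth absorbs the number of
    events in the union.\<close>
  define \<epsilon> where "\<epsilon> = (\<alpha>' - \<alpha>) / 4"
  have \<epsilon>: "\<epsilon> > 0" using \<alpha>'(1) by (simp add: \<epsilon>_def)
  let ?T = "prod_topology topology_W1 (weak_topology UNIV :: 's measure topology)"
  let ?K1 = "{\<mu> \<in> topspace topology_W1. IW \<mu> \<le> ereal \<alpha>'}" and ?K2 = "{\<nu> \<in> topspace (weak_topology UNIV). IX \<nu> \<le> ereal \<alpha>'}"
  let ?E = "\<lambda>n N. {\<omega>\<in>space M. VV n \<omega> \<in> F \<and> (VW n \<omega>, VX n \<omega>) \<in> N}"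
  have K1: "compactin topology_W1 ?K1" and K2: "compactin (weak_topology UNIV) ?K2"
    using good_W good_X unfolding good_rate_def by blast+
  have K: "compactin ?T (?K1 \<times> ?K2)" unfolding compactin_Times using K1 K2 by blast
  \<comment> \<open>Members carry measurability and the bound along, so subadditivity applies to any
    finite subcover.\<close>
  define \<U> where "\<U> = {N. openin ?T N \<and> (\<forall>n\<ge>1. ?E n N \<in> events) \<and>
     eventually (\<lambda>n. prob (?E n N) \<le> exp (- (\<alpha>' - 3 * \<epsilon>) * real n)) sequentially}"
  have "\<exists>\<F>. finite \<F> \<and> \<F> \<subseteq> \<U> \<and> ?K1 \<times> ?K2 \<subseteq> \<Union>\<F>"
  proof (rule compactinD[OF K])
    show "openin ?T N" if "N \<in> \<U>" for N using that by (simp add: \<U>_def)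
    show "?K1 \<times> ?K2 \<subseteq> \<Union>\<U>"
    proof
      fix p assume "p \<in> ?K1 \<times> ?K2"
      then obtain \<mu> \<nu> where p: "p = (\<mu>, \<nu>)" "\<mu> \<in> M11" "IW \<mu> \<le> ereal \<alpha>'" "\<nu> \<in> M1 UNIV" "IX \<nu> \<le> ereal \<alpha>'"
        by (auto simp: topspace_W1 topspace_weak_topology)
      from upper_bound_local[OF F J p(2-5) \<epsilon>] obtain N1 N2 where N: "openin topology_W1 N1" "\<mu> \<in> N1" "openin (weak_topology UNIV) N2" "\<nu> \<in> N2"
        "\<forall>n\<ge>1. {\<omega>\<in>space M. VV n \<omega> \<in> F \<and> VW n \<omega> \<in> N1 \<and> VX n \<omega> \<in> N2} \<in> events"
        "eventually (\<lambda>n. prob {\<omega>\<in>space M. VV n \<omega> \<in> F \<and> VW n \<omega> \<in> N1 \<and> VX n \<omega> \<in> N2} \<le> exp (- (\<alpha>' - 3 * \<epsilon>) * real n)) sequentially"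
        by blast
      have "N1 \<times> N2 \<in> \<U>" using N(1,3,5,6) unfolding \<U>_def by (simp add: openin_prod_Times_iff)
      then show "p \<in> \<Union>\<U>" using p(1) N(2,4) by blast
    qed
  qed
  then obtain \<F> where \<F>: "finite \<F>" "\<F> \<subseteq> \<U>" "?K1 \<times> ?K2 \<subseteq> \<Union>\<F>" by blast
  have oF: "openin ?T (\<Union>\<F>)" using \<F>(2) by (intro openin_Union) (auto simp: \<U>_def)
  obtain O1 O2 where O: "openin topology_W1 O1" "openin (weak_topology UNIV) O2" "?K1 \<subseteq> O1" "?K2 \<subseteq> O2" "O1 \<times> O2 \<subseteq> \<Union>\<F>"
    by (rule Wallace_theorem_prod_topology[OF K1 K2 oF \<F>(3)])
  let ?C1 = "topspace topology_W1 - O1" and ?C2 = "topspace (weak_topology UNIV) - O2"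
  have C1: "closedin topology_W1 ?C1" using O(1) by (intro closedin_diff closedin_topspace)
  have C2: "closedin (weak_topology UNIV) ?C2" using O(2) by (intro closedin_diff closedin_topspace)
  have uW: "eventually (\<lambda>n. pW n ?C1 \<le> exp (- (\<alpha>' - 3 * \<epsilon>) * real n)) sequentially"
  proof (rule pW_upper[OF C1])
    fix \<mu> assume "\<mu> \<in> ?C1"
    then have "\<not> IW \<mu> \<le> ereal \<alpha>'" using O(3) by blast
    then show "ereal \<alpha>' \<le> IW \<mu>" by simp
  qed (use \<epsilon> in simp)
  have uX: "eventually (\<lambda>n. pX n ?C2 \<le> exp (- (\<alpha>' - 3 * \<epsilon>) * real n)) sequentially"
  proof (rule pX_upper[OF C2])
    fix \<nu> assume "\<nu> \<in> ?C2"
    then have "\<not> IX \<nu> \<le> ereal \<alpha>'" using O(4) by blast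
    then show "ereal \<alpha>' \<le> IX \<nu>" by simp
  qed (use \<epsilon> in simp)
  have uF: "eventually (\<lambda>n. \<forall>N\<in>\<F>. prob (?E n N) \<le> exp (- (\<alpha>' - 3 * \<epsilon>) * real n)) sequentially"
    using \<F>(1,2) by (intro eventually_ball_finite) (auto simp: \<U>_def)
  have "filterlim (\<lambda>n. exp (\<epsilon> * real n)) at_top sequentially"
    using \<epsilon> by (intro filterlim_compose[OF exp_at_top] filterlim_tendsto_pos_mult_at_top[OF tendsto_const] filterlim_real_sequentially)
  then have "eventually (\<lambda>n. real (card \<F>) + 2 \<le> exp (\<epsilon> * real n)) sequentially" by (simp add: filterlim_at_top)
  then show ?thesis using uW uX uF eventually_ge_at_top[of 1]
  proof eventually_elim
    case (elim n)
    let ?x = "exp (- (\<alpha>' - 3 * \<epsilon>) * real n)"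
    have ev: "?E n N \<in> events" if "N \<in> \<F>" for N using \<F>(2) that elim(5) by (auto simp: \<U>_def)
    have e1: "{\<omega>\<in>space M. VW n \<omega> \<in> ?C1} \<in> events" by (rule event[OF VW_measurable[OF elim(5)] closedin_borel_of[OF C1]])
    have e2: "{\<omega>\<in>space M. VX n \<omega> \<in> ?C2} \<in> events" by (rule event[OF VX_measurable[OF elim(5)] closedin_borel_of[OF C2]])
    have eF: "(\<Union>N\<in>\<F>. ?E n N) \<in> events" using \<F>(1) ev by (intro sets.finite_UN) auto
    have tW: "VW n \<omega> \<in> topspace topology_W1" if "\<omega> \<in> space M" for \<omega>
      using measurable_space[OF VW_measurable[OF elim(5)] that] by (simp add: sets_borel_of)
    have tX: "VX n \<omega> \<in> topspace (weak_topology UNIV)" if "\<omega> \<in> space M" for \<omega>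
      using measurable_space[OF VX_measurable[OF elim(5)] that] by (simp add: sets_borel_of)
    have "{\<omega>\<in>space M. VV n \<omega> \<in> F} \<subseteq> (\<Union>N\<in>\<F>. ?E n N) \<union> ({\<omega>\<in>space M. VW n \<omega> \<in> ?C1} \<union> {\<omega>\<in>space M. VX n \<omega> \<in> ?C2})"
    proof
      fix \<omega> assume \<omega>: "\<omega> \<in> {\<omega>\<in>space M. VV n \<omega> \<in> F}"
      show "\<omega> \<in> (\<Union>N\<in>\<F>. ?E n N) \<union> ({\<omega>\<in>space M. VW n \<omega> \<in> ?C1} \<union> {\<omega>\<in>space M. VX n \<omega> \<in> ?C2})"
      proof (cases "VW n \<omega> \<in> O1 \<and> VX n \<omega> \<in> O2")
        case True
        then have "(VW n \<omega>, VX n \<omega>) \<in> \<Union>\<F>" using O(5) by blast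
        then show ?thesis using \<omega> by blast
      next
        case False
        then show ?thesis using \<omega> tW tX by blast
      qed
    qed
    then have "pV n F \<le> prob ((\<Union>N\<in>\<F>. ?E n N) \<union> ({\<omega>\<in>space M. VW n \<omega> \<in> ?C1} \<union> {\<omega>\<in>space M. VX n \<omega> \<in> ?C2}))"
      by (intro finite_measure_mono sets.Un eF e1 e2)
    also have "\<dots> \<le> prob (\<Union>N\<in>\<F>. ?E n N) + prob ({\<omega>\<in>space M. VW n \<omega> \<in> ?C1} \<union> {\<omega>\<in>space M. VX n \<omega> \<in> ?C2})"
      by (intro measure_Un_le sets.Un eF e1 e2)
    also have "\<dots> \<le> (\<Sum>N\<in>\<F>. prob (?E n N)) + (pW n ?C1 + pX n ?C2)"
      by (intro add_mono finite_measure_subadditive_finite \<F>(1) measure_Un_le e1 e2) (use ev in blast)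
    also have "\<dots> \<le> real (card \<F>) * ?x + (?x + ?x)"
      by (intro add_mono elim(2,3) sum_bounded_above) (use elim(4) in blast)
    also have "\<dots> = (real (card \<F>) + 2) * ?x" by (simp add: algebra_simps)
    also have "\<dots> \<le> exp (\<epsilon> * real n) * ?x" using elim(1) by (intro mult_right_mono) auto
    also have "\<dots> = exp (\<epsilon> * real n + - (\<alpha>' - 3 * \<epsilon>) * real n)" by (simp only: exp_add)
    also have "\<epsilon> * real n + - (\<alpha>' - 3 * \<epsilon>) * real n = - \<alpha> * real n"
    proof -
      have "\<alpha>' = \<alpha> + 4 * \<epsilon>" by (simp add: \<epsilon>_def field_simps)
      then show ?thesis by (simp add: algebra_simps)
    qed
    finally show ?case .
  qed
qed

text \<open>A Borel set lies between its interior and its closure, to which the bounds for open and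
  closed sets apply.\<close>

lemma ldp: "LDP_rv M (topology_\<Delta> \<delta>) VV (rate_J IW IX)"
  unfolding LDP_rv_def LDP_def
proof (intro conjI allI impI ballI)
  show "VV n \<in> measurable M (borel_of (topology_\<Delta> \<delta>))" if "n \<ge> 1" for n by (rule VV_measurable[OF that])
  show "prob_space (distr M (borel_of (topology_\<Delta> \<delta>)) (VV n))" if "n \<ge> 1" for n by (rule prob_space_distr[OF VV_measurable[OF that]])
  have top: "topspace (topology_\<Delta> \<delta>) = M11_prod"
    unfolding topology_\<Delta>_def by (rule Metric_space.topspace_mtopology[OF Metric_space_\<Delta>[OF compat]])
  show "0 \<le> rate_J IW IX \<rho>" if "\<rho> \<in> topspace (topology_\<Delta> \<delta>)" for \<rho> using that J_nonneg unfolding top by blast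
  show "lower_semicontinuous (topology_\<Delta> \<delta>) (rate_J IW IX)"
    by (rule lower_semicontinuous_rate_J[OF compat IW_nonneg IW_lsc IX_nonneg IX_lsc])
  fix A assume A: "A \<in> sets (borel_of (topology_\<Delta> \<delta>))"
  let ?P = "\<lambda>n. distr M (borel_of (topology_\<Delta> \<delta>)) (VV n)"
  let ?I = "topology_\<Delta> \<delta> interior_of A" and ?C = "topology_\<Delta> \<delta> closure_of A"
  have mA: "measure (?P n) A = pV n A" if "n \<ge> 1" for n by (rule measure_distr_event[OF VV_measurable[OF that] A])
  have At: "A \<subseteq> topspace (topology_\<Delta> \<delta>)" using sets.sets_into_space[OF A] by (simp add: sets_borel_of)
  show "liminf (\<lambda>n. rate n (measure (?P n) A)) \<le> limsup (\<lambda>n. rate n (measure (?P n) A))"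
    by (rule Liminf_le_Limsup) simp
  show "- (INF \<rho>\<in>?I. rate_J IW IX \<rho>) \<le> liminf (\<lambda>n. rate n (measure (?P n) A))"
  proof (rule le_liminf_rate)
    fix \<alpha> assume "(INF \<rho>\<in>?I. rate_J IW IX \<rho>) < ereal \<alpha>"
    then obtain \<kappa> where \<kappa>: "\<kappa> \<in> ?I" "rate_J IW IX \<kappa> < ereal \<alpha>" unfolding INF_less_iff by blast
    from lower_bound[OF openin_interior_of \<kappa>] eventually_ge_at_top[of 1]
    show "eventually (\<lambda>n. exp (- \<alpha> * real n) \<le> measure (?P n) A) sequentially"
    proof eventually_elim
      case (elim n)
      have "pV n ?I \<le> pV n A"
        using interior_of_subset[of "topology_\<Delta> \<delta>" A] by (intro finite_measure_mono event[OF VV_measurable[OF elim(2)] A]) auto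
      then show ?case using elim mA by simp
    qed
  qed simp
  show "limsup (\<lambda>n. rate n (measure (?P n) A)) \<le> - (INF \<rho>\<in>?C. rate_J IW IX \<rho>)"
  proof (rule limsup_rate_le)
    fix \<alpha> assume \<alpha>: "ereal \<alpha> < (INF \<rho>\<in>?C. rate_J IW IX \<rho>)"
    from upper_bound[OF closedin_closure_of \<alpha>] eventually_ge_at_top[of 1]
    show "eventually (\<lambda>n. measure (?P n) A \<le> exp (- \<alpha> * real n)) sequentially"
    proof eventually_elim
      case (elim n)
      have "pV n A \<le> pV n ?C"
        using closure_of_subset[OF At]
        by (intro finite_measure_mono event[OF VV_measurable[OF elim(2)] closedin_borel_of[OF closedin_closure_of]]) auto
      then show ?case using elim mA by simp
    qed
  qed simp
qed simp

end

theorem theorem1p2: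
  fixes M :: "'w measure"
    and W :: "nat \<Rightarrow> nat \<Rightarrow> 'w \<Rightarrow> real"
    and X :: "nat \<Rightarrow> nat \<Rightarrow> 'w \<Rightarrow> 's::polish_space"
    and \<delta> :: "real \<times> 's \<Rightarrow> real \<times> 's \<Rightarrow> real"
    and IW :: "real measure \<Rightarrow> ereal"
    and IX :: "'s measure \<Rightarrow> ereal"
  assumes "prob_space M"
    and "compatible_metric ({0..} \<times> UNIV) \<delta>"
    and "\<And>n i. n \<ge> 1 \<Longrightarrow> i \<in> {1..n} \<Longrightarrow> W n i \<in> measurable M (borel_on {0..})"
    and "\<And>n i. n \<ge> 1 \<Longrightarrow> i \<in> {1..n} \<Longrightarrow> X n i \<in> measurable M borel"
    and "\<And>n \<omega>. n \<ge> 1 \<Longrightarrow> \<omega> \<in> space M \<Longrightarrow> (\<Sum>i=1..n. W n i \<omega>) = real n"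
    and "\<And>n. n \<ge> 1 \<Longrightarrow> exchangeable M (borel_on {0..}) n (W n)"
    and "LDP_rv M topology_W1 (\<lambda>n \<omega>. empirical {0..} n (\<lambda>i. W n i \<omega>)) IW"
    and "good_rate topology_W1 IW"
    and "LDP_rv M (weak_topology UNIV) (\<lambda>n \<omega>. empirical UNIV n (\<lambda>i. X n i \<omega>)) IX"
    and "good_rate (weak_topology UNIV) IX"
    and "\<And>n. n \<ge> 1 \<Longrightarrow> independent_rvs M
           (PiM {1..n} (\<lambda>_. borel)) (\<lambda>\<omega>. \<lambda>i\<in>{1..n}. X n i \<omega>)
           (PiM {1..n} (\<lambda>_. borel_on {0..})) (\<lambda>\<omega>. \<lambda>i\<in>{1..n}. W n i \<omega>)"
  shows "LDP_rv M (topology_\<Delta> \<delta>)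
           (\<lambda>n \<omega>. empirical ({0..} \<times> UNIV) n (\<lambda>i. (W n i \<omega>, X n i \<omega>)))
           (rate_J IW IX)
         \<and> good_rate (topology_\<Delta> \<delta>) (rate_J IW IX)"
proof -
  have st: "exch_step M n (W n) (X n) \<delta>" if n: "n \<ge> 1" for n
    by (intro exch_step.intro exch_step_axioms.intro assms(1) n assms(2) assms(3)[OF n] assms(4)[OF n] assms(5)[OF n] assms(6)[OF n] assms(11)[OF n])
  interpret L: exch_ldp M W X \<delta> IW IX
    by (intro exch_ldp.intro exch_ldp_axioms.intro assms(1,2,7-10) st)
  have "LDP_rv M (topology_\<Delta> \<delta>) (\<lambda>n \<omega>. empirical ({0..} \<times> UNIV) n (\<lambda>i. (W n i \<omega>, X n i \<omega>))) (rate_J IW IX)"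
    using L.ldp unfolding L.VV_def[abs_def] .
  moreover have "good_rate (topology_\<Delta> \<delta>) (rate_J IW IX)"
    by (rule good_rate_J[OF assms(2) L.IW_nonneg L.IW_lsc assms(8) L.IX_nonneg L.IX_lsc assms(10)])
  ultimately show ?thesis by blast
qed

end
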